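(* Let $n$ be a positive integer and let $f,g\in M_{1}(\mathbb{C})$. Let $S_{1}=\{\alpha_1,\alpha_2,\ldots,\alpha_n\}$ and $S_{2}=\{\beta_{1},\beta_{2}\}$, where $\alpha_1,\ldots,\alpha_n,\beta_{1},\beta_{2}$ are $n+2$ distinct non-zero complex constants. Let $P$ be the polynomial associated with $S_1$ and let $\Gamma_1$ be the number of distinct zeros of $P$ (as defined in the context). Suppose that $n>\max\{4,\,2\Gamma_{1}\}$, that $P'(z)$ has exactly two distinct zeros, namely $\beta_{1}$ and $\beta_{2}$, and that $\Gamma_{1}\geq 3$. Suppose moreover that $$(\beta_{1}-\alpha_{1})(\beta_{1}-\alpha_{2})\cdots(\beta_{1}-\alpha_{n})\neq(\beta_{2}-\alpha_{1})(\beta_{2}-\alpha_{2})\cdots(\beta_{2}-\alpha_{n})$$ and that $f$ is of non-integer finite order. If $f$ and $g$ share $(S_{1},2)$ and share $S_{2}$ IM, then $f\equiv g$.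
   Context: $M_{1}(\mathbb{C})$ denotes the class of meromorphic functions in $\mathbb{C}$ which have finitely many poles in $\mathbb{C}$. The order of a meromorphic function $f$ is $\rho(f)=\limsup_{r\to\infty}\frac{\ln T(r,f)}{\ln r}$, where $T(r,f)$ is the Nevanlinna characteristic; "$f$ is of non-integer finite order" means that $\rho(f)$ is finite and is not an integer. Sharing of sets. For a meromorphic $f$, a value $a\in\mathbb{C}\cup\{\infty\}$ and $l$ a non-negative integer or $\infty$, $E_{l}(a;f)$ denotes the collection of all $a$-points of $f$ (in $\mathbb{C}$), where an $a$-point of multiplicity $m$ is counted $m$ times if $m\le l$ and $l+1$ times if $m>l$. For a non-empty set $S\subset\mathbb{C}\cup\{\infty\}$ put $E_f(S,l)=\bigcup_{a\in S}E_l(a;f)$ (with these counts). Two meromorphic functions $f,g$ share $(S,l)$ if $E_f(S,l)=E_g(S,l)$. They share $S$ IM if $\overline{E}_f(S)=\overline{E}_g(S)$, where $\overline{E}_f(S)$ is the set of distinct points $z$ with $f(z)\in S$ (this is the case $l=0$). Polynomial attached to $S_1$. For distinct non-zero complex constants $\alpha_1,\ldots,\alpha_n$, set $$P(z)=\frac{z^{n}-\left(\sum\alpha_{i}\right)z^{n-1}+\cdots+(-1)^{n-1}\left(\sum \alpha_{i_{1}}\alpha_{i_{2}}\cdots\alpha_{i_{n-1}}\right)z}{(-1)^{n+1}\alpha_{1}\alpha_{2}\cdots\alpha_{n}},$$ i.e. $(z-\alpha_1)\cdots(z-\alpha_n)=(-1)^{n+1}\alpha_1\cdots\alpha_n\,(P(z)-1)$.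 Let $m_1$ be the number of simple zeros of $P$ and $m_2$ the number of (distinct) multiple zeros of $P$; then $\Gamma_1:=m_1+m_2$. *)

theory Defs
  imports "HOL-Complex_Analysis.Complex_Analysis"
begin

text \<open>
  A meromorphic function is represented by its normalised version, which is continuous away
  from its poles and takes the dummy value 0 at each pole.  For such functions, equality as HOL
  functions is identity of meromorphic functions.
\<close>

definition M1 :: "(complex \<Rightarrow> complex) set" where
  "M1 = {f. f nicely_meromorphic_on UNIV \<and> finite {z. is_pole f z}}"


subsection \<open>Nevanlinna characteristic and order of growth\<close>

text \<open>\<^term>\<open>ln (0 :: real) = 0\<close>, so \<open>log_plus 0 = 0\<close> as usual.\<close>

definition log_plus :: "real \<Rightarrow> real" where
  "log_plus x = max 0 (ln x)"

definition proximity :: "real \<Rightarrow> (complex \<Rightarrow> complex) \<Rightarrow> real" where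
  "proximity r f =
     1 / (2 * pi) * integral {0..2 * pi} (\<lambda>t. log_plus (norm (f (of_real r * cis t))))"

text \<open>Number of poles in the closed disc of radius \<open>r\<close>, counted with multiplicity.\<close>

definition pole_count :: "real \<Rightarrow> (complex \<Rightarrow> complex) \<Rightarrow> nat" where
  "pole_count r f = (\<Sum>z | norm z \<le> r \<and> is_pole f z. nat (- zorder f z))"

definition integrated_pole_count :: "real \<Rightarrow> (complex \<Rightarrow> complex) \<Rightarrow> real" where
  "integrated_pole_count r f =
     integral {0..r} (\<lambda>t. (real (pole_count t f) - real (pole_count 0 f)) / t)
       + real (pole_count 0 f) * ln r"

definition nevanlinna_char :: "real \<Rightarrow> (complex \<Rightarrow> complex) \<Rightarrow> real" where
  "nevanlinna_char r f = proximity r f + integrated_pole_count r f"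

text \<open>
  If the characteristic vanishes identically (which happens only for some constant functions),
  the convention \<^term>\<open>ln (0 :: real) = 0\<close> makes the order 0.
\<close>

definition growth_order :: "(complex \<Rightarrow> complex) \<Rightarrow> ereal" where
  "growth_order f = Limsup at_top (\<lambda>r. ereal (ln (nevanlinna_char r f) / ln r))"

definition nonint_finite_order :: "(complex \<Rightarrow> complex) \<Rightarrow> bool" where
  "nonint_finite_order f \<longleftrightarrow> (\<exists>\<rho>::real. growth_order f = ereal \<rho> \<and> \<rho> \<notin> \<int>)"


subsection \<open>Sharing of sets of finite values\<close>

definition is_a_point :: "complex \<Rightarrow> (complex \<Rightarrow> complex) \<Rightarrow> complex \<Rightarrow> bool" where
  "is_a_point a f z \<longleftrightarrow> \<not> is_pole f z \<and> f z = a"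

text \<open>The multiplicity is \<open>\<infinity>\<close> if \<open>f\<close> is constantly \<open>a\<close>, where \<^const>\<open>zorder\<close> is meaningless.\<close>

definition a_point_mult :: "complex \<Rightarrow> (complex \<Rightarrow> complex) \<Rightarrow> complex \<Rightarrow> enat" where
  "a_point_mult a f z =
     (if \<forall>\<^sub>F w in at z. f w = a then \<infinity> else enat (nat (zorder (\<lambda>w. f w - a) z)))"

text \<open>
  The collection of \<open>a\<close>-points with truncated counts is a multiset that may be infinite and may
  have infinite counts; it is given by its counting function.
\<close>

definition E_pts :: "enat \<Rightarrow> complex \<Rightarrow> (complex \<Rightarrow> complex) \<Rightarrow> complex \<Rightarrow> enat" where
  "E_pts l a f z =
     (if is_a_point a f z
      then (if a_point_mult a f z \<le> l then a_point_mult a f z else l + 1)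
      else 0)"

text \<open>
  The multisets in the union have pairwise disjoint supports, so their union is the pointwise
  supremum of the counting functions.
\<close>

definition E_set :: "(complex \<Rightarrow> complex) \<Rightarrow> complex set \<Rightarrow> enat \<Rightarrow> complex \<Rightarrow> enat" where
  "E_set f S l z = (SUP a\<in>S. E_pts l a f z)"

definition share :: "(complex \<Rightarrow> complex) \<Rightarrow> (complex \<Rightarrow> complex) \<Rightarrow> complex set \<Rightarrow> enat \<Rightarrow> bool" where
  "share f g S l \<longleftrightarrow> E_set f S l = E_set g S l"

definition E_bar :: "(complex \<Rightarrow> complex) \<Rightarrow> complex set \<Rightarrow> complex set" where
  "E_bar f S = {z. \<exists>a\<in>S. is_a_point a f z}"

definition share_IM :: "(complex \<Rightarrow> complex) \<Rightarrow> (complex \<Rightarrow> complex) \<Rightarrow> complex set \<Rightarrow> bool" where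
  "share_IM f g S \<longleftrightarrow> E_bar f S = E_bar g S"


subsection \<open>The polynomial attached to a finite family of non-zero constants\<close>

text \<open>The elementary symmetric sum of degree \<open>k\<close> in \<open>\<alpha> 1, \<dots>, \<alpha> n\<close>.\<close>

definition esym :: "nat \<Rightarrow> (nat \<Rightarrow> complex) \<Rightarrow> nat \<Rightarrow> complex" where
  "esym n \<alpha> k = (\<Sum>T | T \<subseteq> {1..n} \<and> card T = k. \<Prod>i\<in>T. \<alpha> i)"

definition assoc_poly :: "nat \<Rightarrow> (nat \<Rightarrow> complex) \<Rightarrow> complex poly" where
  "assoc_poly n \<alpha> =
     smult (inverse ((-1) ^ (n + 1) * (\<Prod>i=1..n. \<alpha> i)))
       (\<Sum>k<n. monom ((-1) ^ k * esym n \<alpha> k) (n - k))"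

lemma prod_eq_assoc_poly:
  assumes "\<And>i. i \<in> {1..n} \<Longrightarrow> \<alpha> i \<noteq> 0"
  shows "(\<Prod>i=1..n. [:- \<alpha> i, 1:]) =
    smult ((-1) ^ (n + 1) * (\<Prod>i=1..n. \<alpha> i)) (assoc_poly n \<alpha> - 1)"
proof -
  let ?p = "\<Prod>i=1..n. \<alpha> i"
  have fin: "finite {T. T \<subseteq> {1..n}}" by simp
  have nz: "(-1) ^ (n + 1) * ?p \<noteq> 0" using assms by simp
  have lin: "[:- \<alpha> i, 1:] = [:- \<alpha> i:] + monom 1 1" for i
    by (simp add: monom_altdef)
  have pc: "(\<Prod>i\<in>T. [:- \<alpha> i:]) = [:(-1) ^ card T * (\<Prod>i\<in>T. \<alpha> i):]" if "finite T" for T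
    using that by (induction T) auto
  have "(\<Prod>i=1..n. [:- \<alpha> i, 1:]) =
      (\<Sum>T\<in>Pow {1..n}. (\<Prod>i\<in>T. [:- \<alpha> i:]) * (\<Prod>i\<in>{1..n} - T. monom 1 1))"
    unfolding lin by (rule prod_add) simp
  also have "\<dots> = (\<Sum>T\<in>Pow {1..n}. monom ((-1) ^ card T * (\<Prod>i\<in>T. \<alpha> i)) (n - card T))"
  proof (rule sum.cong[OF refl])
    fix T assume "T \<in> Pow {1..n}"
    then have T: "T \<subseteq> {1..n}" "finite T" by (auto intro: finite_subset)
    have "card ({1..n} - T) = n - card T" using T by (simp add: card_Diff_subset)
    then show "(\<Prod>i\<in>T. [:- \<alpha> i:]) * (\<Prod>i\<in>{1..n} - T. monom 1 1) =
        monom ((-1) ^ card T * (\<Prod>i\<in>T. \<alpha> i)) (n - card T)"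
      using T by (simp add: pc monom_power smult_monom)
  qed
  also have "\<dots> = (\<Sum>k\<le>n. \<Sum>T | T \<in> Pow {1..n} \<and> card T = k.
      monom ((-1) ^ card T * (\<Prod>i\<in>T. \<alpha> i)) (n - card T))"
    by (rule sum.group[symmetric]) (auto dest: card_mono[rotated])
  also have "\<dots> = (\<Sum>k\<le>n. monom ((-1) ^ k * esym n \<alpha> k) (n - k))"
  proof (rule sum.cong[OF refl])
    fix k
    have "monom ((-1) ^ k * esym n \<alpha> k) (n - k) =
        (\<Sum>T | T \<subseteq> {1..n} \<and> card T = k. monom ((-1) ^ k * (\<Prod>i\<in>T. \<alpha> i)) (n - k))"
      unfolding esym_def sum_distrib_left
      by (rule poly_eqI) (simp add: coeff_sum)
    then show "(\<Sum>T | T \<in> Pow {1..n} \<and> card T = k.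
          monom ((-1) ^ card T * (\<Prod>i\<in>T. \<alpha> i)) (n - card T)) =
        monom ((-1) ^ k * esym n \<alpha> k) (n - k)"
      by simp
  qed
  also have "\<dots> = (\<Sum>k<n. monom ((-1) ^ k * esym n \<alpha> k) (n - k)) + [:(-1) ^ n * esym n \<alpha> n:]"
    by (simp add: lessThan_Suc_atMost[symmetric] monom_0)
  also have "esym n \<alpha> n = ?p"
  proof -
    have "{T. T \<subseteq> {1..n} \<and> card T = n} = {{1..n}}"
      by (auto dest: card_subset_eq[rotated])
    then show ?thesis by (simp add: esym_def)
  qed
  also have "(\<Sum>k<n. monom ((-1) ^ k * esym n \<alpha> k) (n - k)) =
      smult ((-1) ^ (n + 1) * ?p) (assoc_poly n \<alpha>)"
    by (simp only: assoc_poly_def smult_smult right_inverse[OF nz] smult_1_left)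
  finally show ?thesis
    by (simp add: smult_diff_right one_pCons)
qed

definition num_simple_zeros :: "complex poly \<Rightarrow> nat" where
  "num_simple_zeros p = card {z. poly p z = 0 \<and> order z p = 1}"

definition num_multiple_zeros :: "complex poly \<Rightarrow> nat" where
  "num_multiple_zeros p = card {z. poly p z = 0 \<and> order z p > 1}"

definition Gamma1 :: "nat \<Rightarrow> (nat \<Rightarrow> complex) \<Rightarrow> nat" where
  "Gamma1 n \<alpha> = num_simple_zeros (assoc_poly n \<alpha>) + num_multiple_zeros (assoc_poly n \<alpha>)"

end

theory Submission
  imports Defs "HOL-Computational_Algebra.Fundamental_Theorem_Algebra"
begin

text \<open>
  Write \<open>F = P(f)\<close> and \<open>G = P(g)\<close>.  Counting the zeros of \<open>P\<close> and of \<open>P'\<close> with multiplicity shows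
  what the condition \<open>n > 2 \<Gamma>\<^sub>1\<close> is for: one of the two critical points, called \<open>b1\<close>, is a zero of \<open>P\<close>
  of order \<open>a > n / 2\<close>, the other one, \<open>b2\<close>, is a zero of \<open>P - P(b2)\<close> of order \<open>b = n + 1 - a < a\<close>
  (\<open>critical_structure\<close>).  The proof then has two parts.

  The first part shows that \<open>G\<close> is a Moebius transform of \<open>F\<close>.  Let
  \<open>L\<^sub>f = F'' / F' - 2 F' / (F - 1)\<close>, the logarithmic derivative of \<open>F' / (F - 1)\<^sup>2\<close>, and
  \<open>X\<^sub>f = f'\<^sup>2 (f - b1) (f - b2) / (F - 1)\<close>.  Because \<open>S\<^sub>1\<close> is shared with weight 2 and \<open>S\<^sub>2\<close> is shared
  ignoring multiplicities, \<open>\<Psi> = (L\<^sub>f - L\<^sub>g)\<^sup>2 X\<^sub>f X\<^sub>g\<close> has no poles except poles of \<open>f\<close> and \<open>g\<close>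
  (\<open>sharing_function_local\<close>); there are finitely many of these.  On the other hand, \<open>\<Psi>\<close> is tiny where
  \<open>f\<close> or \<open>g\<close> is large: the logarithmic derivatives are small on suitable circles, and, since \<open>P - 1\<close> has
  \<open>n \<ge> 5\<close> simple zeros, \<open>X\<^sub>f\<close> is at most a product of such derivatives times \<open>max 1 \<bar>f\<bar>\<close> to the power
  \<open>4 - n\<close>.  If \<open>\<Psi>\<close> did not vanish identically, Jensen's inequality would bound the mean of
  \<open>ln \<bar>\<Psi>\<bar>\<close> over these circles from below, and the proximity function of \<open>f\<close> would be
  \<open>O((ln r)\<^sup>2)\<close> (\<open>slow_growth_of_sharing_function\<close>), although \<open>f\<close> has positive order.  So \<open>\<Psi> = 0\<close>,
  hence \<open>L\<^sub>f = L\<^sub>g\<close>, and two integrations give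
  \<open>G - 1 = \<kappa> (F - 1) + c (F - 1) (G - 1)\<close> with \<open>\<kappa> \<noteq> 0\<close> (\<open>shared_values_moebius\<close>).

  The second part uses that the order is not an integer.  A meromorphic function without zeros and poles
  outside a finite set is a rational function times \<open>exp h\<close>; if its growth is comparable with that of
  \<open>f\<close>, then \<open>h\<close> is a polynomial and the order of \<open>f\<close> is the degree of \<open>h\<close>
  (\<open>zero_free_meromorphic_contradiction\<close>).  In particular \<open>f\<close> takes every value
  (\<open>M1_takes_every_value\<close>).  If \<open>c \<noteq> 0\<close>, then \<open>F\<close> would omit the value \<open>1 + 1 / c\<close>; so
  \<open>P(g) = \<kappa> P(f) + 1 - \<kappa>\<close>.  As \<open>f\<close> takes the values \<open>b1\<close> and \<open>b2\<close>, and as \<open>g\<close> takes a value in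
  \<open>{b1, b2}\<close> at the same points, \<open>\<kappa>\<close> is \<open>1\<close> or \<open>-1\<close>.  If \<open>\<kappa> = -1\<close>, then
  \<open>(f - b1)\<^sup>a / (g - b2)\<^sup>b\<close> is essentially zero-free, and \<open>a > b\<close> makes its growth comparable with
  that of \<open>f\<close>, which is impossible (\<open>reflected_values_contradiction\<close>).  If \<open>\<kappa> = 1\<close>, then the same is true
  of a power of \<open>(f - b1) / (g - b1)\<close>, unless this quotient is constant; and then it is 1, because
  \<open>f = b2\<close> entails \<open>g = b2\<close> (\<open>equal_values_imp_equal\<close>).
\<close>

section \<open>Entire functions and the Poisson-Jensen inequality\<close>

lemma entire_factor_zero:
  fixes \<phi> :: "complex \<Rightarrow> complex"
  assumes hol: "\<phi> holomorphic_on UNIV" and nz: "\<phi> w \<noteq> 0"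
  obtains n k where "k holomorphic_on UNIV" "\<And>z. \<phi> z = (z - a) ^ n * k z" "k a \<noteq> 0"
proof -
  define n where "n = nat (zorder \<phi> a)"
  define p where "p = zor_poly \<phi> a"
  have "\<exists>w\<in>UNIV. \<phi> w \<noteq> 0" using nz by blast
  then obtain r where r: "r > 0" "p holomorphic_on cball a r"
      "\<And>z. z \<in> cball a r \<Longrightarrow> \<phi> z = p z * (z - a) ^ n \<and> p z \<noteq> 0"
    using zorder_exist_zero[OF hol open_UNIV connected_UNIV UNIV_I, of a]
    unfolding n_def p_def by blast
  define k where "k z = (if z = a then p a else \<phi> z / (z - a) ^ n)" for z
  have kp: "k z = p z" if "z \<in> ball a r" for z
    using r(3)[of z] that by (auto simp: k_def)
  have "k field_differentiable at z" for z
  proof (cases "z = a")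
    case True
    have "p holomorphic_on ball a r" using r(2) by (rule holomorphic_on_subset) auto
    then have "k holomorphic_on ball a r" using kp by (metis holomorphic_transform)
    then show ?thesis using True r(1)
      by (metis centre_in_ball holomorphic_on_imp_differentiable_at open_ball)
  next
    case False
    have "(\<lambda>z. \<phi> z / (z - a) ^ n) holomorphic_on (- {a})"
      by (intro holomorphic_intros holomorphic_on_subset[OF hol]) auto
    then have "k holomorphic_on (- {a})"
      by (rule holomorphic_transform) (auto simp: k_def)
    then show ?thesis using False
      by (metis ComplI holomorphic_on_imp_differentiable_at open_delete Compl_eq_Diff_UNIV open_UNIV singletonD)
  qed
  then have "k holomorphic_on UNIV" by (simp add: holomorphic_on_def)
  moreover have "\<phi> z = (z - a) ^ n * k z" for z
    using r(3)[of a] r(1) by (cases "z = a") (auto simp: k_def)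
  moreover have "k a \<noteq> 0" using r(3)[of a] r(1) by (simp add: k_def)
  ultimately show ?thesis using that by blast
qed

text \<open>
  One zero of an entire function is divided out at a time; the cofactor stays entire because the
  singularity is removable.
\<close>

lemma entire_factor_zeros:
  fixes \<phi> :: "complex \<Rightarrow> complex"
  assumes hol: "\<phi> holomorphic_on UNIV" and nz: "\<phi> w \<noteq> 0" and fin: "finite A"
  obtains m k where "k holomorphic_on UNIV" "\<And>z. \<phi> z = (\<Prod>a\<in>A. (z - a) ^ m a) * k z"
    "\<And>a. a \<in> A \<Longrightarrow> k a \<noteq> 0"
proof -
  from fin have "\<exists>m k. k holomorphic_on UNIV \<and> (\<forall>z. \<phi> z = (\<Prod>a\<in>A. (z - a) ^ m a) * k z) \<and>
    (\<forall>a\<in>A. k a \<noteq> 0)"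
  proof (induction A)
    case empty
    then show ?case using hol by auto
  next
    case (insert b A)
    then obtain m k where k: "k holomorphic_on UNIV" "\<And>z. \<phi> z = (\<Prod>a\<in>A. (z - a) ^ m a) * k z"
      "\<And>a. a \<in> A \<Longrightarrow> k a \<noteq> 0" by blast
    have "k w \<noteq> 0" using nz k(2)[of w] by auto
    then obtain n k' where k': "k' holomorphic_on UNIV" "\<And>z. k z = (z - b) ^ n * k' z" "k' b \<noteq> 0"
      by (rule entire_factor_zero[OF k(1), where a = b]) (rule that; assumption)
    have *: "(\<Prod>a\<in>A. (z - a) ^ (m(b := n)) a) = (\<Prod>a\<in>A. (z - a) ^ m a)" for z
      by (rule prod.cong) (use insert.hyps in auto)
    have "\<phi> z = (\<Prod>a\<in>insert b A. (z - a) ^ (m(b := n)) a) * k' z" for z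
      unfolding prod.insert[OF insert.hyps] * k(2)[of z] k'(2)[of z] by simp
    moreover have "\<forall>a\<in>insert b A. k' a \<noteq> 0"
      using k(3) k'(2,3) by (metis insert_iff mult_zero_right)
    ultimately show ?case using k'(1) by blast
  qed
  then show ?thesis using that by blast
qed

lemma finite_entire_zeros:
  fixes \<phi> :: "complex \<Rightarrow> complex"
  assumes hol: "\<phi> holomorphic_on UNIV" and nz: "\<phi> w \<noteq> 0"
  shows "finite {z. norm z \<le> R \<and> \<phi> z = 0}"
proof -
  have "\<not> \<phi> constant_on UNIV \<or> (\<forall>z. \<phi> z \<noteq> 0)"
    using nz by (metis UNIV_I constant_on_def)
  then show ?thesis
  proof
    assume "\<not> \<phi> constant_on UNIV"
    then have "finite {z \<in> cball 0 R. \<phi> z = 0}"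
      using holomorphic_compact_finite_zeros[OF hol open_UNIV connected_UNIV compact_cball subset_UNIV] by blast
    then show ?thesis by simp
  qed auto
qed

text \<open>
  The quotient of \<open>z - a\<close> by the Blaschke factor of the disc of radius
  \<open>R\<close>: for \<open>a\<close> in the disc, it has the modulus of \<open>z - a\<close> on
  the boundary circle, but no zero inside.
\<close>

definition blaschke :: "real \<Rightarrow> complex \<Rightarrow> complex \<Rightarrow> complex" where
  "blaschke R a z = (of_real R ^ 2 - cnj a * z) / of_real R"

lemma norm_blaschke_circle:
  assumes "norm z = R" "R > 0"
  shows "norm (blaschke R a z) = norm (z - a)"
proof -
  have "of_real R ^ 2 = z * cnj z" using assms complex_norm_square[of z] by simp
  then have "of_real R ^ 2 - cnj a * z = z * cnj (z - a)" by (simp add: algebra_simps)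
  then show ?thesis using assms by (simp add: blaschke_def norm_mult norm_divide del: complex_cnj_diff)
qed

lemma norm_blaschke_ge:
  assumes "norm z \<le> R" "norm a \<le> R" "R > 0"
  shows "norm (z - a) \<le> norm (blaschke R a z)"
proof -
  have sq: "norm w ^ 2 = Re w ^ 2 + Im w ^ 2" for w by (simp add: cmod_power2)
  have "(norm (of_real R ^ 2 - cnj a * z))\<^sup>2 - R\<^sup>2 * (norm (z - a))\<^sup>2
      = (R\<^sup>2 - (norm z)\<^sup>2) * (R\<^sup>2 - (norm a)\<^sup>2)"
    unfolding sq by (simp add: power2_eq_square) algebra
  moreover have "\<dots> \<ge> 0" using assms by (intro mult_nonneg_nonneg) (auto simp: power_mono)
  ultimately have "(R * norm (z - a))\<^sup>2 \<le> (norm (of_real R ^ 2 - cnj a * z))\<^sup>2"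
    by (simp add: power_mult_distrib)
  then have "R * norm (z - a) \<le> norm (of_real R ^ 2 - cnj a * z)"
    by (rule power2_le_imp_le) simp
  then show ?thesis using assms by (simp add: blaschke_def norm_divide field_simps)
qed

lemma blaschke_nonzero:
  assumes "norm z \<le> R" "norm a < R"
  shows "blaschke R a z \<noteq> 0"
proof
  have R: "R > 0" using assms(2) norm_ge_zero[of a] by linarith
  assume "blaschke R a z = 0"
  then have "of_real R ^ 2 = cnj a * z" using R by (simp add: blaschke_def)
  then have "R ^ 2 = norm a * norm z"
    by (metis R abs_of_pos complex_mod_cnj norm_mult norm_of_real norm_power)
  moreover have "norm a * norm z \<le> norm a * R" using assms by (intro mult_left_mono) auto
  moreover have "norm a * R < R * R" using assms R by simp
  ultimately show False by (simp add: power2_eq_square)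
qed

lemma holomorphic_blaschke [holomorphic_intros]: "R \<noteq> 0 \<Longrightarrow> blaschke R a holomorphic_on S"
  unfolding blaschke_def by (intro holomorphic_intros) auto

text \<open>
  Replacing each factor \<open>z - a\<close> that vanishes in the disc by \<open>blaschke R a
  z\<close> leaves the modulus on the boundary unchanged and increases it inside.  The function
  \<open>K\<close> is therefore a zero-free majorant of \<open>\<phi>\<close> with the same boundary
  values in modulus.
\<close>

lemma blaschke_factorization:
  fixes \<phi> :: "complex \<Rightarrow> complex"
  assumes hol: "\<phi> holomorphic_on UNIV" and nz: "\<phi> w \<noteq> 0" and R: "R > 0"
  obtains m k K Z where "Z = {a. norm a < R \<and> \<phi> a = 0}" "finite Z"
    "k holomorphic_on UNIV" "\<And>z. \<phi> z = (\<Prod>a\<in>Z. (z - a) ^ m a) * k z"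
    "K holomorphic_on UNIV" "\<And>z. K z = (\<Prod>a\<in>Z. blaschke R a z ^ m a) * k z"
    "\<And>z. norm z < R \<Longrightarrow> K z \<noteq> 0" "\<And>z. norm z < R \<Longrightarrow> k z \<noteq> 0"
    "\<And>z. norm z = R \<Longrightarrow> norm (K z) = norm (\<phi> z)"
    "\<And>z. norm z < R \<Longrightarrow> norm (\<phi> z) \<le> norm (K z)"
proof -
  define Z where "Z = {a. norm a < R \<and> \<phi> a = 0}"
  have fin: "finite Z"
    by (rule finite_subset[OF _ finite_entire_zeros[OF hol nz, of R]]) (auto simp: Z_def)
  obtain m k where mk: "k holomorphic_on UNIV" "\<And>z. \<phi> z = (\<Prod>a\<in>Z. (z - a) ^ m a) * k z"
    "\<And>a. a \<in> Z \<Longrightarrow> k a \<noteq> 0"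
    by (rule entire_factor_zeros[OF hol nz fin]) (rule that; assumption)
  define K where "K z = (\<Prod>a\<in>Z. blaschke R a z ^ m a) * k z" for z
  have k0: "k z \<noteq> 0" if "norm z < R" for z
    using mk(2)[of z] mk(3)[of z] that by (auto simp: Z_def)
  show ?thesis
  proof (rule that[OF Z_def fin mk(1,2), of K])
    show "K holomorphic_on UNIV"
      unfolding K_def using R by (intro holomorphic_intros mk(1)) auto
    show "K z \<noteq> 0" if "norm z < R" for z
      using k0[OF that] that fin blaschke_nonzero[of z R] by (auto simp: K_def Z_def)
    show "norm (K z) = norm (\<phi> z)" if "norm z = R" for z
      using that R by (simp add: K_def mk(2) norm_mult norm_power prod_norm[symmetric] norm_blaschke_circle)
    show "norm (\<phi> z) \<le> norm (K z)" if "norm z < R" for z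
      unfolding K_def mk(2) norm_mult norm_power prod_norm[symmetric]
      using that R by (intro mult_right_mono prod_mono conjI power_mono norm_blaschke_ge) (auto simp: Z_def)
  qed (use K_def k0 in auto)
qed

definition circle_mean :: "real \<Rightarrow> (complex \<Rightarrow> real) \<Rightarrow> real" where
  "circle_mean r u = 1 / (2 * pi) * integral {0..2 * pi} (\<lambda>t. u (of_real r * cis t))"

definition poisson_kernel :: "real \<Rightarrow> complex \<Rightarrow> complex \<Rightarrow> real" where
  "poisson_kernel R z \<zeta> = (R\<^sup>2 - (norm z)\<^sup>2) / (norm (\<zeta> - z))\<^sup>2"

text \<open>
  The Cauchy integral formula is applied to \<open>\<kappa>(u)\<close> times \<open>(R\<^sup>2 -
  \<bar>z\<bar>\<^sup>2) / (R\<^sup>2 - cnj z u)\<close>, which equals 1 at \<open>u = z\<close> and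
  turns the Cauchy kernel into the Poisson kernel on the circle.
\<close>

lemma poisson_integral_holomorphic:
  fixes \<kappa> :: "complex \<Rightarrow> complex"
  assumes hol: "\<kappa> holomorphic_on ball 0 R" and cont: "continuous_on (cball 0 R) \<kappa>"
    and z: "norm z < R"
  shows "((\<lambda>t. \<kappa> (of_real R * cis t) * of_real (poisson_kernel R z (of_real R * cis t)))
           has_integral (2 * pi * \<kappa> z)) {0..2 * pi}"
proof -
  have R: "R > 0" using z norm_ge_zero[of z] by linarith
  define g where "g w = \<kappa> w * (of_real (R\<^sup>2 - (norm z)\<^sup>2) / (of_real R ^ 2 - cnj z * w))" for w
  have den: "of_real R ^ 2 - cnj z * w \<noteq> 0" if "norm w \<le> R" for w
    using blaschke_nonzero[OF that z] R by (simp add: blaschke_def)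
  have contg: "continuous_on (cball 0 R) g"
    unfolding g_def using den by (intro continuous_intros cont) auto
  have holg: "g holomorphic_on ball 0 R"
    unfolding g_def using den by (intro holomorphic_intros hol) auto
  have "((\<lambda>u. g u / (u - z)) has_contour_integral (2 * of_real pi * \<i> * g z)) (circlepath 0 R)"
    using Cauchy_integral_circlepath[OF contg holg] z by simp
  then have "((\<lambda>t. g (R * cis t) / (R * cis t - z) * R * \<i> * cis t) has_integral 2 * of_real pi * \<i> * g z) {0..2*pi}"
    using has_contour_integral_part_circlepath_iff[of 0 "2*pi" "\<lambda>u. g u / (u - z)" _ 0 R]
    by (simp add: circlepath_def)
  then have I: "((\<lambda>t. - \<i> * (g (R * cis t) / (R * cis t - z) * R * \<i> * cis t)) has_integral - \<i> * (2 * of_real pi * \<i> * g z)) {0..2*pi}"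
    by (rule has_integral_mult_right)
  have gz: "g z = \<kappa> z"
  proof -
    have "of_real (R\<^sup>2 - (norm z)\<^sup>2) = of_real R ^ 2 - cnj z * z"
      using complex_norm_square[of z] by (simp add: mult.commute)
    moreover have "of_real R ^ 2 - cnj z * z \<noteq> 0" using den[of z] z by simp
    ultimately show ?thesis by (simp add: g_def)
  qed
  have eq: "- \<i> * (g (R * cis t) / (R * cis t - z) * R * \<i> * cis t)
      = \<kappa> (of_real R * cis t) * of_real (poisson_kernel R z (of_real R * cis t))" for t
  proof -
    define \<zeta> where "\<zeta> = of_real R * cis t"
    have n: "norm \<zeta> = R" using R by (simp add: \<zeta>_def norm_mult)
    then have nz: "\<zeta> \<noteq> z" "\<zeta> \<noteq> 0" using z R by auto
    have "of_real R ^ 2 = \<zeta> * cnj \<zeta>" using n complex_norm_square[of \<zeta>] by simp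
    then have e: "of_real R ^ 2 - cnj z * \<zeta> = \<zeta> * cnj (\<zeta> - z)" by (simp add: algebra_simps)
    have "of_real (poisson_kernel R z \<zeta>) = of_real (R\<^sup>2 - (norm z)\<^sup>2) / ((\<zeta> - z) * cnj (\<zeta> - z))"
      unfolding poisson_kernel_def complex_norm_square[symmetric] by (simp only: of_real_divide of_real_power)
    moreover have "g \<zeta> = \<kappa> \<zeta> * (of_real (R\<^sup>2 - (norm z)\<^sup>2) / (\<zeta> * cnj (\<zeta> - z)))"
      unfolding g_def e ..
    moreover have e2: "- \<i> * (g \<zeta> / (\<zeta> - z) * R * \<i> * cis t) = g \<zeta> / (\<zeta> - z) * \<zeta>"
    proof -
    have "- \<i> * (g \<zeta> / (\<zeta> - z) * R * \<i> * cis t) = (- \<i> * \<i>) * (g \<zeta> / (\<zeta> - z) * \<zeta>)"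
      unfolding \<zeta>_def times_divide_eq_left times_divide_eq_right by (simp only: mult_ac)
    then have "- \<i> * (g \<zeta> / (\<zeta> - z) * R * \<i> * cis t) = g \<zeta> / (\<zeta> - z) * \<zeta>" by simp
    then show ?thesis .
    qed
    moreover have "\<kappa> \<zeta> * (D / (\<zeta> * c)) / (\<zeta> - z) * \<zeta> = \<kappa> \<zeta> * (D / ((\<zeta> - z) * c))" for D c
      using nz by (cases "c = 0") (auto simp: field_simps)
    ultimately show ?thesis unfolding \<zeta>_def[symmetric] e2 by simp
  qed
  have "- \<i> * (2 * of_real pi * \<i> * \<kappa> z) = 2 * pi * \<kappa> z" by (simp add: algebra_simps)
  then show ?thesis using I unfolding eq gz by (simp only:)
qed

lemma poisson_kernel_nonneg: "norm z < R \<Longrightarrow> poisson_kernel R z \<zeta> \<ge> 0"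
  by (auto simp: poisson_kernel_def power_mono intro!: divide_nonneg_nonneg)

lemma poisson_kernel_le:
  assumes "norm z \<le> r" "r < R" "norm \<zeta> = R"
  shows "poisson_kernel R z \<zeta> \<le> (R + r) / (R - r)"
proof -
  have h: "norm (\<zeta> - z) \<ge> R - norm z" using assms norm_triangle_ineq2[of \<zeta> z] by simp
  have "poisson_kernel R z \<zeta> \<le> (R\<^sup>2 - (norm z)\<^sup>2) / (R - norm z)\<^sup>2"
    unfolding poisson_kernel_def using assms h
    by (intro divide_left_mono power_mono mult_pos_pos) (auto simp: power_mono intro!: zero_less_power)
  also have "\<dots> = (R + norm z) / (R - norm z)"
  proof -
    have "R\<^sup>2 - (norm z)\<^sup>2 = (R + norm z) * (R - norm z)" by (simp add: power2_eq_square algebra_simps)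
    then show ?thesis using assms by (simp add: power2_eq_square)
  qed
  also have "\<dots> \<le> (R + r) / (R - r)"
    using assms norm_ge_zero[of z] by (intro frac_le) (auto simp del: norm_ge_zero)
  finally show ?thesis .
qed

text \<open>
  The zero-free majorant \<open>K\<close> of \<open>\<phi>\<close> has a holomorphic logarithm on a
  neighbourhood of the closed disc, so the Poisson integral represents \<open>ln
  \<bar>K\<bar>\<close>, which agrees with \<open>ln \<bar>\<phi>\<bar>\<close> on the circle.
\<close>

lemma poisson_jensen_inequality:
  fixes \<phi> :: "complex \<Rightarrow> complex"
  assumes hol: "\<phi> holomorphic_on UNIV" and z: "norm z < R" and nz: "\<phi> z \<noteq> 0"
    and nz': "\<And>\<zeta>. norm \<zeta> = R \<Longrightarrow> \<phi> \<zeta> \<noteq> 0"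
  shows "ln (norm (\<phi> z)) \<le> circle_mean R (\<lambda>\<zeta>. ln (norm (\<phi> \<zeta>)) * poisson_kernel R z \<zeta>)"
proof -
  have R: "R > 0" using z norm_ge_zero[of z] by linarith
  obtain K where K: "K holomorphic_on UNIV"
    "\<And>z. norm z < R \<Longrightarrow> K z \<noteq> 0"
    "\<And>z. norm z = R \<Longrightarrow> norm (K z) = norm (\<phi> z)"
    "\<And>z. norm z < R \<Longrightarrow> norm (\<phi> z) \<le> norm (K z)"
    by (rule blaschke_factorization[OF hol nz R]) (rule that; assumption)
  have K0: "K \<zeta> \<noteq> 0" if "\<zeta> \<in> cball 0 R" for \<zeta>
    using K(2)[of \<zeta>] K(3)[of \<zeta>] nz'[of \<zeta>] that by (cases "norm \<zeta> = R") auto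
  have "open {\<zeta>. K \<zeta> \<noteq> 0}"
    using K(1) by (intro open_Collect_neq continuous_on_const) (rule holomorphic_on_imp_continuous_on)
  moreover have "cball 0 R \<subseteq> {\<zeta>. K \<zeta> \<noteq> 0}" using K0 by auto
  ultimately obtain e where e: "e > 0" "(\<Union>x\<in>cball 0 R. ball x e) \<subseteq> {\<zeta>. K \<zeta> \<noteq> 0}"
    using compact_subset_open_imp_ball_epsilon_subset[OF compact_cball] by blast
  have sub: "ball 0 (R + e) \<subseteq> {\<zeta>. K \<zeta> \<noteq> 0}"
  proof
    fix \<zeta> :: complex assume \<zeta>: "\<zeta> \<in> ball 0 (R + e)"
    show "\<zeta> \<in> {\<zeta>. K \<zeta> \<noteq> 0}"
    proof (cases "norm \<zeta> \<le> R")
      case True then show ?thesis using K0 by auto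
    next
      case False
      define \<xi> where "\<xi> = of_real (R / norm \<zeta>) * \<zeta>"
      have z0: "norm \<zeta> > 0" using False R by linarith
      then have n: "norm \<xi> = R" using R by (simp add: \<xi>_def norm_mult norm_divide)
      have "\<xi> - \<zeta> = of_real (R / norm \<zeta> - 1) * \<zeta>" by (simp add: \<xi>_def algebra_simps)
      then have "norm (\<xi> - \<zeta>) = \<bar>R / norm \<zeta> - 1\<bar> * norm \<zeta>" by (simp only: norm_mult norm_of_real)
      also have "\<bar>R / norm \<zeta> - 1\<bar> = 1 - R / norm \<zeta>" using False z0 by simp
      also have "(1 - R / norm \<zeta>) * norm \<zeta> = norm \<zeta> - R" using z0 by (simp add: algebra_simps)
      also have "\<dots> < e" using \<zeta> by simp
      finally have "\<zeta> \<in> ball \<xi> e" by (simp add: dist_norm)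
      moreover have "\<xi> \<in> cball 0 R" using n by simp
      ultimately show ?thesis using e(2) by blast
    qed
  qed
  obtain \<kappa> where \<kappa>: "\<kappa> holomorphic_on ball 0 (R + e)" "\<And>x. x \<in> ball 0 (R + e) \<Longrightarrow> exp (\<kappa> x) = K x"
  proof -
    have 1: "K holomorphic_on ball 0 (R + e)" by (rule holomorphic_on_subset[OF K(1)]) simp
    have 2: "K x \<noteq> 0" if "x \<in> ball 0 (R + e)" for x using sub that by blast
    have 3: "0 \<in> ball 0 (R + e)" using R e(1) by simp
    show ?thesis using holomorphic_logarithm_exists[OF convex_ball open_ball 1 2 3] that by blast
  qed
  have Re\<kappa>: "Re (\<kappa> x) = ln (norm (K x))" if "norm x \<le> R" for x
  proof -
    have "norm (K x) = exp (Re (\<kappa> x))"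
      using \<kappa>(2)[of x] norm_exp_eq_Re[of "\<kappa> x"] that e(1) by simp
    then show ?thesis by simp
  qed
  have "((\<lambda>t. \<kappa> (of_real R * cis t) * of_real (poisson_kernel R z (of_real R * cis t)))
           has_integral (2 * pi * \<kappa> z)) {0..2 * pi}"
  proof (rule poisson_integral_holomorphic[OF _ _ z])
    show "\<kappa> holomorphic_on ball 0 R"
      by (rule holomorphic_on_subset[OF \<kappa>(1)]) (use e(1) in auto)
    show "continuous_on (cball 0 R) \<kappa>"
      by (rule continuous_on_subset[OF holomorphic_on_imp_continuous_on[OF \<kappa>(1)]]) (use e(1) in auto)
  qed
  then have I: "((\<lambda>t. Re (\<kappa> (of_real R * cis t) * of_real (poisson_kernel R z (of_real R * cis t))))
           has_integral Re (2 * pi * \<kappa> z)) {0..2 * pi}"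
    by (rule has_integral_Re)
  have eq: "Re (\<kappa> (of_real R * cis t) * of_real (poisson_kernel R z (of_real R * cis t)))
     = ln (norm (\<phi> (of_real R * cis t))) * poisson_kernel R z (of_real R * cis t)" for t
    using K(3)[of "of_real R * cis t"] Re\<kappa>[of "of_real R * cis t"] R by (simp add: norm_mult)
  have eq2: "Re (2 * pi * \<kappa> z) = 2 * pi * ln (norm (K z))" using Re\<kappa>[of z] z by simp
  have "((\<lambda>t. ln (norm (\<phi> (of_real R * cis t))) * poisson_kernel R z (of_real R * cis t))
      has_integral 2 * pi * ln (norm (K z))) {0..2 * pi}"
    using I unfolding eq eq2 .
  then have "circle_mean R (\<lambda>\<zeta>. ln (norm (\<phi> \<zeta>)) * poisson_kernel R z \<zeta>) = ln (norm (K z))"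
    unfolding circle_mean_def by (simp add: integral_unique)
  moreover have "ln (norm (\<phi> z)) \<le> ln (norm (K z))"
    using K(4)[OF z] nz by (intro ln_mono) auto
  ultimately show ?thesis by simp
qed

section \<open>Consequences for circle means and logarithmic derivatives\<close>

lemma log_plus_eq_ln_max: "x \<ge> 0 \<Longrightarrow> log_plus x = ln (max 1 x)"
  using ln_less_zero[of x]
  by (cases "x \<ge> 1"; cases "x = 0") (auto simp: log_plus_def max_def not_le)

lemma log_plus_nonneg [simp]: "log_plus x \<ge> 0"
  by (simp add: log_plus_def)

lemma ln_le_log_plus: "ln x \<le> log_plus x"
  by (simp add: log_plus_def)

lemma log_plus_mono: "0 \<le> x \<Longrightarrow> x \<le> y \<Longrightarrow> log_plus x \<le> log_plus y"
  by (auto simp: log_plus_eq_ln_max max_def)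

lemma continuous_on_log_plus_norm [continuous_intros]:
  "continuous_on S h \<Longrightarrow> continuous_on S (\<lambda>z. log_plus (norm (h z :: complex)))"
  by (simp add: log_plus_eq_ln_max) (intro continuous_intros, auto simp: max_def)

lemma circle_mean_integrable:
  fixes u :: "complex \<Rightarrow> real"
  assumes "continuous_on (sphere 0 r) u" "r \<ge> 0"
  shows "(\<lambda>t. u (of_real r * cis t)) integrable_on {0..2 * pi}"
proof -
  have "continuous_on {0..2*pi} (\<lambda>t. u (of_real r * cis t))"
    by (rule continuous_on_compose2[OF assms(1)])
       (use assms(2) in \<open>auto intro!: continuous_intros simp: norm_mult\<close>)
  then show ?thesis by (rule integrable_continuous_real)
qed

lemma circle_mean_mono:
  assumes "continuous_on (sphere 0 r) u" "continuous_on (sphere 0 r) v" "r \<ge> 0"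
    and "\<And>\<zeta>. norm \<zeta> = r \<Longrightarrow> u \<zeta> \<le> v \<zeta>"
  shows "circle_mean r u \<le> circle_mean r v"
  unfolding circle_mean_def using assms
  by (intro mult_left_mono integral_le circle_mean_integrable) (auto simp: norm_mult)

lemma circle_mean_cong:
  assumes "\<And>\<zeta>. norm \<zeta> = r \<Longrightarrow> u \<zeta> = v \<zeta>" "r \<ge> 0"
  shows "circle_mean r u = circle_mean r v"
  unfolding circle_mean_def by (rule arg_cong[where f = "\<lambda>x. 1 / (2*pi) * x"], rule integral_cong)
    (use assms in \<open>auto simp: norm_mult\<close>)

lemma circle_mean_add:
  assumes "continuous_on (sphere 0 r) u" "continuous_on (sphere 0 r) v" "r \<ge> 0"
  shows "circle_mean r (\<lambda>\<zeta>. u \<zeta> + v \<zeta>) = circle_mean r u + circle_mean r v"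
  unfolding circle_mean_def
  by (subst integral_add[OF circle_mean_integrable[OF assms(1,3)] circle_mean_integrable[OF assms(2,3)]])
     (simp add: algebra_simps add_divide_distrib)

lemma circle_mean_cmult: "circle_mean r (\<lambda>\<zeta>. c * u \<zeta>) = c * circle_mean r u"
  unfolding circle_mean_def by (simp add: algebra_simps)

lemma circle_mean_const [simp]: "circle_mean r (\<lambda>\<zeta>. c) = c"
  unfolding circle_mean_def by simp

lemma circle_mean_nonneg:
  assumes "continuous_on (sphere 0 r) u" "r \<ge> 0" "\<And>\<zeta>. norm \<zeta> = r \<Longrightarrow> u \<zeta> \<ge> 0"
  shows "circle_mean r u \<ge> 0"
  using circle_mean_mono[of r "\<lambda>_. 0" u] assms by simp

text \<open>
  Divided by the power of \<open>z\<close> that vanishes at the origin, the function is covered by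
  the Poisson-Jensen inequality at the origin; for \<open>R \<ge> 1\<close> that power only
  increases the mean.
\<close>

lemma jensen_lower_bound:
  fixes \<phi> :: "complex \<Rightarrow> complex"
  assumes hol: "\<phi> holomorphic_on UNIV" and nz: "\<phi> w \<noteq> 0"
  obtains C where "\<And>R. R \<ge> 1 \<Longrightarrow> (\<And>\<zeta>. norm \<zeta> = R \<Longrightarrow> \<phi> \<zeta> \<noteq> 0) \<Longrightarrow>
    circle_mean R (\<lambda>\<zeta>. ln (norm (\<phi> \<zeta>))) \<ge> C"
proof -
  obtain n k where k: "k holomorphic_on UNIV" "\<And>z. \<phi> z = (z - 0) ^ n * k z" "k 0 \<noteq> 0"
    by (rule entire_factor_zero[OF hol nz, where a = 0]) (rule that; assumption)
  have "circle_mean R (\<lambda>\<zeta>. ln (norm (\<phi> \<zeta>))) \<ge> ln (norm (k 0))"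
    if R: "R \<ge> 1" and nzR: "\<And>\<zeta>. norm \<zeta> = R \<Longrightarrow> \<phi> \<zeta> \<noteq> 0" for R
  proof -
    have k0: "k \<zeta> \<noteq> 0" if "norm \<zeta> = R" for \<zeta> using nzR[OF that] k(2) by auto
    have contk: "continuous_on (sphere 0 R) k"
      by (rule continuous_on_subset[OF holomorphic_on_imp_continuous_on[OF k(1)]]) auto
    have c1: "continuous_on (sphere 0 R) (\<lambda>\<zeta>. ln (norm (k \<zeta>)))"
      by (intro continuous_intros contk) (use k0 in auto)
    have "ln (norm (k 0)) \<le> circle_mean R (\<lambda>\<zeta>. ln (norm (k \<zeta>)) * poisson_kernel R 0 \<zeta>)"
      by (rule poisson_jensen_inequality[OF k(1)]) (use R k(3) k0 in auto)
    also have "\<dots> = circle_mean R (\<lambda>\<zeta>. ln (norm (k \<zeta>)))"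
      by (rule circle_mean_cong) (use R in \<open>auto simp: poisson_kernel_def\<close>)
    also have "\<dots> \<le> circle_mean R (\<lambda>\<zeta>. real n * ln R + ln (norm (k \<zeta>)))"
      by (rule circle_mean_mono) (use R in \<open>auto intro!: continuous_intros c1 c1[unfolded o_def]\<close>)
    also have "\<dots> = circle_mean R (\<lambda>\<zeta>. ln (norm (\<phi> \<zeta>)))"
      by (rule circle_mean_cong)
         (use R k0 in \<open>auto simp: k(2) norm_mult norm_power ln_mult ln_realpow\<close>)
    finally show ?thesis .
  qed
  then show ?thesis using that by blast
qed

text \<open>
  The Poisson kernel is at most \<open>(R + r) / (R - r)\<close>; thus the means of
  \<open>log_plus\<close> control the maximum modulus on smaller discs.
\<close>

lemma harnack_max_bound:
  fixes \<phi> :: "complex \<Rightarrow> complex"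
  assumes hol: "\<phi> holomorphic_on UNIV" and z: "norm z \<le> r" "r < R" 
    and nz': "\<And>\<zeta>. norm \<zeta> = R \<Longrightarrow> \<phi> \<zeta> \<noteq> 0"
  shows "log_plus (norm (\<phi> z)) \<le> (R + r) / (R - r) * circle_mean R (\<lambda>\<zeta>. log_plus (norm (\<phi> \<zeta>)))"
proof -
  have R: "R > 0" "r \<ge> 0" using z norm_ge_zero[of z] by linarith+
  have cont: "continuous_on (sphere 0 R) \<phi>"
    by (rule continuous_on_subset[OF holomorphic_on_imp_continuous_on[OF hol]]) auto
  have nonneg: "0 \<le> (R + r) / (R - r) * circle_mean R (\<lambda>\<zeta>. log_plus (norm (\<phi> \<zeta>)))"
    using R z by (intro mult_nonneg_nonneg circle_mean_nonneg divide_nonneg_nonneg continuous_intros cont) auto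
  have cp: "continuous_on (sphere 0 R) (poisson_kernel R z)"
    unfolding poisson_kernel_def using z by (intro continuous_intros) auto
  have "ln (norm (\<phi> z)) \<le> (R + r) / (R - r) * circle_mean R (\<lambda>\<zeta>. log_plus (norm (\<phi> \<zeta>)))"
  proof (cases "\<phi> z = 0")
    case False
    have "ln (norm (\<phi> z)) \<le> circle_mean R (\<lambda>\<zeta>. ln (norm (\<phi> \<zeta>)) * poisson_kernel R z \<zeta>)"
      by (rule poisson_jensen_inequality[OF hol]) (use z False nz' in auto)
    also have "\<dots> \<le> circle_mean R (\<lambda>\<zeta>. (R + r) / (R - r) * log_plus (norm (\<phi> \<zeta>)))"
    proof (rule circle_mean_mono)
      show "continuous_on (sphere 0 R) (\<lambda>\<zeta>. ln (norm (\<phi> \<zeta>)) * poisson_kernel R z \<zeta>)"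
        by (intro continuous_intros cont cp) (use nz' in auto)
      show "continuous_on (sphere 0 R) (\<lambda>\<zeta>. (R + r) / (R - r) * log_plus (norm (\<phi> \<zeta>)))"
        using z by (intro continuous_intros cont) auto
      fix \<zeta> :: complex assume \<zeta>: "norm \<zeta> = R"
      have p: "0 \<le> poisson_kernel R z \<zeta>" "poisson_kernel R z \<zeta> \<le> (R + r) / (R - r)"
        using poisson_kernel_nonneg[of z R \<zeta>] poisson_kernel_le[of z r R \<zeta>] z \<zeta> by auto
      have "ln (norm (\<phi> \<zeta>)) * poisson_kernel R z \<zeta> \<le> log_plus (norm (\<phi> \<zeta>)) * poisson_kernel R z \<zeta>"
        by (rule mult_right_mono[OF ln_le_log_plus p(1)])
      also have "\<dots> \<le> log_plus (norm (\<phi> \<zeta>)) * ((R + r) / (R - r))"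
        by (rule mult_left_mono[OF p(2)]) simp
      finally show "ln (norm (\<phi> \<zeta>)) * poisson_kernel R z \<zeta> \<le> (R + r) / (R - r) * log_plus (norm (\<phi> \<zeta>))"
        by (simp only: mult.commute)
    qed (use R in auto)
    finally show ?thesis by (simp only: circle_mean_cmult)
  qed (use nonneg in auto)
  then show ?thesis using nonneg by (simp add: log_plus_def)
qed

text \<open>
  A Moebius map takes the half-plane \<open>Re w < 2 A\<close> to the unit disc, and the Schwarz
  lemma applies to the composition.
\<close>

lemma borel_caratheodory:
  fixes h :: "complex \<Rightarrow> complex"
  assumes hol: "h holomorphic_on ball 0 t" and A: "A > 0"
    and Re_le: "\<And>z. norm z < t \<Longrightarrow> Re (h z) \<le> Re (h 0) + A" and z: "norm z < t"
  shows "norm (h z - h 0) \<le> 4 * A * t / (t - norm z)"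
proof -
  have t: "t > 0" using z norm_ge_zero[of z] by linarith
  define g where "g w = h (of_real t * w) - h 0" for w
  \<comment> \<open>With \<open>4 A\<close> in place of \<open>2 A\<close>, the bound \<open>Re g \<le> A\<close> gives the strict inequality \<open>\<bar>q\<bar> < 1\<close>.\<close>
  define q where "q w = g w / (of_real (4 * A) - g w)" for w
  have Reg: "Re (g w) \<le> A" if "norm w < 1" for w
    using Re_le[of "of_real t * w"] that t by (simp add: g_def norm_mult)
  have lt: "norm (g w) < norm (of_real (4 * A) - g w)" if "norm w < 1" for w
  proof (rule power2_less_imp_less)
    have "(norm (of_real (4 * A) - g w))\<^sup>2 - (norm (g w))\<^sup>2 = 8 * A * (2 * A - Re (g w))"
      unfolding cmod_power2 by (simp add: power2_eq_square algebra_simps)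
    also have "\<dots> > 0" using Reg[OF that] A by (intro mult_pos_pos) auto
    finally show "(norm (g w))\<^sup>2 < (norm (of_real (4 * A) - g w))\<^sup>2" by simp
  qed simp
  have holg: "g holomorphic_on ball 0 1"
  proof -
    have "(h \<circ> (\<lambda>w. of_real t * w)) holomorphic_on ball 0 1"
    proof (rule holomorphic_on_compose_gen[OF _ hol])
      show "(\<lambda>w::complex. of_real t * w) ` ball 0 1 \<subseteq> (ball 0 t :: complex set)"
      proof
        fix x :: complex assume "x \<in> (\<lambda>w. of_real t * w) ` ball 0 1"
        then have "\<exists>w::complex. x = of_real t * w \<and> norm w < 1" by auto
        then obtain w where "x = of_real t * w" "norm w < 1" by blast
        then show "x \<in> ball 0 t" using t by (simp add: norm_mult)
      qed
    qed (intro holomorphic_intros)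
    then show ?thesis unfolding g_def o_def by (intro holomorphic_intros)
  qed
  have den: "of_real (4 * A) - g w \<noteq> 0" if "norm w < 1" for w
  proof
    assume "of_real (4 * A) - g w = 0"
    then show False using lt[OF that] norm_ge_zero[of "g w"] by (simp only: norm_zero) 
  qed
  have holq: "q holomorphic_on ball 0 1"
    unfolding q_def by (intro holomorphic_intros holg) (use den in auto)
  have q0: "q 0 = 0" by (simp add: q_def g_def)
  have q1: "norm (q w) < 1" if "norm w < 1" for w
    using lt[OF that] den[OF that] by (simp add: q_def norm_divide)
  define w where "w = z / of_real t"
  have w: "norm w < 1" "of_real t * w = z" using z t by (auto simp: w_def norm_divide)
  have qw: "norm (q w) \<le> norm w" by (rule Schwarz_Lemma(1)[OF holq q0 q1 w(1)])
  have "q w * (of_real (4 * A) - g w) = g w" using den[OF w(1)] by (simp add: q_def)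
  then have gq: "of_real (4 * A) * q w = g w * (1 + q w)" by (simp add: algebra_simps)
  have "norm (g w) * (1 - norm w) \<le> norm (g w) * norm (1 + q w)"
    using norm_triangle_ineq2[of 1 "- q w"] qw by (intro mult_left_mono) auto
  also have "\<dots> = 4 * A * norm (q w)"
    using arg_cong[OF gq, of norm] A by (simp add: norm_mult)
  also have "\<dots> \<le> 4 * A" using q1[OF w(1)] A by simp
  finally have "norm (g w) * (1 - norm w) \<le> 4 * A" .
  moreover have "1 - norm w = (t - norm z) / t" using t by (simp add: w_def norm_divide field_simps)
  ultimately have "norm (g w) * (t - norm z) \<le> 4 * A * t" using t by (simp add: field_simps)
  then show ?thesis using z w(2) by (simp add: g_def field_simps)
qed

text \<open>
  The logarithmic derivative is the derivative of a holomorphic logarithm, whose modulus the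
  Borel-Caratheodory inequality bounds on a circle of radius \<open>(t - r) / 2\<close> about
  \<open>z\<close>; Cauchy's inequality does the rest.
\<close>

lemma zero_free_log_deriv_bound:
  fixes K :: "complex \<Rightarrow> complex"
  assumes hol: "K holomorphic_on ball 0 t" and nz: "\<And>z. norm z < t \<Longrightarrow> K z \<noteq> 0"
    and A: "A > 0" and le: "\<And>z. norm z < t \<Longrightarrow> ln (norm (K z)) \<le> ln (norm (K 0)) + A"
    and z: "norm z \<le> r" "r < t"
  shows "norm (deriv K z / K z) \<le> 16 * A * t / (t - r)\<^sup>2"
proof -
  have t: "t > 0" using z norm_ge_zero[of z] by linarith
  have 0: "0 \<in> ball 0 t" using t by simp
  have nz': "K x \<noteq> 0" if "x \<in> ball 0 t" for x using nz that by simp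
  obtain \<kappa> where \<kappa>: "\<kappa> holomorphic_on ball 0 t" "\<And>x. x \<in> ball 0 t \<Longrightarrow> exp (\<kappa> x) = K x"
    by (rule holomorphic_logarithm_exists[OF convex_ball open_ball hol nz' 0]) (assumption | rule that; assumption)+
  have Re\<kappa>: "Re (\<kappa> x) = ln (norm (K x))" if "norm x < t" for x
  proof -
    have "norm (K x) = exp (Re (\<kappa> x))" using \<kappa>(2)[of x] norm_exp_eq_Re[of "\<kappa> x"] that by simp
    then show ?thesis by simp
  qed
  define \<rho> where "\<rho> = (t - r) / 2"
  have \<rho>: "\<rho> > 0" using z by (simp add: \<rho>_def)
  have in_ball: "norm x \<le> t - \<rho>" if "norm (z - x) \<le> \<rho>" for x
  proof -
    have "norm x \<le> norm z + norm (z - x)" by (metis norm_minus_commute norm_triangle_sub)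
    then show ?thesis using that z by (simp add: \<rho>_def field_simps)
  qed
  have sub: "cball z \<rho> \<subseteq> ball 0 t"
  proof
    fix x assume "x \<in> cball z \<rho>"
    then show "x \<in> ball 0 t" using in_ball[of x] \<rho> by (simp add: dist_norm)
  qed
  have bd: "norm (\<kappa> x - \<kappa> 0) \<le> 8 * A * t / (t - r)" if "norm (z - x) = \<rho>" for x
  proof -
    have x: "norm x \<le> t - \<rho>" using in_ball[of x] that by simp
    have "norm (\<kappa> x - \<kappa> 0) \<le> 4 * A * t / (t - norm x)"
      by (rule borel_caratheodory[OF \<kappa>(1) A]) (use Re\<kappa> le t x \<rho> in auto)
    also have "\<dots> \<le> 4 * A * t / \<rho>"
      using x \<rho> A t by (intro divide_left_mono mult_pos_pos) auto
    also have "\<dots> = 8 * A * t / (t - r)" by (simp add: \<rho>_def)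
    finally show ?thesis .
  qed
  have "norm ((deriv ^^ 1) (\<lambda>x. \<kappa> x - \<kappa> 0) z) \<le> fact 1 * (8 * A * t / (t - r)) / \<rho> ^ 1"
  proof (rule Cauchy_inequality)
    show "(\<lambda>x. \<kappa> x - \<kappa> 0) holomorphic_on ball z \<rho>"
      using sub by (intro holomorphic_intros holomorphic_on_subset[OF \<kappa>(1)]) auto
    show "continuous_on (cball z \<rho>) (\<lambda>x. \<kappa> x - \<kappa> 0)"
      by (intro continuous_intros continuous_on_subset[OF holomorphic_on_imp_continuous_on[OF \<kappa>(1)] sub])
  qed (use \<rho> bd in auto)
  moreover have zt: "z \<in> ball 0 t" using z by simp
  have d\<kappa>: "(\<kappa> has_field_derivative deriv \<kappa> z) (at z)"
    by (rule holomorphic_derivI[OF \<kappa>(1) open_ball zt])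
  have "deriv (\<lambda>x. \<kappa> x - \<kappa> 0) z = deriv \<kappa> z"
    by (rule DERIV_imp_deriv) (auto intro!: derivative_eq_intros d\<kappa>)
  moreover have "deriv K z = K z * deriv \<kappa> z"
  proof -
    have "((\<lambda>x. exp (\<kappa> x)) has_field_derivative exp (\<kappa> z) * deriv \<kappa> z) (at z)"
      by (auto intro!: derivative_eq_intros d\<kappa>)
    then have "(K has_field_derivative exp (\<kappa> z) * deriv \<kappa> z) (at z)"
      by (rule has_field_derivative_transform_within_open[OF _ open_ball zt]) (use \<kappa>(2) in auto)
    then show ?thesis using \<kappa>(2)[OF zt] by (simp add: DERIV_imp_deriv)
  qed
  ultimately have "norm (deriv K z / K z) \<le> 8 * A * t / (t - r) / \<rho>"
    using nz[of z] z by simp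
  also have "\<dots> = 16 * A * t / (t - r)\<^sup>2" by (simp add: \<rho>_def power2_eq_square)
  finally show ?thesis .
qed

section \<open>Logarithmic derivatives of entire functions\<close>

lemma log_deriv_prod_power:
  fixes h :: "'a \<Rightarrow> complex \<Rightarrow> complex"
  assumes fin: "finite Z" and h: "\<And>a. a \<in> Z \<Longrightarrow> (h a has_field_derivative h' a) (at z)"
    "\<And>a. a \<in> Z \<Longrightarrow> h a z \<noteq> 0" and k: "(k has_field_derivative k') (at z)" "k z \<noteq> 0"
  shows "((\<lambda>z. (\<Prod>a\<in>Z. h a z ^ m a) * k z) has_field_derivative
    ((\<Prod>a\<in>Z. h a z ^ m a) * k z) * ((\<Sum>a\<in>Z. of_nat (m a) * (h' a / h a z)) + k' / k z)) (at z)"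
  using fin h
proof (induction Z)
  case empty
  then show ?case using k by (auto intro!: derivative_eq_intros)
next
  case (insert b Z)
  define Q where "Q z = (\<Prod>a\<in>Z. h a z ^ m a) * k z" for z
  define S where "S = (\<Sum>a\<in>Z. of_nat (m a) * (h' a / h a z)) + k' / k z"
  have IH: "(Q has_field_derivative Q z * S) (at z)"
    unfolding Q_def S_def using insert by blast
  have hb: "(h b has_field_derivative h' b) (at z)" and hb0: "h b z \<noteq> 0" using insert.prems by auto
  have "((\<lambda>z. h b z ^ m b * Q z) has_field_derivative
      of_nat (m b) * (h' b * h b z ^ (m b - Suc 0)) * Q z + Q z * S * h b z ^ m b) (at z)"
    by (rule derivative_eq_intros hb IH refl)+
  moreover have "of_nat (m b) * (h' b * h b z ^ (m b - Suc 0)) * Q z + Q z * S * h b z ^ m b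
     = (h b z ^ m b * Q z) * (of_nat (m b) * (h' b / h b z) + S)"
    using hb0 by (cases "m b") (auto simp: field_simps)
  ultimately have "((\<lambda>z. h b z ^ m b * Q z) has_field_derivative
      (h b z ^ m b * Q z) * (of_nat (m b) * (h' b / h b z) + S)) (at z)" by simp
  then show ?case using insert.hyps by (simp add: Q_def S_def mult.assoc add.assoc)
qed

lemma norm_le_of_circle_bound:
  fixes \<phi> :: "complex \<Rightarrow> complex"
  assumes hol: "\<phi> holomorphic_on UNIV" and s: "s > 0"
    and le: "\<And>z. norm z = s \<Longrightarrow> norm (\<phi> z) \<le> B" and z: "norm z \<le> s"
  shows "norm (\<phi> z) \<le> B"
  by (rule maximum_modulus_frontier[of \<phi> "cball 0 s"])
     (use s le z in \<open>auto intro: holomorphic_on_subset[OF hol] continuous_on_subset[OF holomorphic_on_imp_continuous_on[OF hol]]\<close>)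

text \<open>
  The number of zeros is bounded by comparing \<open>\<phi>(0)\<close> with the majorant for the
  larger radius \<open>s\<close>, as in Jensen's formula.  The logarithmic derivative of
  \<open>\<phi>\<close> differs from that of the zero-free majorant for the radius \<open>t\<close>
  by one bounded term for each zero, where \<open>\<eta>\<close> keeps the point away from the
  zeros.
\<close>

lemma zeros_and_log_deriv_bound:
  fixes \<phi> :: "complex \<Rightarrow> complex"
  assumes hol: "\<phi> holomorphic_on UNIV" and nz: "\<phi> 0 \<noteq> 0"
    and t: "0 < t" "t < s" and A: "A > 0"
    and le: "\<And>z. norm z = s \<Longrightarrow> norm (\<phi> z) \<le> norm (\<phi> 0) * exp A"
  shows "real (card {a. norm a < t \<and> \<phi> a = 0}) \<le> A * s / (s - t)"
    and "\<And>r z \<eta>. norm z = r \<Longrightarrow> r < t \<Longrightarrow> 0 < \<eta> \<Longrightarrow>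
      (\<And>a. norm a < t \<Longrightarrow> \<phi> a = 0 \<Longrightarrow> \<eta> \<le> \<bar>norm a - r\<bar>) \<Longrightarrow>
      \<phi> z \<noteq> 0 \<and> norm (deriv \<phi> z / \<phi> z) \<le> 16 * A * t / (t - r)\<^sup>2 + A * s / (s - t) * (1 / \<eta> + 1 / (t - r))"
proof -
  have s: "s > 0" using t by simp
  obtain m k K Z where Z: "Z = {a. norm a < t \<and> \<phi> a = 0}" and fin: "finite Z"
    and k: "k holomorphic_on UNIV" "\<And>z. \<phi> z = (\<Prod>a\<in>Z. (z - a) ^ m a) * k z"
    and K: "K holomorphic_on UNIV" "\<And>z. K z = (\<Prod>a\<in>Z. blaschke t a z ^ m a) * k z"
      "\<And>z. norm z < t \<Longrightarrow> K z \<noteq> 0" and k0: "\<And>z. norm z < t \<Longrightarrow> k z \<noteq> 0"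
    and Kc: "\<And>z. norm z = t \<Longrightarrow> norm (K z) = norm (\<phi> z)"
      "\<And>z. norm z < t \<Longrightarrow> norm (\<phi> z) \<le> norm (K z)"
    by (rule blaschke_factorization[OF hol nz t(1)]) (rule that; assumption)
  define N where "N = (\<Sum>a\<in>Z. m a)"
  have mpos: "m a \<ge> 1" if "a \<in> Z" for a
  proof (rule ccontr)
    assume "\<not> m a \<ge> 1"
    then have "m a = 0" by simp
    moreover have "\<phi> a = 0" "k a \<noteq> 0" using that k0 Z by auto
    then have "(\<Prod>b\<in>Z. (a - b) ^ m b) = 0" using k(2)[of a] by simp
    then obtain b where "b \<in> Z" "(a - b) ^ m b = 0" using fin by (auto simp: prod_zero_iff)
    ultimately show False by (cases "m b = 0") auto
  qed
  have Nle: "real N \<le> A * s / (s - t)"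
  proof -
    define Ks where "Ks z = (\<Prod>a\<in>Z. blaschke s a z ^ m a) * k z" for z
    have holKs: "Ks holomorphic_on UNIV"
      unfolding Ks_def using s by (intro holomorphic_intros k(1)) auto
    have Kss: "norm (Ks z) = norm (\<phi> z)" if "norm z = s" for z
      using that s by (simp add: Ks_def k(2) norm_mult norm_power prod_norm[symmetric] norm_blaschke_circle)
    have "norm (Ks 0) \<le> norm (\<phi> 0) * exp A"
      by (rule norm_le_of_circle_bound[OF holKs s]) (use Kss le s in auto)
    moreover have "blaschke s a 0 = of_real s" for a
      using s by (simp add: blaschke_def power2_eq_square)
    then have "norm (Ks 0) = s ^ N * norm (k 0)"
      using s by (simp add: Ks_def norm_mult norm_power prod_norm[symmetric] N_def power_sum)
    moreover have "norm (\<phi> 0) * exp A \<le> t ^ N * norm (k 0) * exp A"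
    proof (rule mult_right_mono)
      show "norm (\<phi> 0) \<le> t ^ N * norm (k 0)"
      unfolding k(2) norm_mult N_def power_sum prod_norm[symmetric] norm_power
      by (intro mult_right_mono prod_mono conjI power_mono) (use Z in auto)
    qed simp
    ultimately have "s ^ N * norm (k 0) \<le> t ^ N * norm (k 0) * exp A" by linarith
    then have "s ^ N * norm (k 0) \<le> (t ^ N * exp A) * norm (k 0)" by (simp only: mult_ac)
    then have "s ^ N \<le> t ^ N * exp A" using k0[of 0] t by simp
    then have "ln (s ^ N) \<le> ln (t ^ N * exp A)" using s t by (intro ln_mono) auto
    then have "real N * ln s \<le> real N * ln t + A" using s t by (simp add: ln_mult ln_realpow)
    moreover have "(s - t) / s \<le> ln s - ln t"
      using ln_le_minus_one[of "t / s"] s t by (simp add: ln_div field_simps)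
    then have "real N * ((s - t) / s) \<le> real N * (ln s - ln t)" by (intro mult_left_mono) auto
    ultimately have "real N * ((s - t) / s) \<le> A" by (simp add: algebra_simps)
    then show ?thesis using s t by (simp add: field_simps)
  qed
  have "card Z \<le> N" unfolding N_def card_eq_sum by (rule sum_mono) (use mpos in auto)
  then show "real (card {a. norm a < t \<and> \<phi> a = 0}) \<le> A * s / (s - t)"
    using Nle unfolding Z[symmetric] by linarith
  fix r \<eta> :: real and z :: complex
  assume z: "norm z = r" "r < t" and \<eta>: "0 < \<eta>"
    and sep: "\<And>a. norm a < t \<Longrightarrow> \<phi> a = 0 \<Longrightarrow> \<eta> \<le> \<bar>norm a - r\<bar>"
  have \<phi>z: "\<phi> z \<noteq> 0" using sep[of z] z \<eta> by auto
  have kz: "k z \<noteq> 0" using k0 z by simp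
  have zt: "norm z < t" using z by simp
  have tr: "t - r > 0" using z by simp
  have hk: "(k has_field_derivative deriv k z) (at z)"
    by (rule holomorphic_derivI[OF k(1)]) auto
  have sepZ: "\<eta> \<le> norm (z - a)" if "a \<in> Z" for a
    using sep[of a] that Z norm_triangle_ineq3[of z a] z by auto
  have bz: "blaschke t a z \<noteq> 0" if "a \<in> Z" for a
    using blaschke_nonzero[of z t a] that z Z by auto
  have hb: "(blaschke t a has_field_derivative (- cnj a / of_real t)) (at z)" for a
    unfolding blaschke_def using t by (auto intro!: derivative_eq_intros)
  have d1: "deriv \<phi> z / \<phi> z = (\<Sum>a\<in>Z. of_nat (m a) * (1 / (z - a))) + deriv k z / k z"
  proof -
    have "((\<lambda>z. (\<Prod>a\<in>Z. (z - a) ^ m a) * k z) has_field_derivative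
      ((\<Prod>a\<in>Z. (z - a) ^ m a) * k z) * ((\<Sum>a\<in>Z. of_nat (m a) * (1 / (z - a))) + deriv k z / k z)) (at z)"
      by (rule log_deriv_prod_power[OF fin _ _ hk kz, where h = "\<lambda>a z. z - a"])
         (use sepZ \<eta> in \<open>force intro!: derivative_eq_intros\<close>)+
    then have "(\<phi> has_field_derivative \<phi> z * ((\<Sum>a\<in>Z. of_nat (m a) * (1 / (z - a))) + deriv k z / k z)) (at z)"
      unfolding k(2)[symmetric] .
    then show ?thesis using \<phi>z by (simp add: DERIV_imp_deriv)
  qed
  have d2: "deriv K z / K z = (\<Sum>a\<in>Z. of_nat (m a) * ((- cnj a / of_real t) / blaschke t a z)) + deriv k z / k z"
  proof -
    have "((\<lambda>z. (\<Prod>a\<in>Z. blaschke t a z ^ m a) * k z) has_field_derivative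
      ((\<Prod>a\<in>Z. blaschke t a z ^ m a) * k z) * ((\<Sum>a\<in>Z. of_nat (m a) * ((- cnj a / of_real t) / blaschke t a z)) + deriv k z / k z)) (at z)"
      by (rule log_deriv_prod_power[OF fin hb _ hk kz]) (use bz in auto)
    then have "(K has_field_derivative K z * ((\<Sum>a\<in>Z. of_nat (m a) * ((- cnj a / of_real t) / blaschke t a z)) + deriv k z / k z)) (at z)"
      unfolding K(2)[symmetric] .
    then show ?thesis using K(3)[OF zt] by (simp add: DERIV_imp_deriv)
  qed
  have term_le: "norm (of_nat (m a) * (1 / (z - a) - (- cnj a / of_real t) / blaschke t a z))
      \<le> real (m a) * (1 / \<eta> + 1 / (t - r))" if a: "a \<in> Z" for a
  proof -
    have an: "norm a < t" using a Z by auto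
    have "norm (1 / (z - a)) \<le> 1 / \<eta>"
      unfolding norm_divide norm_one using sepZ[OF a] \<eta> by (intro divide_left_mono mult_pos_pos) auto
    moreover have "norm ((- cnj a / of_real t) / blaschke t a z) \<le> 1 / (t - r)"
    proof -
      have "norm a * r \<le> t * r" using an z norm_ge_zero[of z] by (intro mult_right_mono) auto
      then have "t * (t - r) \<le> t\<^sup>2 - norm (cnj a * z)"
        using z by (simp add: norm_mult power2_eq_square algebra_simps)
      also have "\<dots> \<le> norm (of_real t ^ 2 - cnj a * z)"
        using norm_triangle_ineq2[of "of_real t ^ 2" "cnj a * z"] by (simp add: norm_power)
      finally have h: "t * (t - r) \<le> norm (of_real t ^ 2 - cnj a * z)" .
      have "norm ((- cnj a / of_real t) / blaschke t a z) = norm a / norm (of_real t ^ 2 - cnj a * z)"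
        using t by (simp add: blaschke_def norm_divide)
      also have "\<dots> \<le> t / (t * (t - r))"
        using h an t z by (intro frac_le) auto
      also have "\<dots> = 1 / (t - r)" using t by simp
      finally show ?thesis .
    qed
    ultimately have "norm (1 / (z - a) - (- cnj a / of_real t) / blaschke t a z) \<le> 1 / \<eta> + 1 / (t - r)"
      using norm_triangle_ineq4[of "1 / (z - a)" "(- cnj a / of_real t) / blaschke t a z"] by linarith
    then show ?thesis unfolding norm_mult norm_of_nat by (intro mult_left_mono) auto
  qed
  have "deriv \<phi> z / \<phi> z = deriv K z / K z +
      (\<Sum>a\<in>Z. of_nat (m a) * (1 / (z - a) - (- cnj a / of_real t) / blaschke t a z))"
    unfolding d1 d2 by (simp only: right_diff_distrib sum_subtractf) (simp add: algebra_simps)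
  then have "norm (deriv \<phi> z / \<phi> z) \<le> norm (deriv K z / K z) +
      norm (\<Sum>a\<in>Z. of_nat (m a) * (1 / (z - a) - (- cnj a / of_real t) / blaschke t a z))"
    by (simp only: norm_triangle_ineq)
  also have "norm (deriv K z / K z) \<le> 16 * A * t / (t - r)\<^sup>2"
  proof (rule zero_free_log_deriv_bound[OF _ _ A])
    show "K holomorphic_on ball 0 t" by (rule holomorphic_on_subset[OF K(1)]) auto
    fix x :: complex assume x: "norm x < t"
    have "norm (K x) \<le> norm (\<phi> 0) * exp A"
    proof (rule norm_le_of_circle_bound[OF K(1) t(1)])
      fix y :: complex assume "norm y = t"
      then show "norm (K y) \<le> norm (\<phi> 0) * exp A"
        using norm_le_of_circle_bound[OF hol s le, of y] Kc(1)[of y] t by simp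
    qed (use x in simp)
    also have "\<dots> \<le> norm (K 0) * exp A"
      using Kc(2)[of 0] t by (intro mult_right_mono) auto
    finally have "ln (norm (K x)) \<le> ln (norm (K 0) * exp A)"
      using K(3)[OF x] by (intro ln_mono) auto
    then show "ln (norm (K x)) \<le> ln (norm (K 0)) + A"
      using K(3)[of 0] t by (simp add: ln_mult)
  qed (use K(3) z in auto)
  also have "norm (\<Sum>a\<in>Z. of_nat (m a) * (1 / (z - a) - (- cnj a / of_real t) / blaschke t a z))
      \<le> (\<Sum>a\<in>Z. real (m a) * (1 / \<eta> + 1 / (t - r)))"
    by (rule sum_norm_le) (rule term_le)
  also have "\<dots> = real N * (1 / \<eta> + 1 / (t - r))" by (simp add: N_def sum_distrib_right)
  also have "\<dots> \<le> A * s / (s - t) * (1 / \<eta> + 1 / (t - r))"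
    using \<eta> tr by (intro mult_right_mono Nle) auto
  finally show "\<phi> z \<noteq> 0 \<and> norm (deriv \<phi> z / \<phi> z) \<le> 16 * A * t / (t - r)\<^sup>2 + A * s / (s - t) * (1 / \<eta> + 1 / (t - r))"
    using \<phi>z by simp
qed

text \<open>
  Collects, for one function, the bounds of the preceding lemma in the form in which they are used
  for finitely many functions at the same time: the constant is independent of the radii and of the
  bound \<open>exp L\<close> for the modulus.
\<close>

definition log_deriv_const :: "(complex \<Rightarrow> complex) \<Rightarrow> real \<Rightarrow> bool" where
  "log_deriv_const \<phi> C \<longleftrightarrow> C \<ge> 1 \<and>
    (\<forall>t s L. 1 \<le> t \<longrightarrow> t < s \<longrightarrow> 0 \<le> L \<longrightarrow> (\<forall>z. norm z = s \<longrightarrow> norm (\<phi> z) \<le> exp L) \<longrightarrow>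
       real (card {a. norm a < t \<and> \<phi> a = 0}) \<le> C * (1 + L) * (s / (s - t))) \<and>
    (\<forall>r t s L \<eta> z. 1 \<le> r \<longrightarrow> r < t \<longrightarrow> t < s \<longrightarrow> s \<le> 2 * r \<longrightarrow> 0 \<le> L \<longrightarrow> 0 < \<eta> \<longrightarrow> \<eta> \<le> t - r \<longrightarrow>
       (\<forall>z. norm z = s \<longrightarrow> norm (\<phi> z) \<le> exp L) \<longrightarrow>
       (\<forall>a. norm a < t \<longrightarrow> \<phi> a = 0 \<longrightarrow> \<eta> \<le> \<bar>norm a - r\<bar>) \<longrightarrow> norm z = r \<longrightarrow>
       \<phi> z \<noteq> 0 \<and> norm (deriv \<phi> z / \<phi> z) \<le> C * (1 + L) * (t / (t - r)\<^sup>2 + s / (s - t) * (1 / \<eta>)))"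

text \<open>
  A zero at the origin is divided out first; it contributes one further zero and the harmless term
  \<open>n / z\<close> of the logarithmic derivative.
\<close>

lemma log_deriv_bound:
  fixes \<phi> :: "complex \<Rightarrow> complex"
  assumes hol: "\<phi> holomorphic_on UNIV" and nz: "\<phi> w \<noteq> 0"
  shows "\<exists>C. log_deriv_const \<phi> C"
proof -
  obtain n k where k: "k holomorphic_on UNIV" "\<And>z. \<phi> z = (z - 0) ^ n * k z" "k 0 \<noteq> 0"
    by (rule entire_factor_zero[OF hol nz, where a = 0]) (rule that; assumption)
  define C0 where "C0 = \<bar>ln (norm (k 0))\<bar> + 1"
  define C where "C = 16 * C0 + real n + 1"
  have C0: "C0 \<ge> 1" by (simp add: C0_def)
  have A: "\<bar>ln (norm (k 0))\<bar> + 1 + L \<le> C0 * (1 + L)" if "L \<ge> 0" for L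
  proof -
    have "L * 1 \<le> L * C0" using that C0 by (intro mult_left_mono)
    then show ?thesis by (simp add: C0_def algebra_simps)
  qed
  have kle: "norm (k z) \<le> norm (k 0) * exp (\<bar>ln (norm (k 0))\<bar> + 1 + L)"
    if "norm z \<ge> 1" "norm (\<phi> z) \<le> exp L" for z L
  proof -
    have "1 * norm (k z) \<le> norm z ^ n * norm (k z)"
      using that(1) by (intro mult_right_mono) auto
    also have "\<dots> \<le> exp L" using that(2) by (simp add: k(2) norm_mult norm_power)
    also have "\<dots> \<le> exp (ln (norm (k 0)) + (\<bar>ln (norm (k 0))\<bar> + 1 + L))" by simp
    also have "\<dots> = norm (k 0) * exp (\<bar>ln (norm (k 0))\<bar> + 1 + L)"
      using k(3) by (simp only: exp_add exp_ln_iff) simp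
    finally show ?thesis by simp
  qed
  have c1: "C \<ge> 1" using C0 by (simp add: C_def)
  have c2: "real (card {a. norm a < t \<and> \<phi> a = 0}) \<le> C * (1 + L) * (s / (s - t))"
    if h: "1 \<le> t" "t < s" "0 \<le> L" and le: "\<And>z. norm z = s \<Longrightarrow> norm (\<phi> z) \<le> exp L" for t s L :: real
  proof -
    define A0 where "A0 = \<bar>ln (norm (k 0))\<bar> + 1 + L"
    have "finite {a. norm a < t \<and> k a = 0}"
      by (rule finite_subset[OF _ finite_entire_zeros[OF k(1,3), of t]]) auto
    then have "card {a. norm a < t \<and> \<phi> a = 0} \<le> card (insert 0 {a. norm a < t \<and> k a = 0})"
      by (intro card_mono) (auto simp: k(2))
    also have "\<dots> \<le> card {a. norm a < t \<and> k a = 0} + 1"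
      by (simp add: card_insert_le_m1 card_insert_if)
    finally have "real (card {a. norm a < t \<and> \<phi> a = 0}) \<le> real (card {a. norm a < t \<and> k a = 0}) + 1" by simp
    also have "real (card {a. norm a < t \<and> k a = 0}) \<le> A0 * s / (s - t)"
      by (rule zeros_and_log_deriv_bound(1)[OF k(1,3)])
         (use h le kle in \<open>auto simp: A0_def\<close>)
    also have "A0 * s / (s - t) = A0 * (s / (s - t))" by simp
    also have "A0 * (s / (s - t)) \<le> C0 * (1 + L) * (s / (s - t))"
      using A[OF h(3)] h by (intro mult_right_mono) (auto simp: A0_def)
    also have "C0 * (1 + L) * (s / (s - t)) + 1 \<le> C * (1 + L) * (s / (s - t))"
    proof -
      have "1 \<le> s / (s - t)" using h by (simp add: field_simps)
      then have "1 * 1 \<le> (1 + L) * (s / (s - t))" using h by (intro mult_mono) auto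
      moreover have "(C0 + 1) * ((1 + L) * (s / (s - t))) \<le> C * ((1 + L) * (s / (s - t)))"
        using h C0 by (intro mult_right_mono mult_nonneg_nonneg) (auto simp: C_def)
      moreover have "(C0 + 1) * ((1 + L) * (s / (s - t)))
          = C0 * ((1 + L) * (s / (s - t))) + (1 + L) * (s / (s - t))" by (rule distrib_right[THEN trans]) simp
      ultimately show ?thesis unfolding mult.assoc by linarith
    qed
    finally show ?thesis by simp
  qed
  have c3: "\<phi> z \<noteq> 0 \<and> norm (deriv \<phi> z / \<phi> z) \<le> C * (1 + L) * (t / (t - r)\<^sup>2 + s / (s - t) * (1 / \<eta>))"
    if h: "1 \<le> r" "r < t" "t < s" "s \<le> 2 * r" "0 \<le> L" "0 < \<eta>" "\<eta> \<le> t - r"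
      and le: "\<And>z. norm z = s \<Longrightarrow> norm (\<phi> z) \<le> exp L"
      and sep: "\<And>a. norm a < t \<Longrightarrow> \<phi> a = 0 \<Longrightarrow> \<eta> \<le> \<bar>norm a - r\<bar>" and z: "norm z = r"
    for r t s L \<eta> :: real and z :: complex
  proof -
    define A0 where "A0 = \<bar>ln (norm (k 0))\<bar> + 1 + L"
    have A0: "A0 > 0" "A0 \<le> C0 * (1 + L)" using A[OF h(5)] h by (auto simp: A0_def)
    have z0: "z \<noteq> 0" using z h by auto
    have le': "norm (k y) \<le> norm (k 0) * exp A0" if "norm y = s" for y
      unfolding A0_def by (rule kle) (use that h le in auto)
    have *: "k z \<noteq> 0 \<and> norm (deriv k z / k z) \<le> 16 * A0 * t / (t - r)\<^sup>2 + A0 * s / (s - t) * (1 / \<eta> + 1 / (t - r))"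
      by (rule zeros_and_log_deriv_bound(2)[OF k(1,3) _ h(3) A0(1) le' z h(2,6)]) (use h sep k(2) in auto)
    have hk: "(k has_field_derivative deriv k z) (at z)"
      by (rule holomorphic_derivI[OF k(1)]) auto
    have \<phi>eq: "\<phi> = (\<lambda>z. z ^ n * k z)" using k(2) by auto
    have "(\<phi> has_field_derivative of_nat n * z ^ (n - Suc 0) * k z + deriv k z * z ^ n) (at z)"
      unfolding \<phi>eq by (auto intro!: derivative_eq_intros hk)
    then have "deriv \<phi> z / \<phi> z = (of_nat n * z ^ (n - Suc 0) * k z + deriv k z * z ^ n) / (z ^ n * k z)"
      by (simp add: DERIV_imp_deriv k(2))
    also have "\<dots> = of_nat n / z + deriv k z / k z"
      using * z0 by (cases n) (auto simp: field_simps)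
    finally have "norm (deriv \<phi> z / \<phi> z) \<le> norm (of_nat n / z) + norm (deriv k z / k z)"
      by (simp add: norm_triangle_ineq)
    also have "norm (of_nat n / z) = real n * (1 / r)" using z by (simp add: norm_divide)
    also have "real n * (1 / r) \<le> real n * (t / (t - r)\<^sup>2)"
    proof (intro mult_left_mono)
      have "1 / r \<le> 1 / (t - r)" using h by (intro divide_left_mono) auto
      also have "1 / (t - r) = (t - r) / (t - r)\<^sup>2" using h by (simp add: power2_eq_square)
      also have "\<dots> \<le> t / (t - r)\<^sup>2" using h by (intro divide_right_mono) auto
      finally show "1 / r \<le> t / (t - r)\<^sup>2" .
    qed simp
    also have "norm (deriv k z / k z) \<le> 16 * A0 * t / (t - r)\<^sup>2 + A0 * s / (s - t) * (1 / \<eta> + 1 / (t - r))"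
      using * by simp
    also have "\<dots> \<le> 16 * A0 * t / (t - r)\<^sup>2 + A0 * s / (s - t) * (2 * (1 / \<eta>))"
    proof -
      have "1 / (t - r) \<le> 1 / \<eta>" using h by (intro divide_left_mono) auto
      then show ?thesis using h A0 by (intro add_left_mono mult_left_mono) auto
    qed
    also have "\<dots> = A0 * (16 * (t / (t - r)\<^sup>2) + 2 * (s / (s - t) * (1 / \<eta>)))"
      by (simp add: algebra_simps)
    also have "\<dots> \<le> (C0 * (1 + L)) * (16 * (t / (t - r)\<^sup>2) + 16 * (s / (s - t) * (1 / \<eta>)))"
      using h A0 by (intro mult_mono add_mono mult_right_mono) auto
    finally have 1: "norm (deriv \<phi> z / \<phi> z) \<le> real n * (t / (t - r)\<^sup>2)
      + (C0 * (1 + L)) * (16 * (t / (t - r)\<^sup>2) + 16 * (s / (s - t) * (1 / \<eta>)))" by simp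
    define X where "X = t / (t - r)\<^sup>2"
    define Y where "Y = s / (s - t) * (1 / \<eta>)"
    have XY: "X \<ge> 0" "Y \<ge> 0" using h by (auto simp: X_def Y_def)
    have "real n * X \<le> real n * ((1 + L) * (X + Y))"
    proof (intro mult_left_mono)
      have "1 * X \<le> (1 + L) * (X + Y)" using XY h by (intro mult_mono) auto
      then show "X \<le> (1 + L) * (X + Y)" by simp
    qed simp
    moreover have "0 \<le> (1 + L) * (X + Y)" using XY h by auto
    ultimately have "real n * X + (C0 * (1 + L)) * (16 * X + 16 * Y) \<le> C * (1 + L) * (X + Y)"
      unfolding C_def by (simp add: algebra_simps)
    then show ?thesis
      using 1 * z0 unfolding X_def Y_def by (simp add: k(2))
  qed
  have c2': "\<forall>t s L. 1 \<le> t \<longrightarrow> t < s \<longrightarrow> 0 \<le> L \<longrightarrow> (\<forall>z. norm z = s \<longrightarrow> norm (\<phi> z) \<le> exp L) \<longrightarrow>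
       real (card {a. norm a < t \<and> \<phi> a = 0}) \<le> C * (1 + L) * (s / (s - t))"
    by (intro allI impI, rule c2; blast)
  have c3': "\<forall>r t s L \<eta> z. 1 \<le> r \<longrightarrow> r < t \<longrightarrow> t < s \<longrightarrow> s \<le> 2 * r \<longrightarrow> 0 \<le> L \<longrightarrow> 0 < \<eta> \<longrightarrow> \<eta> \<le> t - r \<longrightarrow>
       (\<forall>z. norm z = s \<longrightarrow> norm (\<phi> z) \<le> exp L) \<longrightarrow>
       (\<forall>a. norm a < t \<longrightarrow> \<phi> a = 0 \<longrightarrow> \<eta> \<le> \<bar>norm a - r\<bar>) \<longrightarrow> norm z = r \<longrightarrow>
       \<phi> z \<noteq> 0 \<and> norm (deriv \<phi> z / \<phi> z) \<le> C * (1 + L) * (t / (t - r)\<^sup>2 + s / (s - t) * (1 / \<eta>))"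
    by (intro allI impI, rule c3; blast)
  show ?thesis unfolding log_deriv_const_def using c1 c2' c3' by (intro exI[of _ C] conjI)
qed

text \<open>
  Among \<open>card X + 1\<close> equally spaced points, one is far from \<open>X\<close>, since
  each element of \<open>X\<close> can be close to only one of them; perturbing this point slightly
  avoids the countable set \<open>B\<close>.
\<close>

lemma avoid_finite_set:
  fixes x y :: real
  assumes X: "finite X" and B: "countable B" and xy: "x < y"
  obtains r where "x < r" "r < y" "r \<notin> B" "\<And>\<xi>. \<xi> \<in> X \<Longrightarrow> (y - x) / (4 * (real (card X) + 1)) \<le> \<bar>r - \<xi>\<bar>"
proof -
  define N where "N = card X"
  define h where "h = (y - x) / (real N + 1)"
  have h: "h > 0" using xy by (simp add: h_def)
  have hN: "h * (real N + 1) = y - x" by (simp add: h_def)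
  \<comment> \<open>The midpoints of \<open>N + 1\<close> intervals of equal length \<open>h\<close>.\<close>
  define c where "c i = x + h * (real i + 1/2)" for i :: nat
  have "\<exists>i\<le>N. \<forall>\<xi>\<in>X. h / 2 \<le> \<bar>c i - \<xi>\<bar>"
  proof (rule ccontr)
    assume no: "\<not> ?thesis"
    have ex: "\<exists>\<xi>. \<xi> \<in> X \<and> \<bar>c i - \<xi>\<bar> < h / 2" if "i \<le> N" for i
    proof -
      have "\<not> (\<forall>\<xi>\<in>X. h / 2 \<le> \<bar>c i - \<xi>\<bar>)" using no that by blast
      then show ?thesis by (meson not_le)
    qed
    define g where "g i = (SOME \<xi>. \<xi> \<in> X \<and> \<bar>c i - \<xi>\<bar> < h / 2)" for i
    have g: "g i \<in> X \<and> \<bar>c i - g i\<bar> < h / 2" if "i \<le> N" for i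
      unfolding g_def by (rule someI_ex[OF ex[OF that]])
    have "inj_on g {..N}"
    proof (rule inj_onI)
      fix i j assume ij: "i \<in> {..N}" "j \<in> {..N}" "g i = g j"
      have "\<bar>c i - g i\<bar> < h / 2" "\<bar>c j - g j\<bar> < h / 2" using g[of i] g[of j] ij(1,2) by simp_all
      then have "\<bar>c i - c j\<bar> < h" using ij(3) by linarith
      moreover have "c i - c j = h * (real i - real j)" by (simp add: c_def algebra_simps)
      ultimately have "h * \<bar>real i - real j\<bar> < h * 1" using h by (simp add: abs_mult)
      then have "\<bar>real i - real j\<bar> < 1" using h by (simp only: mult_less_cancel_left_pos)
      then show "i = j" by linarith
    qed
    moreover have "g ` {..N} \<subseteq> X" using g by auto
    ultimately have "card {..N} \<le> card X" using X by (metis card_inj_on_le)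
    then show False by (simp add: N_def)
  qed
  then obtain i where i: "i \<le> N" "\<And>\<xi>. \<xi> \<in> X \<Longrightarrow> h / 2 \<le> \<bar>c i - \<xi>\<bar>" by blast
  have "uncountable ({c i - h/4<..<c i + h/4} - B)"
    using h B by (intro uncountable_minus_countable) (auto simp: uncountable_open_interval)
  then have "{c i - h/4<..<c i + h/4} - B \<noteq> {}" by (metis countable_empty)
  then obtain r where r: "r \<in> {c i - h/4<..<c i + h/4}" "r \<notin> B" by blast
  show ?thesis
  proof (rule that)
    have "c i \<ge> x + h / 2" using h by (simp add: c_def algebra_simps)
    then show "x < r" using r h by auto
    have "h * (real i + 1/2) \<le> h * (real N + 1/2)" using i h by simp
    then have "c i \<le> y - h / 2" using hN by (simp add: c_def algebra_simps)
    then show "r < y" using r h by auto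
    show "r \<notin> B" by fact
    fix \<xi> assume \<xi>: "\<xi> \<in> X"
    have "h / 2 \<le> \<bar>c i - \<xi>\<bar>" using i \<xi> by blast
    then have "h / 4 \<le> \<bar>r - \<xi>\<bar>" using r(1) unfolding greaterThanLessThan_iff by linarith
    moreover have "(y - x) / (4 * (real (card X) + 1)) = h / 4" unfolding h_def N_def divide_divide_eq_left mult.commute[of 4] ..
    ultimately show "(y - x) / (4 * (real (card X) + 1)) \<le> \<bar>r - \<xi>\<bar>" by (simp only:)
  qed
qed

text \<open>
  If \<open>\<mu>\<close> more than doubled on every step from \<open>r\<close> to \<open>r (1 + 1 /
  \<mu> r)\<close>, the steps would shrink geometrically, and \<open>\<mu>\<close> would be
  unbounded on a bounded interval.
\<close>

lemma borel_growth_lemma: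
  fixes \<mu> :: "real \<Rightarrow> real"
  assumes mono: "\<And>x y. 0 \<le> x \<Longrightarrow> x \<le> y \<Longrightarrow> \<mu> x \<le> \<mu> y" and ge1: "\<And>x. \<mu> x \<ge> 1" and r0: "r0 > 0"
  obtains r where "r0 \<le> r" "r \<le> 8 * r0" "\<mu> (r * (1 + 1 / \<mu> r)) \<le> 2 * \<mu> r"
proof -
  have "\<exists>r. r0 \<le> r \<and> r \<le> 8 * r0 \<and> \<mu> (r * (1 + 1 / \<mu> r)) \<le> 2 * \<mu> r"
  proof (rule ccontr)
    assume "\<not> ?thesis"
    then have big: "2 * \<mu> r < \<mu> (r * (1 + 1 / \<mu> r))" if "r0 \<le> r" "r \<le> 8 * r0" for r
      using that by (meson not_le)
    \<comment> \<open>The radii reached by the steps; as \<open>\<mu>\<close> at least doubles each time, they stay below \<open>r0 exp 2\<close>.\<close>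
    define \<rho> where "\<rho> k = ((\<lambda>r. r * (1 + 1 / \<mu> r)) ^^ k) r0" for k :: nat
    have e8: "exp (2::real) \<le> 8"
    proof -
      have "exp (2::real) = exp 1 * exp 1" by (simp flip: exp_add)
      also have "\<dots> \<le> (2.8::real) * 2.8" using e_less_272 by (intro mult_mono) auto
      finally show ?thesis by simp
    qed
    have "r0 \<le> \<rho> k \<and> \<rho> k \<le> r0 * exp (2 - 2 * (1/2) ^ k) \<and> 2 ^ k \<le> \<mu> (\<rho> k)" for k
    proof (induction k)
      case 0 then show ?case using ge1 by (simp add: \<rho>_def)
    next
      case (Suc k)
      have Suc_eq: "\<rho> (Suc k) = \<rho> k * (1 + 1 / \<mu> (\<rho> k))" by (simp add: \<rho>_def)
      have "exp (2 - 2 * (1/2) ^ k) \<le> exp (2::real)" by simp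
      then have "r0 * exp (2 - 2 * (1/2) ^ k) \<le> r0 * 8" using order_trans[OF _ e8] r0 by (intro mult_left_mono) auto
      then have le8: "\<rho> k \<le> 8 * r0" using Suc by simp
      have pos: "\<rho> k > 0" "\<mu> (\<rho> k) > 0" using Suc r0 ge1[of "\<rho> k"] by auto
      have "\<rho> k * 1 \<le> \<rho> (Suc k)" unfolding Suc_eq using pos by (intro mult_left_mono) auto
      moreover have "\<rho> (Suc k) \<le> r0 * exp (2 - 2 * (1/2) ^ Suc k)"
      proof -
        have "1 / \<mu> (\<rho> k) \<le> 1 / 2 ^ k" using Suc pos by (intro divide_left_mono) auto
        moreover have "1 + 1 / 2 ^ k \<le> exp (1 / 2 ^ k :: real)" by (rule exp_ge_add_one_self)
        ultimately have "1 + 1 / \<mu> (\<rho> k) \<le> exp ((1/2) ^ k)"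
          unfolding power_one_over by linarith
        then have "\<rho> (Suc k) \<le> (r0 * exp (2 - 2 * (1/2) ^ k)) * exp ((1/2) ^ k)"
          unfolding Suc_eq using Suc pos r0 by (intro mult_mono) auto
        also have "\<dots> = r0 * exp (2 - 2 * (1/2) ^ k + (1/2) ^ k)" by (simp only: exp_add mult.assoc)
        also have "2 - 2 * (1/2) ^ k + (1/2) ^ k = (2 - 2 * (1/2) ^ Suc k :: real)" by simp
        finally show ?thesis .
      qed
      moreover have "2 * \<mu> (\<rho> k) < \<mu> (\<rho> (Suc k))" unfolding Suc_eq by (rule big) (use Suc le8 in auto)
      then have "2 ^ Suc k \<le> \<mu> (\<rho> (Suc k))" using Suc by simp
      ultimately show ?case using Suc by simp
    qed
    note * = this
    have bd: "2 ^ k \<le> \<mu> (8 * r0)" for k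
    proof -
      have "exp (2 - 2 * (1/2) ^ k) \<le> exp (2::real)" by simp
      then have "r0 * exp (2 - 2 * (1/2) ^ k) \<le> r0 * 8" using order_trans[OF _ e8] r0 by (intro mult_left_mono) auto
      then have "\<rho> k \<le> 8 * r0" using *[of k] by linarith
      then have "\<mu> (\<rho> k) \<le> \<mu> (8 * r0)" using *[of k] r0 by (intro mono) auto
      then show ?thesis using *[of k] by linarith
    qed
    obtain k where "\<mu> (8 * r0) < 2 ^ k" using real_arch_pow[of 2 "\<mu> (8 * r0)"] by auto
    then show False using bd[of k] by simp
  qed
  then show ?thesis using that by blast
qed

section \<open>Circles with small logarithmic derivatives\<close>

definition max_modulus :: "(complex \<Rightarrow> complex) \<Rightarrow> real \<Rightarrow> real" where
  "max_modulus \<phi> r = (SUP z\<in>cball 0 r. norm (\<phi> z))"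

lemma max_modulus_bdd:
  assumes "\<phi> holomorphic_on UNIV"
  shows "bdd_above ((\<lambda>z. norm (\<phi> z)) ` cball 0 r)"
proof -
  have "continuous_on (cball 0 r) (\<lambda>z. norm (\<phi> z))"
    by (intro continuous_intros continuous_on_subset[OF holomorphic_on_imp_continuous_on[OF assms]]) auto
  then have "compact ((\<lambda>z. norm (\<phi> z)) ` cball 0 r)" by (rule compact_continuous_image) simp
  then show ?thesis by (simp add: bounded_imp_bdd_above compact_imp_bounded)
qed

lemma norm_le_max_modulus:
  assumes "\<phi> holomorphic_on UNIV" "norm z \<le> r"
  shows "norm (\<phi> z) \<le> max_modulus \<phi> r"
  unfolding max_modulus_def by (rule cSUP_upper[OF _ max_modulus_bdd]) (use assms in auto)

lemma max_modulus_le: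
  assumes "r \<ge> 0" "\<And>z. norm z \<le> r \<Longrightarrow> norm (\<phi> z) \<le> B"
  shows "max_modulus \<phi> r \<le> B"
  unfolding max_modulus_def by (rule cSUP_least) (use assms in auto)

lemma max_modulus_attained:
  assumes "\<phi> holomorphic_on UNIV" "r \<ge> 0"
  obtains z where "norm z \<le> r" "max_modulus \<phi> r = norm (\<phi> z)"
proof -
  have "continuous_on (cball 0 r) (\<lambda>z. norm (\<phi> z))"
    by (intro continuous_intros continuous_on_subset[OF holomorphic_on_imp_continuous_on[OF assms(1)]]) auto
  then obtain z where z: "z \<in> cball 0 r" "\<And>y. y \<in> cball 0 r \<Longrightarrow> norm (\<phi> y) \<le> norm (\<phi> z)"
    using continuous_attains_sup[of "cball 0 r" "\<lambda>z. norm (\<phi> z)"] assms(2) by auto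
  have "max_modulus \<phi> r = norm (\<phi> z)"
    by (rule antisym) (use z assms in \<open>auto intro!: max_modulus_le norm_le_max_modulus\<close>)
  then show ?thesis using z that by auto
qed

lemma max_modulus_nonneg:
  assumes "\<phi> holomorphic_on UNIV" "r \<ge> 0"
  shows "max_modulus \<phi> r \<ge> 0"
  using norm_le_max_modulus[OF assms(1), of 0 r] assms(2) norm_ge_zero[of "\<phi> 0"] by (simp del: norm_ge_zero)

lemma max_modulus_mono:
  assumes "\<phi> holomorphic_on UNIV" "0 \<le> r" "r \<le> s"
  shows "max_modulus \<phi> r \<le> max_modulus \<phi> s"
  by (rule max_modulus_le) (use assms in \<open>auto intro: norm_le_max_modulus\<close>)

lemma log_deriv_constD1: "log_deriv_const \<phi> C \<Longrightarrow> C \<ge> 1"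
  by (simp add: log_deriv_const_def)

lemmas log_deriv_constD2 =
  log_deriv_const_def[THEN iffD1, THEN conjunct2, THEN conjunct1, rule_format]

lemmas log_deriv_constD3 =
  log_deriv_const_def[THEN iffD1, THEN conjunct2, THEN conjunct2, rule_format]

text \<open>
  The analytic core of the first part, which replaces the lemma on the logarithmic derivative.  The
  parameter \<open>l\<close> is the square root of a sum of maximum moduli (on a logarithmic scale).
  On the circle, the logarithmic derivatives are at most polynomial in \<open>l\<close>, so that
  only \<open>ln l\<close> enters after taking logarithms, whereas \<open>l\<close> itself is at
  most linear in the circle means.  As every disc \<open>norm z \<le> r0\<close> gets such a circle
  within the factor 16, no exceptional set of radii arises.
\<close>

lemma good_circles:
  fixes \<Phi> :: "(complex \<Rightarrow> complex) set"
  assumes fin: "finite \<Phi>" and hol: "\<And>\<phi>. \<phi> \<in> \<Phi> \<Longrightarrow> \<phi> holomorphic_on UNIV"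
    and nz: "\<And>\<phi>. \<phi> \<in> \<Phi> \<Longrightarrow> \<exists>w. \<phi> w \<noteq> 0" and B: "countable B"
  obtains C :: real where "C > 0" "\<And>r0. r0 \<ge> 1 \<Longrightarrow> \<exists>r l. r0 < r \<and> r \<le> 16 * r0 \<and> r \<notin> B \<and> l \<ge> 1 \<and>
     (\<forall>\<phi>\<in>\<Phi>. \<forall>z. norm z \<le> r0 \<longrightarrow> log_plus (norm (\<phi> z)) \<le> l\<^sup>2) \<and>
     l\<^sup>2 \<le> 1 + 12 * l * (\<Sum>\<phi>\<in>\<Phi>. circle_mean r (\<lambda>z. log_plus (norm (\<phi> z)))) \<and>
     (\<forall>\<phi>\<in>\<Phi>. \<forall>z. norm z = r \<longrightarrow> \<phi> z \<noteq> 0 \<and> norm (deriv \<phi> z / \<phi> z) \<le> C * l ^ 7)"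
proof -
  have "\<forall>\<phi>\<in>\<Phi>. \<exists>C. log_deriv_const \<phi> C"
  proof
    fix \<phi> assume \<phi>: "\<phi> \<in> \<Phi>"
    obtain w where w: "\<phi> w \<noteq> 0" using nz[OF \<phi>] by blast
    show "\<exists>C. log_deriv_const \<phi> C" by (rule log_deriv_bound[OF hol[OF \<phi>] w])
  qed
  from bchoice[OF this] obtain c where cc: "\<And>\<phi>. \<phi> \<in> \<Phi> \<Longrightarrow> log_deriv_const \<phi> (c \<phi>)" by blast
  note c = log_deriv_constD1[OF cc] and c1 = log_deriv_constD2[OF cc] and c2 = log_deriv_constD3[OF cc]
  define C1 where "C1 = 1 + (\<Sum>\<phi>\<in>\<Phi>. c \<phi>)"
  have cC1: "c \<phi> \<le> C1" if "\<phi> \<in> \<Phi>" for \<phi>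
  proof -
    have "c \<phi> \<le> (\<Sum>\<phi>\<in>\<Phi>. c \<phi>)"
      by (rule member_le_sum[OF that _ fin]) (use c in force)
    then show ?thesis by (simp add: C1_def)
  qed
  have C1: "C1 \<ge> 1" unfolding C1_def using sum_nonneg[of \<Phi> c] c by force
  define C where "C = C1 * (5 * (32 + 8 * (16 * (40 * C1 + 1))))"
  \<comment> \<open>The square root gains a factor \<open>l\<close>: on the circle found below, \<open>l\<^sup>2 - 1\<close> is at most \<open>12 l\<close> times the sum of the means.\<close>
  define \<mu> where "\<mu> r = sqrt (1 + (\<Sum>\<phi>\<in>\<Phi>. log_plus (max_modulus \<phi> r)))" for r
  have \<mu>sq: "(\<mu> r)\<^sup>2 = 1 + (\<Sum>\<phi>\<in>\<Phi>. log_plus (max_modulus \<phi> r))" for r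
    unfolding \<mu>_def by (rule real_sqrt_pow2) (intro add_nonneg_nonneg sum_nonneg, auto)
  have \<mu>1: "\<mu> r \<ge> 1" for r
    unfolding \<mu>_def by (rule real_le_rsqrt) (simp add: sum_nonneg)
  have \<mu>mono: "\<mu> x \<le> \<mu> y" if "0 \<le> x" "x \<le> y" for x y
    unfolding \<mu>_def using that
    by (intro real_sqrt_le_mono add_left_mono sum_mono log_plus_mono max_modulus_mono max_modulus_nonneg hol) auto
  have exp_bd: "norm (\<phi> z) \<le> exp ((\<mu> s)\<^sup>2)" if "\<phi> \<in> \<Phi>" "norm z \<le> s" for \<phi> z s
  proof (cases "\<phi> z = 0")
    case False
    have "ln (norm (\<phi> z)) \<le> log_plus (max_modulus \<phi> s)"
      using ln_le_log_plus[of "norm (\<phi> z)"] log_plus_mono[OF _ norm_le_max_modulus[OF hol[OF that(1)] that(2)]]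
      by (meson norm_ge_zero order_trans)
    also have "\<dots> \<le> (\<Sum>\<phi>\<in>\<Phi>. log_plus (max_modulus \<phi> s))"
      by (rule member_le_sum[OF that(1) _ fin]) simp
    also have "\<dots> \<le> (\<mu> s)\<^sup>2" by (simp add: \<mu>sq)
    finally have "exp (ln (norm (\<phi> z))) \<le> exp ((\<mu> s)\<^sup>2)" by simp
    then show ?thesis using False by simp
  qed simp
  have main: "\<exists>r l. r0 < r \<and> r \<le> 16 * r0 \<and> r \<notin> B \<and> l \<ge> 1 \<and>
     (\<forall>\<phi>\<in>\<Phi>. \<forall>z. norm z \<le> r0 \<longrightarrow> log_plus (norm (\<phi> z)) \<le> l\<^sup>2) \<and>
     l\<^sup>2 \<le> 1 + 12 * l * (\<Sum>\<phi>\<in>\<Phi>. circle_mean r (\<lambda>z. log_plus (norm (\<phi> z)))) \<and>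
     (\<forall>\<phi>\<in>\<Phi>. \<forall>z. norm z = r \<longrightarrow> \<phi> z \<noteq> 0 \<and> norm (deriv \<phi> z / \<phi> z) \<le> C * l ^ 7)"
    if r0: "r0 \<ge> 1" for r0
  proof -
    have "r0 > 0" using r0 by simp
    then obtain r1 where r1: "r0 \<le> r1" "r1 \<le> 8 * r0" "\<mu> (r1 * (1 + 1 / \<mu> r1)) \<le> 2 * \<mu> r1"
      using borel_growth_lemma[of \<mu> r0] \<mu>mono \<mu>1 by blast
    \<comment> \<open>Between \<open>r1\<close> and \<open>s = r1 (1 + 1 / l)\<close> the logarithm of the maximum modulus grows at most by the factor 4; the circle lies between them, in the part below \<open>t\<close>, at a distance \<open>\<eta>\<close> from all moduli of zeros.\<close>
    define l where "l = \<mu> r1"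
    define \<delta> where "\<delta> = r1 / l"
    define s where "s = r1 + \<delta>"
    define t where "t = r1 + 3 * \<delta> / 4"
    have l1: "l \<ge> 1" unfolding l_def by (rule \<mu>1)
    have r11: "r1 \<ge> 1" and r10: "r1 \<ge> 0" using r1 r0 by simp_all
    have \<delta>: "\<delta> > 0" "\<delta> \<le> r1" "l * \<delta> = r1" using l1 r11 by (auto simp: \<delta>_def field_simps)
    have "s = r1 * (1 + 1 / \<mu> r1)" by (simp add: s_def \<delta>_def l_def algebra_simps)
    then have "\<mu> s \<le> 2 * l" using r1 by (simp add: l_def)
    then have "(\<mu> s)\<^sup>2 \<le> (2 * l)\<^sup>2" using \<mu>1[of s] by (intro power_mono) auto
    then have L: "(\<mu> s)\<^sup>2 \<le> 4 * l\<^sup>2" by (simp add: power_mult_distrib)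
    have bd: "norm (\<phi> z) \<le> exp (4 * l\<^sup>2)" if "\<phi> \<in> \<Phi>" "norm z = s" for \<phi> z
      using exp_bd[OF that(1), of z s] L that(2) by (meson dual_order.trans exp_le_cancel_iff order_refl)
    have pw: "1 \<le> l ^ k" for k using l1 by simp
    have l5: "1 + 4 * l\<^sup>2 \<le> 5 * l\<^sup>2" using pw[of 2] by simp
    have st: "s - t = \<delta> / 4" by (simp add: s_def t_def)
    have sst: "s / (s - t) \<le> 8 * l"
    proof -
      have "s \<le> 2 * (l * \<delta>)" using \<delta> by (simp add: s_def)
      then show ?thesis unfolding st using \<delta>(1) by (simp add: field_simps)
    qed
    define X where "X = (\<Union>\<phi>\<in>\<Phi>. norm ` {a. norm a < t \<and> \<phi> a = 0})"
    have finZ: "finite {a. norm a < t \<and> \<phi> a = 0}" if \<phi>: "\<phi> \<in> \<Phi>" for \<phi>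
    proof -
      obtain w where "\<phi> w \<noteq> 0" using nz[OF \<phi>] by blast
      then show ?thesis
        by (intro finite_subset[OF _ finite_entire_zeros[OF hol[OF \<phi>], of w t]]) auto
    qed
    have finX: "finite X" unfolding X_def using fin finZ by auto
    have cardX: "real (card X) \<le> 40 * C1 * l ^ 3"
    proof -
      have "card X \<le> (\<Sum>\<phi>\<in>\<Phi>. card (norm ` {a. norm a < t \<and> \<phi> a = 0}))"
        unfolding X_def by (rule card_UN_le[OF fin])
      also have "\<dots> \<le> (\<Sum>\<phi>\<in>\<Phi>. card {a. norm a < t \<and> \<phi> a = 0})"
        by (intro sum_mono card_image_le finZ)
      finally have "real (card X) \<le> real (\<Sum>\<phi>\<in>\<Phi>. card {a. norm a < t \<and> \<phi> a = 0})" by (simp only: of_nat_le_iff)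
      also have "\<dots> = (\<Sum>\<phi>\<in>\<Phi>. real (card {a. norm a < t \<and> \<phi> a = 0}))" by simp
      also have "\<dots> \<le> (\<Sum>\<phi>\<in>\<Phi>. c \<phi> * (40 * l ^ 3))"
      proof (rule sum_mono)
        fix \<phi> assume \<phi>: "\<phi> \<in> \<Phi>"
        have "real (card {a. norm a < t \<and> \<phi> a = 0}) \<le> c \<phi> * (1 + 4 * l\<^sup>2) * (s / (s - t))"
          by (rule c1[OF \<phi>]) (use bd[OF \<phi>] \<delta> r11 in \<open>auto simp: s_def t_def\<close>)
        also have "\<dots> \<le> c \<phi> * (5 * l\<^sup>2) * (8 * l)"
          using sst l5 c[OF \<phi>] l1 \<delta> r11 by (intro mult_mono) (auto simp: s_def t_def)
        also have "\<dots> = c \<phi> * (40 * l ^ 3)" by (simp add: power2_eq_square power3_eq_cube)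
        finally show "real (card {a. norm a < t \<and> \<phi> a = 0}) \<le> c \<phi> * (40 * l ^ 3)" .
      qed
      also have "\<dots> = (\<Sum>\<phi>\<in>\<Phi>. c \<phi>) * (40 * l ^ 3)" by (simp add: sum_distrib_right)
      also have "\<dots> \<le> C1 * (40 * l ^ 3)" using l1 by (intro mult_right_mono) (auto simp: C1_def)
      finally show ?thesis by simp
    qed
    have lt: "r1 + \<delta> / 4 < r1 + \<delta> / 2" using \<delta> by simp
    obtain r where r: "r1 + \<delta> / 4 < r" "r < r1 + \<delta> / 2" "r \<notin> B"
      "\<And>\<xi>. \<xi> \<in> X \<Longrightarrow> (r1 + \<delta> / 2 - (r1 + \<delta> / 4)) / (4 * (real (card X) + 1)) \<le> \<bar>r - \<xi>\<bar>"
      by (rule avoid_finite_set[OF finX B lt]) (rule that; assumption)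
    define \<eta> where "\<eta> = \<delta> / (16 * (real (card X) + 1))"
    have \<eta>1: "\<eta> > 0" using \<delta> by (simp add: \<eta>_def)
    have \<eta>2: "\<eta> \<le> \<delta> / 16" unfolding \<eta>_def using \<delta> by (intro divide_left_mono) auto
    note \<eta> = \<eta>1 \<eta>2
    have \<eta>eq: "(r1 + \<delta> / 2 - (r1 + \<delta> / 4)) / (4 * (real (card X) + 1)) = \<eta>"
      by (simp add: \<eta>_def field_simps)
    have inv\<eta>: "1 / \<eta> \<le> 16 * (40 * C1 + 1) * l ^ 4"
    proof -
      have "1 / \<eta> = 16 * (real (card X) + 1) / \<delta>" by (simp add: \<eta>_def)
      also have "\<dots> \<le> 16 * (40 * C1 * l ^ 3 + 1 * l ^ 3) / \<delta>"
        using cardX pw[of 3] \<delta> by (intro divide_right_mono mult_left_mono add_mono) auto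
      also have "\<dots> = 16 * (40 * C1 + 1) * l ^ 3 * (1 / \<delta>)" by (simp add: distrib_right)
      also have "\<dots> \<le> 16 * (40 * C1 + 1) * l ^ 3 * l"
      proof (intro mult_left_mono)
        have "1 \<le> l * \<delta>" using \<delta> r11 by simp
        then show "1 / \<delta> \<le> l" using \<delta> by (simp add: field_simps)
      qed (use C1 l1 in auto)
      also have "\<dots> = 16 * (40 * C1 + 1) * l ^ 4" by (simp add: power_numeral_reduce)
      finally show ?thesis .
    qed
    have logd: "\<phi> z \<noteq> 0 \<and> norm (deriv \<phi> z / \<phi> z) \<le> C * l ^ 7" if \<phi>: "\<phi> \<in> \<Phi>" and z: "norm z = r" for \<phi> z
    proof -
      have sep: "\<eta> \<le> \<bar>norm a - r\<bar>" if "norm a < t" "\<phi> a = 0" for a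
        using r(4)[of "norm a"] that \<phi> unfolding \<eta>eq by (auto simp: X_def abs_minus_commute)
      have *: "\<phi> z \<noteq> 0 \<and> norm (deriv \<phi> z / \<phi> z) \<le> c \<phi> * (1 + 4 * l\<^sup>2) * (t / (t - r)\<^sup>2 + s / (s - t) * (1 / \<eta>))"
        by (rule c2[OF \<phi>]) (use bd[OF \<phi>] \<delta> r11 r \<eta> sep z in \<open>auto simp: s_def t_def\<close>)
      have tr: "t / (t - r)\<^sup>2 \<le> 32 * l ^ 5"
      proof -
        have "t / (t - r)\<^sup>2 \<le> 2 * r1 / (\<delta> / 4)\<^sup>2"
          using \<delta> r r11 by (intro frac_le power_mono) (auto simp: t_def)
        also have "\<dots> = 32 * (r1 / \<delta>\<^sup>2)" by (simp add: power_divide)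
        also have "r1 / \<delta>\<^sup>2 = l / \<delta>" using \<delta>(1) unfolding \<delta>(3)[symmetric] by (simp add: power2_eq_square)
        also have "l / \<delta> \<le> l * l"
        proof -
          have "1 \<le> l * \<delta>" using \<delta> r11 by simp
          then show ?thesis using \<delta> l1 by (simp add: field_simps)
        qed
        also have "l * l \<le> l ^ 5" using l1 power_increasing[of 2 5 l] by (simp add: power2_eq_square)
        finally show ?thesis by simp
      qed
      have "s / (s - t) * (1 / \<eta>) \<le> 8 * l * (16 * (40 * C1 + 1) * l ^ 4)"
        using sst inv\<eta> l1 \<eta> by (intro mult_mono) auto
      also have "\<dots> = 8 * (16 * (40 * C1 + 1)) * l ^ 5" by (simp add: power_numeral_reduce)
      finally have "t / (t - r)\<^sup>2 + s / (s - t) * (1 / \<eta>) \<le> (32 + 8 * (16 * (40 * C1 + 1))) * l ^ 5"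
        using tr by (simp only: distrib_right)
      moreover have "0 \<le> t / (t - r)\<^sup>2 + s / (s - t) * (1 / \<eta>)"
        using \<delta> r11 \<eta> by (intro add_nonneg_nonneg mult_nonneg_nonneg divide_nonneg_nonneg) (auto simp: t_def s_def)
      ultimately have "c \<phi> * (1 + 4 * l\<^sup>2) * (t / (t - r)\<^sup>2 + s / (s - t) * (1 / \<eta>))
          \<le> C1 * (5 * l\<^sup>2) * ((32 + 8 * (16 * (40 * C1 + 1))) * l ^ 5)"
        using cC1[OF \<phi>] C1 l5 c[OF \<phi>] by (intro mult_mono) auto
      also have "\<dots> = C * l ^ 7" by (simp add: C_def power_numeral_reduce)
      finally show ?thesis using * by auto
    qed
    have mean0: "0 \<le> circle_mean r (\<lambda>z. log_plus (norm (\<phi> z)))" if "\<phi> \<in> \<Phi>" for \<phi>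
      using r \<delta> r11
      by (intro circle_mean_nonneg continuous_intros continuous_on_subset[OF holomorphic_on_imp_continuous_on[OF hol[OF that]]]) auto
    have coef: "(r + r1) / (r - r1) \<le> 12 * l"
    proof -
      have "(r + r1) / (r - r1) \<le> (3 * r1) / (\<delta> / 4)"
        using r \<delta> r11 by (intro frac_le) auto
      also have "\<dots> = 12 * l" using \<delta>(1) unfolding \<delta>(3)[symmetric] by simp
      finally show ?thesis .
    qed
    have "l\<^sup>2 = 1 + (\<Sum>\<phi>\<in>\<Phi>. log_plus (max_modulus \<phi> r1))" by (simp add: l_def \<mu>sq)
    also have "(\<Sum>\<phi>\<in>\<Phi>. log_plus (max_modulus \<phi> r1)) \<le>
        (\<Sum>\<phi>\<in>\<Phi>. 12 * l * circle_mean r (\<lambda>z. log_plus (norm (\<phi> z))))"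
    proof (rule sum_mono)
      fix \<phi> assume \<phi>: "\<phi> \<in> \<Phi>"
      obtain z where z: "norm z \<le> r1" "max_modulus \<phi> r1 = norm (\<phi> z)"
        by (rule max_modulus_attained[OF hol[OF \<phi>] r10]) (rule that; assumption)
      have "log_plus (norm (\<phi> z)) \<le> (r + r1) / (r - r1) * circle_mean r (\<lambda>\<zeta>. log_plus (norm (\<phi> \<zeta>)))"
        by (rule harnack_max_bound[OF hol[OF \<phi>] z(1)]) (use r \<delta> logd[OF \<phi>] in auto)
      also have "\<dots> \<le> 12 * l * circle_mean r (\<lambda>\<zeta>. log_plus (norm (\<phi> \<zeta>)))"
        by (rule mult_right_mono[OF coef mean0[OF \<phi>]])
      finally show "log_plus (max_modulus \<phi> r1) \<le> 12 * l * circle_mean r (\<lambda>z. log_plus (norm (\<phi> z)))"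
        unfolding z(2) .
    qed
    finally have key: "l\<^sup>2 \<le> 1 + 12 * l * (\<Sum>\<phi>\<in>\<Phi>. circle_mean r (\<lambda>z. log_plus (norm (\<phi> z))))"
      by (simp add: sum_distrib_left)
    have small: "log_plus (norm (\<phi> z)) \<le> l\<^sup>2" if "\<phi> \<in> \<Phi>" "norm z \<le> r0" for \<phi> z
    proof -
      have "log_plus (norm (\<phi> z)) \<le> log_plus (max_modulus \<phi> r1)"
        by (rule log_plus_mono[OF _ norm_le_max_modulus[OF hol[OF that(1)]]]) (use that r1 in auto)
      also have "\<dots> \<le> (\<Sum>\<phi>\<in>\<Phi>. log_plus (max_modulus \<phi> r1))"
        by (rule member_le_sum[OF that(1) _ fin]) simp
      also have "\<dots> \<le> l\<^sup>2" by (simp add: l_def \<mu>sq)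
      finally show ?thesis .
    qed
    have "r0 < r" "r \<le> 16 * r0" using r r1 \<delta> by auto
    then show ?thesis using r(3) l1 small key logd by blast
  qed
  have "C > 0" using C1 by (simp add: C_def)
  then show ?thesis using main that by blast
qed

section \<open>Functions with finitely many poles\<close>

text \<open>
  Means over circles are only taken for radii outside this exceptional set.
\<close>

lemma countable_zero_radii:
  fixes \<phi> :: "complex \<Rightarrow> complex"
  assumes "\<phi> holomorphic_on UNIV" "\<phi> w \<noteq> 0"
  shows "countable (norm ` {z. \<phi> z = 0})"
proof -
  have "{z. \<phi> z = 0} \<subseteq> (\<Union>n::nat. {z. norm z \<le> real n \<and> \<phi> z = 0})"
    using real_arch_simple by auto
  moreover have "countable (\<Union>n::nat. {z. norm z \<le> real n \<and> \<phi> z = 0})"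
    by (intro countable_UN countableI_type countable_finite finite_entire_zeros[OF assms])
  ultimately show ?thesis by (intro countable_image) (rule countable_subset)
qed

lemma generic_radius:
  fixes x y :: real
  assumes "countable B" "x < y"
  obtains r where "x < r" "r < y" "r \<notin> B"
  by (rule avoid_finite_set[OF finite.emptyI assms]) (rule that; assumption)

lemma log_plus_mult_le: "0 \<le> x \<Longrightarrow> 0 \<le> y \<Longrightarrow> log_plus (x * y) \<le> log_plus x + log_plus y"
proof (cases "x = 0 \<or> y = 0")
  case False
  assume "0 \<le> x" "0 \<le> y"
  then have "ln (x * y) = ln x + ln y" using False by (intro ln_mult_pos) auto
  then show ?thesis by (simp add: log_plus_def)
qed (auto simp: log_plus_def)

lemma log_plus_add_le:
  assumes "0 \<le> x" "0 \<le> y"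
  shows "log_plus (x + y) \<le> log_plus x + log_plus y + ln 2"
proof -
  have "max 1 (x + y) \<le> (max 1 x * max 1 y) * 2"
  proof -
    have "max 1 x * 1 \<le> max 1 x * max 1 y" "1 * max 1 y \<le> max 1 x * max 1 y"
      by (intro mult_left_mono mult_right_mono; simp)+
    then show ?thesis by linarith
  qed
  then have "ln (max 1 (x + y)) \<le> ln ((max 1 x * max 1 y) * 2)" by (intro ln_mono) auto
  also have "\<dots> = ln (max 1 x) + ln (max 1 y) + ln 2" by (simp add: ln_mult_pos)
  finally show ?thesis using assms by (simp add: log_plus_eq_ln_max)
qed

lemma log_plus_le_abs_ln: "log_plus x \<le> \<bar>ln x\<bar>"
  by (simp add: log_plus_def)

text \<open>
  A polynomial is asymptotic to its leading monomial.
\<close>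

lemma poly_log_bound:
  fixes d :: "complex poly"
  assumes "d \<noteq> 0"
  obtains C r0 where "C \<ge> 0" "r0 \<ge> 1"
    "\<And>z. norm z \<ge> r0 \<Longrightarrow> poly d z \<noteq> 0 \<and> \<bar>ln (norm (poly d z))\<bar> \<le> C * (1 + ln (norm z))"
proof -
  have low: "\<exists>c r. c > 0 \<and> (\<forall>z. r \<le> norm z \<longrightarrow> c \<le> norm (poly d z))"
  proof (cases "degree d = 0")
    case True
    then obtain c where "d = [:c:]" by (rule degree_eq_zeroE)
    then show ?thesis using assms by (intro exI[of _ "norm c"]) auto
  next
    case False
    obtain a p where d: "d = pCons a p" by (cases d)
    with False have "p \<noteq> 0" by auto
    note d = d this
    obtain r where "\<forall>z. r \<le> norm z \<longrightarrow> 1 \<le> norm (poly (pCons a p) z)"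
      using poly_infinity[OF d(2), of 1 a] by blast
    then show ?thesis unfolding d(1) by (intro exI[of _ 1] exI[of _ r]) (simp only: zero_less_one)
  qed
  then obtain c r where c: "c > 0" "\<And>z. r \<le> norm z \<Longrightarrow> c \<le> norm (poly d z)" by blast
  define S where "S = (\<Sum>i\<le>degree d. norm (coeff d i)) + 1"
  have S: "S \<ge> 1" by (simp add: S_def sum_nonneg)
  have up: "norm (poly d z) \<le> S * norm z ^ degree d" if "norm z \<ge> 1" for z
  proof -
    have "norm (poly d z) \<le> (\<Sum>i\<le>degree d. norm (coeff d i * z ^ i))"
      unfolding poly_altdef by (rule norm_sum)
    also have "\<dots> \<le> (\<Sum>i\<le>degree d. norm (coeff d i) * norm z ^ degree d)"
      by (intro sum_mono) (use that in \<open>auto simp: norm_mult norm_power intro!: mult_left_mono power_increasing\<close>)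
    also have "\<dots> = (\<Sum>i\<le>degree d. norm (coeff d i)) * norm z ^ degree d" by (simp add: sum_distrib_right)
    also have "\<dots> \<le> S * norm z ^ degree d" by (intro mult_right_mono) (auto simp: S_def)
    finally show ?thesis .
  qed
  define C where "C = ln S + \<bar>ln c\<bar> + real (degree d)"
  have lnS: "ln S \<ge> 0" using S by simp
  show ?thesis
  proof (rule that[of C "max 1 r"])
    show "C \<ge> 0" using lnS by (simp add: C_def)
    fix z :: complex assume z: "norm z \<ge> max 1 r"
    have l: "ln (norm z) \<ge> 0" using z by simp
    have "c \<le> norm (poly d z)" using c(2)[of z] z by simp
    then have nz: "0 < norm (poly d z)" using c(1) by linarith
    have "ln (norm (poly d z)) \<le> ln (S * norm z ^ degree d)"
      using up[of z] z nz by (intro ln_mono) auto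
    also have "\<dots> = ln S + real (degree d) * ln (norm z)"
    proof -
      have "norm z > 0" using z by linarith
      then show ?thesis using S by (simp add: ln_mult_pos ln_realpow)
    qed
    finally have 1: "ln (norm (poly d z)) \<le> ln S + real (degree d) * ln (norm z)" .
    have 2: "ln c \<le> ln (norm (poly d z))" using c z by (intro ln_mono) auto
    have "0 \<le> (ln S + \<bar>ln c\<bar>) * ln (norm z)" using l lnS by (intro mult_nonneg_nonneg) auto
    moreover have "0 \<le> real (degree d) * ln (norm z)" using l by simp
    ultimately have "ln S + real (degree d) * ln (norm z) \<le> C * (1 + ln (norm z))"
      "\<bar>ln c\<bar> \<le> C * (1 + ln (norm z))"
      using lnS unfolding C_def distrib_right distrib_left by auto
    then show "poly d z \<noteq> 0 \<and> \<bar>ln (norm (poly d z))\<bar> \<le> C * (1 + ln (norm z))"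
      using 1 2 nz by (auto simp: abs_le_iff)
  qed simp
qed

text \<open>
  The Weierstrass factorization has a denominator with finitely many zeros, which is a polynomial
  times a zero-free entire function.
\<close>

lemma M1_quotient:
  assumes f: "f \<in> M1"
  obtains u d where "u holomorphic_on UNIV" "d \<noteq> 0" "\<And>z. poly d z = 0 \<Longrightarrow> is_pole f z"
    "\<And>z. \<not> is_pole f z \<Longrightarrow> f z = u z / poly d z"
proof -
  have mero: "f nicely_meromorphic_on UNIV" and fin: "finite {z. is_pole f z}"
    using f by (auto simp: M1_def)
  obtain h f1 f2 where W: "h holomorphic_on UNIV" "f1 holomorphic_on UNIV" "f2 holomorphic_on UNIV"
    "\<forall>z. f2 z = 0 \<longleftrightarrow> is_pole f z" "\<forall>z. f z = h z * f1 z / f2 z"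
    by (rule weierstrass_factorization_meromorphic_UNIV[OF mero]) (rule that; assumption)
  define A where "A = {z. is_pole f z}"
  have "A \<noteq> UNIV" using fin infinite_UNIV_char_0[where ?'a = complex] by (auto simp: A_def)
  then obtain w where "w \<notin> A" by blast
  then have w: "f2 w \<noteq> 0" using W(4) by (simp add: A_def)
  obtain m k where k: "k holomorphic_on UNIV" "\<And>z. f2 z = (\<Prod>a\<in>A. (z - a) ^ m a) * k z"
    "\<And>a. a \<in> A \<Longrightarrow> k a \<noteq> 0"
    using fin unfolding A_def[symmetric] by (rule entire_factor_zeros[OF W(3) w]) (rule that; assumption)
  have k0: "k z \<noteq> 0" for z
  proof (cases "z \<in> A")
    case False
    then have "f2 z \<noteq> 0" using W(4) by (simp add: A_def)
    then show ?thesis using k(2)[of z] by auto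
  qed (use k(3) in auto)
  define d where "d = (\<Prod>a\<in>A. [:- a, 1:] ^ m a)"
  have d: "poly d z = (\<Prod>a\<in>A. (z - a) ^ m a)" for z
    by (simp add: d_def poly_prod poly_power)
  show ?thesis
  proof (rule that[of "\<lambda>z. h z * f1 z / k z" d])
    show "(\<lambda>z. h z * f1 z / k z) holomorphic_on UNIV"
      by (intro holomorphic_intros W k) (use k0 in auto)
    show "d \<noteq> 0" unfolding d_def using fin by (auto simp: A_def)
    show "is_pole f z" if "poly d z = 0" for z
      using that k(2)[of z] W(4) by (simp add: d)
    show "f z = (h z * f1 z / k z) / poly d z" for z
      using W(5) k(2)[of z] by (simp add: d)
  qed
qed

lemma quotient_log_plus_bound:
  fixes d :: "complex poly" and u :: "complex \<Rightarrow> complex"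
  assumes "d \<noteq> 0"
  obtains C r0 where "C \<ge> 0" "r0 \<ge> 1" "\<And>z. norm z \<ge> r0 \<Longrightarrow> poly d z \<noteq> 0"
    "\<And>z. norm z \<ge> r0 \<Longrightarrow> log_plus (norm (u z / poly d z)) \<le> log_plus (norm (u z)) + C * (1 + ln (norm z))"
    "\<And>z. norm z \<ge> r0 \<Longrightarrow> log_plus (norm (u z)) \<le> log_plus (norm (u z / poly d z)) + C * (1 + ln (norm z))"
proof -
  obtain C r0 where C: "C \<ge> 0" "r0 \<ge> 1"
    "\<And>z. norm z \<ge> r0 \<Longrightarrow> poly d z \<noteq> 0 \<and> \<bar>ln (norm (poly d z))\<bar> \<le> C * (1 + ln (norm z))"
    by (rule poly_log_bound[OF assms]) (rule that; assumption)
  have a: "log_plus (norm (u z / poly d z)) \<le> log_plus (norm (u z)) + C * (1 + ln (norm z))"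
    and b: "log_plus (norm (u z)) \<le> log_plus (norm (u z / poly d z)) + C * (1 + ln (norm z))"
    if z: "norm z \<ge> r0" for z
  proof -
    have d0: "poly d z \<noteq> 0" using C(3)[OF z] by blast
    have "log_plus (norm (u z / poly d z)) = log_plus (norm (u z) * (1 / norm (poly d z)))"
      by (simp add: norm_divide)
    also have "\<dots> \<le> log_plus (norm (u z)) + log_plus (1 / norm (poly d z))"
      by (rule log_plus_mult_le) auto
    also have "log_plus (1 / norm (poly d z)) \<le> \<bar>ln (norm (poly d z))\<bar>"
      using log_plus_le_abs_ln[of "1 / norm (poly d z)"] d0 by (simp add: ln_div)
    also have "\<dots> \<le> C * (1 + ln (norm z))" using C(3)[OF z] by blast
    finally show "log_plus (norm (u z / poly d z)) \<le> log_plus (norm (u z)) + C * (1 + ln (norm z))" by simp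
    have "log_plus (norm (u z)) = log_plus (norm (u z / poly d z) * norm (poly d z))"
      using d0 by (simp add: norm_divide)
    also have "\<dots> \<le> log_plus (norm (u z / poly d z)) + log_plus (norm (poly d z))"
      by (rule log_plus_mult_le) auto
    also have "log_plus (norm (poly d z)) \<le> \<bar>ln (norm (poly d z))\<bar>" by (rule log_plus_le_abs_ln)
    also have "\<dots> \<le> C * (1 + ln (norm z))" using C(3)[OF z] by blast
    finally show "log_plus (norm (u z)) \<le> log_plus (norm (u z / poly d z)) + C * (1 + ln (norm z))" by simp
  qed
  show ?thesis by (rule that[OF C(1,2) _ a b]) (use C(3) in auto)
qed

lemma proximity_eq_circle_mean: "proximity r f = circle_mean r (\<lambda>z. log_plus (norm (f z)))"
  by (simp only: proximity_def circle_mean_def)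

text \<open>
  For finitely many poles, the integral of the counting function can be evaluated pole by pole.
\<close>

lemma integrated_pole_count_eq:
  assumes fin: "finite {z. is_pole f z}" and r: "r > 0"
  shows "integrated_pole_count r f =
    (\<Sum>a | is_pole f a \<and> a \<noteq> 0. real (nat (- zorder f a)) * (if norm a \<le> r then ln r - ln (norm a) else 0))
    + real (pole_count 0 f) * ln r"
proof -
  define A where "A = {a. is_pole f a \<and> a \<noteq> 0}"
  define m where "m a = real (nat (- zorder f a))" for a
  have finA: "finite A" unfolding A_def by (rule finite_subset[OF _ fin]) auto
  have diff: "real (pole_count t f) - real (pole_count 0 f) = (\<Sum>a\<in>A. m a * (if norm a \<le> t then 1 else 0))"
    if "t \<ge> 0" for t
  proof -
    have "{z. norm z \<le> t \<and> is_pole f z} = {z. norm z \<le> 0 \<and> is_pole f z} \<union> {a\<in>A. norm a \<le> t}"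
      using that by (auto simp: A_def)
    then have "pole_count t f = pole_count 0 f + (\<Sum>a | a \<in> A \<and> norm a \<le> t. nat (- zorder f a))"
      unfolding pole_count_def
      by (simp only:) (rule sum.union_disjoint, auto simp: A_def intro: finite_subset[OF _ fin])
    then have "real (pole_count t f) - real (pole_count 0 f) = (\<Sum>a | a \<in> A \<and> norm a \<le> t. m a)"
      by (simp add: m_def)
    also have "\<dots> = (\<Sum>a\<in>A. if norm a \<le> t then m a else 0)"
      using sum.inter_filter[OF finA, of m "\<lambda>a. norm a \<le> t"] by simp
    also have "\<dots> = (\<Sum>a\<in>A. m a * (if norm a \<le> t then 1 else 0))"
      by (rule sum.cong) auto
    finally show ?thesis .
  qed
  have one: "((\<lambda>t. if t \<in> {norm a..r} then 1 / t else 0) has_integral (if norm a \<le> r then ln r - ln (norm a) else 0)) {0..r}"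
    if a: "a \<in> A" for a
  proof (cases "norm a \<le> r")
    case True
    have pos: "norm a > 0" using a by (auto simp: A_def)
    have "((\<lambda>t. 1 / t) has_integral (ln r - ln (norm a))) {norm a..r}"
    proof (rule fundamental_theorem_of_calculus[OF True])
      fix x assume "x \<in> {norm a..r}"
      then have "x > 0" using less_le_trans[OF pos, of x] by simp
      then have "(ln has_real_derivative 1 / x) (at x within {norm a..r})"
        by (auto intro!: derivative_eq_intros)
      then show "(ln has_vector_derivative 1 / x) (at x within {norm a..r})"
        by (simp add: has_real_derivative_iff_has_vector_derivative)
    qed
    then show ?thesis using True by (subst has_integral_restrict) auto
  next
    case False
    then have "{norm a..r} = {}" by simp
    then show ?thesis using False by simp
  qed
  have "((\<lambda>t. \<Sum>a\<in>A. m a * (if t \<in> {norm a..r} then 1 / t else 0)) has_integral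
      (\<Sum>a\<in>A. m a * (if norm a \<le> r then ln r - ln (norm a) else 0))) {0..r}"
    by (intro has_integral_sum finA has_integral_mult_right one)
  then have "((\<lambda>t. (real (pole_count t f) - real (pole_count 0 f)) / t) has_integral
      (\<Sum>a\<in>A. m a * (if norm a \<le> r then ln r - ln (norm a) else 0))) {0..r}"
  proof (rule has_integral_eq[rotated])
    fix t assume t: "t \<in> {0..r}"
    have "(\<Sum>a\<in>A. m a * (if t \<in> {norm a..r} then 1 / t else 0)) = (\<Sum>a\<in>A. m a * (if norm a \<le> t then 1 else 0) / t)"
      by (rule sum.cong) (use t in auto)
    then show "(\<Sum>a\<in>A. m a * (if t \<in> {norm a..r} then 1 / t else 0)) = (real (pole_count t f) - real (pole_count 0 f)) / t"
      using diff[of t] t by (simp add: sum_divide_distrib)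
  qed
  then show ?thesis
    unfolding integrated_pole_count_def A_def[symmetric] m_def[symmetric] by (simp add: integral_unique)
qed

lemma integrated_pole_count_nonneg:
  assumes "finite {z. is_pole f z}" "r \<ge> 1"
  shows "integrated_pole_count r f \<ge> 0"
  unfolding integrated_pole_count_eq[OF assms(1) less_le_trans[OF zero_less_one assms(2)]]
  using assms(2) by (intro add_nonneg_nonneg sum_nonneg mult_nonneg_nonneg) auto

lemma integrated_pole_count_le:
  assumes fin: "finite {z. is_pole f z}"
  obtains C where "C \<ge> 0" "\<And>r. r \<ge> 1 \<Longrightarrow> integrated_pole_count r f \<le> C * (1 + ln r)"
proof -
  define A where "A = {a. is_pole f a \<and> a \<noteq> 0}"
  have finA: "finite A" unfolding A_def by (rule finite_subset[OF _ fin]) auto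
  define C where "C = (\<Sum>a\<in>A. real (nat (- zorder f a)) * (1 + \<bar>ln (norm a)\<bar>)) + real (pole_count 0 f)"
  have "integrated_pole_count r f \<le> C * (1 + ln r)" if r: "r \<ge> 1" for r
  proof -
    have l: "ln r \<ge> 0" using r by simp
    have "integrated_pole_count r f =
      (\<Sum>a\<in>A. real (nat (- zorder f a)) * (if norm a \<le> r then ln r - ln (norm a) else 0)) + real (pole_count 0 f) * ln r"
      unfolding A_def using integrated_pole_count_eq[OF fin, of r] r by simp
    also have "\<dots> \<le> (\<Sum>a\<in>A. real (nat (- zorder f a)) * ((1 + \<bar>ln (norm a)\<bar>) * (1 + ln r)))
       + real (pole_count 0 f) * (1 + ln r)"
    proof (intro add_mono sum_mono mult_left_mono)
      fix a assume "a \<in> A"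
      have "0 \<le> \<bar>ln (norm a)\<bar> * ln r" using l by simp
      then have "ln r + \<bar>ln (norm a)\<bar> \<le> (1 + \<bar>ln (norm a)\<bar>) * (1 + ln r)"
        unfolding distrib_left distrib_right by simp
      then show "(if norm a \<le> r then ln r - ln (norm a) else 0) \<le> (1 + \<bar>ln (norm a)\<bar>) * (1 + ln r)"
        using l by auto
    qed auto
    also have "\<dots> = C * (1 + ln r)"
      by (simp add: C_def distrib_right sum_distrib_right mult.assoc)
    finally show ?thesis .
  qed
  moreover have "C \<ge> 0" unfolding C_def by (intro add_nonneg_nonneg sum_nonneg mult_nonneg_nonneg) auto
  ultimately show ?thesis using that by blast
qed

lemma integrated_pole_count_ge:
  assumes fin: "finite {z. is_pole f z}" and pole: "is_pole f a" and mero: "f meromorphic_on {a}"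
    and r: "r \<ge> max 1 (norm a)"
  shows "integrated_pole_count r f \<ge> min (ln r) (ln r - ln (norm a))"
proof -
  have iso: "isolated_singularity_at f a" using mero by (simp add: meromorphic_at_iff)
  have "zorder f a < 0" by (rule isolated_pole_imp_neg_zorder[OF iso pole])
  then have m: "1 \<le> real (nat (- zorder f a))" by simp
  have r1: "r \<ge> 1" "r > 0" using r by auto
  define A where "A = {a. is_pole f a \<and> a \<noteq> 0}"
  have finA: "finite A" unfolding A_def by (rule finite_subset[OF _ fin]) auto
  define g where "g a = real (nat (- zorder f a)) * (if norm a \<le> r then ln r - ln (norm a) else 0)" for a
  have N: "integrated_pole_count r f = sum g A + real (pole_count 0 f) * ln r"
    unfolding A_def g_def by (rule integrated_pole_count_eq[OF fin r1(2)])
  have g0: "g x \<ge> 0" if "x \<in> A" for x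
    using that r by (auto simp: g_def A_def)
  show ?thesis
  proof (cases "a = 0")
    case True
    have "{z. norm z \<le> 0 \<and> is_pole f z} = {0}" using pole True by auto
    then have "1 \<le> real (pole_count 0 f)" using m True by (simp add: pole_count_def)
    then have "1 * ln r \<le> real (pole_count 0 f) * ln r" using r1 by (intro mult_right_mono) auto
    moreover have "0 \<le> sum g A" by (rule sum_nonneg) (rule g0)
    ultimately show ?thesis unfolding N by linarith
  next
    case False
    then have aA: "a \<in> A" using pole by (simp add: A_def)
    have pos: "norm a > 0" using False by simp
    have "1 * (ln r - ln (norm a)) \<le> g a"
    proof -
      have "0 \<le> ln r - ln (norm a)" using r pos by simp
      then show ?thesis unfolding g_def using r mult_right_mono[OF m] by simp
    qed
    also have "g a \<le> sum g A" by (rule member_le_sum[OF aA _ finA]) (use g0 in auto)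
    finally have "ln r - ln (norm a) \<le> sum g A" by simp
    moreover have "0 \<le> real (pole_count 0 f) * ln r" using r1 by simp
    ultimately show ?thesis unfolding N by linarith
  qed
qed

section \<open>Order of growth and the proximity function\<close>

lemma nevanlinna_char_le_powr:
  assumes ord: "growth_order f = ereal \<rho>" and \<epsilon>: "\<epsilon> > 0"
  obtains r0 where "r0 \<ge> 1" "\<And>r. r \<ge> r0 \<Longrightarrow> nevanlinna_char r f \<le> r powr (\<rho> + \<epsilon>)"
proof -
  have "Limsup at_top (\<lambda>r. ereal (ln (nevanlinna_char r f) / ln r)) < ereal (\<rho> + \<epsilon>)"
    using ord \<epsilon> by (simp add: growth_order_def)
  then have "eventually (\<lambda>r. ereal (ln (nevanlinna_char r f) / ln r) < ereal (\<rho> + \<epsilon>)) at_top"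
    by (rule Limsup_lessD)
  then obtain N where N: "\<And>r. r \<ge> N \<Longrightarrow> ln (nevanlinna_char r f) / ln r < \<rho> + \<epsilon>"
    unfolding eventually_at_top_linorder by auto
  show ?thesis
  proof (rule that[of "max N 2"])
    fix r assume r: "r \<ge> max N 2"
    show "nevanlinna_char r f \<le> r powr (\<rho> + \<epsilon>)"
    proof (cases "nevanlinna_char r f > 0")
      case True
      have lr: "ln r > 0" using r by simp
      have "ln (nevanlinna_char r f) < (\<rho> + \<epsilon>) * ln r"
        using N[of r] r lr by (simp add: field_simps)
      then have "exp (ln (nevanlinna_char r f)) \<le> exp ((\<rho> + \<epsilon>) * ln r)" by simp
      then show ?thesis using True r by (simp add: powr_def)
    next
      case False
      then show ?thesis by (meson not_le order_trans powr_ge_zero linear)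
    qed
  qed simp
qed

lemma nevanlinna_char_not_le_powr:
  assumes ord: "growth_order f = ereal \<rho>" and \<sigma>: "0 \<le> \<sigma>" "\<sigma> < \<rho>"
    and le: "\<And>r. r \<ge> r0 \<Longrightarrow> nevanlinna_char r f \<le> C * r powr \<sigma>"
    and nn: "\<And>r. r \<ge> r0 \<Longrightarrow> nevanlinna_char r f \<ge> 0"
  shows False
proof -
  define c where "c = (\<sigma> + \<rho>) / 2"
  define C' where "C' = max C 1"
  have c: "\<sigma> < c" "c < \<rho>" "c > 0" using \<sigma> by (auto simp: c_def)
  have X: "ln (nevanlinna_char r f) / ln r \<le> c"
    if r: "r \<ge> max r0 2" "r \<ge> exp (ln C' / (c - \<sigma>))" for r
  proof (cases "nevanlinna_char r f > 0")
    case True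
    have r2: "r > 0" "ln r > 0" using r by auto
    have "nevanlinna_char r f \<le> C' * r powr \<sigma>"
    proof -
      have "C * r powr \<sigma> \<le> C' * r powr \<sigma>" by (intro mult_right_mono) (auto simp: C'_def)
      moreover have "nevanlinna_char r f \<le> C * r powr \<sigma>" using le r by simp
      ultimately show ?thesis by linarith
    qed
    then have "ln (nevanlinna_char r f) \<le> ln (C' * r powr \<sigma>)" using True by (intro ln_mono) auto
    also have "\<dots> = ln C' + \<sigma> * ln r" using r2 by (simp add: C'_def ln_mult_pos ln_powr)
    also have "ln C' \<le> (c - \<sigma>) * ln r"
    proof -
      have "ln (exp (ln C' / (c - \<sigma>))) \<le> ln r" using r by (intro ln_mono) auto
      then show ?thesis using c by (simp add: field_simps)
    qed
    finally have "ln (nevanlinna_char r f) \<le> c * ln r" by (simp add: algebra_simps)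
    then show ?thesis using r2 by (simp add: field_simps)
  next
    case False
    then have "nevanlinna_char r f = 0" using nn[of r] r by simp
    then show ?thesis using c by simp
  qed
  have "eventually (\<lambda>r. ereal (ln (nevanlinna_char r f) / ln r) \<le> ereal c) at_top"
    unfolding eventually_at_top_linorder
    by (intro exI[of _ "max (max r0 2) (exp (ln C' / (c - \<sigma>)))"]) (use X in auto)
  then have "growth_order f \<le> ereal c" unfolding growth_order_def by (rule Limsup_bounded)
  then show False using ord c by simp
qed

lemma M1_entire_of_no_poles:
  assumes f: "f \<in> M1" and np: "\<And>z. \<not> is_pole f z"
  shows "f holomorphic_on UNIV"
proof (rule analytic_imp_holomorphic, rule nicely_meromorphic_without_singularities)
  show "f nicely_meromorphic_on UNIV" using f by (simp add: M1_def)
  show "\<forall>z\<in>UNIV. \<not> is_pole f z" using np by simp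
qed

lemma proximity_nonneg_M1:
  assumes f: "f \<in> M1"
  obtains r0 where "r0 \<ge> 1" "\<And>r. r \<ge> r0 \<Longrightarrow> proximity r f \<ge> 0"
    "\<And>r. r \<ge> r0 \<Longrightarrow> continuous_on (sphere 0 r) f"
    "\<And>r z. r \<ge> r0 \<Longrightarrow> norm z = r \<Longrightarrow> \<not> is_pole f z"
proof -
  have mero: "f nicely_meromorphic_on UNIV" and fin: "finite {z. is_pole f z}"
    using f by (auto simp: M1_def)
  define r0 where "r0 = Max (insert 0 (norm ` {z. is_pole f z})) + 1"
  have lt: "norm z < r0" if "is_pole f z" for z
  proof -
    have "norm z \<le> Max (insert 0 (norm ` {z. is_pole f z}))" using that fin by (intro Max_ge) auto
    then show ?thesis by (simp add: r0_def)
  qed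
  have r01: "r0 \<ge> 1" using fin by (simp add: r0_def)
  have np: "\<not> is_pole f z" if "r \<ge> r0" "norm z = r" for r z using lt[of z] that by auto
  have cont: "continuous_on (sphere 0 r) f" if "r \<ge> r0" for r
  proof (rule continuous_at_imp_continuous_on, rule ballI)
    fix z :: complex assume "z \<in> sphere 0 r"
    then have "\<not> is_pole f z" using np that by simp
    then have "f analytic_on {z}" using nicely_meromorphic_on_imp_analytic_at[OF mero] by simp
    then show "isCont f z" by (rule analytic_at_imp_isCont)
  qed
  have "proximity r f \<ge> 0" if "r \<ge> r0" for r
    unfolding proximity_eq_circle_mean
    by (rule circle_mean_nonneg) (use cont[OF that] r01 that in \<open>auto intro!: continuous_intros\<close>)
  then show ?thesis using that r01 cont np by blast
qed

text \<open>
  A negative order would force the characteristic to tend to 0.  Then there are no poles, as a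
  single pole contributes at least about \<open>ln r\<close>, and \<open>\<bar>f\<bar> \<le>
  1\<close> everywhere by the Poisson-Jensen inequality; but then the characteristic vanishes, and
  the convention for \<open>ln 0\<close> makes the quotient of logarithms 0.
\<close>

lemma growth_order_nonneg:
  assumes f: "f \<in> M1" and ord: "growth_order f = ereal \<rho>"
  shows "\<rho> \<ge> 0"
proof (rule ccontr)
  assume "\<not> \<rho> \<ge> 0"
  then have \<rho>: "\<rho> < 0" by simp
  have mero: "f nicely_meromorphic_on UNIV" and fin: "finite {z. is_pole f z}"
    using f by (auto simp: M1_def)
  have "Limsup at_top (\<lambda>r. ereal (ln (nevanlinna_char r f) / ln r)) < ereal (\<rho> / 2)"
    using ord \<rho> by (simp add: growth_order_def)
  then have "eventually (\<lambda>r. ereal (ln (nevanlinna_char r f) / ln r) < ereal (\<rho> / 2)) at_top"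
    by (rule Limsup_lessD)
  then obtain N where N: "\<And>r. r \<ge> N \<Longrightarrow> ln (nevanlinna_char r f) / ln r < \<rho> / 2"
    unfolding eventually_at_top_linorder by auto
  obtain r0 where r0: "r0 \<ge> 1" "\<And>r. r \<ge> r0 \<Longrightarrow> proximity r f \<ge> 0"
    by (rule proximity_nonneg_M1[OF f]) (rule that; assumption)
  have Tpos: "nevanlinna_char r f > 0" and Tle: "nevanlinna_char r f \<le> r powr (\<rho> / 2)"
    if r: "r \<ge> max (max N r0) 2" for r
  proof -
    have "nevanlinna_char r f \<ge> 0"
      unfolding nevanlinna_char_def using r0(2)[of r] integrated_pole_count_nonneg[OF fin, of r] r by auto
    moreover have "nevanlinna_char r f \<noteq> 0" using N[of r] r \<rho> by auto
    ultimately show pos: "nevanlinna_char r f > 0" by simp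
    have lr: "ln r > 0" using r by simp
    have "ln (nevanlinna_char r f) < (\<rho> / 2) * ln r"
      using N[of r] r lr by (simp add: field_simps)
    then have "exp (ln (nevanlinna_char r f)) \<le> exp ((\<rho> / 2) * ln r)" by simp
    then show "nevanlinna_char r f \<le> r powr (\<rho> / 2)" using pos r by (simp add: powr_def)
  qed
  have lim: "((\<lambda>r. r powr (\<rho> / 2)) \<longlongrightarrow> 0) at_top"
    using \<rho> by (intro tendsto_neg_powr filterlim_ident) auto
  have small: "\<exists>R. \<forall>r\<ge>R. nevanlinna_char r f < e" if "e > 0" for e
  proof -
    have "eventually (\<lambda>r. r powr (\<rho> / 2) < e) at_top"
      using order_tendstoD(2)[OF lim that] .
    then obtain R where "\<And>r. r \<ge> R \<Longrightarrow> r powr (\<rho> / 2) < e" unfolding eventually_at_top_linorder by auto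
    then have "nevanlinna_char r f < e" if "r \<ge> max R (max (max N r0) 2)" for r
      using that Tle[of r] le_less_trans[of "nevanlinna_char r f" "r powr (\<rho> / 2)" e] by simp
    then show ?thesis by blast
  qed
  have np: "\<not> is_pole f a" for a
  proof
    assume a: "is_pole f a"
    have mero_a: "f meromorphic_on {a}"
      using mero by (auto simp: nicely_meromorphic_on_def intro: meromorphic_on_subset)
    obtain R where R: "\<And>r. r \<ge> R \<Longrightarrow> nevanlinna_char r f < 1" using small[of 1] by auto
    define r where "r = Max {R, r0, exp 1 * (1 + norm a), norm a}"
    have r: "r \<ge> R" "r \<ge> r0" "r \<ge> exp 1 * (1 + norm a)" "r \<ge> norm a" by (auto simp: r_def)
    have r1: "r \<ge> 1" using r r0 by simp
    have "ln (exp 1 * (1 + norm a)) \<le> ln r" using r by (intro ln_mono) (auto intro!: mult_pos_pos add_pos_nonneg)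
    then have l: "1 + ln (1 + norm a) \<le> ln r" by (simp add: ln_mult_pos add_pos_nonneg)
    moreover have "ln (norm a) \<le> ln (1 + norm a)" 
      by (cases "a = 0") (auto intro!: ln_mono)
    moreover have "0 \<le> ln (1 + norm a)" by simp
    ultimately have "1 \<le> min (ln r) (ln r - ln (norm a))" by linarith
    also have "\<dots> \<le> integrated_pole_count r f"
      by (rule integrated_pole_count_ge[OF fin a mero_a]) (use r r1 in auto)
    also have "\<dots> \<le> nevanlinna_char r f" unfolding nevanlinna_char_def using r0(2)[OF r(2)] by simp
    finally show False using R[OF r(1)] by simp
  qed
  have T: "nevanlinna_char r f = proximity r f" for r
    using np by (simp add: nevanlinna_char_def integrated_pole_count_def pole_count_def)
  have hol: "f holomorphic_on UNIV" by (rule M1_entire_of_no_poles[OF f np])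
  have f1: "log_plus (norm (f z)) \<le> 0" for z
  proof (cases "\<exists>w. f w \<noteq> 0")
    case True
    then obtain w where w: "f w \<noteq> 0" by blast
    show ?thesis
    proof (rule field_le_epsilon)
      fix e :: real assume e: "e > 0"
      then obtain R where R: "\<And>r. r \<ge> R \<Longrightarrow> nevanlinna_char r f < e / 3" using small[of "e/3"] by auto
      have "max R (2 * norm z + 1) < max R (2 * norm z + 1) + 1" by simp
      then obtain r where r: "max R (2 * norm z + 1) < r" "r \<notin> norm ` {z. f z = 0}"
        by (rule generic_radius[OF countable_zero_radii[OF hol w]]) (rule that; assumption)
      have "2 * norm z + 1 < r" using r(1) by simp
      then have rz: "norm z < r" "2 * norm z < r" and rpos: "r \<ge> 0" using norm_ge_zero[of z] by linarith+
      have m0: "0 \<le> circle_mean r (\<lambda>\<zeta>. log_plus (norm (f \<zeta>)))"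
        by (rule circle_mean_nonneg)
           (use rpos in \<open>auto intro!: continuous_intros continuous_on_subset[OF holomorphic_on_imp_continuous_on[OF hol]]\<close>)
      have "log_plus (norm (f z)) \<le> (r + norm z) / (r - norm z) * circle_mean r (\<lambda>\<zeta>. log_plus (norm (f \<zeta>)))"
        by (rule harnack_max_bound[OF hol order_refl rz(1)]) (use r(2) in auto)
      also have "\<dots> \<le> 3 * circle_mean r (\<lambda>\<zeta>. log_plus (norm (f \<zeta>)))"
        using rz by (intro mult_right_mono m0) (auto simp: field_simps)
      also have "\<dots> \<le> 0 + e" using R[of r] r T[of r] by (simp add: proximity_eq_circle_mean)
      finally show "log_plus (norm (f z)) \<le> 0 + e" .
    qed
  qed (simp add: log_plus_def)
  then have "log_plus (norm (f z)) = 0" for z by (simp add: order_antisym)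
  then have "proximity r f = 0" for r by (simp add: proximity_def)
  then show False using Tpos[of "max (max N r0) 2"] T by simp
qed

text \<open>
  The proximity function need not be monotone; this is the substitute.  It allows estimates that
  hold outside a countable set of radii to be transferred to all radii.
\<close>

lemma M1_max_growth:
  assumes f: "f \<in> M1" and B: "countable B"
  obtains K r0 where "K \<ge> 0" "r0 \<ge> 1"
    "\<And>r. r \<ge> r0 \<Longrightarrow> \<exists>R. 2 * r < R \<and> R < 3 * r \<and> R \<notin> B \<and> R \<ge> r0 \<and>
       proximity r f \<le> 3 * proximity R f + K * (1 + ln r)"
proof -
  obtain u d where ud: "u holomorphic_on UNIV" "d \<noteq> 0" "\<And>z. poly d z = 0 \<Longrightarrow> is_pole f z"
    "\<And>z. \<not> is_pole f z \<Longrightarrow> f z = u z / poly d z"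
    by (rule M1_quotient[OF f]) (rule that; assumption)
  obtain C r1 where C: "C \<ge> 0" "r1 \<ge> 1" "\<And>z. norm z \<ge> r1 \<Longrightarrow> poly d z \<noteq> 0"
    "\<And>z. norm z \<ge> r1 \<Longrightarrow> log_plus (norm (u z / poly d z)) \<le> log_plus (norm (u z)) + C * (1 + ln (norm z))"
    "\<And>z. norm z \<ge> r1 \<Longrightarrow> log_plus (norm (u z)) \<le> log_plus (norm (u z / poly d z)) + C * (1 + ln (norm z))"
    by (rule quotient_log_plus_bound[OF ud(2), of u]) (rule that; assumption)
  obtain r2 where r2: "r2 \<ge> 1" "\<And>r. r \<ge> r2 \<Longrightarrow> proximity r f \<ge> 0"
    "\<And>r. r \<ge> r2 \<Longrightarrow> continuous_on (sphere 0 r) f"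
    "\<And>r z. r \<ge> r2 \<Longrightarrow> norm z = r \<Longrightarrow> \<not> is_pole f z"
    by (rule proximity_nonneg_M1[OF f]) (rule that; assumption)
  define r0 where "r0 = max r1 r2"
  have r0: "r0 \<ge> 1" "r0 \<ge> r1" "r0 \<ge> r2" using C(2) by (auto simp: r0_def)
  have contu: "continuous_on S u" for S
    by (rule continuous_on_subset[OF holomorphic_on_imp_continuous_on[OF ud(1)]]) auto
  define K where "K = 10 * C"
  show ?thesis
  proof (rule that[of K r0])
    fix r assume r: "r \<ge> r0"
    have r11: "r \<ge> 1" using r r0 by simp
    show "\<exists>R. 2 * r < R \<and> R < 3 * r \<and> R \<notin> B \<and> R \<ge> r0 \<and> proximity r f \<le> 3 * proximity R f + K * (1 + ln r)"
    proof (cases "\<exists>w. u w \<noteq> 0")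
      case True
      then obtain w where w: "u w \<noteq> 0" by blast
      have "countable (B \<union> norm ` {z. u z = 0})" using B countable_zero_radii[OF ud(1) w] by simp
      moreover have "2 * r < 3 * r" using r11 by simp
      ultimately obtain R where R: "2 * r < R" "R < 3 * r" "R \<notin> B \<union> norm ` {z. u z = 0}"
        by (rule generic_radius) (rule that; assumption)
      have Rr: "R \<ge> r0" "R \<ge> 1" using R r r0 by auto
      have lnR: "ln R \<le> 2 + ln r"
      proof -
        have "ln R \<le> ln (3 * r)" using R r11 by (intro ln_mono) auto
        also have "\<dots> = ln 3 + ln r" using r11 by (simp add: ln_mult_pos)
        also have "ln (3::real) \<le> 2" using ln_le_minus_one[of "3::real"] by simp
        finally show ?thesis by simp
      qed
      have lr: "ln r \<ge> 0" using r11 by simp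
      have muR: "circle_mean R (\<lambda>z. log_plus (norm (u z))) \<le> proximity R f + C * (1 + ln R)"
      proof -
        have "circle_mean R (\<lambda>z. log_plus (norm (u z))) \<le> circle_mean R (\<lambda>z. log_plus (norm (f z)) + C * (1 + ln R))"
        proof (rule circle_mean_mono)
          fix z :: complex assume z: "norm z = R"
          then show "log_plus (norm (u z)) \<le> log_plus (norm (f z)) + C * (1 + ln R)"
            using C(5)[of z] ud(4)[of z] r2(4)[of R z] Rr r0 by simp
        qed (use Rr r0 r2(3) contu in \<open>auto intro!: continuous_intros\<close>)
        also have "\<dots> = proximity R f + C * (1 + ln R)"
          unfolding proximity_eq_circle_mean
          by (subst circle_mean_add) (use Rr r0 r2(3) in \<open>auto intro!: continuous_intros\<close>)
        finally show ?thesis .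
      qed
      have "proximity r f \<le> circle_mean r (\<lambda>z. 3 * circle_mean R (\<lambda>z. log_plus (norm (u z))) + C * (1 + ln r))"
        unfolding proximity_eq_circle_mean
      proof (rule circle_mean_mono)
        fix z :: complex assume z: "norm z = r"
        have "log_plus (norm (f z)) \<le> log_plus (norm (u z)) + C * (1 + ln r)"
          using C(4)[of z] ud(4)[of z] r2(4)[of r z] r r0 z by simp
        also have "log_plus (norm (u z)) \<le> (R + r) / (R - r) * circle_mean R (\<lambda>\<zeta>. log_plus (norm (u \<zeta>)))"
          by (rule harnack_max_bound[OF ud(1)]) (use R z r11 in auto)
        also have "\<dots> \<le> 3 * circle_mean R (\<lambda>\<zeta>. log_plus (norm (u \<zeta>)))"
          using R r11 Rr by (intro mult_right_mono circle_mean_nonneg)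
            (auto simp: field_simps intro!: continuous_intros contu)
        finally show "log_plus (norm (f z)) \<le> 3 * circle_mean R (\<lambda>z. log_plus (norm (u z))) + C * (1 + ln r)" by simp
      qed (use r r0 r11 r2(3) in \<open>auto intro!: continuous_intros\<close>)
      also have "\<dots> = 3 * circle_mean R (\<lambda>z. log_plus (norm (u z))) + C * (1 + ln r)" by simp
      also have "\<dots> \<le> 3 * (proximity R f + C * (1 + ln R)) + C * (1 + ln r)" using muR by simp
      also have "\<dots> \<le> 3 * (proximity R f + C * (3 + ln r)) + C * (1 + ln r)"
        using mult_left_mono[of "1 + ln R" "3 + ln r" C] lnR C(1) by simp
      also have "\<dots> \<le> 3 * proximity R f + K * (1 + ln r)"
        using mult_nonneg_nonneg[OF C(1) lr] C(1) unfolding K_def by (simp add: algebra_simps)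
      finally show ?thesis using R Rr by blast
    next
      case False
      have "2 * r < 3 * r" using r11 by simp
      then obtain R where R: "2 * r < R" "R < 3 * r" "R \<notin> B"
        by (rule generic_radius[OF B]) (rule that; assumption)
      have "proximity r f = circle_mean r (\<lambda>z. 0)"
        unfolding proximity_eq_circle_mean
      proof (rule circle_mean_cong)
        fix z :: complex assume "norm z = r"
        then have "f z = 0" using ud(4)[of z] r2(4)[of r z] r r0 False by simp
        then show "log_plus (norm (f z)) = 0" by (simp add: log_plus_def)
      qed (use r11 in simp)
      then have "proximity r f \<le> 3 * proximity R f + K * (1 + ln r)"
        using r2(2)[of R] R r r0 C(1) r11 by (simp add: K_def)
      then show ?thesis using R r r11 by (intro exI[of _ R]) auto
    qed
  qed (use C r0 in \<open>auto simp: K_def\<close>)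
qed

lemma ln_le_powr: "\<sigma> > 0 \<Longrightarrow> r \<ge> 1 \<Longrightarrow> ln r \<le> (1 / \<sigma>) * r powr \<sigma>" for r \<sigma> :: real
  using ln_le_minus_one[of "r powr \<sigma>"] by (simp add: ln_powr field_simps)

text \<open>
  The pole count is only \<open>O(ln r)\<close>, so that the order is determined by the proximity
  function, and a countable set of radii may be left out.
\<close>

lemma proximity_not_le_powr:
  assumes f: "f \<in> M1" and ord: "growth_order f = ereal \<rho>" and \<sigma>: "0 < \<sigma>" "\<sigma> < \<rho>"
    and B: "countable B" and le: "\<And>r. r \<ge> r0 \<Longrightarrow> r \<notin> B \<Longrightarrow> proximity r f \<le> C * r powr \<sigma>"
  shows False
proof -
  have fin: "finite {z. is_pole f z}" using f by (auto simp: M1_def)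
  obtain K r1 where K: "K \<ge> 0" "r1 \<ge> 1"
    "\<And>r. r \<ge> r1 \<Longrightarrow> \<exists>R. 2 * r < R \<and> R < 3 * r \<and> R \<notin> B \<and> R \<ge> r1 \<and>
       proximity r f \<le> 3 * proximity R f + K * (1 + ln r)"
    by (rule M1_max_growth[OF f B]) (rule that; assumption)
  obtain N where N: "N \<ge> 0" "\<And>r. r \<ge> 1 \<Longrightarrow> integrated_pole_count r f \<le> N * (1 + ln r)"
    by (rule integrated_pole_count_le[OF fin]) (rule that; assumption)
  obtain r2 where r2: "r2 \<ge> 1" "\<And>r. r \<ge> r2 \<Longrightarrow> proximity r f \<ge> 0"
    by (rule proximity_nonneg_M1[OF f]) (rule that; assumption)
  define C' where "C' = 3 * \<bar>C\<bar> * 3 powr \<sigma> + (K + N) * (1 + 1 / \<sigma>)"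
  show False
  proof (rule nevanlinna_char_not_le_powr[OF ord less_imp_le[OF \<sigma>(1)] \<sigma>(2), of "max (max r0 r1) r2" C'])
    fix r assume r: "r \<ge> max (max r0 r1) r2"
    have r11: "r \<ge> 1" using r K by simp
    show "0 \<le> nevanlinna_char r f"
      unfolding nevanlinna_char_def using r2(2)[of r] r integrated_pole_count_nonneg[OF fin r11] by simp
    obtain R where R: "2 * r < R" "R < 3 * r" "R \<notin> B" "proximity r f \<le> 3 * proximity R f + K * (1 + ln r)"
      using K(3)[of r] r by auto
    have p1: "1 \<le> r powr \<sigma>" using r11 \<sigma> by (simp add: ge_one_powr_ge_zero)
    have "proximity R f \<le> C * R powr \<sigma>" using R r r11 by (intro le) auto
    also have "\<dots> \<le> \<bar>C\<bar> * (3 * r) powr \<sigma>"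
      using R r11 \<sigma> by (intro mult_mono powr_mono2) auto
    also have "\<dots> = \<bar>C\<bar> * 3 powr \<sigma> * r powr \<sigma>" using r11 by (simp add: powr_mult)
    finally have 1: "proximity R f \<le> \<bar>C\<bar> * 3 powr \<sigma> * r powr \<sigma>" .
    have "1 + ln r \<le> (1 + 1 / \<sigma>) * r powr \<sigma>"
      using ln_le_powr[OF \<sigma>(1) r11] p1 by (simp add: algebra_simps)
    then have "(K + N) * (1 + ln r) \<le> (K + N) * ((1 + 1 / \<sigma>) * r powr \<sigma>)"
      using K N by (intro mult_left_mono) auto
    then show "nevanlinna_char r f \<le> C' * r powr \<sigma>"
      unfolding nevanlinna_char_def C'_def using R(4) N(2)[OF r11] 1 by (simp add: algebra_simps)
  qed
qed

section \<open>Two polynomial estimates\<close>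

text \<open>
  With \<open>y = f'(z)\<close> and \<open>x = f(z)\<close>, this bounds the logarithmic derivative
  of \<open>p(f)\<close> by those of \<open>f - c\<close> for the zeros \<open>c\<close> of
  \<open>p\<close>.
\<close>

lemma poly_log_deriv_bound:
  fixes p :: "complex poly"
  assumes "p \<noteq> 0" "X \<ge> 0" "\<And>c. poly p c = 0 \<Longrightarrow> norm y \<le> X * norm (x - c)"
  shows "norm (poly (pderiv p) x * y) \<le> real (degree p) * X * norm (poly p x)"
  using assms
proof (induction "degree p" arbitrary: p)
  case 0
  then obtain c where "p = [:c:]" by (metis degree_eq_zeroE)
  then show ?case by simp
next
  case (Suc n)
  then have "\<not> constant (poly p)" by (simp add: constant_degree)
  then obtain c where c: "poly p c = 0" using fundamental_theorem_of_algebra by blast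
  then obtain q where q: "p = [:- c, 1:] * q" by (auto simp: poly_eq_0_iff_dvd dvd_def)
  have q0: "q \<noteq> 0" using q Suc.prems(1) by auto
  have deg: "degree p = degree q + 1" unfolding q using q0 by (subst degree_mult_eq) auto
  have IH: "norm (poly (pderiv q) x * y) \<le> real (degree q) * X * norm (poly q x)"
    by (rule Suc.hyps(1)) (use Suc deg q0 q in auto)
  have pd: "poly (pderiv p) x * y = poly q x * y + (x - c) * (poly (pderiv q) x * y)"
    unfolding q pderiv_mult by (simp add: pderiv_pCons algebra_simps)
  have "norm (poly (pderiv p) x * y) \<le> norm (poly q x) * norm y + norm (x - c) * norm (poly (pderiv q) x * y)"
    unfolding pd norm_mult[symmetric] by (rule norm_triangle_ineq)
  also have "\<dots> \<le> norm (poly q x) * (X * norm (x - c)) + norm (x - c) * (real (degree q) * X * norm (poly q x))"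
    using IH Suc.prems(3)[OF c] by (intro add_mono mult_left_mono) auto
  also have "\<dots> = real (degree p) * X * norm (poly p x)"
  proof -
    have "poly p x = (x - c) * poly q x" unfolding q poly_mult by simp
    then show ?thesis by (simp add: deg norm_mult distrib_right distrib_left mult_ac)
  qed
  finally show ?case .
qed

text \<open>
  Only the factor for the root closest to \<open>x\<close> can be small; the other \<open>card S -
  1\<close> factors are comparable with \<open>max 1 \<bar>x\<bar>\<close>.  Since the roots are
  simple, one of the two factors \<open>y\<close> compensates the small factor, and the hypothesis
  on \<open>y\<close> is used for both of them.
\<close>

lemma simple_roots_ratio_bound:
  fixes S :: "complex set" and c b1 b2 :: complex
  assumes fin: "finite S" and ne: "S \<noteq> {}" and c: "c \<noteq> 0"
  obtains C where "C > 0" "\<And>x (y :: complex) X. X \<ge> 0 \<Longrightarrow> (\<And>a. a \<in> S \<Longrightarrow> norm y \<le> X * norm (x - a)) \<Longrightarrow>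
     norm y ^ 2 * norm (x - b1) * norm (x - b2) * max 1 (norm x) ^ card S
       \<le> C * X ^ 2 * norm (c * (\<Prod>a\<in>S. x - a)) * max 1 (norm x) ^ 4"
proof -
  define A where "A = Max (norm ` S)"
  have A: "norm a \<le> A" if "a \<in> S" for a unfolding A_def using that fin by simp
  have A0: "A \<ge> 0" using A ne norm_ge_zero by (metis all_not_in_conv order_trans)
  \<comment> \<open>Half the minimal distance of two roots separates \<open>x\<close> from all roots but one; the 1 covers the case of a single root.\<close>
  define D where "D = insert 1 ((\<lambda>(a, l). norm (l - a) / 2) ` {(a, l). a \<in> S \<and> l \<in> S \<and> a \<noteq> l})"
  define \<delta> where "\<delta> = Min D"
  have finD: "finite D" unfolding D_def
    by (intro finite.insertI finite_imageI finite_subset[OF _ finite_cartesian_product[OF fin fin]]) auto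
  have \<delta>: "\<delta> > 0" unfolding \<delta>_def using finD by (subst Min_gr_iff) (auto simp: D_def)
  have \<delta>1: "\<delta> \<le> 1" unfolding \<delta>_def using finD by (intro Min_le) (auto simp: D_def)
  have \<delta>le: "\<delta> \<le> norm (l - a) / 2" if "a \<in> S" "l \<in> S" "a \<noteq> l" for a l
    unfolding \<delta>_def using finD that by (intro Min_le) (auto simp: D_def)
  \<comment> \<open>Beyond \<open>M\<close> all roots are at distance at least \<open>\<bar>x\<bar> / 2\<close> from \<open>x\<close>.\<close>
  define M where "M = max 1 (2 * A)"
  define \<kappa> where "\<kappa> = min (1/2) (\<delta> / M)"
  have M: "M \<ge> 1" by (simp add: M_def)
  have \<kappa>: "\<kappa> > 0" using \<delta> M by (simp add: \<kappa>_def)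
  define N where "N = card S - 1"
  have cardS: "card S = N + 1" using fin ne by (simp add: N_def card_gt_0_iff Suc_leI)
  define E where "E = (1 + A) * (1 + norm b1) * (1 + norm b2)"
  have E: "E > 0" unfolding E_def using A0 by (intro mult_pos_pos) (auto intro: add_pos_nonneg)
  define C where "C = E / (norm c * \<kappa> ^ N)"
  have C: "C > 0" using E c \<kappa> by (simp add: C_def)
  show ?thesis
  proof (rule that[OF C])
    fix x y :: complex and X :: real
    assume X: "X \<ge> 0" and le: "\<And>a. a \<in> S \<Longrightarrow> norm y \<le> X * norm (x - a)"
    define m where "m = max 1 (norm x)"
    have m: "m \<ge> 1" "norm x \<le> m" by (auto simp: m_def)
    obtain a where a: "a \<in> S" "\<And>l. l \<in> S \<Longrightarrow> norm (x - a) \<le> norm (x - l)"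
      using ex_is_arg_min_if_finite[OF fin ne, of "\<lambda>a. norm (x - a)"]
      by (auto simp: is_arg_min_def not_less)
    have far: "\<kappa> * m \<le> norm (x - l)" if l: "l \<in> S - {a}" for l
    proof -
      have "norm (l - a) \<le> norm (x - a) + norm (x - l)"
        using norm_triangle_ineq4[of "x - a" "x - l"] by simp
      then have d: "\<delta> \<le> norm (x - l)" using \<delta>le[of a l] a l by force
      show ?thesis
      proof (cases "norm x \<ge> M")
        case True
        have "norm x - norm l \<le> norm (x - l)" by (rule norm_triangle_ineq2)
        moreover have "norm l \<le> norm x / 2" using A[of l] l True by (simp add: M_def)
        moreover have "m = norm x" using True M by (simp add: m_def)
        moreover have "\<kappa> * m \<le> 1/2 * m"
        proof (rule mult_right_mono)
          show "\<kappa> \<le> 1/2" unfolding \<kappa>_def by (rule min.cobounded1)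
        qed (use m in simp)
        ultimately show ?thesis by linarith
      next
        case False
        have "\<kappa> * m \<le> \<delta> / M * M" using False M m \<delta> by (intro mult_mono) (auto simp: \<kappa>_def m_def)
        then show ?thesis using d M by simp
      qed
    qed
    define Q where "Q = (\<Prod>l\<in>S - {a}. norm (x - l))"
    have Q: "(\<kappa> * m) ^ N \<le> Q"
    proof -
      have "(\<kappa> * m) ^ N = (\<Prod>l\<in>S - {a}. \<kappa> * m)" using a fin by (simp add: N_def)
      also have "\<dots> \<le> Q" unfolding Q_def using far \<kappa> m by (intro prod_mono) auto
      finally show ?thesis .
    qed
    have px: "norm (c * (\<Prod>a\<in>S. x - a)) = norm c * (norm (x - a) * Q)"
      unfolding Q_def norm_mult prod_norm[symmetric] using a fin by (subst prod.remove[of S a]) auto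
    define t where "t = norm (x - a)"
    have bnd: "norm (x - w) \<le> (1 + norm w) * m" for w
    proof -
      have "norm (x - w) \<le> norm x + norm w" by (rule norm_triangle_ineq4)
      also have "\<dots> \<le> m + norm w * m" using m mult_left_mono[of 1 m "norm w"] by auto
      finally show ?thesis by (simp add: algebra_simps)
    qed
    have t: "t \<le> (1 + A) * m"
    proof -
      have "(1 + norm a) * m \<le> (1 + A) * m" using A[OF a(1)] m by (intro mult_right_mono) auto
      then show ?thesis using bnd[of a] by (simp add: t_def)
    qed
    have "norm y ^ 2 * norm (x - b1) * norm (x - b2) * m ^ card S
        \<le> (X * t) ^ 2 * ((1 + norm b1) * m) * ((1 + norm b2) * m) * m ^ card S"
      using le[OF a(1)] X m bnd[of b1] bnd[of b2]
      by (intro mult_mono power_mono mult_nonneg_nonneg) (auto simp: t_def)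
    also have "\<dots> = X^2 * t * ((1 + norm b1) * (1 + norm b2)) * m ^ (N + 3) * t"
      by (simp add: cardS power_numeral_reduce power_add algebra_simps)
    also have "\<dots> \<le> X^2 * t * ((1 + norm b1) * (1 + norm b2)) * m ^ (N + 3) * ((1 + A) * m)"
      using t m by (intro mult_left_mono mult_nonneg_nonneg) (auto simp: t_def)
    also have "\<dots> = X^2 * t * E * m ^ N * m ^ 4"
      by (simp add: E_def power_numeral_reduce power_add algebra_simps)
    also have "\<dots> = C * X^2 * (norm c * (t * (\<kappa> ^ N * m ^ N))) * m ^ 4"
      using c \<kappa> by (simp add: C_def)
    also have "\<dots> \<le> C * X^2 * (norm c * (t * Q)) * m ^ 4"
      using Q C m by (intro mult_right_mono mult_left_mono) (auto simp: power_mult_distrib t_def)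
    finally show "norm y ^ 2 * norm (x - b1) * norm (x - b2) * max 1 (norm x) ^ card S
       \<le> C * X ^ 2 * norm (c * (\<Prod>a\<in>S. x - a)) * max 1 (norm x) ^ 4"
      unfolding px m_def[symmetric] t_def .
  qed
qed

section \<open>Local expansions of the second order term\<close>

text \<open>
  The multiplicity \<open>k\<close> is 0 if \<open>q\<close> does not vanish at the centre.
\<close>

lemma local_zero_factor:
  fixes q :: "complex \<Rightarrow> complex"
  assumes hol: "q holomorphic_on ball z0 r" and r: "r > 0" and nz: "w \<in> ball z0 r" "q w \<noteq> 0"
  obtains k h \<rho> where "k = nat (zorder q z0)" "k = 0 \<longleftrightarrow> q z0 \<noteq> 0" "0 < \<rho>" "\<rho> \<le> r" "h holomorphic_on ball z0 \<rho>"
    "\<And>z. z \<in> ball z0 \<rho> \<Longrightarrow> q z = (z - z0) ^ k * h z" "\<And>z. z \<in> ball z0 \<rho> \<Longrightarrow> h z \<noteq> 0"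
proof -
  have z0: "z0 \<in> ball z0 r" using r by simp
  have "\<exists>w\<in>ball z0 r. q w \<noteq> 0" using nz by blast
  from zorder_exist_zero[OF hol open_ball connected_ball z0 this]
  obtain e where e: "if q z0 = 0 then zorder q z0 > 0 else zorder q z0 = 0" "e > 0" "cball z0 e \<subseteq> ball z0 r"
    "zor_poly q z0 holomorphic_on cball z0 e"
    "\<And>w. w \<in> cball z0 e \<Longrightarrow> q w = zor_poly q z0 w * (w - z0) ^ nat (zorder q z0) \<and> zor_poly q z0 w \<noteq> 0"
    by blast
  show ?thesis
  proof (rule that[of "nat (zorder q z0)" "min e r" "zor_poly q z0"])
    show "nat (zorder q z0) = 0 \<longleftrightarrow> q z0 \<noteq> 0" using e(1) by (auto split: if_splits)
    show "zor_poly q z0 holomorphic_on ball z0 (min e r)" by (rule holomorphic_on_subset[OF e(4)]) auto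
  qed (use e r in auto)
qed

lemma deriv_zero_factor:
  assumes h: "h holomorphic_on ball z0 \<rho>" and q: "\<And>z. z \<in> ball z0 \<rho> \<Longrightarrow> q z = (z - z0) ^ k * h z"
    and z: "z \<in> ball z0 \<rho>"
  shows "deriv q z = of_nat k * (z - z0) ^ (k - 1) * h z + (z - z0) ^ k * deriv h z"
proof -
  have dh: "(h has_field_derivative deriv h z) (at z)" by (rule holomorphic_derivI[OF h open_ball z])
  have "((\<lambda>z. (z - z0) ^ k * h z) has_field_derivative
     of_nat k * (z - z0) ^ (k - 1) * h z + (z - z0) ^ k * deriv h z) (at z)"
    by (auto intro!: derivative_eq_intros dh)
  then have "(q has_field_derivative of_nat k * (z - z0) ^ (k - 1) * h z + (z - z0) ^ k * deriv h z) (at z)"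
    by (rule has_field_derivative_transform_within_open[OF _ open_ball z]) (use q in auto)
  then show ?thesis by (rule DERIV_imp_deriv)
qed

lemma log_deriv_zero_factor:
  assumes h: "h holomorphic_on ball z0 \<rho>" "\<And>z. z \<in> ball z0 \<rho> \<Longrightarrow> h z \<noteq> 0"
    and q: "\<And>z. z \<in> ball z0 \<rho> \<Longrightarrow> q z = (z - z0) ^ k * h z"
    and z: "z \<in> ball z0 \<rho>" "z \<noteq> z0"
  shows "deriv q z / q z = of_nat k / (z - z0) + deriv h z / h z"
proof -
  have d: "deriv q z = of_nat k * (z - z0) ^ (k - 1) * h z + (z - z0) ^ k * deriv h z"
    by (rule deriv_zero_factor[OF h(1) q z(1)])
  have gen: "(of_nat k * e ^ (k - 1) * a + e ^ k * b) / (e ^ k * a) = of_nat k / e + b / a"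
    if "e \<noteq> 0" "a \<noteq> 0" for e a b :: complex
    using that by (cases k) (auto simp: field_simps)
  show ?thesis unfolding d q[OF z(1)] by (rule gen) (use z h(2)[OF z(1)] in auto)
qed

lemma nonzero_near:
  fixes q :: "complex \<Rightarrow> complex"
  assumes "q holomorphic_on ball z0 r" "r > 0" "q z0 \<noteq> 0"
  obtains \<rho> where "0 < \<rho>" "\<rho> \<le> r" "\<And>z. z \<in> ball z0 \<rho> \<Longrightarrow> q z \<noteq> 0"
proof -
  have "continuous_on (ball z0 r) q" by (rule holomorphic_on_imp_continuous_on[OF assms(1)])
  then obtain e where e: "e > 0" "\<And>z. dist z0 z < e \<Longrightarrow> z \<in> ball z0 r \<Longrightarrow> q z \<noteq> 0"
    using continuous_on_avoid[of "ball z0 r" q z0 0] assms by auto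
  show ?thesis by (rule that[of "min e r"]) (use e assms(2) in auto)
qed

lemma holomorphic_poly_comp [holomorphic_intros]:
  fixes f :: "complex \<Rightarrow> complex"
  shows "f holomorphic_on S \<Longrightarrow> (\<lambda>z. poly p (f z)) holomorphic_on S"
  unfolding poly_altdef by (intro holomorphic_intros)

definition pderiv_comp :: "complex poly \<Rightarrow> (complex \<Rightarrow> complex) \<Rightarrow> complex \<Rightarrow> complex" where
  "pderiv_comp P f z = poly (pderiv P) (f z) * deriv f z"

text \<open>
  With \<open>F = P(f)\<close> this is \<open>F'' / F' - 2 F' / (F - 1)\<close>, the logarithmic
  derivative of \<open>F' / (F - 1)\<^sup>2\<close>; it is invariant under affine changes of
  \<open>1 / (F - 1)\<close>.
\<close>

definition second_order_term :: "complex poly \<Rightarrow> (complex \<Rightarrow> complex) \<Rightarrow> complex \<Rightarrow> complex" where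
  "second_order_term P f z =
     deriv (pderiv_comp P f) z / pderiv_comp P f z - 2 * (pderiv_comp P f z / (poly P (f z) - 1))"

text \<open>
  Its zeros at the points where \<open>f\<close> takes the value \<open>b1\<close> or
  \<open>b2\<close> or is ramified compensate the poles of the second order term there.
\<close>

definition ramification_factor :: "complex poly \<Rightarrow> complex \<Rightarrow> complex \<Rightarrow> (complex \<Rightarrow> complex) \<Rightarrow> complex \<Rightarrow> complex" where
  "ramification_factor P b1 b2 f z =
     (deriv f z)\<^sup>2 * (f z - b1) * (f z - b2) / (poly P (f z) - 1)"

lemma deriv_poly_comp:
  assumes f: "f holomorphic_on S" "open S" "z \<in> S"
  shows "((\<lambda>z. poly P (f z) - 1) has_field_derivative pderiv_comp P f z) (at z)"
proof -
  have df: "(f has_field_derivative deriv f z) (at z)" by (rule holomorphic_derivI[OF f])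
  have "((\<lambda>z. poly P (f z)) has_field_derivative poly (pderiv P) (f z) * deriv f z) (at z)"
    by (rule DERIV_chain2[OF poly_DERIV df])
  from DERIV_diff[OF this DERIV_const[of 1]] show ?thesis unfolding pderiv_comp_def by simp
qed

lemma holomorphic_pderiv_comp:
  assumes f: "f holomorphic_on S" "open S"
  shows "pderiv_comp P f holomorphic_on S"
  unfolding pderiv_comp_def by (intro holomorphic_intros f)

text \<open>
  At a point where \<open>P(f) - 1\<close> has a zero of order \<open>p\<close>, the residue of the
  second order term depends only on \<open>p\<close>.  For \<open>p = 1\<close> the constant term
  vanishes as well: this is the classical cancellation that makes simple shared points harmless.
\<close>

lemma local_form_at_one_point:
  assumes f: "f holomorphic_on ball z0 r" and r: "r > 0" and nc: "w \<in> ball z0 r" "f w \<noteq> f z0"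
    and one: "poly P (f z0) = 1" and simple: "poly (pderiv P) (f z0) \<noteq> 0"
  obtains \<rho> p \<psi> \<xi> where "p = nat (zorder (\<lambda>z. f z - f z0) z0)" "p \<ge> 1" "0 < \<rho>"
    "\<psi> holomorphic_on ball z0 \<rho>" "\<xi> holomorphic_on ball z0 \<rho>" "p = 1 \<Longrightarrow> \<psi> z0 = 0"
    "\<And>z. z \<in> ball z0 \<rho> \<Longrightarrow> z \<noteq> z0 \<Longrightarrow> second_order_term P f z = - of_nat (p + 1) / (z - z0) + \<psi> z"
    "\<And>z. z \<in> ball z0 \<rho> \<Longrightarrow> z \<noteq> z0 \<Longrightarrow> ramification_factor P b1 b2 f z * (z - z0)\<^sup>2 = (z - z0) ^ p * \<xi> z"
proof -
  define q where "q = (\<lambda>z. f z - f z0)"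
  have holq: "q holomorphic_on ball z0 r" unfolding q_def by (intro holomorphic_intros f)
  have qw: "q w \<noteq> 0" using nc by (simp add: q_def)
  obtain p h \<rho>1 where p: "p = nat (zorder q z0)" "p = 0 \<longleftrightarrow> q z0 \<noteq> 0" and \<rho>1: "0 < \<rho>1" "\<rho>1 \<le> r"
    and h: "h holomorphic_on ball z0 \<rho>1" "\<And>z. z \<in> ball z0 \<rho>1 \<Longrightarrow> q z = (z - z0) ^ p * h z"
      "\<And>z. z \<in> ball z0 \<rho>1 \<Longrightarrow> h z \<noteq> 0"
    by (rule local_zero_factor[OF holq r nc(1) qw]) (rule that; assumption)
  have p1: "p \<ge> 1" using p(2) by (simp add: q_def)
  obtain R where R: "P - 1 = [:- f z0, 1:] * R"
    using one by (metis dvdE poly_1 poly_diff poly_eq_0_iff_dvd right_minus_eq)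
  have Peq: "poly P x - 1 = (x - f z0) * poly R x" for x
    using arg_cong[OF R, of "\<lambda>p. poly p x"] by (simp add: algebra_simps)
  have "pderiv P = pderiv (P - 1)" by (simp add: pderiv_diff)
  then have "poly (pderiv P) (f z0) = poly R (f z0)"
    unfolding R pderiv_mult by (simp add: pderiv_pCons)
  then have R0: "poly R (f z0) \<noteq> 0" using simple by simp
  define g where "g = (\<lambda>z. h z * poly R (f z))"
  have f1: "f holomorphic_on ball z0 \<rho>1" by (rule holomorphic_on_subset[OF f]) (use \<rho>1 in auto)
  have holg: "g holomorphic_on ball z0 \<rho>1" unfolding g_def by (intro holomorphic_intros h f1)
  have F: "poly P (f z) - 1 = (z - z0) ^ p * g z" if "z \<in> ball z0 \<rho>1" for z
    using h(2)[OF that] by (simp add: Peq q_def g_def)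
  have g0: "g z0 \<noteq> 0" using h(3)[of z0] \<rho>1 R0 by (simp add: g_def)
  define h2 where "h2 = (\<lambda>z. of_nat p * g z + (z - z0) * deriv g z)"
  have holdg: "deriv g holomorphic_on ball z0 \<rho>1" by (rule holomorphic_deriv[OF holg open_ball])
  have holh2: "h2 holomorphic_on ball z0 \<rho>1" unfolding h2_def by (intro holomorphic_intros holg holdg)
  have h20: "h2 z0 \<noteq> 0" using g0 p1 by (simp add: h2_def)
  have pc: "pderiv_comp P f z = (z - z0) ^ (p - 1) * h2 z" if z: "z \<in> ball z0 \<rho>1" for z
  proof -
    have "pderiv_comp P f z = deriv (\<lambda>z. poly P (f z) - 1) z"
      using DERIV_imp_deriv[OF deriv_poly_comp[OF f1 open_ball z]] by simp
    also have "\<dots> = of_nat p * (z - z0) ^ (p - 1) * g z + (z - z0) ^ p * deriv g z"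
      by (rule deriv_zero_factor[OF holg F z])
    also have "\<dots> = (z - z0) ^ (p - 1) * h2 z"
      using p1 by (cases p) (auto simp: h2_def algebra_simps)
    finally show ?thesis .
  qed
  have "(\<lambda>z. g z * h2 z) holomorphic_on ball z0 \<rho>1" by (intro holomorphic_intros holg holh2)
  moreover have "g z0 * h2 z0 \<noteq> 0" using g0 h20 by simp
  ultimately obtain \<rho> where \<rho>: "0 < \<rho>" "\<rho> \<le> \<rho>1" "\<And>z. z \<in> ball z0 \<rho> \<Longrightarrow> g z * h2 z \<noteq> 0"
    by (rule nonzero_near[OF _ \<rho>1(1)]) (rule that; assumption)
  have sub: "z \<in> ball z0 \<rho>1" if "z \<in> ball z0 \<rho>" for z using that \<rho> by simp
  have sub': "ball z0 \<rho> \<subseteq> ball z0 \<rho>1" using sub by blast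
  have gn: "g z \<noteq> 0" and h2n: "h2 z \<noteq> 0" if "z \<in> ball z0 \<rho>" for z using \<rho>(3)[OF that] by auto
  define \<psi> where "\<psi> = (\<lambda>z. deriv h2 z / h2 z - 2 * (deriv g z / g z))"
  have hol\<psi>: "\<psi> holomorphic_on ball z0 \<rho>" unfolding \<psi>_def
    using gn h2n by (intro holomorphic_intros holomorphic_deriv[OF holomorphic_on_subset[OF holh2 sub'] open_ball]
        holomorphic_on_subset[OF holh2 sub'] holomorphic_on_subset[OF holg sub'] holomorphic_on_subset[OF holdg sub']) auto
  \<comment> \<open>With \<open>F - 1 = (z - z0) g\<close>, the constant term is \<open>2 g' / g - 2 g' / g\<close> at \<open>z0\<close>.\<close>
  have \<psi>0: "\<psi> z0 = 0" if p1: "p = 1"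
  proof -
    have z0: "z0 \<in> ball z0 \<rho>1" using \<rho>1 by simp
    have dg: "(g has_field_derivative deriv g z0) (at z0)" by (rule holomorphic_derivI[OF holg open_ball z0])
    have ddg: "(deriv g has_field_derivative deriv (deriv g) z0) (at z0)"
      by (rule holomorphic_derivI[OF holdg open_ball z0])
    have "(h2 has_field_derivative of_nat p * deriv g z0 + (deriv g z0 + (z0 - z0) * deriv (deriv g) z0)) (at z0)"
      unfolding h2_def by (auto intro!: derivative_eq_intros dg ddg)
    then have "deriv h2 z0 = of_nat p * deriv g z0 + deriv g z0" by (simp add: DERIV_imp_deriv)
    then show ?thesis using p1 g0 by (simp add: \<psi>_def h2_def)
  qed
  define h3 where "h3 = (\<lambda>z. of_nat p * h z + (z - z0) * deriv h z)"
  define \<xi> where "\<xi> = (\<lambda>z. (h3 z)\<^sup>2 * (f z - b1) * (f z - b2) / g z)"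
  have hol\<xi>: "\<xi> holomorphic_on ball z0 \<rho>" unfolding \<xi>_def h3_def
    using gn by (intro holomorphic_intros holomorphic_deriv[OF holomorphic_on_subset[OF h(1) sub'] open_ball]
        holomorphic_on_subset[OF h(1) sub'] holomorphic_on_subset[OF holg sub'] holomorphic_on_subset[OF f1 sub']) auto
  show ?thesis
  proof (rule that[OF p(1)[unfolded q_def] p1 \<rho>(1) hol\<psi> hol\<xi> \<psi>0])
    fix z assume z: "z \<in> ball z0 \<rho>" "z \<noteq> z0"
    note z1 = sub[OF z(1)]
    have e: "z - z0 \<noteq> 0" using z by simp
    have "deriv (pderiv_comp P f) z / pderiv_comp P f z = of_nat (p - 1) / (z - z0) + deriv h2 z / h2 z"
      by (rule log_deriv_zero_factor[of h2 z0 \<rho>])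
         (use z h2n pc sub in \<open>auto intro: holomorphic_on_subset[OF holh2 sub']\<close>)
    moreover have "pderiv_comp P f z / (poly P (f z) - 1) = of_nat p / (z - z0) + deriv g z / g z"
    proof -
      have "deriv (\<lambda>z. poly P (f z) - 1) z / (poly P (f z) - 1) = of_nat p / (z - z0) + deriv g z / g z"
        by (rule log_deriv_zero_factor[of g z0 \<rho>])
           (use z gn F sub in \<open>auto intro: holomorphic_on_subset[OF holg sub']\<close>)
      then show ?thesis using DERIV_imp_deriv[OF deriv_poly_comp[OF f1 open_ball z1]] by simp
    qed
    ultimately have "second_order_term P f z =
       of_nat (p - 1) / (z - z0) + deriv h2 z / h2 z - 2 * (of_nat p / (z - z0) + deriv g z / g z)"
      by (simp add: second_order_term_def)
    also have "\<dots> = (of_nat (p - 1) - 2 * of_nat p) / (z - z0) + \<psi> z"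
      by (simp add: \<psi>_def diff_divide_distrib algebra_simps)
    also have "of_nat (p - 1) - 2 * of_nat p = (- of_nat (p + 1) :: complex)"
      using p1 by (simp add: of_nat_diff)
    finally show "second_order_term P f z = - of_nat (p + 1) / (z - z0) + \<psi> z" .
    have "deriv f z = deriv q z"
    proof -
      have "(q has_field_derivative deriv f z - 0) (at z)"
        unfolding q_def by (intro DERIV_diff holomorphic_derivI[OF f1 open_ball z1] DERIV_const)
      then show ?thesis by (simp add: DERIV_imp_deriv)
    qed
    also have "\<dots> = of_nat p * (z - z0) ^ (p - 1) * h z + (z - z0) ^ p * deriv h z"
      by (rule deriv_zero_factor[OF h(1,2) z1])
    also have "\<dots> = (z - z0) ^ (p - 1) * h3 z"
      using p1 by (cases p) (auto simp: h3_def algebra_simps)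
    finally have df: "deriv f z = (z - z0) ^ (p - 1) * h3 z" .
    have "ramification_factor P b1 b2 f z * (z - z0)\<^sup>2 =
        ((z - z0) ^ (p - 1) * (z - z0))\<^sup>2 * ((h3 z)\<^sup>2 * (f z - b1) * (f z - b2)) / ((z - z0) ^ p * g z)"
      unfolding ramification_factor_def df F[OF z1] by (simp only: power_mult_distrib times_divide_eq_left times_divide_eq_right mult_ac)
    also have "(z - z0) ^ (p - 1) * (z - z0) = (z - z0) ^ p" using p1 by (cases p) auto
    also have "((z - z0) ^ p)\<^sup>2 * ((h3 z)\<^sup>2 * (f z - b1) * (f z - b2)) / ((z - z0) ^ p * g z) = (z - z0) ^ p * \<xi> z"
      using e gn[OF z(1)] by (simp add: \<xi>_def power2_eq_square)
    finally show "ramification_factor P b1 b2 f z * (z - z0)\<^sup>2 = (z - z0) ^ p * \<xi> z" .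
  qed
qed

text \<open>
  The pole of the second order term comes from a zero of \<open>(P(f))'\<close> of order
  \<open>k\<close>.  If \<open>f\<close> does not take a critical value there, this is a zero of
  \<open>f'\<close> of the same order, so that the ramification factor vanishes to order \<open>2
  k\<close>; otherwise it vanishes because of its factor \<open>(f - b1) (f - b2)\<close>.
\<close>

lemma local_form_elsewhere:
  assumes f: "f holomorphic_on ball z0 r" and r: "r > 0" and nc: "w \<in> ball z0 r" "f w \<noteq> f z0"
    and none: "poly P (f z0) \<noteq> 1"
    and crit: "\<And>x. poly (pderiv P) x = 0 \<longleftrightarrow> x = b1 \<or> x = b2"
  obtains \<rho> k e \<psi> \<xi> where "0 < \<rho>"
    "\<psi> holomorphic_on ball z0 \<rho>" "\<xi> holomorphic_on ball z0 \<rho>"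
    "f z0 \<in> {b1, b2} \<Longrightarrow> e \<ge> 1" "f z0 \<notin> {b1, b2} \<Longrightarrow> e = 2 * k"
    "\<And>z. z \<in> ball z0 \<rho> \<Longrightarrow> z \<noteq> z0 \<Longrightarrow> second_order_term P f z = of_nat k / (z - z0) + \<psi> z"
    "\<And>z. z \<in> ball z0 \<rho> \<Longrightarrow> z \<noteq> z0 \<Longrightarrow> ramification_factor P b1 b2 f z = (z - z0) ^ e * \<xi> z"
proof -
  define G where "G = (\<lambda>z. poly P (f z) - 1)"
  have holG: "G holomorphic_on ball z0 r" unfolding G_def by (intro holomorphic_intros f)
  have G0: "G z0 \<noteq> 0" using none by (simp add: G_def)
  have holdf: "deriv f holomorphic_on ball z0 r" by (rule holomorphic_deriv[OF f open_ball])
  have holpc: "pderiv_comp P f holomorphic_on ball z0 r" by (rule holomorphic_pderiv_comp[OF f open_ball])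
  have z0: "z0 \<in> ball z0 r" using r by simp
  have "\<exists>v\<in>ball z0 r. pderiv_comp P f v \<noteq> 0"
  proof (rule ccontr)
    assume "\<not> ?thesis"
    then have "((\<lambda>z. poly P (f z) - 1) has_field_derivative 0) (at z)" if "z \<in> ball z0 r" for z
      using deriv_poly_comp[OF f open_ball that, of P] that by simp
    then have "((\<lambda>z. poly P (f z) - 1) has_field_derivative 0) (at z within ball z0 r)" if "z \<in> ball z0 r" for z
      using that by (blast intro: has_field_derivative_at_within)
    then obtain c where c: "\<And>z. z \<in> ball z0 r \<Longrightarrow> poly P (f z) - 1 = c"
      using has_field_derivative_zero_constant[OF convex_ball] by metis
    have "P - [:1 + c:] \<noteq> 0"
    proof
      assume "P - [:1 + c:] = 0"
      then have "P = [:1 + c:]" by simp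
      then have "pderiv P = 0" by (simp add: pderiv_pCons)
      then have "x = b1 \<or> x = b2" for x using crit[of x] by simp
      then have "UNIV = {b1, b2}" by blast
      then show False using infinite_UNIV_char_0[where ?'a = complex] by (metis finite.emptyI finite.insertI)
    qed
    then have "finite {x. poly (P - [:1 + c:]) x = 0}" by (rule poly_roots_finite)
    moreover have "f ` ball z0 r \<subseteq> {x. poly (P - [:1 + c:]) x = 0}"
      using c by (force simp: algebra_simps)
    ultimately have "finite (f ` ball z0 r)" by (rule finite_subset[rotated])
    then have "f constant_on ball z0 r"
      using continuous_finite_range_constant[OF connected_ball holomorphic_on_imp_continuous_on[OF f]] by blast
    then show False using nc z0 by (metis constant_on_def)
  qed
  then obtain v where v: "v \<in> ball z0 r" "pderiv_comp P f v \<noteq> 0" by blast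
  then have v': "deriv f v \<noteq> 0" by (auto simp: pderiv_comp_def)
  obtain \<rho>0 where \<rho>0: "0 < \<rho>0" "\<rho>0 \<le> r" "\<And>z. z \<in> ball z0 \<rho>0 \<Longrightarrow> G z \<noteq> 0"
    by (rule nonzero_near[OF holG r G0]) (rule that; assumption)
  obtain k h \<rho>1 where k: "k = nat (zorder (pderiv_comp P f) z0)" "k = 0 \<longleftrightarrow> pderiv_comp P f z0 \<noteq> 0" and \<rho>1: "0 < \<rho>1" "\<rho>1 \<le> r"
    and h: "h holomorphic_on ball z0 \<rho>1" "\<And>z. z \<in> ball z0 \<rho>1 \<Longrightarrow> pderiv_comp P f z = (z - z0) ^ k * h z"
      "\<And>z. z \<in> ball z0 \<rho>1 \<Longrightarrow> h z \<noteq> 0"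
    by (rule local_zero_factor[OF holpc r v]) (rule that; assumption)
  define \<psi> where "\<psi> = (\<lambda>z. deriv h z / h z - 2 * (pderiv_comp P f z / G z))"
  define \<rho>2 where "\<rho>2 = min \<rho>0 \<rho>1"
  have \<rho>2: "0 < \<rho>2" "ball z0 \<rho>2 \<subseteq> ball z0 \<rho>0" "ball z0 \<rho>2 \<subseteq> ball z0 \<rho>1" "ball z0 \<rho>2 \<subseteq> ball z0 r"
    using \<rho>0 \<rho>1 by (auto simp: \<rho>2_def)
  have hol\<psi>: "\<psi> holomorphic_on ball z0 \<rho>2" unfolding \<psi>_def
    using h(3) \<rho>0(3) \<rho>2
    by (intro holomorphic_intros holomorphic_deriv[OF holomorphic_on_subset[OF h(1) \<rho>2(3)] open_ball]
        holomorphic_on_subset[OF h(1) \<rho>2(3)] holomorphic_on_subset[OF holpc \<rho>2(4)] holomorphic_on_subset[OF holG \<rho>2(4)]) auto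
  have L: "second_order_term P f z = of_nat k / (z - z0) + \<psi> z" if z: "z \<in> ball z0 \<rho>2" "z \<noteq> z0" for z
  proof -
    have "deriv (pderiv_comp P f) z / pderiv_comp P f z = of_nat k / (z - z0) + deriv h z / h z"
      by (rule log_deriv_zero_factor[OF h(1,3,2)]) (use z \<rho>2 in auto)
    then show ?thesis by (simp add: second_order_term_def \<psi>_def G_def)
  qed
  define D where "D = (\<lambda>z. (deriv f z)\<^sup>2 * (f z - b1) * (f z - b2))"
  have holD: "D holomorphic_on ball z0 r" unfolding D_def by (intro holomorphic_intros f holdf)
  have X: "ramification_factor P b1 b2 f z = D z / G z" for z
    by (simp add: ramification_factor_def D_def G_def)
  show ?thesis
  proof (cases "f z0 \<in> {b1, b2}")
    case True
    then have D0: "D z0 = 0" by (auto simp: D_def)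
    have "\<exists>v\<in>ball z0 r. D v \<noteq> 0"
      using v v' crit[of "f v"] by (intro bexI[of _ v]) (auto simp: D_def pderiv_comp_def)
    then obtain v2 where v2: "v2 \<in> ball z0 r" "D v2 \<noteq> 0" by blast
    obtain e h1 \<rho>3 where e: "e = nat (zorder D z0)" "e = 0 \<longleftrightarrow> D z0 \<noteq> 0" and \<rho>3: "0 < \<rho>3" "\<rho>3 \<le> r"
      and h1: "h1 holomorphic_on ball z0 \<rho>3" "\<And>z. z \<in> ball z0 \<rho>3 \<Longrightarrow> D z = (z - z0) ^ e * h1 z"
        "\<And>z. z \<in> ball z0 \<rho>3 \<Longrightarrow> h1 z \<noteq> 0"
      by (rule local_zero_factor[OF holD r v2]) (rule that; assumption)
    have sub: "ball z0 (min \<rho>2 \<rho>3) \<subseteq> ball z0 \<rho>2" "ball z0 (min \<rho>2 \<rho>3) \<subseteq> ball z0 \<rho>3" by auto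
    show ?thesis
    proof (rule that[of "min \<rho>2 \<rho>3" \<psi> "\<lambda>z. h1 z / G z" e k])
      show "(\<lambda>z. h1 z / G z) holomorphic_on ball z0 (min \<rho>2 \<rho>3)"
        using \<rho>0(3) \<rho>2 sub
        by (intro holomorphic_intros holomorphic_on_subset[OF h1(1) sub(2)] holomorphic_on_subset[OF holG]) auto
      show "\<psi> holomorphic_on ball z0 (min \<rho>2 \<rho>3)" by (rule holomorphic_on_subset[OF hol\<psi> sub(1)])
    qed (use True e D0 \<rho>2(1) \<rho>3(1) L X h1(2) in auto)
  next
    case False
    then have P0: "poly (pderiv P) (f z0) \<noteq> 0" using crit by auto
    have holPd: "(\<lambda>z. poly (pderiv P) (f z)) holomorphic_on ball z0 r" by (intro holomorphic_intros f)
    obtain \<rho>3 where \<rho>3: "0 < \<rho>3" "\<rho>3 \<le> r" "\<And>z. z \<in> ball z0 \<rho>3 \<Longrightarrow> poly (pderiv P) (f z) \<noteq> 0"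
      by (rule nonzero_near[OF holPd r P0]) (rule that; assumption)
    define \<xi> where "\<xi> = (\<lambda>z. (h z / poly (pderiv P) (f z))\<^sup>2 * (f z - b1) * (f z - b2) / G z)"
    have sub: "ball z0 (min \<rho>2 \<rho>3) \<subseteq> ball z0 \<rho>2" "ball z0 (min \<rho>2 \<rho>3) \<subseteq> ball z0 \<rho>3"
      "ball z0 (min \<rho>2 \<rho>3) \<subseteq> ball z0 r" "ball z0 (min \<rho>2 \<rho>3) \<subseteq> ball z0 \<rho>1" "ball z0 (min \<rho>2 \<rho>3) \<subseteq> ball z0 \<rho>0"
      using \<rho>2 \<rho>3 by auto
    show ?thesis
    proof (rule that[of "min \<rho>2 \<rho>3" \<psi> \<xi> "2 * k" k])
      show "\<xi> holomorphic_on ball z0 (min \<rho>2 \<rho>3)" unfolding \<xi>_def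
        using \<rho>0(3) \<rho>3(3) sub
        by (intro holomorphic_intros holomorphic_on_subset[OF h(1) sub(4)] holomorphic_on_subset[OF f sub(3)]
            holomorphic_on_subset[OF holG sub(3)]) auto
      show "\<psi> holomorphic_on ball z0 (min \<rho>2 \<rho>3)" by (rule holomorphic_on_subset[OF hol\<psi> sub(1)])
      fix z assume z: "z \<in> ball z0 (min \<rho>2 \<rho>3)" "z \<noteq> z0"
      show "second_order_term P f z = of_nat k / (z - z0) + \<psi> z" by (rule L) (use z sub in auto)
      have "poly (pderiv P) (f z) * deriv f z = (z - z0) ^ k * h z"
        using h(2)[of z] z sub by (auto simp: pderiv_comp_def)
      then have "deriv f z = (z - z0) ^ k * (h z / poly (pderiv P) (f z))"
        using \<rho>3(3)[of z] z by (simp add: field_simps)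
      then have "(deriv f z)\<^sup>2 = (z - z0) ^ (2 * k) * (h z / poly (pderiv P) (f z))\<^sup>2"
        by (simp only: power_mult_distrib power_even_eq)
      then show "ramification_factor P b1 b2 f z = (z - z0) ^ (2 * k) * \<xi> z"
        by (simp add: X D_def \<xi>_def)
    qed (use False \<rho>2(1) \<rho>3(1) in auto)
  qed
qed

section \<open>An auxiliary function with finitely many poles\<close>

text \<open>
  The square and the two ramification factors balance the poles of the difference at the points that
  are shared with truncated multiplicities.
\<close>

definition sharing_function :: "complex poly \<Rightarrow> complex \<Rightarrow> complex \<Rightarrow> (complex \<Rightarrow> complex) \<Rightarrow> (complex \<Rightarrow> complex) \<Rightarrow> complex \<Rightarrow> complex" where
  "sharing_function P b1 b2 f g z = (second_order_term P f z - second_order_term P g z)\<^sup>2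
     * ramification_factor P b1 b2 f z * ramification_factor P b1 b2 g z"

lemma power_shift: "m \<le> k \<Longrightarrow> (x :: complex) ^ k = x ^ (k - m) * x ^ m"
  by (metis le_add_diff_inverse2 power_add)

lemma divide_out_zero:
  fixes \<delta> :: "complex \<Rightarrow> complex"
  assumes "\<delta> holomorphic_on ball z0 \<rho>" "\<delta> z0 = 0"
  obtains \<eta> where "\<eta> holomorphic_on ball z0 \<rho>" "\<And>z. \<delta> z = (z - z0) * \<eta> z"
proof (rule that)
  show "(\<lambda>z. if z = z0 then deriv \<delta> z0 else (\<delta> z - \<delta> z0) / (z - z0)) holomorphic_on ball z0 \<rho>"
    by (rule pole_lemma_open[OF assms(1) open_ball])
  show "\<delta> z = (z - z0) * (if z = z0 then deriv \<delta> z0 else (\<delta> z - \<delta> z0) / (z - z0))" for z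
    using assms(2) by simp
qed

text \<open>
  Let \<open>H\<close> be the difference of the second order terms and \<open>p\<close>,
  \<open>p'\<close> the multiplicities at a shared point of \<open>S\<^sub>1\<close>, where the two
  ramification factors together have order at least \<open>p + p' - 4\<close>.  For \<open>p = p' =
  1\<close> the difference \<open>H\<close> vanishes, for \<open>p = p' = 2\<close> it is regular,
  and otherwise both multiplicities are at least 3 and the double pole of \<open>H\<^sup>2\<close>
  is compensated.  At other points \<open>H\<close> has at most a simple pole, and if it has one,
  the ramification factors together have order at least 2; if \<open>f\<close> takes one of the
  values \<open>b1\<close>, \<open>b2\<close>, each of the two contributes.
\<close>

lemma sharing_function_local:
  assumes f: "f holomorphic_on ball z0 r" and g: "g holomorphic_on ball z0 r" and r: "r > 0"
    and ncf: "w1 \<in> ball z0 r" "f w1 \<noteq> f z0" and ncg: "w2 \<in> ball z0 r" "g w2 \<noteq> g z0"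
    and crit: "\<And>x. poly (pderiv P) x = 0 \<longleftrightarrow> x = b1 \<or> x = b2"
    and b: "poly P b1 \<noteq> 1" "poly P b2 \<noteq> 1"
    and sh1: "poly P (f z0) = 1 \<longleftrightarrow> poly P (g z0) = 1"
    and sh1m: "poly P (f z0) = 1 \<Longrightarrow>
       min (nat (zorder (\<lambda>z. f z - f z0) z0)) 3 = min (nat (zorder (\<lambda>z. g z - g z0) z0)) 3"
    and sh2: "f z0 \<in> {b1, b2} \<longleftrightarrow> g z0 \<in> {b1, b2}"
  obtains \<rho> \<Theta> where "\<rho> > 0" "\<Theta> holomorphic_on ball z0 \<rho>"
    "\<And>z. z \<in> ball z0 \<rho> \<Longrightarrow> z \<noteq> z0 \<Longrightarrow> sharing_function P b1 b2 f g z = \<Theta> z"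
proof (cases "poly P (f z0) = 1")
  case True
  then have True': "poly P (g z0) = 1" using sh1 by simp
  have sf: "poly (pderiv P) (f z0) \<noteq> 0" using crit[of "f z0"] b True by auto
  have sg: "poly (pderiv P) (g z0) \<noteq> 0" using crit[of "g z0"] b True' by auto
  obtain \<rho> p \<psi> \<xi> where F: "p = nat (zorder (\<lambda>z. f z - f z0) z0)" "p \<ge> 1" "0 < \<rho>"
    "\<psi> holomorphic_on ball z0 \<rho>" "\<xi> holomorphic_on ball z0 \<rho>" "p = 1 \<Longrightarrow> \<psi> z0 = 0"
    "\<And>z. z \<in> ball z0 \<rho> \<Longrightarrow> z \<noteq> z0 \<Longrightarrow> second_order_term P f z = - of_nat (p + 1) / (z - z0) + \<psi> z"
    "\<And>z. z \<in> ball z0 \<rho> \<Longrightarrow> z \<noteq> z0 \<Longrightarrow> ramification_factor P b1 b2 f z * (z - z0)\<^sup>2 = (z - z0) ^ p * \<xi> z"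
    by (rule local_form_at_one_point[OF f r ncf True sf]) (rule that; assumption)
  obtain \<rho>' p' \<psi>' \<xi>' where G: "p' = nat (zorder (\<lambda>z. g z - g z0) z0)" "p' \<ge> 1" "0 < \<rho>'"
    "\<psi>' holomorphic_on ball z0 \<rho>'" "\<xi>' holomorphic_on ball z0 \<rho>'" "p' = 1 \<Longrightarrow> \<psi>' z0 = 0"
    "\<And>z. z \<in> ball z0 \<rho>' \<Longrightarrow> z \<noteq> z0 \<Longrightarrow> second_order_term P g z = - of_nat (p' + 1) / (z - z0) + \<psi>' z"
    "\<And>z. z \<in> ball z0 \<rho>' \<Longrightarrow> z \<noteq> z0 \<Longrightarrow> ramification_factor P b1 b2 g z * (z - z0)\<^sup>2 = (z - z0) ^ p' * \<xi>' z"
    by (rule local_form_at_one_point[OF g r ncg True' sg]) (rule that; assumption)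
  define \<rho>m where "\<rho>m = min \<rho> \<rho>'"
  have sub: "ball z0 \<rho>m \<subseteq> ball z0 \<rho>" "ball z0 \<rho>m \<subseteq> ball z0 \<rho>'" by (auto simp: \<rho>m_def)
  have mem: "z \<in> ball z0 \<rho>" "z \<in> ball z0 \<rho>'" if "z \<in> ball z0 \<rho>m" for z using that sub by blast+
  have \<rho>m: "\<rho>m > 0" using F(3) G(3) by (simp add: \<rho>m_def)
  define \<delta> where "\<delta> = (\<lambda>z. \<psi> z - \<psi>' z)"
  have hol\<delta>: "\<delta> holomorphic_on ball z0 \<rho>m" unfolding \<delta>_def
    by (intro holomorphic_intros holomorphic_on_subset[OF F(4) sub(1)] holomorphic_on_subset[OF G(4) sub(2)])
  have hol\<xi>: "\<xi> holomorphic_on ball z0 \<rho>m" "\<xi>' holomorphic_on ball z0 \<rho>m"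
    using holomorphic_on_subset[OF F(5) sub(1)] holomorphic_on_subset[OF G(5) sub(2)] by auto
  have H: "second_order_term P f z - second_order_term P g z = (of_nat p' - of_nat p) / (z - z0) + \<delta> z"
    if "z \<in> ball z0 \<rho>m" "z \<noteq> z0" for z
    unfolding F(7)[OF mem(1)[OF that(1)] that(2)] G(7)[OF mem(2)[OF that(1)] that(2)]
    by (simp add: \<delta>_def diff_divide_distrib add_divide_distrib)
  have W: "sharing_function P b1 b2 f g z * (z - z0) ^ 4 =
      ((of_nat p' - of_nat p) / (z - z0) + \<delta> z)\<^sup>2 * (z - z0) ^ (p + p') * (\<xi> z * \<xi>' z)"
    if z: "z \<in> ball z0 \<rho>m" "z \<noteq> z0" for z
  proof -
    have "sharing_function P b1 b2 f g z * (z - z0) ^ 4 =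
       (second_order_term P f z - second_order_term P g z)\<^sup>2 *
       ((ramification_factor P b1 b2 f z * (z - z0)\<^sup>2) * (ramification_factor P b1 b2 g z * (z - z0)\<^sup>2))"
      by (simp add: sharing_function_def power_numeral_reduce power2_eq_square)
    also have "(ramification_factor P b1 b2 f z * (z - z0)\<^sup>2) * (ramification_factor P b1 b2 g z * (z - z0)\<^sup>2)
       = (z - z0) ^ p * \<xi> z * ((z - z0) ^ p' * \<xi>' z)"
      unfolding F(8)[OF mem(1)[OF z(1)] z(2)] G(8)[OF mem(2)[OF z(1)] z(2)] ..
    finally show ?thesis unfolding H[OF z] by (simp add: power_add mult_ac)
  qed
  have sh: "min p 3 = min p' 3" using sh1m[OF True] F(1) G(1) by simp
  consider "p = 1" "p' = 1" | "p = 2" "p' = 2" | "p \<ge> 3" "p' \<ge> 3"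
    using sh F(2) G(2) by (fastforce simp: min_def split: if_splits)
  then show ?thesis
  proof cases
    case 1
    have "\<delta> z0 = 0" using F(6) G(6) 1 by (simp add: \<delta>_def)
    then obtain \<eta> where \<eta>: "\<eta> holomorphic_on ball z0 \<rho>m" "\<And>z. \<delta> z = (z - z0) * \<eta> z"
      by (rule divide_out_zero[OF hol\<delta>]) (rule that; assumption)
    show ?thesis
    proof (rule that[OF \<rho>m])
      show "(\<lambda>z. (\<eta> z)\<^sup>2 * (\<xi> z * \<xi>' z)) holomorphic_on ball z0 \<rho>m" by (intro holomorphic_intros \<eta> hol\<xi>)
      fix z assume z: "z \<in> ball z0 \<rho>m" "z \<noteq> z0"
      have "sharing_function P b1 b2 f g z * (z - z0) ^ 4 = ((\<eta> z)\<^sup>2 * (\<xi> z * \<xi>' z)) * (z - z0) ^ 4"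
        unfolding W[OF z] \<eta>(2) using 1 by (simp add: power_mult_distrib power_numeral_reduce mult_ac)
      then show "sharing_function P b1 b2 f g z = (\<eta> z)\<^sup>2 * (\<xi> z * \<xi>' z)" using z by simp
    qed
  next
    case 2
    show ?thesis
    proof (rule that[OF \<rho>m])
      show "(\<lambda>z. (\<delta> z)\<^sup>2 * (\<xi> z * \<xi>' z)) holomorphic_on ball z0 \<rho>m" by (intro holomorphic_intros hol\<delta> hol\<xi>)
      fix z assume z: "z \<in> ball z0 \<rho>m" "z \<noteq> z0"
      have "sharing_function P b1 b2 f g z * (z - z0) ^ 4 = ((\<delta> z)\<^sup>2 * (\<xi> z * \<xi>' z)) * (z - z0) ^ 4"
        unfolding W[OF z] using 2 by (simp add: mult_ac)
      then show "sharing_function P b1 b2 f g z = (\<delta> z)\<^sup>2 * (\<xi> z * \<xi>' z)" using z by simp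
    qed
  next
    case 3
    show ?thesis
    proof (rule that[OF \<rho>m])
      show "(\<lambda>z. ((of_nat p' - of_nat p) + (z - z0) * \<delta> z)\<^sup>2 * (z - z0) ^ (p + p' - 6) * (\<xi> z * \<xi>' z)) holomorphic_on ball z0 \<rho>m"
        by (intro holomorphic_intros hol\<delta> hol\<xi>)
      fix z assume z: "z \<in> ball z0 \<rho>m" "z \<noteq> z0"
      have e: "z - z0 \<noteq> 0" using z by simp
      have "(z - z0) ^ (p + p') = (z - z0) ^ (p + p' - 6) * (z - z0) ^ 2 * (z - z0) ^ 4"
        using 3 power_shift[of 6 "p + p'" "z - z0"] power_add[of "z - z0" 2 4] by simp
      then have "sharing_function P b1 b2 f g z * (z - z0) ^ 4 =
          (((of_nat p' - of_nat p) / (z - z0) + \<delta> z) * (z - z0))\<^sup>2 * (z - z0) ^ (p + p' - 6) * (\<xi> z * \<xi>' z) * (z - z0) ^ 4"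
        unfolding W[OF z] by (simp add: power_mult_distrib mult_ac)
      also have "((of_nat p' - of_nat p) / (z - z0) + \<delta> z) * (z - z0) = (of_nat p' - of_nat p) + (z - z0) * \<delta> z"
        using e by (simp only: distrib_right nonzero_eq_divide_eq[symmetric] mult.commute[of "\<delta> z"]) simp
      finally show "sharing_function P b1 b2 f g z =
          ((of_nat p' - of_nat p) + (z - z0) * \<delta> z)\<^sup>2 * (z - z0) ^ (p + p' - 6) * (\<xi> z * \<xi>' z)" using e by simp
    qed
  qed
next
  case False
  then have False': "poly P (g z0) \<noteq> 1" using sh1 by simp
  obtain \<rho> k e \<psi> \<xi> where F: "0 < \<rho>"
    "\<psi> holomorphic_on ball z0 \<rho>" "\<xi> holomorphic_on ball z0 \<rho>"
    "f z0 \<in> {b1, b2} \<Longrightarrow> e \<ge> 1" "f z0 \<notin> {b1, b2} \<Longrightarrow> e = 2 * k"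
    "\<And>z. z \<in> ball z0 \<rho> \<Longrightarrow> z \<noteq> z0 \<Longrightarrow> second_order_term P f z = of_nat k / (z - z0) + \<psi> z"
    "\<And>z. z \<in> ball z0 \<rho> \<Longrightarrow> z \<noteq> z0 \<Longrightarrow> ramification_factor P b1 b2 f z = (z - z0) ^ e * \<xi> z"
    by (rule local_form_elsewhere[OF f r ncf False crit]) (rule that; assumption)
  obtain \<rho>' k' e' \<psi>' \<xi>' where G: "0 < \<rho>'"
    "\<psi>' holomorphic_on ball z0 \<rho>'" "\<xi>' holomorphic_on ball z0 \<rho>'"
    "g z0 \<in> {b1, b2} \<Longrightarrow> e' \<ge> 1" "g z0 \<notin> {b1, b2} \<Longrightarrow> e' = 2 * k'"
    "\<And>z. z \<in> ball z0 \<rho>' \<Longrightarrow> z \<noteq> z0 \<Longrightarrow> second_order_term P g z = of_nat k' / (z - z0) + \<psi>' z"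
    "\<And>z. z \<in> ball z0 \<rho>' \<Longrightarrow> z \<noteq> z0 \<Longrightarrow> ramification_factor P b1 b2 g z = (z - z0) ^ e' * \<xi>' z"
    by (rule local_form_elsewhere[OF g r ncg False' crit]) (rule that; assumption)
  define \<rho>m where "\<rho>m = min \<rho> \<rho>'"
  have sub: "ball z0 \<rho>m \<subseteq> ball z0 \<rho>" "ball z0 \<rho>m \<subseteq> ball z0 \<rho>'" by (auto simp: \<rho>m_def)
  have mem: "z \<in> ball z0 \<rho>" "z \<in> ball z0 \<rho>'" if "z \<in> ball z0 \<rho>m" for z using that sub by blast+
  have \<rho>m: "\<rho>m > 0" using F(1) G(1) by (simp add: \<rho>m_def)
  define \<delta> where "\<delta> = (\<lambda>z. \<psi> z - \<psi>' z)"
  have hol\<delta>: "\<delta> holomorphic_on ball z0 \<rho>m" unfolding \<delta>_def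
    by (intro holomorphic_intros holomorphic_on_subset[OF F(2) sub(1)] holomorphic_on_subset[OF G(2) sub(2)])
  have hol\<xi>: "\<xi> holomorphic_on ball z0 \<rho>m" "\<xi>' holomorphic_on ball z0 \<rho>m"
    using holomorphic_on_subset[OF F(3) sub(1)] holomorphic_on_subset[OF G(3) sub(2)] by auto
  have W: "sharing_function P b1 b2 f g z =
      ((of_nat k - of_nat k') / (z - z0) + \<delta> z)\<^sup>2 * (z - z0) ^ (e + e') * (\<xi> z * \<xi>' z)"
    if z: "z \<in> ball z0 \<rho>m" "z \<noteq> z0" for z
  proof -
    have "second_order_term P f z - second_order_term P g z = (of_nat k - of_nat k') / (z - z0) + \<delta> z"
      unfolding F(6)[OF mem(1)[OF z(1)] z(2)] G(6)[OF mem(2)[OF z(1)] z(2)]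
      by (simp add: \<delta>_def diff_divide_distrib)
    then show ?thesis
      unfolding sharing_function_def F(7)[OF mem(1)[OF z(1)] z(2)] G(7)[OF mem(2)[OF z(1)] z(2)]
      by (simp add: power_add mult_ac)
  qed
  show ?thesis
  proof (cases "k = 0 \<and> k' = 0")
    case True
    show ?thesis
    proof (rule that[OF \<rho>m])
      show "(\<lambda>z. (\<delta> z)\<^sup>2 * (z - z0) ^ (e + e') * (\<xi> z * \<xi>' z)) holomorphic_on ball z0 \<rho>m"
        by (intro holomorphic_intros hol\<delta> hol\<xi>)
    qed (use W True in auto)
  next
    case False
    have ee: "e + e' \<ge> 2"
    proof (cases "f z0 \<in> {b1, b2}")
      case True
      then have "e \<ge> 1" "e' \<ge> 1" using F(4) G(4) sh2 by auto
      then show ?thesis by simp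
    next
      case nb: False
      then have "e = 2 * k" "e' = 2 * k'" using F(5) G(5) sh2 by auto
      then show ?thesis using False by auto
    qed
    show ?thesis
    proof (rule that[OF \<rho>m])
      show "(\<lambda>z. ((of_nat k - of_nat k') + (z - z0) * \<delta> z)\<^sup>2 * (z - z0) ^ (e + e' - 2) * (\<xi> z * \<xi>' z)) holomorphic_on ball z0 \<rho>m"
        by (intro holomorphic_intros hol\<delta> hol\<xi>)
      fix z assume z: "z \<in> ball z0 \<rho>m" "z \<noteq> z0"
      have e: "z - z0 \<noteq> 0" using z by simp
      have "(z - z0) ^ (e + e') = (z - z0) ^ (e + e' - 2) * (z - z0) ^ 2"
        using ee by (rule power_shift)
      then have "sharing_function P b1 b2 f g z =
          (((of_nat k - of_nat k') / (z - z0) + \<delta> z) * (z - z0))\<^sup>2 * (z - z0) ^ (e + e' - 2) * (\<xi> z * \<xi>' z)"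
        unfolding W[OF z] by (simp add: power_mult_distrib mult_ac)
      also have "((of_nat k - of_nat k') / (z - z0) + \<delta> z) * (z - z0) = (of_nat k - of_nat k') + (z - z0) * \<delta> z"
        using e by (simp only: distrib_right nonzero_eq_divide_eq[symmetric] mult.commute[of "\<delta> z"]) simp
      finally show "sharing_function P b1 b2 f g z =
          ((of_nat k - of_nat k') + (z - z0) * \<delta> z)\<^sup>2 * (z - z0) ^ (e + e' - 2) * (\<xi> z * \<xi>' z)" .
    qed
  qed
qed

lemma meromorphic_on_poly_comp [meromorphic_intros]:
  "f meromorphic_on A \<Longrightarrow> (\<lambda>z. poly p (f z)) meromorphic_on A"
  unfolding poly_altdef by (intro meromorphic_intros)

lemma sharing_function_meromorphic:
  assumes "f meromorphic_on A" "g meromorphic_on A"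
  shows "sharing_function P b1 b2 f g meromorphic_on A"
proof -
  have 1: "pderiv_comp P h meromorphic_on A" if "h meromorphic_on A" for h
    unfolding pderiv_comp_def using that by (intro meromorphic_intros)
  have 2: "second_order_term P h meromorphic_on A" if "h meromorphic_on A" for h
    unfolding second_order_term_def using that 1[OF that] by (intro meromorphic_intros)
  have 3: "ramification_factor P b1 b2 h meromorphic_on A" if "h meromorphic_on A" for h
    unfolding ramification_factor_def using that by (intro meromorphic_intros)
  show ?thesis unfolding sharing_function_def using assms 2 3 by (intro meromorphic_intros)
qed

lemma M1_remove_sings:
  assumes mero: "K meromorphic_on UNIV" and A: "finite A"
    and loc: "\<And>z0. z0 \<notin> A \<Longrightarrow> \<exists>\<rho> \<Theta>. \<rho> > 0 \<and> \<Theta> holomorphic_on ball z0 \<rho> \<and> (\<forall>z\<in>ball z0 \<rho> - {z0}. K z = \<Theta> z)"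
  shows "remove_sings K \<in> M1" and "\<And>z0. z0 \<notin> A \<Longrightarrow> \<not> is_pole (remove_sings K) z0"
proof -
  have nicely: "remove_sings K nicely_meromorphic_on UNIV" by (rule remove_sings_nicely_meromorphic[OF mero])
  show np: "\<not> is_pole (remove_sings K) z0" if z0: "z0 \<notin> A" for z0
  proof
    assume pole: "is_pole (remove_sings K) z0"
    obtain \<rho> \<Theta> where \<rho>: "\<rho> > 0" "\<Theta> holomorphic_on ball z0 \<rho>" "\<And>z. z \<in> ball z0 \<rho> - {z0} \<Longrightarrow> K z = \<Theta> z"
      using loc[OF z0] by blast
    have iso: "isolated_singularity_at K z0"
      using mero by (auto simp: meromorphic_on_altdef)
    have "is_pole K z0" using pole iso by simp
    moreover have "eventually (\<lambda>z. K z = \<Theta> z) (at z0)"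
      unfolding eventually_at by (intro exI[of _ \<rho>]) (use \<rho> in \<open>auto simp: dist_commute\<close>)
    ultimately have "is_pole \<Theta> z0" using is_pole_cong[of K \<Theta> z0 z0] by simp
    moreover have "\<Theta> analytic_on {z0}" using \<rho> by (auto simp: analytic_at_ball)
    ultimately show False using analytic_at_imp_no_pole by blast
  qed
  have "finite {z. is_pole (remove_sings K) z}" by (rule finite_subset[OF _ A]) (use np in auto)
  then show "remove_sings K \<in> M1" using nicely by (simp add: M1_def)
qed

section \<open>Estimates on circles for functions with finitely many poles\<close>

lemma open_nonpoles: "f \<in> M1 \<Longrightarrow> open {z. \<not> is_pole f z}"
proof -
  assume "f \<in> M1"
  then have "finite {z. is_pole f z}" by (simp add: M1_def)
  then have "closed {z. is_pole f z}" by (rule finite_imp_closed)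
  moreover have "{z. \<not> is_pole f z} = - {z. is_pole f z}" by auto
  ultimately show ?thesis by (simp add: open_Compl)
qed

lemma M1_analytic_at: "f \<in> M1 \<Longrightarrow> \<not> is_pole f z \<Longrightarrow> f analytic_on {z}"
  using nicely_meromorphic_on_imp_analytic_at[of f UNIV z] by (auto simp: M1_def)

lemma M1_holomorphic: "f \<in> M1 \<Longrightarrow> f holomorphic_on {z. \<not> is_pole f z}"
  by (rule analytic_imp_holomorphic, subst analytic_on_analytic_at) (auto intro: M1_analytic_at)

lemma M1_deriv_quotient:
  assumes f: "f \<in> M1" and u: "u holomorphic_on UNIV"
    and dz: "\<And>z. poly d z = 0 \<Longrightarrow> is_pole f z"
    and fud: "\<And>z. \<not> is_pole f z \<Longrightarrow> f z = u z / poly d z" and z: "\<not> is_pole f z"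
  shows "deriv f z = (deriv u z * poly d z - u z * poly (pderiv d) z) / (poly d z)\<^sup>2"
proof (rule DERIV_imp_deriv)
  have du: "(u has_field_derivative deriv u z) (at z)"
    by (rule holomorphic_derivI[OF u open_UNIV]) simp
  have "((\<lambda>z. u z / poly d z) has_field_derivative (deriv u z * poly d z - u z * poly (pderiv d) z) / (poly d z)\<^sup>2) (at z)"
    unfolding power2_eq_square by (rule DERIV_divide[OF du poly_DERIV]) (use dz z in blast)
  then show "(f has_field_derivative (deriv u z * poly d z - u z * poly (pderiv d) z) / (poly d z)\<^sup>2) (at z)"
    by (rule has_field_derivative_transform_within_open[OF _ open_nonpoles[OF f]]) (use fud z in auto)
qed

text \<open>
  For \<open>f = u / d\<close>, \<open>\<phi> c\<close> is the numerator of \<open>f - c\<close> and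
  \<open>w\<close> that of \<open>f'\<close>.  Stated as a definition so that the same estimates can
  be carried around for \<open>f\<close> and for \<open>g\<close>: a bound \<open>X\<close> for the
  logarithmic derivatives of the entire numerators on a circle yields bounds for those of \<open>f -
  c\<close> and \<open>f'\<close>, and the numerators are not much larger than \<open>f\<close>.
\<close>

definition quotient_circle_bounds where
  "quotient_circle_bounds f \<phi> w T K R0 \<longleftrightarrow> (\<forall>(r::real) (X::real) (z::complex). r \<ge> R0 \<longrightarrow> X \<ge> 1 \<longrightarrow> norm z = r \<longrightarrow>
      (\<forall>c\<in>T. \<phi> c z \<noteq> 0 \<and> norm (deriv (\<phi> c) z / \<phi> c z) \<le> X) \<longrightarrow>
      w z \<noteq> 0 \<longrightarrow> norm (deriv w z / w z) \<le> X \<longrightarrow>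
      \<not> is_pole f z \<and> (\<forall>c\<in>T. f z \<noteq> c \<and> norm (deriv f z) \<le> K * X * norm (f z - c :: complex)) \<and>
      deriv f z \<noteq> 0 \<and> norm (deriv (deriv f) z) \<le> K * X * norm (deriv f z) \<and>
      (\<forall>c\<in>T. log_plus (norm (\<phi> c z :: complex)) \<le> log_plus (norm (f z)) + K * (1 + ln r)) \<and>
      log_plus (norm (w z)) \<le> log_plus (norm (f z)) + K * (1 + ln r) + ln X)"

lemmas quotient_circle_boundsD = quotient_circle_bounds_def[THEN iffD1, rule_format]

lemma quotient_circle_estimates:
  fixes u :: "complex \<Rightarrow> complex" and d :: "complex poly"
  assumes f: "f \<in> M1" and u: "u holomorphic_on UNIV" and d: "d \<noteq> 0"
    and dz: "\<And>z. poly d z = 0 \<Longrightarrow> is_pole f z"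
    and fud: "\<And>z. \<not> is_pole f z \<Longrightarrow> f z = u z / poly d z"
    and T: "finite T" "0 \<in> T"
  defines "\<phi> \<equiv> \<lambda>c z. u z - c * poly d z"
  defines "w \<equiv> \<lambda>z. deriv u z * poly d z - u z * poly (pderiv d) z"
  shows "\<exists>K R0. K \<ge> 1 \<and> R0 \<ge> 1 \<and> quotient_circle_bounds f \<phi> w T K R0"
proof -
  define \<Omega> where "\<Omega> = {z. \<not> is_pole f z}"
  have op: "open \<Omega>" unfolding \<Omega>_def by (rule open_nonpoles[OF f])
  have fin: "finite {z. is_pole f z}" using f by (simp add: M1_def)
  obtain C0 r1 where C0: "C0 \<ge> 0" "r1 \<ge> 1"
    "\<And>z. norm z \<ge> r1 \<Longrightarrow> poly d z \<noteq> 0 \<and> \<bar>ln (norm (poly d z))\<bar> \<le> C0 * (1 + ln (norm z))"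
    by (rule poly_log_bound[OF d]) (rule that; assumption)
  define M where "M = Max (insert 0 (norm ` {z. is_pole f z}))"
  have M: "norm z \<le> M" if "is_pole f z" for z unfolding M_def using that fin by (intro Max_ge) auto
  define D where "D = real (degree d)"
  define L0 where "L0 = (\<Sum>c\<in>T. log_plus (norm c))"
  define K where "K = 1 + 2 * D + L0 + ln 2 + 2 * C0 + ln (1 + 2 * D)"
  define R0 where "R0 = max r1 (M + 1)"
  have D0: "D \<ge> 0" by (simp add: D_def)
  have L0: "L0 \<ge> 0" unfolding L0_def by (rule sum_nonneg) simp
  have lnD: "ln (1 + 2 * D) \<ge> 0" using D0 by simp
  have K1: "K \<ge> 1 + 2 * D" "K \<ge> 1" using D0 L0 lnD C0(1) by (auto simp: K_def intro: add_nonneg_nonneg)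
  have hold: "(\<lambda>z. poly d z) holomorphic_on UNIV" by (intro holomorphic_intros)
  have du: "(u has_field_derivative deriv u z) (at z)" for z
    by (rule holomorphic_derivI[OF u open_UNIV]) simp
  have holw: "w holomorphic_on UNIV" unfolding w_def
    by (intro holomorphic_intros u holomorphic_deriv[OF u open_UNIV])
  have dw: "(w has_field_derivative deriv w z) (at z)" for z
    by (rule holomorphic_derivI[OF holw open_UNIV]) simp
  have d\<phi>: "deriv (\<phi> c) z = deriv u z - c * poly (pderiv d) z" for c z
    unfolding \<phi>_def by (rule DERIV_imp_deriv) (auto intro!: derivative_eq_intros du poly_DERIV)
  have d\<Omega>: "poly d z \<noteq> 0" if "z \<in> \<Omega>" for z using dz that by (auto simp: \<Omega>_def)
  have df: "deriv f z = w z / (poly d z)\<^sup>2" if z: "z \<in> \<Omega>" for z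
    unfolding w_def by (rule M1_deriv_quotient[OF f u dz fud]) (use z in \<open>auto simp: \<Omega>_def\<close>)
  have ddf: "deriv (deriv f) z = (deriv w z * (poly d z)\<^sup>2 - w z * (2 * poly d z * poly (pderiv d) z)) / (poly d z) ^ 4"
    if z: "z \<in> \<Omega>" for z
  proof (rule DERIV_imp_deriv)
    have d2: "((\<lambda>z. (poly d z)\<^sup>2) has_field_derivative 2 * poly d z * poly (pderiv d) z) (at z)"
      by (auto intro!: derivative_eq_intros poly_DERIV)
    have "((\<lambda>z. w z / (poly d z)\<^sup>2) has_field_derivative
       (deriv w z * (poly d z)\<^sup>2 - w z * (2 * poly d z * poly (pderiv d) z)) / ((poly d z)\<^sup>2 * (poly d z)\<^sup>2)) (at z)"
      by (rule DERIV_divide[OF dw d2]) (use d\<Omega>[OF z] in simp)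
    then have "((\<lambda>z. w z / (poly d z)\<^sup>2) has_field_derivative
       (deriv w z * (poly d z)\<^sup>2 - w z * (2 * poly d z * poly (pderiv d) z)) / (poly d z) ^ 4) (at z)"
      by (simp flip: power_add)
    then show "(deriv f has_field_derivative
       (deriv w z * (poly d z)\<^sup>2 - w z * (2 * poly d z * poly (pderiv d) z)) / (poly d z) ^ 4) (at z)"
      by (rule has_field_derivative_transform_within_open[OF _ op z]) (use df in auto)
  qed
  have R01: "R0 \<ge> 1" using C0(2) by (simp add: R0_def)
  have "quotient_circle_bounds f \<phi> w T K R0"
    unfolding quotient_circle_bounds_def
  proof (intro allI impI)
    fix r X :: real and z :: complex
    assume r: "r \<ge> R0" and X: "X \<ge> 1" and z: "norm z = r"
      and T1': "\<forall>c\<in>T. \<phi> c z \<noteq> 0 \<and> norm (deriv (\<phi> c) z / \<phi> c z) \<le> X"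
      and w0: "w z \<noteq> 0" and w1: "norm (deriv w z / w z) \<le> X"
    have T1: "\<phi> c z \<noteq> 0 \<and> norm (deriv (\<phi> c) z / \<phi> c z) \<le> X" if "c \<in> T" for c using T1' that by blast
    have np: "\<not> is_pole f z" using M[of z] r z by (auto simp: R0_def)
    then have z\<Omega>: "z \<in> \<Omega>" by (simp add: \<Omega>_def)
    note d0 = d\<Omega>[OF z\<Omega>]
    have r1: "r \<ge> r1" "r \<ge> 1" using r C0(2) by (auto simp: R0_def)
    have lr: "ln r \<ge> 0" using r1 by simp
    have dd: "norm (poly (pderiv d) z / poly d z) \<le> D"
    proof -
      have "norm (poly (pderiv d) z * 1) \<le> real (degree d) * 1 * norm (poly d z)"
      proof (rule poly_log_deriv_bound[OF d])
        fix c assume "poly d c = 0"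
        then have "norm c \<le> M" using dz M by blast
        moreover have "norm z \<ge> M + 1" using r z by (simp add: R0_def)
        ultimately show "norm (1::complex) \<le> 1 * norm (z - c)" using norm_triangle_ineq2[of z c] by simp
      qed simp
      then show ?thesis using d0 by (simp add: norm_divide D_def field_simps)
    qed
    have XK: "X + 2 * D \<le> (1 + 2 * D) * X"
      using mult_left_mono[OF X, of "2 * D"] D0 by (simp add: algebra_simps)
    have X2: "(1 + 2 * D) * X \<le> K * X" using K1(1) X by (intro mult_right_mono) auto
    have fc: "f z - c = \<phi> c z / poly d z" for c
      using fud[OF np] d0 by (simp add: \<phi>_def field_simps)
    have fcb: "f z \<noteq> c \<and> norm (deriv f z) \<le> (1 + 2 * D) * X * norm (f z - c)" if c: "c \<in> T" for c
    proof -
      have \<phi>0: "\<phi> c z \<noteq> 0" using T1[OF c] by blast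
      then have fne: "f z - c \<noteq> 0" using fc[of c] d0 by simp
      have weq: "w z = deriv (\<phi> c) z * poly d z - \<phi> c z * poly (pderiv d) z"
        unfolding d\<phi> by (simp add: w_def \<phi>_def algebra_simps)
      have "deriv f z = (f z - c) * (deriv (\<phi> c) z / \<phi> c z - poly (pderiv d) z / poly d z)"
        unfolding df[OF z\<Omega>] fc weq using \<phi>0 d0 by (simp add: field_simps power2_eq_square)
      then have "norm (deriv f z) = norm (f z - c) * norm (deriv (\<phi> c) z / \<phi> c z - poly (pderiv d) z / poly d z)"
        by (simp only: norm_mult)
      also have "\<dots> \<le> norm (f z - c) * ((1 + 2 * D) * X)"
      proof (rule mult_left_mono)
        have "norm (deriv (\<phi> c) z / \<phi> c z - poly (pderiv d) z / poly d z) \<le> X + D"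
          using norm_triangle_ineq4 T1[OF c] dd by (meson add_mono order_trans)
        then show "norm (deriv (\<phi> c) z / \<phi> c z - poly (pderiv d) z / poly d z) \<le> (1 + 2 * D) * X"
          using XK D0 by linarith
      qed simp
      finally show ?thesis using fne by (simp add: mult.commute)
    qed
    have df0: "deriv f z \<noteq> 0" using w0 d0 df[OF z\<Omega>] by simp
    have "deriv (deriv f) z = deriv f z * (deriv w z / w z - 2 * (poly (pderiv d) z / poly d z))"
      unfolding ddf[OF z\<Omega>] df[OF z\<Omega>] using w0 d0 by (simp add: field_simps power2_eq_square power_numeral_reduce)
    then have "norm (deriv (deriv f) z) = norm (deriv f z) * norm (deriv w z / w z - 2 * (poly (pderiv d) z / poly d z))"
      by (simp only: norm_mult)
    also have "\<dots> \<le> norm (deriv f z) * (K * X)"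
    proof (rule mult_left_mono)
      have "norm (deriv w z / w z - 2 * (poly (pderiv d) z / poly d z))
          \<le> norm (deriv w z / w z) + norm (2 * (poly (pderiv d) z / poly d z))" by (rule norm_triangle_ineq4)
      also have "norm (2 * (poly (pderiv d) z / poly d z)) = 2 * norm (poly (pderiv d) z / poly d z)"
        by (simp only: norm_mult norm_numeral)
      finally show "norm (deriv w z / w z - 2 * (poly (pderiv d) z / poly d z)) \<le> K * X"
        using w1 dd XK X2 by linarith
    qed simp
    finally have ddfb: "norm (deriv (deriv f) z) \<le> K * X * norm (deriv f z)" by (simp add: mult.commute)
    have logd: "log_plus (norm (poly d z)) \<le> C0 * (1 + ln r)"
      using log_plus_le_abs_ln[of "norm (poly d z)"] C0(3)[of z] r1 z by (auto intro: order_trans)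
    have K2: "(L0 + ln 2 + C0) * (1 + ln r) \<le> K * (1 + ln r)" "(2 * C0 + ln (1 + 2 * D)) * (1 + ln r) \<le> K * (1 + ln r)"
      using lr D0 L0 lnD C0(1) by (auto simp: K_def intro!: mult_right_mono)
    have l\<phi>: "log_plus (norm (\<phi> c z)) \<le> log_plus (norm (f z)) + K * (1 + ln r)" if c: "c \<in> T" for c
    proof -
      have "norm (\<phi> c z) = norm (f z - c) * norm (poly d z)" using fc[of c] d0 by (simp add: norm_divide)
      then have "log_plus (norm (\<phi> c z)) \<le> log_plus (norm (f z - c)) + log_plus (norm (poly d z))"
        using log_plus_mult_le by simp
      also have "log_plus (norm (f z - c)) \<le> log_plus (norm (f z) + norm c)"
        by (rule log_plus_mono) (auto simp: norm_triangle_ineq4)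
      also have "\<dots> \<le> log_plus (norm (f z)) + log_plus (norm c) + ln 2" by (rule log_plus_add_le) auto
      also have "log_plus (norm c) \<le> L0" unfolding L0_def by (rule member_le_sum[OF c _ T(1)]) simp
      finally have "log_plus (norm (\<phi> c z)) \<le> log_plus (norm (f z)) + (L0 + ln 2) + C0 * (1 + ln r)"
        using logd by simp
      also have "L0 + ln 2 \<le> (L0 + ln 2) * (1 + ln r)" using mult_nonneg_nonneg[of "L0 + ln 2" "ln r"] lr L0 by (simp add: algebra_simps)
      finally show ?thesis using K2(1) by (simp add: distrib_right)
    qed
    have lw: "log_plus (norm (w z)) \<le> log_plus (norm (f z)) + K * (1 + ln r) + ln X"
    proof -
      have "norm (w z) = norm (deriv f z) * (norm (poly d z) * norm (poly d z))"
        using df[OF z\<Omega>] d0 by (simp add: norm_divide norm_mult power2_eq_square)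
      also have "\<dots> \<le> ((1 + 2 * D) * X * norm (f z)) * (norm (poly d z) * norm (poly d z))"
        using fcb[OF T(2)] by (intro mult_right_mono) auto
      finally have "log_plus (norm (w z)) \<le> log_plus (((1 + 2 * D) * X * norm (f z)) * (norm (poly d z) * norm (poly d z)))"
        by (rule log_plus_mono[OF norm_ge_zero])
      also have "\<dots> \<le> log_plus ((1 + 2 * D) * X) + log_plus (norm (f z)) + (log_plus (norm (poly d z)) + log_plus (norm (poly d z)))"
        using log_plus_mult_le[of "(1 + 2 * D) * X * norm (f z)" "norm (poly d z) * norm (poly d z)"]
          log_plus_mult_le[of "(1 + 2 * D) * X" "norm (f z)"] log_plus_mult_le[of "norm (poly d z)" "norm (poly d z)"] D0 X
        by (simp add: mult_nonneg_nonneg)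
      also have "log_plus ((1 + 2 * D) * X) = ln (1 + 2 * D) + ln X"
      proof -
        have "1 * 1 \<le> (1 + 2 * D) * X" using D0 X by (intro mult_mono) auto
        then have "log_plus ((1 + 2 * D) * X) = ln ((1 + 2 * D) * X)" by (simp add: log_plus_eq_ln_max max_def)
        also have "\<dots> = ln (1 + 2 * D) + ln X" using D0 X by (intro ln_mult_pos) auto
        finally show ?thesis .
      qed
      also have "ln (1 + 2 * D) \<le> ln (1 + 2 * D) * (1 + ln r)" using mult_nonneg_nonneg[OF lnD lr] by (simp add: algebra_simps)
      finally show ?thesis using K2(2) logd by (simp add: distrib_right)
    qed
    show "\<not> is_pole f z \<and> (\<forall>c\<in>T. f z \<noteq> c \<and> norm (deriv f z) \<le> K * X * norm (f z - c)) \<and>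
      deriv f z \<noteq> 0 \<and> norm (deriv (deriv f) z) \<le> K * X * norm (deriv f z) \<and>
      (\<forall>c\<in>T. log_plus (norm (\<phi> c z)) \<le> log_plus (norm (f z)) + K * (1 + ln r)) \<and>
      log_plus (norm (w z)) \<le> log_plus (norm (f z)) + K * (1 + ln r) + ln X"
    proof (intro conjI ballI)
      fix c assume c: "c \<in> T"
      show "norm (deriv f z) \<le> K * X * norm (f z - c)"
        using fcb[OF c] mult_right_mono[OF X2, of "norm (f z - c)"] by auto
    qed (use np fcb df0 ddfb l\<phi> lw in auto)
  qed
  then show ?thesis using K1(2) R01 by blast
qed

text \<open>
  The term is a combination of three logarithmic derivatives: those of \<open>P'(f)\<close>, of
  \<open>f'\<close> and of \<open>P(f) - 1\<close>.
\<close>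

lemma second_order_term_bound:
  assumes an: "f analytic_on {z}" and PS: "\<And>x. poly P x - 1 = cc * (\<Prod>a\<in>S. x - a)"
    and S: "finite S" "cc \<noteq> 0" and crit: "\<And>x. poly (pderiv P) x = 0 \<longleftrightarrow> x = b1 \<or> x = b2"
    and X: "X \<ge> 1" and n: "degree P \<le> n" "n \<ge> 1"
    and le: "\<And>c. c \<in> S \<union> {b1, b2} \<Longrightarrow> f z \<noteq> c \<and> norm (deriv f z) \<le> X * norm (f z - c)"
    and d0: "deriv f z \<noteq> 0" and d2: "norm (deriv (deriv f) z) \<le> X * norm (deriv f z)"
  shows "norm (second_order_term P f z) \<le> 4 * real n * X"
proof -
  obtain e where e: "e > 0" "f holomorphic_on ball z e" using an by (auto simp: analytic_at_ball)
  have z: "z \<in> ball z e" using e by simp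
  have df: "(f has_field_derivative deriv f z) (at z)" by (rule holomorphic_derivI[OF e(2) open_ball z])
  have ddf: "(deriv f has_field_derivative deriv (deriv f) z) (at z)"
    by (rule holomorphic_derivI[OF holomorphic_deriv[OF e(2) open_ball] open_ball z])
  have "(pderiv_comp P f has_field_derivative
     poly (pderiv (pderiv P)) (f z) * deriv f z * deriv f z + deriv (deriv f) z * poly (pderiv P) (f z)) (at z)"
    unfolding pderiv_comp_def
    by (rule DERIV_mult[OF DERIV_chain2[OF poly_DERIV df] ddf])
  then have dp: "deriv (pderiv_comp P f) z =
     poly (pderiv (pderiv P)) (f z) * deriv f z * deriv f z + deriv (deriv f) z * poly (pderiv P) (f z)"
    by (rule DERIV_imp_deriv)
  have P'0: "poly (pderiv P) (f z) \<noteq> 0" using le[of b1] le[of b2] crit[of "f z"] by auto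
  have F0: "poly P (f z) - 1 \<noteq> 0" using PS[of "f z"] S le by auto
  have pP0: "pderiv P \<noteq> 0" using P'0 by auto
  have P10: "P - 1 \<noteq> 0" using F0 by (metis poly_0 poly_1 poly_diff)
  have A: "norm (poly (pderiv (pderiv P)) (f z) * deriv f z / poly (pderiv P) (f z)) \<le> real n * X"
  proof -
    have "norm (poly (pderiv (pderiv P)) (f z) * deriv f z) \<le> real (degree (pderiv P)) * X * norm (poly (pderiv P) (f z))"
      by (rule poly_log_deriv_bound[OF pP0]) (use X le crit in auto)
    also have "\<dots> \<le> real n * X * norm (poly (pderiv P) (f z))"
      using n X by (intro mult_right_mono) (auto simp: degree_pderiv)
    finally show ?thesis using P'0 by (simp add: norm_divide field_simps)
  qed
  have B: "norm (deriv (deriv f) z / deriv f z) \<le> X"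
    using d0 d2 by (simp add: norm_divide field_simps)
  have C: "norm (pderiv_comp P f z / (poly P (f z) - 1)) \<le> real n * X"
  proof -
    have "norm (poly (pderiv (P - 1)) (f z) * deriv f z) \<le> real (degree (P - 1)) * X * norm (poly (P - 1) (f z))"
    proof (rule poly_log_deriv_bound[OF P10])
      fix c assume "poly (P - 1) c = 0"
      then have "cc * (\<Prod>a\<in>S. c - a) = 0" using PS[of c] by simp
      then have "c \<in> S" using S by auto
      then show "norm (deriv f z) \<le> X * norm (f z - c)" using le by simp
    qed (use X in simp)
    moreover have "pderiv (P - 1) = pderiv P" by (simp add: pderiv_diff)
    moreover have "degree (P - 1) \<le> n" using degree_diff_le_max[of P 1] n by simp
    then have "real (degree (P - 1)) * X * norm (poly (P - 1) (f z)) \<le> real n * X * norm (poly (P - 1) (f z))"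
      using X by (intro mult_right_mono) auto
    ultimately have "norm (pderiv_comp P f z) \<le> real n * X * norm (poly P (f z) - 1)"
      by (simp add: pderiv_comp_def)
    then show ?thesis using F0 by (simp add: norm_divide field_simps)
  qed
  have "second_order_term P f z = poly (pderiv (pderiv P)) (f z) * deriv f z / poly (pderiv P) (f z)
      + deriv (deriv f) z / deriv f z - 2 * (pderiv_comp P f z / (poly P (f z) - 1))"
    unfolding second_order_term_def dp using P'0 d0 by (simp add: pderiv_comp_def field_simps)
  also have "norm \<dots> \<le> norm (poly (pderiv (pderiv P)) (f z) * deriv f z / poly (pderiv P) (f z))
      + norm (deriv (deriv f) z / deriv f z) + norm (2 * (pderiv_comp P f z / (poly P (f z) - 1)))"
    by (meson norm_triangle_ineq norm_triangle_ineq4 add_right_mono order_trans)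
  also have "norm (2 * (pderiv_comp P f z / (poly P (f z) - 1))) = 2 * norm (pderiv_comp P f z / (poly P (f z) - 1))"
    by (simp only: norm_mult norm_numeral)
  finally have "norm (second_order_term P f z) \<le> real n * X + X + 2 * (real n * X)" using A B C by linarith
  moreover have "1 * X \<le> real n * X" using n X by (intro mult_right_mono) auto
  ultimately show ?thesis by linarith
qed

lemma sharing_function_analytic:
  assumes f: "f analytic_on {z}" and g: "g analytic_on {z}"
    and nz: "pderiv_comp P f z \<noteq> 0" "pderiv_comp P g z \<noteq> 0" "poly P (f z) \<noteq> 1" "poly P (g z) \<noteq> 1"
  shows "sharing_function P b1 b2 f g analytic_on {z}"
proof -
  have pc: "(\<lambda>z. poly p (h z)) analytic_on {z}" if "h analytic_on {z}" for h p
    unfolding poly_altdef using that by (intro analytic_intros)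
  have 1: "pderiv_comp P h analytic_on {z}" if "h analytic_on {z}" for h
    unfolding pderiv_comp_def using that by (intro analytic_intros pc)
  have 2: "second_order_term P h analytic_on {z}"
    if "h analytic_on {z}" "pderiv_comp P h z \<noteq> 0" "poly P (h z) \<noteq> 1" for h
    unfolding second_order_term_def using that by (intro analytic_intros pc 1) auto
  have 3: "ramification_factor P b1 b2 h analytic_on {z}" if "h analytic_on {z}" "poly P (h z) \<noteq> 1" for h
    unfolding ramification_factor_def using that by (intro analytic_intros pc) auto
  show ?thesis unfolding sharing_function_def using assms by (intro analytic_intros 2 3) auto
qed

section \<open>Slow growth if the auxiliary function does not vanish\<close>

text \<open>
  On a good circle, \<open>ln \<bar>\<Psi>\<bar>\<close> is at most \<open>O(ln r + ln l)\<close>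
  minus \<open>log_plus \<bar>f\<bar> + log_plus \<bar>g\<bar>\<close>.  By Jensen's inequality its
  mean is bounded below up to \<open>O(ln r)\<close>, so that the proximity functions of
  \<open>f\<close> and \<open>g\<close> on this circle are \<open>O(ln r + ln l)\<close>.  The means
  of all the entire functions involved have the same bound, and since \<open>l\<close> is at most
  linear in them, \<open>l = O(ln r)\<close>.  Finally \<open>l\<^sup>2\<close> bounds
  \<open>log_plus \<bar>f\<bar>\<close> on the smaller circle.
\<close>

lemma slow_growth_of_sharing_function:
  fixes P :: "complex poly" and S :: "complex set"
  assumes fM: "f \<in> M1" and gM: "g \<in> M1"
    and S: "finite S" "card S \<ge> 5" and cc: "cc \<noteq> 0" and PS: "\<And>x. poly P x - 1 = cc * (\<Prod>a\<in>S. x - a)"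
    and deg: "degree P \<le> card S" and crit: "\<And>x. poly (pderiv P) x = 0 \<longleftrightarrow> x = b1 \<or> x = b2"
    and ncf: "\<And>c. \<exists>z. \<not> is_pole f z \<and> f z \<noteq> c" "\<exists>z. \<not> is_pole f z \<and> deriv f z \<noteq> 0"
    and ncg: "\<And>c. \<exists>z. \<not> is_pole g z \<and> g z \<noteq> c" "\<exists>z. \<not> is_pole g z \<and> deriv g z \<noteq> 0"
    and KM: "remove_sings (sharing_function P b1 b2 f g) \<in> M1"
    and Kz: "\<not> is_pole (remove_sings (sharing_function P b1 b2 f g)) z1"
      "remove_sings (sharing_function P b1 b2 f g) z1 \<noteq> 0"
  obtains C r0 where "r0 \<ge> 1" "C \<ge> 0" "\<And>r. r \<ge> r0 \<Longrightarrow> proximity r f \<le> C * (1 + ln r)\<^sup>2"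
proof -
  define \<Psi> where "\<Psi> = sharing_function P b1 b2 f g"
  define n where "n = card S"
  have n: "n \<ge> 5" "real n \<ge> 5" using S by (auto simp: n_def)
  have Sne: "S \<noteq> {}" using S by auto
  obtain u d where ud: "u holomorphic_on UNIV" "d \<noteq> 0" "\<And>z. poly d z = 0 \<Longrightarrow> is_pole f z"
    "\<And>z. \<not> is_pole f z \<Longrightarrow> f z = u z / poly d z"
    by (rule M1_quotient[OF fM]) (rule that; assumption)
  obtain v d' where vd: "v holomorphic_on UNIV" "d' \<noteq> 0" "\<And>z. poly d' z = 0 \<Longrightarrow> is_pole g z"
    "\<And>z. \<not> is_pole g z \<Longrightarrow> g z = v z / poly d' z"
    by (rule M1_quotient[OF gM]) (rule that; assumption)
  obtain q dd where qd: "q holomorphic_on UNIV" "dd \<noteq> 0" "\<And>z. poly dd z = 0 \<Longrightarrow> is_pole (remove_sings \<Psi>) z"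
    "\<And>z. \<not> is_pole (remove_sings \<Psi>) z \<Longrightarrow> remove_sings \<Psi> z = q z / poly dd z"
    by (rule M1_quotient[OF KM[folded \<Psi>_def]]) (rule that; assumption)
  have q0: "q z1 \<noteq> 0" using qd(4)[of z1] Kz by (auto simp: \<Psi>_def)
  \<comment> \<open>The values \<open>c\<close> for which the logarithmic derivative of \<open>f - c\<close> is needed; 0 is included so that the numerator \<open>u\<close> of \<open>f\<close> itself belongs to \<open>\<Phi>\<close>.\<close>
  define T where "T = insert 0 (S \<union> {b1, b2})"
  have T: "finite T" "0 \<in> T" using S by (auto simp: T_def)
  define \<phi>f where "\<phi>f = (\<lambda>c z. u z - c * poly d z)"
  define \<phi>g where "\<phi>g = (\<lambda>c z. v z - c * poly d' z)"
  define wf where "wf = (\<lambda>z. deriv u z * poly d z - u z * poly (pderiv d) z)"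
  define wg where "wg = (\<lambda>z. deriv v z * poly d' z - v z * poly (pderiv d') z)"
  define \<Phi> where "\<Phi> = insert wf (insert wg (\<phi>f ` T \<union> \<phi>g ` T))"
  have fin\<Phi>: "finite \<Phi>" using T by (simp add: \<Phi>_def)
  have hol\<Phi>: "\<phi> holomorphic_on UNIV" if "\<phi> \<in> \<Phi>" for \<phi>
  proof -
    have "\<phi>f c holomorphic_on UNIV" "\<phi>g c holomorphic_on UNIV" for c
      unfolding \<phi>f_def \<phi>g_def by (intro holomorphic_intros ud vd)+
    moreover have "wf holomorphic_on UNIV" "wg holomorphic_on UNIV"
      unfolding wf_def wg_def
      by (intro holomorphic_intros ud vd holomorphic_deriv[OF ud(1) open_UNIV] holomorphic_deriv[OF vd(1) open_UNIV])+
    ultimately show ?thesis using that by (auto simp: \<Phi>_def)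
  qed
  have nz\<Phi>: "\<exists>w. \<phi> w \<noteq> 0" if "\<phi> \<in> \<Phi>" for \<phi>
  proof -
    have "\<exists>w. \<phi>f c w \<noteq> 0" for c
    proof -
      obtain z where z: "\<not> is_pole f z" "f z \<noteq> c" using ncf(1) by blast
      have "poly d z \<noteq> 0" using ud(3) z(1) by blast
      then have "u z - c * poly d z \<noteq> 0" using ud(4)[OF z(1)] z(2) by auto
      then show ?thesis unfolding \<phi>f_def by blast
    qed
    moreover have "\<exists>w. \<phi>g c w \<noteq> 0" for c
    proof -
      obtain z where z: "\<not> is_pole g z" "g z \<noteq> c" using ncg(1) by blast
      have "poly d' z \<noteq> 0" using vd(3) z(1) by blast
      then have "v z - c * poly d' z \<noteq> 0" using vd(4)[OF z(1)] z(2) by auto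
      then show ?thesis unfolding \<phi>g_def by blast
    qed
    moreover have "\<exists>w. wf w \<noteq> 0"
    proof -
      obtain z where z: "\<not> is_pole f z" "deriv f z \<noteq> 0" using ncf(2) by blast
      then show ?thesis using M1_deriv_quotient[OF fM ud(1,3,4) z(1)] by (intro exI[of _ z]) (auto simp: wf_def)
    qed
    moreover have "\<exists>w. wg w \<noteq> 0"
    proof -
      obtain z where z: "\<not> is_pole g z" "deriv g z \<noteq> 0" using ncg(2) by blast
      then show ?thesis using M1_deriv_quotient[OF gM vd(1,3,4) z(1)] by (intro exI[of _ z]) (auto simp: wg_def)
    qed
    ultimately show ?thesis using that by (auto simp: \<Phi>_def)
  qed
  obtain C where C: "C > 0" and circ: "\<And>r0. r0 \<ge> 1 \<Longrightarrow> \<exists>r l. r0 < r \<and> r \<le> 16 * r0 \<and> r \<notin> norm ` {z. q z = 0} \<and> l \<ge> 1 \<and>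
     (\<forall>\<phi>\<in>\<Phi>. \<forall>z. norm z \<le> r0 \<longrightarrow> log_plus (norm (\<phi> z)) \<le> l\<^sup>2) \<and>
     l\<^sup>2 \<le> 1 + 12 * l * (\<Sum>\<phi>\<in>\<Phi>. circle_mean r (\<lambda>z. log_plus (norm (\<phi> z)))) \<and>
     (\<forall>\<phi>\<in>\<Phi>. \<forall>z. norm z = r \<longrightarrow> \<phi> z \<noteq> 0 \<and> norm (deriv \<phi> z / \<phi> z) \<le> C * l ^ 7)"
    by (rule good_circles[OF fin\<Phi> hol\<Phi> nz\<Phi> countable_zero_radii[OF qd(1) q0]]) (assumption | rule that; assumption)+
  obtain Kf Rf where Kf: "Kf \<ge> 1" "Rf \<ge> 1" "quotient_circle_bounds f \<phi>f wf T Kf Rf"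
    using quotient_circle_estimates[OF fM ud T] unfolding \<phi>f_def wf_def by blast
  obtain Kg Rg where Kg: "Kg \<ge> 1" "Rg \<ge> 1" "quotient_circle_bounds g \<phi>g wg T Kg Rg"
    using quotient_circle_estimates[OF gM vd T] unfolding \<phi>g_def wg_def by blast
  obtain Cq rq where Cq: "Cq \<ge> 0" "rq \<ge> 1"
    "\<And>z. norm z \<ge> rq \<Longrightarrow> poly dd z \<noteq> 0 \<and> \<bar>ln (norm (poly dd z))\<bar> \<le> Cq * (1 + ln (norm z))"
    by (rule poly_log_bound[OF qd(2)]) (rule that; assumption)
  obtain Cj where Cj: "\<And>R. R \<ge> 1 \<Longrightarrow> (\<And>\<zeta>. norm \<zeta> = R \<Longrightarrow> q \<zeta> \<noteq> 0) \<Longrightarrow> circle_mean R (\<lambda>\<zeta>. ln (norm (q \<zeta>))) \<ge> Cj"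
    by (rule jensen_lower_bound[OF qd(1) q0]) (rule that, blast)
  obtain Cr where Cr: "Cr > 0" "\<And>x (y :: complex) X. X \<ge> 0 \<Longrightarrow> (\<And>a. a \<in> S \<Longrightarrow> norm y \<le> X * norm (x - a)) \<Longrightarrow>
     norm y ^ 2 * norm (x - b1) * norm (x - b2) * max 1 (norm x) ^ card S
       \<le> Cr * X ^ 2 * norm (cc * (\<Prod>a\<in>S. x - a)) * max 1 (norm x) ^ 4"
    by (rule simple_roots_ratio_bound[OF S(1) Sne cc, of b1 b2]) (rule that, assumption, blast)
  obtain Cu ru where Cu: "Cu \<ge> 0" "ru \<ge> 1" "\<And>z. norm z \<ge> ru \<Longrightarrow> poly d z \<noteq> 0"
    "\<And>z. norm z \<ge> ru \<Longrightarrow> log_plus (norm (u z / poly d z)) \<le> log_plus (norm (u z)) + Cu * (1 + ln (norm z))"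
    "\<And>z. norm z \<ge> ru \<Longrightarrow> log_plus (norm (u z)) \<le> log_plus (norm (u z / poly d z)) + Cu * (1 + ln (norm z))"
    by (rule quotient_log_plus_bound[OF ud(2), of u]) (rule that; assumption)
  obtain pf where pf: "pf \<ge> 1" "\<And>r. r \<ge> pf \<Longrightarrow> continuous_on (sphere 0 r) f"
    "\<And>r z. r \<ge> pf \<Longrightarrow> norm z = r \<Longrightarrow> \<not> is_pole f z"
    by (rule proximity_nonneg_M1[OF fM]) (rule that; assumption)
  obtain pg where pg: "pg \<ge> 1" "\<And>r. r \<ge> pg \<Longrightarrow> continuous_on (sphere 0 r) g"
    by (rule proximity_nonneg_M1[OF gM]) (rule that; assumption)
  define K1 where "K1 = max Kf Kg"
  define C1 where "C1 = max 1 C"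
  define R0 where "R0 = Max {Rf, Rg, rq, ru, pf, pg}"
  have R0: "R0 \<ge> Rf" "R0 \<ge> Rg" "R0 \<ge> rq" "R0 \<ge> ru" "R0 \<ge> pf" "R0 \<ge> pg" "R0 \<ge> 1"
    using Kf(2) by (auto simp: R0_def)
  have K1: "K1 \<ge> 1" "K1 \<ge> Kf" "K1 \<ge> Kg" and C1: "C1 \<ge> 1" "C1 \<ge> C" using Kf(1) by (auto simp: K1_def C1_def)
  define E1 where "E1 = 2 * ln (8 * real n) + 2 * \<bar>ln Cr\<bar>"
  define Q where "Q = ln K1 + ln C1"
  have Q0: "Q \<ge> 0" using K1 C1 by (simp add: Q_def)
  have E10: "E1 \<ge> 0" using n by (simp add: E1_def)
  define E2 where "E2 = E1 + \<bar>Cj\<bar> + 6 * Q + Cq + 42"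
  define E3 where "E3 = E2 + K1 + Q + 7"
  define N where "N = real (card \<Phi>)"
  define E4 where "E4 = 1 + 12 * (N * E3)"
  have E20: "E2 \<ge> 0" using E10 Q0 Cq(1) by (simp add: E2_def)
  have E30: "E3 \<ge> 0" using E20 K1 Q0 by (simp add: E3_def)
  have N0: "N \<ge> 0" by (simp add: N_def)
  have E41: "E4 \<ge> 1" using N0 E30 by (simp add: E4_def)
  define E6 where "E6 = 2 * E4 + 2 * (E4 * ln (2 * E4))"
  have E60: "E6 \<ge> 0" using E41 by (simp add: E6_def)
  define Cfin where "Cfin = (5 * E6)\<^sup>2 + Cu"
  have main: "proximity r0 f \<le> Cfin * (1 + ln r0)\<^sup>2" if r0: "r0 \<ge> R0" for r0
  proof -
    have r01: "r0 \<ge> 1" using r0 R0 by simp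
    obtain r l where r: "r0 < r" "r \<le> 16 * r0" "r \<notin> norm ` {z. q z = 0}" and l: "l \<ge> 1"
      and small: "\<And>\<phi> z. \<phi> \<in> \<Phi> \<Longrightarrow> norm z \<le> r0 \<Longrightarrow> log_plus (norm (\<phi> z)) \<le> l\<^sup>2"
      and key: "l\<^sup>2 \<le> 1 + 12 * l * (\<Sum>\<phi>\<in>\<Phi>. circle_mean r (\<lambda>z. log_plus (norm (\<phi> z))))"
      and ld: "\<And>\<phi> z. \<phi> \<in> \<Phi> \<Longrightarrow> norm z = r \<Longrightarrow> \<phi> z \<noteq> 0 \<and> norm (deriv \<phi> z / \<phi> z) \<le> C * l ^ 7"
      using circ[OF r01] by blast
    have rr: "r \<ge> R0" "r \<ge> 1" using r r0 r01 by auto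
    have lr: "ln r \<ge> 0" using rr by simp
    have ll: "ln l \<ge> 0" using l by simp
    define X where "X = C1 * l ^ 7"
    define Y where "Y = K1 * X"
    have l7: "l ^ 7 \<ge> 1" using l by simp
    have X1: "X \<ge> 1" unfolding X_def using mult_mono[OF C1(1) l7] C1 by simp
    have Y1: "Y \<ge> 1" unfolding Y_def using mult_mono[OF K1(1) X1] K1 by simp
    have lnX: "ln X = ln C1 + 7 * ln l" unfolding X_def using C1 l by (simp add: ln_mult_pos ln_realpow)
    have lnY: "ln Y = Q + 7 * ln l" unfolding Y_def using K1 X1 lnX by (simp add: ln_mult_pos Q_def)
    have ldX: "\<phi> z \<noteq> 0 \<and> norm (deriv \<phi> z / \<phi> z) \<le> X" if "\<phi> \<in> \<Phi>" "norm z = r" for \<phi> z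
    proof -
      have "C * l ^ 7 \<le> X" unfolding X_def using C1 l by (intro mult_right_mono) auto
      then show ?thesis using ld[OF that] by auto
    qed
    have EF: "\<not> is_pole f z \<and> (\<forall>c\<in>T. f z \<noteq> c \<and> norm (deriv f z) \<le> Kf * X * norm (f z - c)) \<and>
      deriv f z \<noteq> 0 \<and> norm (deriv (deriv f) z) \<le> Kf * X * norm (deriv f z) \<and>
      (\<forall>c\<in>T. log_plus (norm (\<phi>f c z)) \<le> log_plus (norm (f z)) + Kf * (1 + ln r)) \<and>
      log_plus (norm (wf z)) \<le> log_plus (norm (f z)) + Kf * (1 + ln r) + ln X" if z: "norm z = r" for z
      by (rule quotient_circle_boundsD[OF Kf(3) order_trans[OF R0(1) rr(1)] X1 z]) (use ldX z in \<open>auto simp: \<Phi>_def\<close>)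
    have EG: "\<not> is_pole g z \<and> (\<forall>c\<in>T. g z \<noteq> c \<and> norm (deriv g z) \<le> Kg * X * norm (g z - c)) \<and>
      deriv g z \<noteq> 0 \<and> norm (deriv (deriv g) z) \<le> Kg * X * norm (deriv g z) \<and>
      (\<forall>c\<in>T. log_plus (norm (\<phi>g c z)) \<le> log_plus (norm (g z)) + Kg * (1 + ln r)) \<and>
      log_plus (norm (wg z)) \<le> log_plus (norm (g z)) + Kg * (1 + ln r) + ln X" if z: "norm z = r" for z
      by (rule quotient_circle_boundsD[OF Kg(3) order_trans[OF R0(2) rr(1)] X1 z]) (use ldX z in \<open>auto simp: \<Phi>_def\<close>)
    have one: "h analytic_on {z} \<and> poly P (h z) \<noteq> 1 \<and> pderiv_comp P h z \<noteq> 0 \<and>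
        norm (second_order_term P h z) \<le> 4 * real n * Y \<and>
        ln (norm (ramification_factor P b1 b2 h z)) \<le> ln Cr + 2 * ln Y - log_plus (norm (h z)) \<and>
        ramification_factor P b1 b2 h z \<noteq> 0"
      if hM: "h \<in> M1" and np: "\<not> is_pole h z" and hT: "\<And>c. c \<in> T \<Longrightarrow> h z \<noteq> c \<and> norm (deriv h z) \<le> k * X * norm (h z - c)"
        and h0: "deriv h z \<noteq> 0" and h2: "norm (deriv (deriv h) z) \<le> k * X * norm (deriv h z)" and k: "k \<le> K1"
      for h z k
    proof -
      have an: "h analytic_on {z}" by (rule M1_analytic_at[OF hM np])
      have kX: "k * X \<le> Y" unfolding Y_def using k X1 by (intro mult_right_mono) auto
      have hT': "h z \<noteq> c \<and> norm (deriv h z) \<le> Y * norm (h z - c)" if "c \<in> T" for c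
        using hT[OF that] order_trans[OF _ mult_right_mono[OF kX norm_ge_zero[of "h z - c"]]] by blast
      have h2': "norm (deriv (deriv h) z) \<le> Y * norm (deriv h z)"
        using h2 mult_right_mono[OF kX, of "norm (deriv h z)"] by auto
      have nS: "h z \<notin> S" "h z \<noteq> b1" "h z \<noteq> b2" using hT' by (auto simp: T_def)
      have P1: "poly P (h z) \<noteq> 1"
      proof
        assume "poly P (h z) = 1"
        then have "(\<Prod>a\<in>S. h z - a) = 0" using PS[of "h z"] cc by simp
        then show False using nS S by auto
      qed
      have pc: "pderiv_comp P h z \<noteq> 0" using crit[of "h z"] nS h0 by (simp add: pderiv_comp_def)
      have L: "norm (second_order_term P h z) \<le> 4 * real n * Y"
        by (rule second_order_term_bound[OF an PS S(1) cc crit Y1, of n]) (use deg n h0 h2' hT' in \<open>auto simp: n_def T_def\<close>)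
      define m where "m = max 1 (norm (h z))"
      have m: "m \<ge> 1" by (simp add: m_def)
      define \<rho> where "\<rho> = ramification_factor P b1 b2 h z"
      have \<rho>0: "\<rho> \<noteq> 0" using nS h0 P1 by (simp add: \<rho>_def ramification_factor_def)
      have "norm (deriv h z) ^ 2 * norm (h z - b1) * norm (h z - b2) * max 1 (norm (h z)) ^ card S
       \<le> Cr * Y ^ 2 * norm (cc * (\<Prod>a\<in>S. h z - a)) * max 1 (norm (h z)) ^ 4"
        by (rule Cr(2)) (use Y1 hT' in \<open>auto simp: T_def\<close>)
      then have "norm (\<rho> * (poly P (h z) - 1)) * m ^ n \<le> Cr * Y ^ 2 * norm (poly P (h z) - 1) * m ^ 4"
        using P1 by (simp add: PS[symmetric] m_def n_def \<rho>_def ramification_factor_def norm_mult norm_power)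
      then have "(norm \<rho> * m ^ n) * norm (poly P (h z) - 1) \<le> (Cr * Y ^ 2 * m ^ 4) * norm (poly P (h z) - 1)"
        by (simp add: norm_mult mult_ac)
      then have "norm \<rho> * m ^ n \<le> Cr * Y ^ 2 * m ^ 4" using P1 by simp
      then have "ln (norm \<rho> * m ^ n) \<le> ln (Cr * Y ^ 2 * m ^ 4)" using \<rho>0 m by (intro ln_mono) auto
      then have "ln (norm \<rho>) + real n * ln m \<le> ln Cr + 2 * ln Y + 4 * ln m"
        using \<rho>0 m Cr(1) Y1 by (simp add: ln_mult_pos ln_realpow)
      moreover have "5 * ln m \<le> real n * ln m" using n m by (intro mult_right_mono) auto
      moreover have "ln m = log_plus (norm (h z))" by (simp add: m_def log_plus_eq_ln_max)
      ultimately have "ln (norm \<rho>) \<le> ln Cr + 2 * ln Y - log_plus (norm (h z))" by linarith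
      then show ?thesis using an P1 pc L \<rho>0 by (simp add: \<rho>_def)
    qed
    have q0r: "q z \<noteq> 0" if "norm z = r" for z using r(3) that by auto
    have pw: "ln (norm (q z)) \<le> E1 + 6 * ln Y + Cq * (1 + ln r) - (log_plus (norm (f z)) + log_plus (norm (g z)))"
      if z: "norm z = r" for z
    proof -
      have F: "f analytic_on {z} \<and> poly P (f z) \<noteq> 1 \<and> pderiv_comp P f z \<noteq> 0 \<and>
        norm (second_order_term P f z) \<le> 4 * real n * Y \<and>
        ln (norm (ramification_factor P b1 b2 f z)) \<le> ln Cr + 2 * ln Y - log_plus (norm (f z)) \<and>
        ramification_factor P b1 b2 f z \<noteq> 0"
        by (rule one[OF fM, of z Kf]) (use EF[OF z] K1 in auto)
      have G: "g analytic_on {z} \<and> poly P (g z) \<noteq> 1 \<and> pderiv_comp P g z \<noteq> 0 \<and>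
        norm (second_order_term P g z) \<le> 4 * real n * Y \<and>
        ln (norm (ramification_factor P b1 b2 g z)) \<le> ln Cr + 2 * ln Y - log_plus (norm (g z)) \<and>
        ramification_factor P b1 b2 g z \<noteq> 0"
        by (rule one[OF gM, of z Kg]) (use EG[OF z] K1 in auto)
      have an: "\<Psi> analytic_on {z}" unfolding \<Psi>_def
        by (rule sharing_function_analytic) (use F G in auto)
      have np: "\<not> is_pole (remove_sings \<Psi>) z"
        using an analytic_at_imp_no_pole[of "remove_sings \<Psi>"] remove_sings_analytic_at[of \<Psi> z]
        by (meson analytic_at_imp_no_pole isolated_singularity_at_analytic is_pole_remove_sings_iff)
      have dd0: "poly dd z \<noteq> 0" using Cq(3)[of z] z rr R0 by simp
      have eq: "\<Psi> z = q z / poly dd z" using qd(4)[OF np] remove_sings_at_analytic[OF an] by simp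
      define H where "H = second_order_term P f z - second_order_term P g z"
      have \<Psi>eq: "\<Psi> z = H\<^sup>2 * ramification_factor P b1 b2 f z * ramification_factor P b1 b2 g z"
        by (simp add: \<Psi>_def sharing_function_def H_def)
      have H0: "H \<noteq> 0" using eq q0r[OF z] dd0 by (auto simp: \<Psi>eq)
      have "norm H \<le> norm (second_order_term P f z) + norm (second_order_term P g z)"
        unfolding H_def by (rule norm_triangle_ineq4)
      also have "\<dots> \<le> 8 * real n * Y" using F G by linarith
      finally have "ln (norm H) \<le> ln (8 * real n * Y)" using H0 by (intro ln_mono) auto
      also have "\<dots> = ln (8 * real n) + ln Y" using n Y1 by (intro ln_mult_pos) auto
      finally have Hb: "ln (norm H) \<le> ln (8 * real n) + ln Y" .
      have "norm (q z) = norm (\<Psi> z) * norm (poly dd z)" using eq dd0 by (simp add: norm_divide)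
      then have "ln (norm (q z)) = 2 * ln (norm H) + ln (norm (ramification_factor P b1 b2 f z))
          + ln (norm (ramification_factor P b1 b2 g z)) + ln (norm (poly dd z))"
        unfolding \<Psi>eq using H0 F G dd0 by (simp add: norm_mult norm_power ln_mult_pos ln_realpow)
      moreover have "\<bar>ln (norm (poly dd z))\<bar> \<le> Cq * (1 + ln r)"
        using Cq(3)[of z, THEN conjunct2] z rr R0 by simp
      then have "ln (norm (poly dd z)) \<le> Cq * (1 + ln r)" by linarith
      moreover have "ln Cr \<le> \<bar>ln Cr\<bar>" by simp
      ultimately show ?thesis using Hb F G unfolding E1_def by linarith
    qed
    have contf: "continuous_on (sphere 0 r) f" "continuous_on (sphere 0 r) g"
      using pf(2) pg(2) rr R0 by auto
    have contq: "continuous_on (sphere 0 r) (\<lambda>z. ln (norm (q z)))"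
      by (intro continuous_intros continuous_on_subset[OF holomorphic_on_imp_continuous_on[OF qd(1)]]) (use q0r in auto)
    define mf where "mf = circle_mean r (\<lambda>z. log_plus (norm (f z)))"
    define mg where "mg = circle_mean r (\<lambda>z. log_plus (norm (g z)))"
    have r00: "r \<ge> 0" using rr by simp
    have mf0: "mf \<ge> 0" "mg \<ge> 0" unfolding mf_def mg_def
      by (intro circle_mean_nonneg continuous_intros contf r00; simp)+
    have "Cj \<le> circle_mean r (\<lambda>z. ln (norm (q z)))" by (rule Cj[OF rr(2) q0r])
    also have "\<dots> \<le> circle_mean r (\<lambda>z. (E1 + 6 * ln Y + Cq * (1 + ln r)) + (-1) * (log_plus (norm (f z)) + log_plus (norm (g z))))"
    proof (rule circle_mean_mono[OF contq _ r00])
      show "continuous_on (sphere 0 r) (\<lambda>z. (E1 + 6 * ln Y + Cq * (1 + ln r)) + (-1) * (log_plus (norm (f z)) + log_plus (norm (g z))))"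
        by (intro continuous_intros contf)
      fix z :: complex assume "norm z = r"
      from pw[OF this] show "ln (norm (q z)) \<le> (E1 + 6 * ln Y + Cq * (1 + ln r)) + (-1) * (log_plus (norm (f z)) + log_plus (norm (g z)))"
        by (simp add: algebra_simps)
    qed
    also have "\<dots> = (E1 + 6 * ln Y + Cq * (1 + ln r)) - (mf + mg)"
    proof -
      have "circle_mean r (\<lambda>z. (E1 + 6 * ln Y + Cq * (1 + ln r)) + (-1) * (log_plus (norm (f z)) + log_plus (norm (g z))))
        = circle_mean r (\<lambda>z. E1 + 6 * ln Y + Cq * (1 + ln r)) + circle_mean r (\<lambda>z. (-1) * (log_plus (norm (f z)) + log_plus (norm (g z))))"
        by (rule circle_mean_add) (use r00 in \<open>auto intro!: continuous_intros contf\<close>)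
      also have "circle_mean r (\<lambda>z. (-1) * (log_plus (norm (f z)) + log_plus (norm (g z)))) = (-1) * circle_mean r (\<lambda>z. log_plus (norm (f z)) + log_plus (norm (g z)))"
        by (rule circle_mean_cmult)
      also have "circle_mean r (\<lambda>z. log_plus (norm (f z)) + log_plus (norm (g z))) = mf + mg"
        unfolding mf_def mg_def by (rule circle_mean_add) (use r00 in \<open>auto intro!: continuous_intros contf\<close>)
      finally show ?thesis by simp
    qed
    finally have mm: "mf + mg \<le> E1 - Cj + 6 * ln Y + Cq * (1 + ln r)" by simp
    define Z where "Z = 1 + ln r + ln l"
    have Z1: "Z \<ge> 1" "1 + ln r \<le> Z" "ln l \<le> Z" using lr ll by (auto simp: Z_def)
    have "E1 - Cj + 6 * ln Y + Cq * (1 + ln r) \<le> (E1 + \<bar>Cj\<bar> + 6 * Q) * Z + 42 * Z + Cq * Z"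
    proof -
      define W where "W = (E1 + \<bar>Cj\<bar> + 6 * Q) * Z"
      have w: "(E1 + \<bar>Cj\<bar> + 6 * Q) * 1 \<le> W" unfolding W_def
        using E10 Q0 Z1 by (intro mult_left_mono) auto
      have v: "Cq * (1 + ln r) \<le> Cq * Z" using Cq(1) Z1 by (intro mult_left_mono) auto
      have "E1 - Cj + 6 * ln Y + Cq * (1 + ln r) = (E1 + (- Cj) + 6 * Q) * 1 + 42 * ln l + Cq * (1 + ln r)"
        unfolding lnY by simp
      also have "\<dots> \<le> (E1 + \<bar>Cj\<bar> + 6 * Q) * 1 + 42 * Z + Cq * Z"
        using v Z1(3) by (intro add_mono) auto
      also have "\<dots> \<le> W + 42 * Z + Cq * Z" using w by (intro add_right_mono)
      finally show ?thesis unfolding W_def .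
    qed
    also have "\<dots> = E2 * Z" by (simp add: E2_def algebra_simps)
    finally have mm2: "mf + mg \<le> E2 * Z" using mm by linarith
    have extra: "K1 * (1 + ln r) + ln X \<le> (K1 + Q + 7) * Z"
    proof -
      have "K1 * (1 + ln r) \<le> K1 * Z" using K1 Z1 by (intro mult_left_mono) auto
      moreover have "Q * 1 \<le> Q * Z" using Q0 Z1 by (intro mult_left_mono) auto
      moreover have "ln C1 \<le> Q" using K1 by (simp add: Q_def)
      ultimately show ?thesis unfolding lnX using Z1 by (simp add: distrib_right)
    qed
    have mean_le: "circle_mean r (\<lambda>z. log_plus (norm (\<phi> z))) \<le> E3 * Z" if \<phi>: "\<phi> \<in> \<Phi>" for \<phi>
    proof -
      have KK: "k * (1 + ln r) \<le> K1 * (1 + ln r)" if "k \<le> K1" for k using that lr by (intro mult_right_mono) auto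
      have lX: "ln X \<ge> 0" using X1 by simp
      have pt: "log_plus (norm (\<phi> z)) \<le> (log_plus (norm (f z)) + log_plus (norm (g z))) + (K1 * (1 + ln r) + ln X)" if z: "norm z = r" for z
      proof -
        have nn: "0 \<le> log_plus (norm (f z))" "0 \<le> log_plus (norm (g z))" by simp_all
        consider "\<phi> = wf" | "\<phi> = wg" | c where "c \<in> T" "\<phi> = \<phi>f c" | c where "c \<in> T" "\<phi> = \<phi>g c"
          using \<phi> by (auto simp: \<Phi>_def)
        then show ?thesis
        proof cases
          case 1
          have "log_plus (norm (wf z)) \<le> log_plus (norm (f z)) + Kf * (1 + ln r) + ln X" using EF[OF z] by blast
          then show ?thesis unfolding 1 using nn KK[OF K1(2)] by linarith
        next
          case 2
          have "log_plus (norm (wg z)) \<le> log_plus (norm (g z)) + Kg * (1 + ln r) + ln X" using EG[OF z] by blast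
          then show ?thesis unfolding 2 using nn KK[OF K1(3)] by linarith
        next
          case (3 c)
          have "log_plus (norm (\<phi>f c z)) \<le> log_plus (norm (f z)) + Kf * (1 + ln r)" using EF[OF z] 3 by blast
          then show ?thesis unfolding 3(2) using nn KK[OF K1(2)] lX by linarith
        next
          case (4 c)
          have "log_plus (norm (\<phi>g c z)) \<le> log_plus (norm (g z)) + Kg * (1 + ln r)" using EG[OF z] 4 by blast
          then show ?thesis unfolding 4(2) using nn KK[OF K1(3)] lX by linarith
        qed
      qed
      have cont\<phi>: "continuous_on (sphere 0 r) \<phi>"
        by (rule continuous_on_subset[OF holomorphic_on_imp_continuous_on[OF hol\<Phi>[OF \<phi>]]]) auto
      have "circle_mean r (\<lambda>z. log_plus (norm (\<phi> z))) \<le>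
          circle_mean r (\<lambda>z. (log_plus (norm (f z)) + log_plus (norm (g z))) + (K1 * (1 + ln r) + ln X))"
        by (rule circle_mean_mono) (use pt r00 in \<open>auto intro!: continuous_intros contf cont\<phi>\<close>)
      also have "\<dots> = circle_mean r (\<lambda>z. log_plus (norm (f z)) + log_plus (norm (g z))) + circle_mean r (\<lambda>z. K1 * (1 + ln r) + ln X)"
        by (rule circle_mean_add) (use r00 in \<open>auto intro!: continuous_intros contf\<close>)
      also have "circle_mean r (\<lambda>z. log_plus (norm (f z)) + log_plus (norm (g z))) = mf + mg"
        unfolding mf_def mg_def by (rule circle_mean_add) (use r00 in \<open>auto intro!: continuous_intros contf\<close>)
      also have "mf + mg + circle_mean r (\<lambda>z. K1 * (1 + ln r) + ln X) \<le> E2 * Z + (K1 + Q + 7) * Z"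
        using mm2 extra by simp
      also have "\<dots> = E3 * Z" by (simp add: E3_def algebra_simps)
      finally show ?thesis .
    qed
    have "(\<Sum>\<phi>\<in>\<Phi>. circle_mean r (\<lambda>z. log_plus (norm (\<phi> z)))) \<le> (\<Sum>\<phi>\<in>\<Phi>. E3 * Z)"
      by (rule sum_mono) (rule mean_le)
    also have "\<dots> = N * E3 * Z" by (simp add: N_def)
    finally have "12 * l * (\<Sum>\<phi>\<in>\<Phi>. circle_mean r (\<lambda>z. log_plus (norm (\<phi> z)))) \<le> 12 * l * (N * E3 * Z)"
      using l by (intro mult_left_mono) auto
    then have "l\<^sup>2 \<le> 1 + 12 * l * (N * E3 * Z)" using key by linarith
    also have "1 \<le> l * Z" using mult_mono[of 1 l 1 Z] l Z1 by simp
    also have "l * Z + 12 * l * (N * E3 * Z) = l * (E4 * Z)" by (simp add: E4_def algebra_simps)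
    finally have "l * l \<le> l * (E4 * Z)" by (simp add: power2_eq_square)
    then have lE: "l \<le> E4 * Z" using l by simp
    \<comment> \<open>The term with \<open>ln l\<close> is absorbed into the left-hand side of \<open>l \<le> E4 (1 + ln r + ln l)\<close>.\<close>
    have "E4 * ln l \<le> l / 2 + E4 * ln (2 * E4)"
    proof -
      have "ln (l / (2 * E4)) \<le> l / (2 * E4)" using ln_le_minus_one[of "l / (2 * E4)"] l E41 by simp
      then have "ln l \<le> l / (2 * E4) + ln (2 * E4)" using l E41 by (simp add: ln_div)
      then have "E4 * ln l \<le> E4 * (l / (2 * E4) + ln (2 * E4))" using E41 by (intro mult_left_mono) auto
      then show ?thesis using E41 by (simp add: distrib_left)
    qed
    then have "l \<le> 2 * E4 * (1 + ln r) + 2 * (E4 * ln (2 * E4))"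
      using lE unfolding Z_def by (simp add: algebra_simps)
    also have "2 * (E4 * ln (2 * E4)) \<le> 2 * (E4 * ln (2 * E4)) * (1 + ln r)"
    proof -
      have "0 \<le> 2 * (E4 * ln (2 * E4)) * ln r" using E41 lr by (intro mult_nonneg_nonneg) auto
      then show ?thesis unfolding distrib_left mult_1_right by linarith
    qed
    also have "2 * E4 * (1 + ln r) + 2 * (E4 * ln (2 * E4)) * (1 + ln r) = E6 * (1 + ln r)"
      by (simp add: E6_def distrib_right)
    also have "\<dots> \<le> E6 * (5 * (1 + ln r0))"
    proof (rule mult_left_mono[OF _ E60])
      have "ln r \<le> ln (16 * r0)" using r rr by (intro ln_mono) auto
      also have "\<dots> = ln 16 + ln r0" using r01 by (simp add: ln_mult_pos)
      also have "ln (16::real) \<le> 4"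
        using ln_realpow[of "2::real" 4] ln_2_less_1 by simp
      finally have "ln r \<le> 4 + ln r0" by simp
      moreover have "ln r0 \<ge> 0" using r01 by simp
      ultimately show "1 + ln r \<le> 5 * (1 + ln r0)" by simp
    qed
    finally have "l \<le> E6 * (5 * (1 + ln r0))" by simp
    then have lfin: "l \<le> 5 * E6 * (1 + ln r0)" by (simp only: mult_ac)
    have l2: "l\<^sup>2 \<le> (5 * E6)\<^sup>2 * (1 + ln r0)\<^sup>2"
      using power_mono[OF lfin, of 2] l by (simp add: power_mult_distrib)
    have u\<Phi>: "\<phi>f 0 \<in> \<Phi>" using T by (auto simp: \<Phi>_def)
    have contf0: "continuous_on (sphere 0 r0) f" using pf(2) r0 R0 by auto
    have "proximity r0 f \<le> circle_mean r0 (\<lambda>z. l\<^sup>2 + Cu * (1 + ln r0))"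
      unfolding proximity_eq_circle_mean
    proof (rule circle_mean_mono)
      fix z :: complex assume z: "norm z = r0"
      have "\<not> is_pole f z" using pf(3)[of r0 z] z r0 R0 by simp
      then have "log_plus (norm (f z)) \<le> log_plus (norm (u z)) + Cu * (1 + ln r0)"
        using ud(4)[of z] Cu(4)[of z] z r0 R0 by simp
      moreover have "log_plus (norm (\<phi>f 0 z)) \<le> l\<^sup>2" by (rule small[OF u\<Phi>]) (use z in simp)
      ultimately show "log_plus (norm (f z)) \<le> l\<^sup>2 + Cu * (1 + ln r0)" by (simp add: \<phi>f_def)
    qed (use r01 in \<open>auto intro!: continuous_intros contf0\<close>)
    also have "\<dots> = l\<^sup>2 + Cu * (1 + ln r0)" by simp
    also have "1 + ln r0 \<le> (1 + ln r0)\<^sup>2" using r01 by (intro self_le_power) auto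
    finally have "proximity r0 f \<le> l\<^sup>2 + Cu * (1 + ln r0)\<^sup>2" using Cu(1) by (simp add: mult_left_mono)
    then show ?thesis using l2 by (simp add: Cfin_def distrib_right)
  qed
  have "Cfin \<ge> 0" using Cu(1) by (simp add: Cfin_def)
  then show ?thesis using that[of R0 Cfin] main R0 by blast
qed

section \<open>Zero-free functions and non-integer order\<close>

text \<open>
  Write \<open>e = exp h\<close> and let \<open>k\<close> be the integer part of the order
  \<open>\<rho>\<close> of \<open>f\<close>.  The first estimate bounds \<open>Re h\<close>, hence
  \<open>h\<close>, by a power with exponent below \<open>k + 1\<close>, so \<open>h\<close> is a
  polynomial of degree at most \<open>k\<close>; the second estimate then bounds the growth of
  \<open>f\<close> by a power with exponent below \<open>\<rho>\<close>.
\<close>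

lemma zero_free_comparable_contradiction:
  assumes f: "f \<in> M1" and ord: "nonint_finite_order f"
    and e: "e holomorphic_on UNIV" "\<And>z. e z \<noteq> 0" and B: "countable B"
    and le1: "\<And>r. r \<ge> r0 \<Longrightarrow> r \<notin> B \<Longrightarrow> circle_mean r (\<lambda>z. log_plus (norm (e z))) \<le> C * (1 + ln r + proximity r f)"
    and le2: "\<And>r. r \<ge> r0 \<Longrightarrow> r \<notin> B \<Longrightarrow> proximity r f \<le> C * (1 + ln r + circle_mean r (\<lambda>z. log_plus (norm (e z))))"
    and C: "C \<ge> 0"
  shows False
proof -
  have fin: "finite {z. is_pole f z}" using f by (simp add: M1_def)
  obtain \<rho> where \<rho>: "growth_order f = ereal \<rho>" "\<rho> \<notin> \<int>" using ord by (auto simp: nonint_finite_order_def)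
  have \<rho>0: "\<rho> \<ge> 0" by (rule growth_order_nonneg[OF f \<rho>(1)])
  define k where "k = nat \<lfloor>\<rho>\<rfloor>"
  have fl: "real k = of_int \<lfloor>\<rho>\<rfloor>" using \<rho>0 by (simp add: k_def)
  have "\<rho> \<noteq> of_int \<lfloor>\<rho>\<rfloor>" using \<rho>(2) by (metis Ints_of_int)
  then have k: "real k < \<rho>" "\<rho> < real k + 1" unfolding fl by linarith+
  \<comment> \<open>An exponent strictly between the order and the next integer.\<close>
  define \<tau> where "\<tau> = (\<rho> + (real k + 1)) / 2"
  have \<tau>: "\<rho> < \<tau>" "\<tau> < real k + 1" "\<tau> > 0" using k by (auto simp: \<tau>_def)
  have \<tau>\<rho>: "0 < \<tau> - \<rho>" using \<tau> by simp
  obtain r1 where r1: "r1 \<ge> 1" "\<And>r. r \<ge> r1 \<Longrightarrow> nevanlinna_char r f \<le> r powr (\<rho> + (\<tau> - \<rho>))"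
    by (rule nevanlinna_char_le_powr[OF \<rho>(1) \<tau>\<rho>]) (rule that; assumption)
  have prox: "proximity r f \<le> r powr \<tau>" if "r \<ge> r1" for r
    using r1(2)[OF that] integrated_pole_count_nonneg[OF fin, of r] r1(1) that by (simp add: nevanlinna_char_def)
  define r2 where "r2 = max r0 r1"
  have r2: "r2 \<ge> r0" "r2 \<ge> r1" "r2 \<ge> 1" using r1 by (auto simp: r2_def)
  have "0 \<in> (UNIV :: complex set)" by simp
  then obtain h where h: "h holomorphic_on UNIV" "\<And>x. exp (h x) = e x"
    using holomorphic_logarithm_exists[OF convex_UNIV open_UNIV e(1) e(2)] by (metis UNIV_I)
  have Reh: "Re (h z) = ln (norm (e z))" for z
    using norm_exp_eq_Re[of "h z"] h(2)[of z] by (metis ln_exp)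
  define C2 where "C2 = 3 * (C * (2 + 1 / \<tau>)) * 3 powr \<tau>"
  have C20: "C2 \<ge> 0" using C \<tau> by (simp add: C2_def)
  have Rele: "Re (h z) \<le> C2 * r powr \<tau>" if z: "norm z \<le> r" and r: "r \<ge> r2" for z r
  proof -
    have rp: "r \<ge> 1" using r r2 by simp
    then have lt: "2 * r < 3 * r" by simp
    obtain R where R: "2 * r < R" "R < 3 * r" "R \<notin> B"
      by (rule generic_radius[OF B lt]) (rule that; assumption)
    have R1: "R \<ge> r0" "R \<ge> r1" "R \<ge> 1" using R r r2 rp by auto
    have p1: "1 \<le> R powr \<tau>" using R1 \<tau> by (simp add: ge_one_powr_ge_zero)
    have "Re (h z) \<le> log_plus (norm (e z))" unfolding Reh by (rule ln_le_log_plus)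
    also have "\<dots> \<le> (R + r) / (R - r) * circle_mean R (\<lambda>\<zeta>. log_plus (norm (e \<zeta>)))"
      by (rule harnack_max_bound[OF e(1) z]) (use R rp e(2) in auto)
    also have "\<dots> \<le> 3 * circle_mean R (\<lambda>\<zeta>. log_plus (norm (e \<zeta>)))"
    proof (rule mult_right_mono)
      show "(R + r) / (R - r) \<le> 3" using R rp by (simp add: field_simps)
      show "0 \<le> circle_mean R (\<lambda>\<zeta>. log_plus (norm (e \<zeta>)))"
        by (rule circle_mean_nonneg)
           (use R1 in \<open>auto intro!: continuous_intros continuous_on_subset[OF holomorphic_on_imp_continuous_on[OF e(1)]]\<close>)
    qed
    also have "\<dots> \<le> 3 * (C * (1 + ln R + proximity R f))" using le1[OF R1(1) R(3)] by simp
    also have "\<dots> \<le> 3 * (C * ((2 + 1 / \<tau>) * R powr \<tau>))"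
    proof -
      have "1 + ln R + proximity R f \<le> (2 + 1 / \<tau>) * R powr \<tau>"
        using p1 ln_le_powr[OF \<tau>(3) R1(3)] prox[OF R1(2)] by (simp add: distrib_right)
      then show ?thesis using C by (intro mult_left_mono) auto
    qed
    also have "\<dots> \<le> 3 * (C * ((2 + 1 / \<tau>) * (3 * r) powr \<tau>))"
      using C \<tau> R rp by (intro mult_left_mono powr_mono2) auto
    also have "\<dots> = C2 * r powr \<tau>" using rp by (simp add: C2_def powr_mult)
    finally show ?thesis .
  qed
  define C3 where "C3 = 8 * (C2 * 2 powr \<tau> + \<bar>Re (h 0)\<bar> + 1) + norm (h 0)"
  have C30: "C3 \<ge> 0" using C20 by (simp add: C3_def)
  have hle: "norm (h z) \<le> C3 * r powr \<tau>" if z: "norm z \<le> r" and r: "r \<ge> r2" for z r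
  proof -
    have rp: "r \<ge> 1" using r r2 by simp
    have p1: "1 \<le> r powr \<tau>" using rp \<tau> by (simp add: ge_one_powr_ge_zero)
    define A where "A = C2 * (2 * r) powr \<tau> + \<bar>Re (h 0)\<bar> + 1"
    have A: "A > 0" using C20 by (simp add: A_def add_nonneg_pos)
    have "norm (h z - h 0) \<le> 4 * A * (2 * r) / (2 * r - norm z)"
    proof (rule borel_caratheodory[OF _ A])
      show "h holomorphic_on ball 0 (2 * r)" by (rule holomorphic_on_subset[OF h(1)]) auto
      show "Re (h y) \<le> Re (h 0) + A" if "norm y < 2 * r" for y
        using Rele[of y "2 * r"] that r rp unfolding A_def by simp
      show "norm z < 2 * r" using z rp by simp
    qed
    also have "\<dots> \<le> 4 * A * (2 * r) / r"
      using z rp A by (intro divide_left_mono) auto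
    also have "\<dots> = 8 * A" using rp by simp
    finally have "norm (h z) \<le> 8 * A + norm (h 0)" using norm_triangle_sub[of "h z" "h 0"] by linarith
    also have "A = C2 * 2 powr \<tau> * r powr \<tau> + (\<bar>Re (h 0)\<bar> + 1)" using rp by (simp add: A_def powr_mult)
    also have "8 * (C2 * 2 powr \<tau> * r powr \<tau> + (\<bar>Re (h 0)\<bar> + 1)) + norm (h 0)
        \<le> 8 * (C2 * 2 powr \<tau> * r powr \<tau> + (\<bar>Re (h 0)\<bar> + 1) * r powr \<tau>) + norm (h 0) * r powr \<tau>"
      using mult_left_mono[OF p1, of "\<bar>Re (h 0)\<bar> + 1"] mult_left_mono[OF p1, of "norm (h 0)"] by simp
    also have "\<dots> = C3 * r powr \<tau>" by (simp add: C3_def algebra_simps)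
    finally show ?thesis .
  qed
  have coef: "(deriv ^^ (Suc k)) h 0 = 0"
  proof -
    define a where "a = norm ((deriv ^^ (Suc k)) h 0)"
    have bd: "a \<le> fact (Suc k) * C3 * r powr (\<tau> - real (Suc k))" if r: "r \<ge> r2" for r
    proof -
      have rp: "r > 0" using r r2 by simp
      have "a \<le> fact (Suc k) * (C3 * r powr \<tau>) / r ^ Suc k" unfolding a_def
        by (rule Cauchy_inequality)
           (use hle r rp in \<open>auto intro: holomorphic_on_subset[OF h(1)] continuous_on_subset[OF holomorphic_on_imp_continuous_on[OF h(1)]]\<close>)
      also have "\<dots> = fact (Suc k) * C3 * (r powr \<tau> / r powr real (Suc k))"
        using rp by (simp only: powr_realpow) simp
      also have "r powr \<tau> / r powr real (Suc k) = r powr (\<tau> - real (Suc k))" by (simp only: powr_diff)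
      finally show ?thesis .
    qed
    have neg: "\<tau> - real (Suc k) < 0" using \<tau> by simp
    have "((\<lambda>r::real. fact (Suc k) * C3 * r powr (\<tau> - real (Suc k))) \<longlongrightarrow> fact (Suc k) * C3 * 0) at_top"
      by (intro tendsto_intros tendsto_neg_powr[OF neg] filterlim_ident)
    then have "a \<le> fact (Suc k) * C3 * 0"
    proof (rule tendsto_lowerbound)
      show "\<forall>\<^sub>F r in at_top. a \<le> fact (Suc k) * C3 * r powr (\<tau> - real (Suc k))"
        using eventually_ge_at_top[of r2] by eventually_elim (rule bd)
    qed simp
    then show ?thesis by (simp add: a_def)
  qed
  have poly: "h \<xi> = (\<Sum>j\<le>Suc k. (deriv ^^ j) h 0 / fact j * \<xi> ^ j)" for \<xi>
  proof (rule Liouville_polynomial[OF h(1), of r2 C3])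
    fix z :: complex assume z: "r2 \<le> norm z"
    have n1: "norm z \<ge> 1" "norm z > 0" using z r2 by linarith+
    have "norm (h z) \<le> C3 * norm z powr \<tau>" by (rule hle[OF order_refl z])
    also have "\<dots> \<le> C3 * norm z powr real (Suc k)"
      using C30 n1 \<tau> by (intro mult_left_mono powr_mono) auto
    also have "\<dots> = C3 * norm z ^ Suc k" using n1 by (simp only: powr_realpow)
    finally show "norm (h z) \<le> C3 * norm z ^ Suc k" .
  qed
  define C4 where "C4 = (\<Sum>j\<le>k. norm ((deriv ^^ j) h 0 / fact j))"
  have C40: "C4 \<ge> 0" unfolding C4_def by (rule sum_nonneg) simp
  have hpoly: "norm (h z) \<le> C4 * norm z ^ k" if z: "norm z \<ge> 1" for z
  proof -
    have "h z = (\<Sum>j\<le>k. (deriv ^^ j) h 0 / fact j * z ^ j)" using poly[of z] coef by simp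
    then have "norm (h z) \<le> (\<Sum>j\<le>k. norm ((deriv ^^ j) h 0 / fact j * z ^ j))" by (simp only: norm_sum)
    also have "\<dots> \<le> (\<Sum>j\<le>k. norm ((deriv ^^ j) h 0 / fact j) * norm z ^ k)"
      unfolding norm_mult norm_power using z by (intro sum_mono mult_left_mono power_increasing) auto
    also have "\<dots> = C4 * norm z ^ k" by (simp add: C4_def sum_distrib_right)
    finally show ?thesis .
  qed
  \<comment> \<open>An exponent between the integer part and the order.\<close>
  define \<sigma> where "\<sigma> = (real k + \<rho>) / 2"
  have \<sigma>: "0 < \<sigma>" "\<sigma> < \<rho>" "real k \<le> \<sigma>" using k by (auto simp: \<sigma>_def)
  show False
  proof (rule proximity_not_le_powr[OF f \<rho>(1) \<sigma>(1,2) B, of r2 "C * (1 + 1 / \<sigma> + C4)"])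
    fix r assume r: "r \<ge> r2" "r \<notin> B"
    have rp: "r \<ge> 1" using r r2 by simp
    have p1: "1 \<le> r powr \<sigma>" using rp \<sigma> by (simp add: ge_one_powr_ge_zero)
    have "circle_mean r (\<lambda>z. log_plus (norm (e z))) \<le> circle_mean r (\<lambda>z. C4 * r ^ k)"
    proof (rule circle_mean_mono)
      fix z :: complex assume z: "norm z = r"
      have "Re (h z) \<le> norm (h z)" by (rule complex_Re_le_cmod)
      then have "ln (norm (e z)) \<le> C4 * r ^ k" using hpoly[of z] z rp Reh[of z] by simp
      then show "log_plus (norm (e z)) \<le> C4 * r ^ k" using C40 rp by (simp add: log_plus_def)
    qed (use rp in \<open>auto intro!: continuous_intros continuous_on_subset[OF holomorphic_on_imp_continuous_on[OF e(1)]]\<close>)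
    also have "\<dots> = C4 * r ^ k" by simp
    also have "\<dots> = C4 * r powr real k" using rp by (simp add: powr_realpow)
    also have "\<dots> \<le> C4 * r powr \<sigma>" using C40 rp \<sigma> by (intro mult_left_mono powr_mono) auto
    finally have m: "circle_mean r (\<lambda>z. log_plus (norm (e z))) \<le> C4 * r powr \<sigma>" .
    have "proximity r f \<le> C * (1 + ln r + circle_mean r (\<lambda>z. log_plus (norm (e z))))"
      by (rule le2) (use r r2 in auto)
    also have "\<dots> \<le> C * ((1 + 1 / \<sigma> + C4) * r powr \<sigma>)"
      using C m p1 ln_le_powr[OF \<sigma>(1) rp] by (intro mult_left_mono) (auto simp: distrib_right)
    finally show "proximity r f \<le> C * (1 + 1 / \<sigma> + C4) * r powr \<sigma>" by (simp add: mult.assoc)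
  qed
qed

text \<open>
  In the Weierstrass factorization, numerator and denominator have finitely many zeros, and dividing
  these out leaves zero-free entire functions.
\<close>

lemma meromorphic_zero_free_outside:
  assumes E: "E nicely_meromorphic_on UNIV" and A: "finite A"
    and nz: "\<And>z. z \<notin> A \<Longrightarrow> \<not> is_pole E z \<and> E z \<noteq> 0"
  obtains e p1 p2 where "e holomorphic_on UNIV" "\<And>z. e z \<noteq> 0" "p1 \<noteq> 0" "p2 \<noteq> 0"
    "\<And>z. z \<notin> A \<Longrightarrow> poly p1 z \<noteq> 0 \<and> poly p2 z \<noteq> 0 \<and> E z = e z * poly p1 z / poly p2 z"
proof -
  obtain h f1 f2 where W: "h holomorphic_on UNIV" "f1 holomorphic_on UNIV" "f2 holomorphic_on UNIV"
    "\<forall>z. f1 z = 0 \<longleftrightarrow> \<not> is_pole E z \<and> E z = 0" "\<forall>z. f2 z = 0 \<longleftrightarrow> is_pole E z"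
    "\<forall>z. h z \<noteq> 0" "\<forall>z. E z = h z * f1 z / f2 z"
    by (rule weierstrass_factorization_meromorphic_UNIV[OF E]) (rule that; assumption)
  have "A \<noteq> UNIV" using A infinite_UNIV_char_0[where ?'a = complex] by auto
  then obtain w where w: "w \<notin> A" by blast
  have fac: "\<exists>k p. k holomorphic_on UNIV \<and> (\<forall>z. k z \<noteq> 0) \<and> p \<noteq> 0 \<and> (\<forall>z. z \<notin> A \<longrightarrow> poly p z \<noteq> 0) \<and> (\<forall>z. \<phi> z = poly p z * k z)"
    if hol: "\<phi> holomorphic_on UNIV" and z0: "\<And>z. z \<notin> A \<Longrightarrow> \<phi> z \<noteq> 0" for \<phi> :: "complex \<Rightarrow> complex"
  proof -
    obtain m k where k: "k holomorphic_on UNIV" "\<And>z. \<phi> z = (\<Prod>a\<in>A. (z - a) ^ m a) * k z"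
      "\<And>a. a \<in> A \<Longrightarrow> k a \<noteq> 0"
      by (rule entire_factor_zeros[OF hol z0[OF w] A]) (rule that; assumption)
    have "k z \<noteq> 0" for z using k(2,3)[of z] z0[of z] by (cases "z \<in> A") auto
    moreover have "poly (\<Prod>a\<in>A. [:- a, 1:] ^ m a) z = (\<Prod>a\<in>A. (z - a) ^ m a)" for z
      by (simp add: poly_prod poly_power)
    moreover have "(\<Prod>a\<in>A. [:- a, 1:] ^ m a) \<noteq> 0" using A by auto
    moreover have "(\<Prod>a\<in>A. (z - a) ^ m a) \<noteq> 0" if "z \<notin> A" for z using A that by auto
    ultimately show ?thesis using k(1,2) by (intro exI[of _ k] exI[of _ "\<Prod>a\<in>A. [:- a, 1:] ^ m a"]) auto
  qed
  have f10: "f1 z \<noteq> 0" and f20: "f2 z \<noteq> 0" if "z \<notin> A" for z using nz[OF that] W(4,5) by auto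
  obtain k1 p1 where k1: "k1 holomorphic_on UNIV" "\<forall>z. k1 z \<noteq> 0" "p1 \<noteq> 0" "\<forall>z. z \<notin> A \<longrightarrow> poly p1 z \<noteq> 0" "\<forall>z. f1 z = poly p1 z * k1 z"
    using fac[OF W(2) f10] by blast
  obtain k2 p2 where k2: "k2 holomorphic_on UNIV" "\<forall>z. k2 z \<noteq> 0" "p2 \<noteq> 0" "\<forall>z. z \<notin> A \<longrightarrow> poly p2 z \<noteq> 0" "\<forall>z. f2 z = poly p2 z * k2 z"
    using fac[OF W(3) f20] by blast
  show ?thesis
  proof (rule that[of "\<lambda>z. h z * k1 z / k2 z" p1 p2])
    show "(\<lambda>z. h z * k1 z / k2 z) holomorphic_on UNIV" using k2(2) by (intro holomorphic_intros W k1 k2) auto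
    show "poly p1 z \<noteq> 0 \<and> poly p2 z \<noteq> 0 \<and> E z = (h z * k1 z / k2 z) * poly p1 z / poly p2 z" if "z \<notin> A" for z
      using that W(7) k1 k2 by (simp add: field_simps)
  qed (use W(6) k1 k2 in auto)
qed

lemma log_plus_ratio_bound:
  fixes p1 p2 :: "complex poly"
  assumes "p1 \<noteq> 0" "p2 \<noteq> 0"
  obtains C r0 where "C \<ge> 0" "r0 \<ge> 1"
    "\<And>z x. norm z \<ge> r0 \<Longrightarrow> log_plus (norm (x * poly p1 z / poly p2 z)) \<le> log_plus (norm x) + C * (1 + ln (norm z))"
    "\<And>z x. norm z \<ge> r0 \<Longrightarrow> log_plus (norm x) \<le> log_plus (norm (x * poly p1 z / poly p2 z)) + C * (1 + ln (norm z))"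
proof -
  obtain C1 r1 where 1: "C1 \<ge> 0" "r1 \<ge> 1"
    "\<And>z. norm z \<ge> r1 \<Longrightarrow> poly p1 z \<noteq> 0 \<and> \<bar>ln (norm (poly p1 z))\<bar> \<le> C1 * (1 + ln (norm z))"
    by (rule poly_log_bound[OF assms(1)]) (rule that; assumption)
  obtain C2 r2 where 2: "C2 \<ge> 0" "r2 \<ge> 1"
    "\<And>z. norm z \<ge> r2 \<Longrightarrow> poly p2 z \<noteq> 0 \<and> \<bar>ln (norm (poly p2 z))\<bar> \<le> C2 * (1 + ln (norm z))"
    by (rule poly_log_bound[OF assms(2)]) (rule that; assumption)
  have gen: "log_plus (norm (x * a / b)) \<le> log_plus (norm x) + (\<bar>ln (norm a)\<bar> + \<bar>ln (norm b)\<bar>)"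
    if "a \<noteq> 0" "b \<noteq> 0" for x a b :: complex
  proof -
    have "norm (x * a / b) = norm x * (norm a * (1 / norm b))" by (simp add: norm_mult norm_divide)
    then have "log_plus (norm (x * a / b)) \<le> log_plus (norm x) + log_plus (norm a * (1 / norm b))"
      using log_plus_mult_le[of "norm x" "norm a * (1 / norm b)"] by simp
    also have "log_plus (norm a * (1 / norm b)) \<le> log_plus (norm a) + log_plus (1 / norm b)"
      by (rule log_plus_mult_le) auto
    also have "log_plus (norm a) \<le> \<bar>ln (norm a)\<bar>" by (rule log_plus_le_abs_ln)
    also have "log_plus (1 / norm b) \<le> \<bar>ln (norm b)\<bar>"
      using log_plus_le_abs_ln[of "1 / norm b"] that by (simp add: ln_div)
    finally show ?thesis by simp
  qed
  show ?thesis
  proof (rule that[of "C1 + C2" "max r1 r2"])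
    fix z x :: complex assume z: "norm z \<ge> max r1 r2"
    have p: "poly p1 z \<noteq> 0" "poly p2 z \<noteq> 0" "\<bar>ln (norm (poly p1 z))\<bar> \<le> C1 * (1 + ln (norm z))"
      "\<bar>ln (norm (poly p2 z))\<bar> \<le> C2 * (1 + ln (norm z))" using 1(3)[of z] 2(3)[of z] z by auto
    show "log_plus (norm (x * poly p1 z / poly p2 z)) \<le> log_plus (norm x) + (C1 + C2) * (1 + ln (norm z))"
      using gen[OF p(1,2), of x] p(3,4) by (simp add: distrib_right)
    have "x = (x * poly p1 z / poly p2 z) * poly p2 z / poly p1 z" using p by simp
    then show "log_plus (norm x) \<le> log_plus (norm (x * poly p1 z / poly p2 z)) + (C1 + C2) * (1 + ln (norm z))"
      using gen[OF p(2,1), of "x * poly p1 z / poly p2 z"] p(3,4) by (simp add: distrib_right)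
  qed (use 1 2 in auto)
qed

text \<open>
  The rational factor changes the means only by \<open>O(ln r)\<close>, which reduces the claim to
  the zero-free entire factor.
\<close>

lemma zero_free_meromorphic_contradiction:
  assumes f: "f \<in> M1" and ord: "nonint_finite_order f"
    and E: "E nicely_meromorphic_on UNIV" and A: "finite A"
    and nz: "\<And>z. z \<notin> A \<Longrightarrow> \<not> is_pole E z \<and> E z \<noteq> 0" and B: "countable B"
    and le1: "\<And>r. r \<ge> r0 \<Longrightarrow> r \<notin> B \<Longrightarrow> circle_mean r (\<lambda>z. log_plus (norm (E z))) \<le> C * (1 + ln r + proximity r f)"
    and le2: "\<And>r. r \<ge> r0 \<Longrightarrow> r \<notin> B \<Longrightarrow> proximity r f \<le> C * (1 + ln r + circle_mean r (\<lambda>z. log_plus (norm (E z))))"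
    and C: "C \<ge> 0"
  shows False
proof -
  obtain e p1 p2 where e: "e holomorphic_on UNIV" "\<And>z. e z \<noteq> 0" "p1 \<noteq> 0" "p2 \<noteq> 0"
    "\<And>z. z \<notin> A \<Longrightarrow> poly p1 z \<noteq> 0 \<and> poly p2 z \<noteq> 0 \<and> E z = e z * poly p1 z / poly p2 z"
    by (rule meromorphic_zero_free_outside[OF E A nz]) (assumption | rule that; assumption)+
  obtain D r1 where D: "D \<ge> 0" "r1 \<ge> 1"
    "\<And>z x. norm z \<ge> r1 \<Longrightarrow> log_plus (norm (x * poly p1 z / poly p2 z)) \<le> log_plus (norm x) + D * (1 + ln (norm z))"
    "\<And>z x. norm z \<ge> r1 \<Longrightarrow> log_plus (norm x) \<le> log_plus (norm (x * poly p1 z / poly p2 z)) + D * (1 + ln (norm z))"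
    by (rule log_plus_ratio_bound[OF e(3,4)]) (rule that; assumption)
  define r2 where "r2 = max (max r0 r1) (Max (insert 0 (norm ` A)) + 1)"
  have r2: "r2 \<ge> r0" "r2 \<ge> r1" "r2 \<ge> 1" using D by (auto simp: r2_def)
  have notA: "z \<notin> A" if "norm z = r" "r \<ge> r2" for z r
  proof
    assume "z \<in> A"
    then have "norm z \<le> Max (insert 0 (norm ` A))" using A by (intro Max_ge) auto
    then show False using that by (simp add: r2_def)
  qed
  have cmp: "circle_mean r (\<lambda>z. log_plus (norm (E z))) \<le> circle_mean r (\<lambda>z. log_plus (norm (e z))) + D * (1 + ln r)"
    "circle_mean r (\<lambda>z. log_plus (norm (e z))) \<le> circle_mean r (\<lambda>z. log_plus (norm (E z))) + D * (1 + ln r)" if r: "r \<ge> r2" for r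
  proof -
    have rp: "r \<ge> 0" using r r2 by simp
    have conte: "continuous_on (sphere 0 r) e"
      by (rule continuous_on_subset[OF holomorphic_on_imp_continuous_on[OF e(1)]]) auto
    have contE: "continuous_on (sphere 0 r) E"
    proof (rule continuous_on_eq)
      show "continuous_on (sphere 0 r) (\<lambda>z. e z * poly p1 z / poly p2 z)"
        using e(5) notA[OF _ r] by (intro continuous_intros conte) auto
      show "e z * poly p1 z / poly p2 z = E z" if "z \<in> sphere 0 r" for z
        using e(5)[OF notA[OF _ r]] that by simp
    qed
    have a: "log_plus (norm (E z)) \<le> log_plus (norm (e z)) + D * (1 + ln r)"
      and b: "log_plus (norm (e z)) \<le> log_plus (norm (E z)) + D * (1 + ln r)" if z: "norm z = r" for z
      using D(3)[of z "e z"] D(4)[of z "e z"] e(5)[OF notA[OF z r]] z r r2 by auto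
    have "circle_mean r (\<lambda>z. log_plus (norm (E z))) \<le> circle_mean r (\<lambda>z. log_plus (norm (e z)) + D * (1 + ln r))"
      by (rule circle_mean_mono) (use a rp in \<open>auto intro!: continuous_intros conte contE\<close>)
    also have "\<dots> = circle_mean r (\<lambda>z. log_plus (norm (e z))) + D * (1 + ln r)"
      by (subst circle_mean_add) (use rp in \<open>auto intro!: continuous_intros conte contE\<close>)
    finally show "circle_mean r (\<lambda>z. log_plus (norm (E z))) \<le> circle_mean r (\<lambda>z. log_plus (norm (e z))) + D * (1 + ln r)" .
    have "circle_mean r (\<lambda>z. log_plus (norm (e z))) \<le> circle_mean r (\<lambda>z. log_plus (norm (E z)) + D * (1 + ln r))"
      by (rule circle_mean_mono) (use b rp in \<open>auto intro!: continuous_intros conte contE\<close>)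
    also have "\<dots> = circle_mean r (\<lambda>z. log_plus (norm (E z))) + D * (1 + ln r)"
      by (subst circle_mean_add) (use rp in \<open>auto intro!: continuous_intros conte contE\<close>)
    finally show "circle_mean r (\<lambda>z. log_plus (norm (e z))) \<le> circle_mean r (\<lambda>z. log_plus (norm (E z))) + D * (1 + ln r)" .
  qed
  obtain r3 where r3: "r3 \<ge> 1" "\<And>r. r \<ge> r3 \<Longrightarrow> proximity r f \<ge> 0"
    by (rule proximity_nonneg_M1[OF f]) (rule that; assumption)
  have mn: "circle_mean r (\<lambda>z. log_plus (norm (e z))) \<ge> 0" if "r \<ge> r2" for r
    by (rule circle_mean_nonneg)
       (use r2 that in \<open>auto intro!: continuous_intros continuous_on_subset[OF holomorphic_on_imp_continuous_on[OF e(1)]]\<close>)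
  define C' where "C' = C + D + C * D"
  show False
  proof (rule zero_free_comparable_contradiction[OF f ord e(1,2) B, of "max r2 r3" C'])
    show "C' \<ge> 0" using C D by (simp add: C'_def)
    fix r assume r: "r \<ge> max r2 r3" "r \<notin> B"
    have l: "ln r \<ge> 0" using r r2 by simp
    have p: "proximity r f \<ge> 0" using r3 r by simp
    define m where "m = circle_mean r (\<lambda>z. log_plus (norm (e z)))"
    have m: "m \<ge> 0" using mn r by (simp add: m_def)
    have "m \<le> C * (1 + ln r + proximity r f) + D * (1 + ln r)"
      using cmp(2)[of r] le1[of r] r r2 by (simp add: m_def)
    also have "\<dots> \<le> C * (1 + ln r + proximity r f) + D * (1 + ln r + proximity r f) + C * D * (1 + ln r + proximity r f)"
    proof -
      have "D * (1 + ln r) \<le> D * (1 + ln r + proximity r f)" using D p by (intro mult_left_mono) auto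
      moreover have "0 \<le> C * D * (1 + ln r + proximity r f)" using C D p l by (intro mult_nonneg_nonneg) auto
      ultimately show ?thesis by linarith
    qed
    also have "\<dots> = C' * (1 + ln r + proximity r f)" by (simp add: C'_def distrib_right)
    finally show "circle_mean r (\<lambda>z. log_plus (norm (e z))) \<le> C' * (1 + ln r + proximity r f)" by (simp only: m_def)
    have "proximity r f \<le> C * (1 + ln r + circle_mean r (\<lambda>z. log_plus (norm (E z))))" by (rule le2) (use r r2 in auto)
    also have "\<dots> \<le> C * (1 + ln r + (m + D * (1 + ln r)))"
      using cmp(1)[of r] r C by (intro mult_left_mono) (auto simp: m_def)
    also have "\<dots> = C * (1 + ln r + m) + C * D * (1 + ln r)" by (simp add: algebra_simps)
    also have "\<dots> \<le> C * (1 + ln r + m) + D * (1 + ln r + m) + C * D * (1 + ln r + m)"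
    proof -
      have "C * D * (1 + ln r) \<le> C * D * (1 + ln r + m)" using C D m by (intro mult_left_mono) auto
      moreover have "0 \<le> D * (1 + ln r + m)" using D m l by (intro mult_nonneg_nonneg) auto
      ultimately show ?thesis by linarith
    qed
    also have "\<dots> = C' * (1 + ln r + m)" by (simp add: C'_def distrib_right)
    finally show "proximity r f \<le> C' * (1 + ln r + circle_mean r (\<lambda>z. log_plus (norm (e z))))" by (simp only: m_def)
  qed
qed

text \<open>
  The means of \<open>log_plus x\<close> and of \<open>log_plus (1 / x)\<close> differ by the mean
  of \<open>ln x\<close>, and Jensen's inequality bounds the latter from below.
\<close>

lemma reciprocal_mean_bound:
  fixes \<phi> :: "complex \<Rightarrow> complex" and d :: "complex poly"
  assumes hol: "\<phi> holomorphic_on UNIV" and nz: "\<phi> w \<noteq> 0" and d: "d \<noteq> 0"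
  obtains C r0 where "C \<ge> 0" "r0 \<ge> 1" "\<And>r. r \<ge> r0 \<Longrightarrow> r \<notin> norm ` {z. \<phi> z = 0} \<Longrightarrow>
    circle_mean r (\<lambda>z. log_plus (1 / norm (\<phi> z / poly d z))) \<le>
      circle_mean r (\<lambda>z. log_plus (norm (\<phi> z / poly d z))) + C * (1 + ln r)"
    "\<And>r. r \<ge> r0 \<Longrightarrow> r \<notin> norm ` {z. \<phi> z = 0} \<Longrightarrow> continuous_on (sphere 0 r) (\<lambda>z. \<phi> z / poly d z)"
proof -
  obtain C0 r0 where C0: "C0 \<ge> 0" "r0 \<ge> 1"
    "\<And>z. norm z \<ge> r0 \<Longrightarrow> poly d z \<noteq> 0 \<and> \<bar>ln (norm (poly d z))\<bar> \<le> C0 * (1 + ln (norm z))"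
    by (rule poly_log_bound[OF d]) (rule that; assumption)
  obtain Cj where Cj: "\<And>R. R \<ge> 1 \<Longrightarrow> (\<And>\<zeta>. norm \<zeta> = R \<Longrightarrow> \<phi> \<zeta> \<noteq> 0) \<Longrightarrow> circle_mean R (\<lambda>\<zeta>. ln (norm (\<phi> \<zeta>))) \<ge> Cj"
    by (rule jensen_lower_bound[OF hol nz]) (rule that, blast)
  have cont: "continuous_on (sphere 0 r) (\<lambda>z. \<phi> z / poly d z)" if r: "r \<ge> r0" for r
    using C0(3) r by (intro continuous_intros continuous_on_subset[OF holomorphic_on_imp_continuous_on[OF hol]]) auto
  have "circle_mean r (\<lambda>z. log_plus (1 / norm (\<phi> z / poly d z))) \<le>
      circle_mean r (\<lambda>z. log_plus (norm (\<phi> z / poly d z))) + (C0 + \<bar>Cj\<bar>) * (1 + ln r)"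
    if r: "r \<ge> r0" "r \<notin> norm ` {z. \<phi> z = 0}" for r
  proof -
    have rp: "r \<ge> 0" "r \<ge> 1" using r C0 by auto
    have nzr: "\<phi> z \<noteq> 0" if "norm z = r" for z using r(2) that by auto
    have d0: "poly d z \<noteq> 0" if "norm z = r" for z using C0(3)[of z] that r by simp
    have pt: "log_plus (1 / norm (\<phi> z / poly d z)) \<le> log_plus (norm (\<phi> z / poly d z)) + (C0 * (1 + ln r) + (-1) * ln (norm (\<phi> z)))"
      if z: "norm z = r" for z
    proof -
      define x where "x = norm (\<phi> z / poly d z)"
      have x: "x > 0" using nzr[OF z] d0[OF z] by (simp add: x_def)
      have "log_plus (1 / x) = log_plus x - ln x" using x by (simp add: log_plus_def ln_div)
      moreover have "ln x = ln (norm (\<phi> z)) - ln (norm (poly d z))"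
        using nzr[OF z] d0[OF z] by (simp add: x_def norm_divide ln_div)
      moreover have "\<bar>ln (norm (poly d z))\<bar> \<le> C0 * (1 + ln r)" using C0(3)[of z] z r by simp
      ultimately have "log_plus (1 / x) \<le> log_plus x + (C0 * (1 + ln r) + (-1) * ln (norm (\<phi> z)))" by linarith
      then show ?thesis by (simp only: x_def)
    qed
    have cl: "continuous_on (sphere 0 r) (\<lambda>z. ln (norm (\<phi> z)))"
      by (intro continuous_intros continuous_on_subset[OF holomorphic_on_imp_continuous_on[OF hol]]) (use nzr in auto)
    have ci: "continuous_on (sphere 0 r) (\<lambda>z. log_plus (1 / norm (\<phi> z / poly d z)))"
    proof -
      have "continuous_on (sphere 0 r) (\<lambda>z. 1 / (\<phi> z / poly d z))"
        by (intro continuous_intros cont[OF r(1)]) (use nzr d0 in auto)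
      then have "continuous_on (sphere 0 r) (\<lambda>z. log_plus (norm (1 / (\<phi> z / poly d z))))" by (rule continuous_on_log_plus_norm)
      then show ?thesis by (simp only: norm_divide norm_one)
    qed
    have "circle_mean r (\<lambda>z. log_plus (1 / norm (\<phi> z / poly d z))) \<le>
       circle_mean r (\<lambda>z. log_plus (norm (\<phi> z / poly d z)) + (C0 * (1 + ln r) + (-1) * ln (norm (\<phi> z))))"
      by (rule circle_mean_mono[OF ci _ rp(1) pt]) (auto intro!: continuous_intros cont[OF r(1)] cl)
    also have "\<dots> = circle_mean r (\<lambda>z. log_plus (norm (\<phi> z / poly d z))) + circle_mean r (\<lambda>z. C0 * (1 + ln r) + (-1) * ln (norm (\<phi> z)))"
      by (rule circle_mean_add) (use rp in \<open>auto intro!: continuous_intros cont[OF r(1)] cl\<close>)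
    also have "circle_mean r (\<lambda>z. C0 * (1 + ln r) + (-1) * ln (norm (\<phi> z))) = circle_mean r (\<lambda>z. C0 * (1 + ln r)) + circle_mean r (\<lambda>z. (-1) * ln (norm (\<phi> z)))"
      by (rule circle_mean_add) (use rp in \<open>auto intro!: continuous_intros cl\<close>)
    also have "circle_mean r (\<lambda>z. (-1) * ln (norm (\<phi> z))) = (-1) * circle_mean r (\<lambda>z. ln (norm (\<phi> z)))" by (rule circle_mean_cmult)
    also have "circle_mean r (\<lambda>z. C0 * (1 + ln r)) + (-1) * circle_mean r (\<lambda>z. ln (norm (\<phi> z))) \<le> (C0 + \<bar>Cj\<bar>) * (1 + ln r)"
    proof -
      have "Cj \<le> circle_mean r (\<lambda>z. ln (norm (\<phi> z)))" by (rule Cj[OF rp(2) nzr])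
      moreover have "- Cj \<le> \<bar>Cj\<bar>" by simp
      moreover have "\<bar>Cj\<bar> * 1 \<le> \<bar>Cj\<bar> * (1 + ln r)" using rp by (intro mult_left_mono) auto
      ultimately show ?thesis by (simp add: distrib_right del: abs_ge_minus_self)
    qed
    finally show ?thesis by simp
  qed
  then show ?thesis using that[of "C0 + \<bar>Cj\<bar>" r0] C0 cont by auto
qed

section \<open>The attached polynomial and the shared values\<close>

lemma degree_eq_sum_order:
  fixes p :: "complex poly"
  assumes "p \<noteq> 0"
  shows "degree p = (\<Sum>z | poly p z = 0. order z p)"
proof -
  have "degree p = size (proots p)" by (simp add: size_proots_complex)
  also have "\<dots> = (\<Sum>z\<in>set_mset (proots p). count (proots p) z)" by (simp add: size_multiset_overloaded_eq)
  also have "set_mset (proots p) = {z. poly p z = 0}" using assms by simp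
  also have "(\<Sum>z | poly p z = 0. count (proots p) z) = (\<Sum>z | poly p z = 0. order z p)" using assms by simp
  finally show ?thesis .
qed

lemma assoc_poly_eq_prod:
  assumes "inj_on \<alpha> {1..n}" "0 \<notin> \<alpha> ` {1..n}"
  shows "\<exists>c. c \<noteq> 0 \<and> (\<forall>x. poly (assoc_poly n \<alpha>) x - 1 = c * (\<Prod>a\<in>\<alpha> ` {1..n}. x - a))"
proof -
  define k where "k = (-1) ^ (n + 1) * (\<Prod>i=1..n. \<alpha> i)"
  have k: "k \<noteq> 0" using assms(2) by (auto simp: k_def)
  have nz: "\<alpha> i \<noteq> 0" if "i \<in> {1..n}" for i using assms(2) that by (metis imageI)
  have eq: "(\<Prod>i=1..n. [:- \<alpha> i, 1:]) = smult k (assoc_poly n \<alpha> - 1)"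
    unfolding k_def by (rule prod_eq_assoc_poly) (rule nz)
  have "poly (assoc_poly n \<alpha>) x - 1 = inverse k * (\<Prod>a\<in>\<alpha> ` {1..n}. x - a)" for x
  proof -
    have "(\<Prod>a\<in>\<alpha> ` {1..n}. x - a) = (\<Prod>i=1..n. x - \<alpha> i)" using assms(1) by (simp add: prod.reindex)
    also have "\<dots> = poly (\<Prod>i=1..n. [:- \<alpha> i, 1:]) x" by (simp add: poly_prod)
    also have "\<dots> = k * (poly (assoc_poly n \<alpha>) x - 1)" unfolding eq by simp
    finally show ?thesis using k by simp
  qed
  then show ?thesis using k by (intro exI[of _ "inverse k"]) auto
qed

lemma degree_of_prod_form:
  fixes P :: "complex poly"
  assumes S: "finite S" "card S \<ge> 1" and c: "c \<noteq> 0" and PS: "\<And>x. poly P x - 1 = c * (\<Prod>a\<in>S. x - a)"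
  shows "degree P = card S"
proof -
  have "poly (P - 1) x = poly (smult c (\<Prod>a\<in>S. [:- a, 1:])) x" for x
    using PS[of x] by (simp add: poly_prod)
  then have "P - 1 = smult c (\<Prod>a\<in>S. [:- a, 1:])" by (intro poly_eqI_degree poly_ext) (auto simp: poly_eq_poly_eq_iff[symmetric] fun_eq_iff)
  then have P: "P = smult c (\<Prod>a\<in>S. [:- a, 1:]) + 1" by (simp add: algebra_simps)
  have "degree (\<Prod>a\<in>S. [:- a, 1::complex:]) = card S"
    using S(1) by (subst degree_prod_eq_sum_degree) auto
  then have "degree (smult c (\<Prod>a\<in>S. [:- a, 1:])) = card S" using c by simp
  then show ?thesis unfolding P using S by (subst degree_add_eq_left) auto
qed

text \<open>
  If neither critical point were a zero of \<open>P\<close>, all \<open>n\<close> zeros would be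
  simple.  So one of them, \<open>b1\<close>, is a zero, and the other zeros are simple, as
  \<open>P\<close> takes another value at \<open>b2\<close>.  Hence \<open>n = a + (number of other
  zeros)\<close>, which gives \<open>a > n / 2\<close>, and the orders of the two zeros of
  \<open>P'\<close> add up to \<open>n - 1\<close>, which gives \<open>a + b = n + 1\<close>.
\<close>

lemma critical_structure:
  fixes P :: "complex poly"
  assumes deg: "degree P = n" and n: "n \<ge> 2"
    and crit: "\<And>x. poly (pderiv P) x = 0 \<longleftrightarrow> x = \<beta>1 \<or> x = \<beta>2" and ne: "\<beta>1 \<noteq> \<beta>2"
    and val: "poly P \<beta>1 \<noteq> poly P \<beta>2" and few: "n > 2 * card {z. poly P z = 0}"
  obtains b1 b2 a b Q Q2 where "{b1, b2} = {\<beta>1, \<beta>2}" "b1 \<noteq> b2" "poly P b1 = 0" "poly P b2 \<noteq> 0"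
    "a > b" "b \<ge> 1" "P = [:- b1, 1:] ^ a * Q" "poly Q b1 \<noteq> 0"
    "P - [:poly P b2:] = [:- b2, 1:] ^ b * Q2" "poly Q2 b2 \<noteq> 0"
proof -
  have P0: "P \<noteq> 0" using deg n by auto
  have pP: "degree (pderiv P) = n - 1" using deg by (simp add: degree_pderiv)
  then have pP0: "pderiv P \<noteq> 0" using n by auto
  have simple: "order z P = 1" if "poly P z = 0" "z \<noteq> \<beta>1" "z \<noteq> \<beta>2" for z
  proof -
    have "order z P = Suc (order z (pderiv P))" by (rule order_pderiv[OF P0 that(1)])
    moreover have "order z (pderiv P) = 0" using crit[of z] that order_root[of "pderiv P" z] by simp
    ultimately show ?thesis by simp
  qed
  define Zr where "Zr = {z. poly P z = 0}"
  have finZ: "finite Zr" unfolding Zr_def by (rule poly_roots_finite[OF P0])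
  have sumo: "n = (\<Sum>z\<in>Zr. order z P)" using degree_eq_sum_order[OF P0] deg by (simp add: Zr_def)
  have "poly P \<beta>1 = 0 \<or> poly P \<beta>2 = 0"
  proof (rule ccontr)
    assume no: "\<not> ?thesis"
    have "(\<Sum>z\<in>Zr. order z P) = (\<Sum>z\<in>Zr. 1)" by (rule sum.cong) (use simple no in \<open>auto simp: Zr_def\<close>)
    then have "n = card Zr" using sumo by simp
    then show False using few n by (simp add: Zr_def)
  qed
  then obtain b1 b2 where b: "{b1, b2} = {\<beta>1, \<beta>2}" "b1 \<noteq> b2" "poly P b1 = 0"
  proof
    assume "poly P \<beta>1 = 0" then show ?thesis using that[of \<beta>1 \<beta>2] ne by auto
  next
    assume "poly P \<beta>2 = 0" then show ?thesis using that[of \<beta>2 \<beta>1] ne by auto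
  qed
  have b2: "poly P b2 \<noteq> 0" using b val by (metis doubleton_eq_iff)
  have crit': "poly (pderiv P) x = 0 \<longleftrightarrow> x = b1 \<or> x = b2" for x
  proof -
    have "x \<in> {b1, b2} \<longleftrightarrow> x \<in> {\<beta>1, \<beta>2}" using b(1) by simp
    then show ?thesis using crit[of x] by simp
  qed
  have simple': "order z P = 1" if "z \<in> Zr - {b1}" for z
  proof -
    have "poly P z = 0" "z \<noteq> b1" "z \<noteq> b2" using that b2 by (auto simp: Zr_def)
    then have "z \<notin> {b1, b2}" by simp
    then have "z \<notin> {\<beta>1, \<beta>2}" using b(1) by simp
    then show ?thesis using simple[of z] that by (auto simp: Zr_def)
  qed
  define a where "a = order b1 P"
  have "(\<Sum>z\<in>Zr. order z P) = order b1 P + (\<Sum>z\<in>Zr - {b1}. order z P)"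
    by (rule sum.remove) (use finZ b in \<open>auto simp: Zr_def\<close>)
  also have "(\<Sum>z\<in>Zr - {b1}. order z P) = (\<Sum>z\<in>Zr - {b1}. 1)" by (rule sum.cong) (use simple' in auto)
  also have "\<dots> = card Zr - 1" using finZ b by (simp add: Zr_def)
  finally have na: "n = a + (card Zr - 1)" using sumo by (simp add: a_def)
  have cZ: "card Zr \<ge> 1" using finZ b by (auto simp: Zr_def card_gt_0_iff Suc_le_eq)
  define q where "q = poly P b2"
  define Pq where "Pq = P - [:q:]"
  have pdq: "pderiv Pq = pderiv P" by (simp add: Pq_def pderiv_diff pderiv_pCons)
  have Pq0: "Pq \<noteq> 0" using pP0 pdq by auto
  have Pqb: "poly Pq b2 = 0" by (simp add: Pq_def q_def)
  define bb where "bb = order b2 Pq"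
  have o1: "a = Suc (order b1 (pderiv P))" unfolding a_def by (rule order_pderiv[OF P0 b(3)])
  have o2: "bb = Suc (order b2 (pderiv P))" unfolding bb_def using order_pderiv[OF Pq0 Pqb] pdq by simp
  have "n - 1 = (\<Sum>z | poly (pderiv P) z = 0. order z (pderiv P))"
    using degree_eq_sum_order[OF pP0] pP by simp
  also have "{z. poly (pderiv P) z = 0} = {b1, b2}" using crit' by auto
  also have "(\<Sum>z\<in>{b1, b2}. order z (pderiv P)) = (a - 1) + (bb - 1)" using b(2) o1 o2 by simp
  finally have "n - 1 = (a - 1) + (bb - 1)" .
  then have ab: "a + bb = n + 1" using o1 o2 n by simp
  have "a > bb" using na ab cZ few by (simp add: Zr_def)
  obtain Q where Q: "P = [:- b1, 1:] ^ a * Q" "\<not> [:- b1, 1:] dvd Q"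
    using order_decomp[OF P0, of b1] unfolding a_def by blast
  obtain Q2 where Q2: "Pq = [:- b2, 1:] ^ bb * Q2" "\<not> [:- b2, 1:] dvd Q2"
    using order_decomp[OF Pq0, of b2] unfolding bb_def by blast
  show ?thesis
    by (rule that[OF b(1,2,3) b2 \<open>a > bb\<close> _ Q(1) _ Q2(1)[unfolded Pq_def q_def]])
       (use o2 Q(2) Q2(2) in \<open>auto simp: poly_eq_0_iff_dvd\<close>)
qed

text \<open>
  The support of the counting function is the set of points that are mapped into \<open>S\<close>;
  this includes the case that \<open>f\<close> is constant, where the multiplicity is infinite.
\<close>

lemma E_set_eq_0_iff:
  assumes f: "f \<in> M1"
  shows "E_set f S 2 z \<noteq> 0 \<longleftrightarrow> \<not> is_pole f z \<and> f z \<in> S"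
proof -
  have pos: "E_pts 2 (f z) f z \<noteq> 0" if np: "\<not> is_pole f z"
  proof (cases "\<forall>\<^sub>F w in at z. f w = f z")
    case True
    then have "a_point_mult (f z) f z = \<infinity>" by (simp add: a_point_mult_def)
    then show ?thesis using np by (simp add: E_pts_def is_a_point_def)
  next
    case False
    have an: "f analytic_on {z}" by (rule M1_analytic_at[OF f np])
    have "zorder (\<lambda>w. f w - f z) z > 0"
    proof (rule zorder_isolated_zero_pos)
      show "(\<lambda>w. f w - f z) analytic_on {z}" by (intro analytic_intros an)
      show "isolated_zero (\<lambda>w. f w - f z) z"
      proof (rule ccontr)
        assume ni: "\<not> isolated_zero (\<lambda>w. f w - f z) z"
        have an': "(\<lambda>w. f w - f z) analytic_on {z}" by (intro analytic_intros an)
        have "\<forall>\<^sub>F w in at z. f w - f z = 0"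
          by (rule non_isolated_zero_imp_eventually_zero[OF an' _ ni]) simp
        then have "\<forall>\<^sub>F w in at z. f w = f z" by eventually_elim simp
        then show False using False by blast
      qed
    qed
    then have "a_point_mult (f z) f z \<noteq> 0" using False by (simp add: a_point_mult_def zero_enat_def)
    then show ?thesis using np by (auto simp: E_pts_def is_a_point_def)
  qed
  show ?thesis
  proof
    assume "E_set f S 2 z \<noteq> 0"
    then have "\<not> E_set f S 2 z \<le> 0" by simp
    have "\<exists>a\<in>S. E_pts 2 a f z \<noteq> 0"
    proof (rule ccontr)
      assume "\<not> ?thesis"
      then have "E_pts 2 a f z \<le> 0" if "a \<in> S" for a using that by auto
      then have "E_set f S 2 z \<le> 0" unfolding E_set_def by (rule SUP_least)
      then show False using \<open>\<not> E_set f S 2 z \<le> 0\<close> by blast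
    qed
    then obtain a where "a \<in> S" "E_pts 2 a f z \<noteq> 0" by blast
    then show "\<not> is_pole f z \<and> f z \<in> S" by (auto simp: E_pts_def is_a_point_def split: if_splits)
  next
    assume h: "\<not> is_pole f z \<and> f z \<in> S"
    then have "E_pts 2 (f z) f z \<le> E_set f S 2 z" unfolding E_set_def by (intro SUP_upper) auto
    then show "E_set f S 2 z \<noteq> 0" using pos h by auto
  qed
qed

lemma E_set_eq_min:
  assumes np: "\<not> is_pole f z" and S: "f z \<in> S" and nc: "\<not> (\<forall>\<^sub>F w in at z. f w = f z)"
  shows "E_set f S 2 z = enat (min (nat (zorder (\<lambda>w. f w - f z) z)) 3)"
proof -
  define m where "m = nat (zorder (\<lambda>w. f w - f z) z)"
  have mult: "a_point_mult (f z) f z = enat m" using nc by (simp add: a_point_mult_def m_def)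
  have two: "(2::enat) = enat 2" by (simp add: numeral_eq_enat)
  have E: "E_pts 2 (f z) f z = enat (min m 3)"
  proof (cases "m \<le> 2")
    case True
    then show ?thesis using np mult by (simp add: E_pts_def is_a_point_def two)
  next
    case False
    have "(2::enat) + 1 = enat 3" by (simp add: two one_enat_def)
    then show ?thesis using np mult False by (simp add: E_pts_def is_a_point_def two min_def)
  qed
  have "E_set f S 2 z = E_pts 2 (f z) f z"
    unfolding E_set_def
  proof (rule antisym)
    show "(SUP a\<in>S. E_pts 2 a f z) \<le> E_pts 2 (f z) f z"
    proof (rule SUP_least)
      fix a assume "a \<in> S"
      show "E_pts 2 a f z \<le> E_pts 2 (f z) f z" by (cases "a = f z") (auto simp: E_pts_def is_a_point_def)
    qed
    show "E_pts 2 (f z) f z \<le> (SUP a\<in>S. E_pts 2 a f z)" by (rule SUP_upper[OF S])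
  qed
  then show ?thesis using E by (simp add: m_def)
qed

lemma M1_not_locally_constant:
  assumes f: "f \<in> M1" and z1: "\<not> is_pole f z1" and z2: "\<not> is_pole f z2" "f z1 \<noteq> f z2"
  shows "\<not> (\<exists>\<^sub>F w in at z. f w = c)"
proof
  assume "\<exists>\<^sub>F w in at z. f w = c"
  moreover have "f nicely_meromorphic_on UNIV" using f by (simp add: M1_def)
  ultimately have "f w = c" for w
    by (rule frequently_eq_meromorphic_imp_constant) (auto simp: connected_UNIV)
  then show False using z2 by simp
qed

lemma M1_nonconstant_on_ball:
  assumes f: "f \<in> M1" and z1: "\<not> is_pole f z1" and z2: "\<not> is_pole f z2" "f z1 \<noteq> f z2" and r: "r > 0"
  shows "\<exists>w\<in>ball z r. f w \<noteq> c"
proof (rule ccontr)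
  assume no: "\<not> ?thesis"
  have "\<forall>\<^sub>F w in at z. f w = c"
    unfolding eventually_at by (intro exI[of _ r]) (use no r in \<open>auto simp: dist_commute\<close>)
  then have "\<exists>\<^sub>F w in at z. f w = c" by (rule eventually_frequently[rotated]) simp
  then show False using M1_not_locally_constant[OF f z1 z2] by blast
qed

text \<open>
  The identity theorem in the form used here: one regular point with a non-zero value is enough.
\<close>

lemma meromorphic_eventually_nonzero:
  assumes \<phi>: "\<phi> meromorphic_on UNIV" and w: "\<phi> analytic_on {w}" "\<phi> w \<noteq> 0"
  shows "\<forall>\<^sub>F z in at z0. \<phi> z \<noteq> 0"
proof (rule ccontr)
  assume "\<not> ?thesis"
  then have fr: "\<exists>\<^sub>F z in at z0. \<phi> z = 0" by (simp add: frequently_def)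
  have ev: "\<forall>\<^sub>F z in at z0. remove_sings \<phi> z = \<phi> z"
    using \<phi> by (intro eventually_remove_sings_eq_at) (auto simp: meromorphic_on_altdef)
  have "\<exists>\<^sub>F z in at z0. remove_sings \<phi> z = 0"
    by (rule frequently_rev_mp[OF fr]) (use ev in eventually_elim, simp)
  moreover have "remove_sings \<phi> nicely_meromorphic_on UNIV" by (rule remove_sings_nicely_meromorphic[OF \<phi>])
  ultimately have "remove_sings \<phi> w = 0"
    by (rule frequently_eq_meromorphic_imp_constant) (auto simp: connected_UNIV)
  then show False using w by simp
qed

lemma meromorphic_identity:
  assumes \<phi>: "\<phi> meromorphic_on UNIV" and r: "r > 0" "\<And>z. z \<in> ball z1 r \<Longrightarrow> \<phi> z = 0" and w: "\<phi> analytic_on {w}"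
  shows "\<phi> w = 0"
proof (rule ccontr)
  assume "\<phi> w \<noteq> 0"
  then have 1: "\<forall>\<^sub>F z in at z1. \<phi> z \<noteq> 0" by (rule meromorphic_eventually_nonzero[OF \<phi> w])
  have 2: "\<forall>\<^sub>F z in at z1. \<phi> z = 0"
    unfolding eventually_at by (intro exI[of _ r]) (use r in \<open>auto simp: dist_commute\<close>)
  have "\<forall>\<^sub>F z in at z1. False" using 1 2 by eventually_elim simp
  then show False by simp
qed

lemma analytic_poly_comp [analytic_intros]:
  fixes f :: "complex \<Rightarrow> complex"
  shows "f analytic_on A \<Longrightarrow> (\<lambda>z. poly p (f z)) analytic_on A"
  unfolding poly_altdef by (intro analytic_intros)

text \<open>
  Equality of the second order terms says that \<open>(1 / (F - 1))'\<close> and \<open>(1 / (G -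
  1))'\<close> have the same logarithmic derivative, so they are proportional, and \<open>1 / (F -
  1)\<close> is an affine function of \<open>1 / (G - 1)\<close>.
\<close>

lemma moebius_of_equal_second_order_terms:
  assumes f: "f holomorphic_on ball z1 r" and g: "g holomorphic_on ball z1 r" and r: "r > 0"
    and nz: "\<And>z. z \<in> ball z1 r \<Longrightarrow> pderiv_comp P f z \<noteq> 0 \<and> pderiv_comp P g z \<noteq> 0 \<and> poly P (f z) \<noteq> 1 \<and> poly P (g z) \<noteq> 1"
    and eq: "\<And>z. z \<in> ball z1 r \<Longrightarrow> second_order_term P f z = second_order_term P g z"
  obtains \<kappa> c where "\<kappa> \<noteq> 0"
    "\<And>z. z \<in> ball z1 r \<Longrightarrow> poly P (g z) - 1 = \<kappa> * (poly P (f z) - 1) + c * (poly P (f z) - 1) * (poly P (g z) - 1)"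
proof -
  \<comment> \<open>Up to sign, the derivative of \<open>1 / (P(h) - 1)\<close>.\<close>
  define M where "M h z = pderiv_comp P h z / (poly P (h z) - 1)\<^sup>2" for h z
  have dM: "(M h has_field_derivative M h z * second_order_term P h z) (at z)"
    if h: "h holomorphic_on ball z1 r" and z: "z \<in> ball z1 r" and n1: "pderiv_comp P h z \<noteq> 0" and n2: "poly P (h z) \<noteq> 1" for h z
  proof -
    have d1: "(pderiv_comp P h has_field_derivative deriv (pderiv_comp P h) z) (at z)"
      by (rule holomorphic_derivI[OF holomorphic_pderiv_comp[OF h open_ball] open_ball z])
    have d2: "((\<lambda>z. poly P (h z) - 1) has_field_derivative pderiv_comp P h z) (at z)"
      by (rule deriv_poly_comp[OF h open_ball z])
    have d3: "((\<lambda>z. (poly P (h z) - 1)\<^sup>2) has_field_derivative 2 * (poly P (h z) - 1) * pderiv_comp P h z) (at z)"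
    proof -
      have "pderiv_comp P h z * (poly P (h z) - 1) + pderiv_comp P h z * (poly P (h z) - 1) = 2 * (poly P (h z) - 1) * pderiv_comp P h z"
        by (simp add: algebra_simps)
      then show ?thesis using DERIV_mult[OF d2 d2] by (simp only: power2_eq_square)
    qed
    have "(M h has_field_derivative (deriv (pderiv_comp P h) z * (poly P (h z) - 1)\<^sup>2 -
        pderiv_comp P h z * (2 * (poly P (h z) - 1) * pderiv_comp P h z)) / ((poly P (h z) - 1)\<^sup>2 * (poly P (h z) - 1)\<^sup>2)) (at z)"
      unfolding M_def by (rule DERIV_divide[OF d1 d3]) (use n2 in simp)
    moreover have "(deriv (pderiv_comp P h) z * (poly P (h z) - 1)\<^sup>2 -
        pderiv_comp P h z * (2 * (poly P (h z) - 1) * pderiv_comp P h z)) / ((poly P (h z) - 1)\<^sup>2 * (poly P (h z) - 1)\<^sup>2)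
        = M h z * second_order_term P h z"
    proof -
      have gen: "(x * y\<^sup>2 - p * (2 * y * p)) / (y\<^sup>2 * y\<^sup>2) = p / y\<^sup>2 * (x / p - 2 * (p / y))"
        if "p \<noteq> 0" "y \<noteq> 0" for x y p :: complex
        using that by (simp add: field_simps power2_eq_square)
      show ?thesis unfolding M_def second_order_term_def by (rule gen) (use n1 n2 in auto)
    qed
    ultimately show ?thesis by simp
  qed
  have z1: "z1 \<in> ball z1 r" using r by simp
  have Mg0: "M g z \<noteq> 0" and Mf0: "M f z \<noteq> 0" if "z \<in> ball z1 r" for z using nz[OF that] by (auto simp: M_def)
  have "((\<lambda>z. M f z / M g z) has_field_derivative 0) (at z within ball z1 r)" if z: "z \<in> ball z1 r" for z
  proof -
    have "((\<lambda>z. M f z / M g z) has_field_derivative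
       (M f z * second_order_term P f z * M g z - M f z * (M g z * second_order_term P g z)) / (M g z * M g z)) (at z)"
      by (rule DERIV_divide[OF dM[OF f z] dM[OF g z] Mg0[OF z]]) (use nz[OF z] in auto)
    then have "((\<lambda>z. M f z / M g z) has_field_derivative 0) (at z)" using eq[OF z] by simp
    then show ?thesis by (rule has_field_derivative_at_within)
  qed
  then have "\<exists>k. \<forall>z\<in>ball z1 r. M f z / M g z = k"
    by (rule has_field_derivative_zero_constant[OF convex_ball])
  then obtain k where k: "\<And>z. z \<in> ball z1 r \<Longrightarrow> M f z / M g z = k" by blast
  have k0: "k \<noteq> 0" using k[OF z1] Mf0[OF z1] Mg0[OF z1] by auto
  have Mk: "M f z = k * M g z" if "z \<in> ball z1 r" for z using k[OF that] Mg0[OF that] by (simp add: field_simps)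
  define I where "I z = 1 / (poly P (f z) - 1) - k * (1 / (poly P (g z) - 1))" for z
  have "(I has_field_derivative 0) (at z within ball z1 r)" if z: "z \<in> ball z1 r" for z
  proof -
    have inv: "((\<lambda>z. 1 / (poly P (h z) - 1)) has_field_derivative - M h z) (at z)"
      if h: "h holomorphic_on ball z1 r" "poly P (h z) \<noteq> 1" for h
      using DERIV_divide[OF DERIV_const[of 1] deriv_poly_comp[OF h(1) open_ball z, of P]] h(2)
      by (simp add: M_def power2_eq_square)
    have "(I has_field_derivative - M f z - k * (- M g z)) (at z)"
      unfolding I_def by (intro DERIV_diff DERIV_cmult inv f g) (use nz[OF z] in auto)
    then have "(I has_field_derivative 0) (at z)" using Mk[OF z] by simp
    then show ?thesis by (rule has_field_derivative_at_within)
  qed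
  then have "\<exists>k. \<forall>z\<in>ball z1 r. I z = k"
    by (rule has_field_derivative_zero_constant[OF convex_ball])
  then obtain c where c: "\<And>z. z \<in> ball z1 r \<Longrightarrow> I z = c" by blast
  show ?thesis
  proof (rule that[OF k0])
    fix z assume z: "z \<in> ball z1 r"
    have gen: "y = k * x + c * x * y" if "1 / x - k * (1 / y) = c" "x \<noteq> 0" "y \<noteq> 0" for x y :: complex
      using that by (auto simp: field_simps)
    show "poly P (g z) - 1 = k * (poly P (f z) - 1) + c * (poly P (f z) - 1) * (poly P (g z) - 1)"
      by (rule gen) (use c[OF z] nz[OF z] in \<open>auto simp: I_def\<close>)
  qed
qed

section \<open>Growth comparison and zero-free quotients\<close>

lemma remove_sings_eventually_analytic:
  assumes ev: "\<forall>\<^sub>F w in at z. \<phi> w = \<psi> w" and an: "\<psi> analytic_on {z}"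
  shows "\<not> is_pole (remove_sings \<phi>) z" and "remove_sings \<phi> z = \<psi> z"
proof -
  have iso: "isolated_singularity_at \<phi> z"
    using isolated_singularity_at_analytic[OF an] isolated_singularity_at_cong[OF ev refl] by simp
  have "\<not> is_pole \<psi> z" using an analytic_at_imp_no_pole by blast
  then have "\<not> is_pole \<phi> z" using is_pole_cong[OF ev refl] by simp
  then show "\<not> is_pole (remove_sings \<phi>) z" using iso by simp
  show "remove_sings \<phi> z = \<psi> z" using remove_sings_cong[OF ev refl] an by simp
qed

lemma finite_avoided_near:
  fixes z :: complex
  assumes "finite A" "z \<notin> A"
  shows "\<forall>\<^sub>F w in at z. w \<notin> A"
  using eventually_at_in_open'[of "- A" z] assms finite_imp_closed[of A] by (auto simp: open_Compl)

lemma M1_not_frequently: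
  assumes g: "g \<in> M1" and nc: "\<not> (\<exists>\<^sub>F w in at z. g w = c)"
  shows "\<forall>\<^sub>F w in at z. g w \<noteq> c"
  using nc by (simp add: frequently_def)

lemma circle_mean_linear_bound:
  assumes "continuous_on (sphere 0 r) u" "continuous_on (sphere 0 r) v" "continuous_on (sphere 0 r) w"
    and r: "r \<ge> 0" and le: "\<And>z. norm z = r \<Longrightarrow> u z \<le> p * v z + q * w z + k"
  shows "circle_mean r u \<le> p * circle_mean r v + q * circle_mean r w + k"
proof -
  have "circle_mean r u \<le> circle_mean r (\<lambda>z. (p * v z + q * w z) + k)"
    by (rule circle_mean_mono) (use assms in \<open>auto intro!: continuous_intros\<close>)
  also have "\<dots> = circle_mean r (\<lambda>z. p * v z + q * w z) + circle_mean r (\<lambda>z. k)"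
    by (rule circle_mean_add) (use assms in \<open>auto intro!: continuous_intros\<close>)
  also have "circle_mean r (\<lambda>z. p * v z + q * w z) = circle_mean r (\<lambda>z. p * v z) + circle_mean r (\<lambda>z. q * w z)"
    by (rule circle_mean_add) (use assms in \<open>auto intro!: continuous_intros\<close>)
  finally show ?thesis by (simp only: circle_mean_cmult circle_mean_const)
qed

lemma log_plus_power: "x \<ge> 0 \<Longrightarrow> log_plus (x ^ k) = real k * log_plus x"
proof (cases "x = 0")
  case True
  then show ?thesis by (cases k) (auto simp: log_plus_def)
next
  case False
  assume "x \<ge> 0"
  then have "ln (x ^ k) = real k * ln x" using False by (simp add: ln_realpow)
  then show ?thesis by (auto simp: log_plus_def max_def mult_le_0_iff zero_le_mult_iff)
qed

lemma log_plus_shift: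
  fixes x c :: complex
  shows "log_plus (norm (x - c)) \<le> log_plus (norm x) + (log_plus (norm c) + ln 2)"
    and "log_plus (norm x) \<le> log_plus (norm (x - c)) + (log_plus (norm c) + ln 2)"
proof -
  have "log_plus (norm (x - c)) \<le> log_plus (norm x + norm c)"
    by (rule log_plus_mono) (auto intro: norm_triangle_ineq4)
  then show "log_plus (norm (x - c)) \<le> log_plus (norm x) + (log_plus (norm c) + ln 2)"
    using log_plus_add_le[of "norm x" "norm c"] by simp
  have "norm x \<le> norm (x - c) + norm c" using norm_triangle_ineq[of "x - c" c] by simp
  then have "log_plus (norm x) \<le> log_plus (norm (x - c) + norm c)"
    by (intro log_plus_mono) auto
  then show "log_plus (norm x) \<le> log_plus (norm (x - c)) + (log_plus (norm c) + ln 2)"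
    using log_plus_add_le[of "norm (x - c)" "norm c"] by simp
qed

text \<open>
  A non-integer order that is not negative is positive.
\<close>

lemma slow_growth_contradiction:
  assumes f: "f \<in> M1" and ord: "nonint_finite_order f" and C: "C \<ge> 0"
    and slow: "\<And>r. r \<ge> r0 \<Longrightarrow> proximity r f \<le> C * (1 + ln r)\<^sup>2"
  shows False
proof -
  obtain \<rho> where \<rho>: "growth_order f = ereal \<rho>" "\<rho> \<notin> \<int>" using ord by (auto simp: nonint_finite_order_def)
  have "\<rho> \<ge> 0" by (rule growth_order_nonneg[OF f \<rho>(1)])
  moreover have "\<rho> \<noteq> 0" using \<rho>(2) by auto
  ultimately have \<rho>0: "\<rho> > 0" by simp
  define \<sigma> where "\<sigma> = \<rho> / 2"
  have \<sigma>: "0 < \<sigma>" "\<sigma> < \<rho>" "\<sigma> / 2 > 0" using \<rho>0 by (auto simp: \<sigma>_def)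
  show False
  proof (rule proximity_not_le_powr[OF f \<rho>(1) \<sigma>(1,2), of "{}" "max r0 1" "C * (1 + 1 / (\<sigma> / 2))\<^sup>2"])
    fix r assume "r \<ge> max r0 1"
    then have r: "r \<ge> r0" "r \<ge> 1" by auto
    have p1: "1 \<le> r powr (\<sigma> / 2)" using r \<sigma> by (simp add: ge_one_powr_ge_zero)
    have "1 + ln r \<le> (1 + 1 / (\<sigma> / 2)) * r powr (\<sigma> / 2)"
      using ln_le_powr[OF \<sigma>(3) r(2)] p1 by (simp add: distrib_right)
    then have "(1 + ln r)\<^sup>2 \<le> ((1 + 1 / (\<sigma> / 2)) * r powr (\<sigma> / 2))\<^sup>2"
      using r by (intro power_mono) auto
    also have "\<dots> = (1 + 1 / (\<sigma> / 2))\<^sup>2 * r powr \<sigma>"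
      by (simp only: power_mult_distrib) (simp add: power2_eq_square powr_add[symmetric])
    finally have "C * (1 + ln r)\<^sup>2 \<le> C * ((1 + 1 / (\<sigma> / 2))\<^sup>2 * r powr \<sigma>)"
      using C by (rule mult_left_mono)
    then show "proximity r f \<le> C * (1 + 1 / (\<sigma> / 2))\<^sup>2 * r powr \<sigma>"
      using slow[OF r(1)] by (simp add: mult.assoc)
  qed simp
qed

text \<open>
  If \<open>f\<close> took the value \<open>c\<close> only on a finite set, then \<open>f -
  c\<close> would have no zeros and poles outside a finite set, and its growth is that of
  \<open>f\<close>.
\<close>

lemma M1_takes_every_value:
  assumes f: "f \<in> M1" and ord: "nonint_finite_order f" and A: "finite A"
  shows "\<exists>z. z \<notin> A \<and> \<not> is_pole f z \<and> f z = c"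
proof (rule ccontr)
  assume no: "\<not> ?thesis"
  define A' where "A' = A \<union> {z. is_pole f z}"
  define E where "E = remove_sings (\<lambda>z. f z - c)"
  have mer: "f meromorphic_on UNIV" using f by (simp add: M1_def nicely_meromorphic_on_def)
  have En: "E nicely_meromorphic_on UNIV" unfolding E_def
    by (rule remove_sings_nicely_meromorphic) (intro meromorphic_intros mer)
  have Ez: "\<not> is_pole E z \<and> E z = f z - c" if "\<not> is_pole f z" for z
  proof -
    have an: "(\<lambda>z. f z - c) analytic_on {z}" by (intro analytic_intros M1_analytic_at[OF f that])
    show ?thesis unfolding E_def using remove_sings_eventually_analytic[OF _ an, of "\<lambda>z. f z - c"] by simp
  qed
  have EM: "E \<in> M1"
  proof -
    have "{z. is_pole E z} \<subseteq> {z. is_pole f z}" using Ez by auto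
    then show ?thesis using f En by (auto simp: M1_def intro: finite_subset)
  qed
  obtain r1 where r1: "r1 \<ge> 1" "\<And>r. r \<ge> r1 \<Longrightarrow> continuous_on (sphere 0 r) f"
    "\<And>r z. r \<ge> r1 \<Longrightarrow> norm z = r \<Longrightarrow> \<not> is_pole f z"
    by (rule proximity_nonneg_M1[OF f]) (rule that; assumption)
  obtain r2 where r2: "r2 \<ge> 1" "\<And>r. r \<ge> r2 \<Longrightarrow> continuous_on (sphere 0 r) E"
    by (rule proximity_nonneg_M1[OF EM]) (rule that; assumption)
  define K where "K = log_plus (norm c) + ln 2"
  have K: "K \<ge> 0" by (simp add: K_def add_nonneg_nonneg)
  have bnd: "x \<le> (1 + K) * (1 + l + y)" if "x \<le> 1 * y + 0 * y' + K" "l \<ge> 0" "y \<ge> 0" for x y y' l :: real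
  proof -
    have "K * 1 \<le> K * (1 + l + y)" using K that by (intro mult_left_mono) auto
    then show ?thesis using that by (simp add: distrib_right)
  qed
  show False
  proof (rule zero_free_meromorphic_contradiction[OF f ord En, of A' "{}" "max r1 r2" "1 + K"])
    show "finite A'" using A f by (simp add: A'_def M1_def)
    show "\<not> is_pole E z \<and> E z \<noteq> 0" if "z \<notin> A'" for z
      using that no Ez[of z] by (auto simp: A'_def)
    show "1 + K \<ge> 0" using K by simp
    fix r assume r: "r \<ge> max r1 r2"
    then have rp: "r \<ge> 0" "ln r \<ge> 0" using r1 by auto
    have cf: "continuous_on (sphere 0 r) (\<lambda>z. log_plus (norm (f z)))"
      and cE: "continuous_on (sphere 0 r) (\<lambda>z. log_plus (norm (E z)))"
      using r by (intro continuous_intros r1 r2; simp)+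
    have E: "E z = f z - c" if "norm z = r" for z using Ez[of z] r1(3)[of r z] that r by simp
    show "circle_mean r (\<lambda>z. log_plus (norm (E z))) \<le> (1 + K) * (1 + ln r + proximity r f)"
    proof (rule bnd)
      show "circle_mean r (\<lambda>z. log_plus (norm (E z))) \<le> 1 * proximity r f + 0 * proximity r f + K"
        unfolding proximity_eq_circle_mean
        by (rule circle_mean_linear_bound[OF cE cf cf rp(1)]) (use E log_plus_shift(1) in \<open>simp add: K_def\<close>)
      show "proximity r f \<ge> 0" unfolding proximity_eq_circle_mean by (rule circle_mean_nonneg[OF cf rp(1)]) simp
    qed (rule rp)
    show "proximity r f \<le> (1 + K) * (1 + ln r + circle_mean r (\<lambda>z. log_plus (norm (E z))))"
    proof (rule bnd)
      show "proximity r f \<le> 1 * circle_mean r (\<lambda>z. log_plus (norm (E z))) + 0 * circle_mean r (\<lambda>z. log_plus (norm (E z))) + K"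
        unfolding proximity_eq_circle_mean
        by (rule circle_mean_linear_bound[OF cf cE cE rp(1)]) (use E log_plus_shift(2)[of "f _" c] in \<open>simp add: K_def\<close>)
      show "circle_mean r (\<lambda>z. log_plus (norm (E z))) \<ge> 0" by (rule circle_mean_nonneg[OF cE rp(1)]) simp
    qed (rule rp)
  qed simp
qed

lemma M1_reciprocal_mean:
  assumes g: "g \<in> M1" and w: "\<not> is_pole g w" "g w \<noteq> c"
  obtains B C r0 where "countable B" "C \<ge> 0" "r0 \<ge> 1"
    "\<And>r z. r \<ge> r0 \<Longrightarrow> r \<notin> B \<Longrightarrow> norm z = r \<Longrightarrow> \<not> is_pole g z \<and> g z \<noteq> c"
    "\<And>r. r \<ge> r0 \<Longrightarrow> continuous_on (sphere 0 r) g"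
    "\<And>r. r \<ge> r0 \<Longrightarrow> r \<notin> B \<Longrightarrow>
      circle_mean r (\<lambda>z. log_plus (1 / norm (g z - c))) \<le> proximity r g + C * (1 + ln r)"
proof -
  obtain u d where ud: "u holomorphic_on UNIV" "d \<noteq> 0" "\<And>z. poly d z = 0 \<Longrightarrow> is_pole g z"
    "\<And>z. \<not> is_pole g z \<Longrightarrow> g z = u z / poly d z"
    by (rule M1_quotient[OF g]) (rule that; assumption)
  define \<phi> where "\<phi> = (\<lambda>z. u z - c * poly d z)"
  have hol: "\<phi> holomorphic_on UNIV" unfolding \<phi>_def by (intro holomorphic_intros ud)
  have gc: "g z - c = \<phi> z / poly d z" if "\<not> is_pole g z" for z
  proof -
    have "poly d z \<noteq> 0" using ud(3) that by blast
    then show ?thesis unfolding ud(4)[OF that] \<phi>_def by (simp add: field_simps)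
  qed
  have nz: "\<phi> w \<noteq> 0" using gc[OF w(1)] w(2) by auto
  obtain C1 r1 where 1: "C1 \<ge> 0" "r1 \<ge> 1" "\<And>r. r \<ge> r1 \<Longrightarrow> r \<notin> norm ` {z. \<phi> z = 0} \<Longrightarrow>
    circle_mean r (\<lambda>z. log_plus (1 / norm (\<phi> z / poly d z))) \<le>
      circle_mean r (\<lambda>z. log_plus (norm (\<phi> z / poly d z))) + C1 * (1 + ln r)"
    by (rule reciprocal_mean_bound[OF hol nz ud(2)]) (rule that; assumption)
  obtain r2 where r2: "r2 \<ge> 1" "\<And>r. r \<ge> r2 \<Longrightarrow> continuous_on (sphere 0 r) g"
    "\<And>r z. r \<ge> r2 \<Longrightarrow> norm z = r \<Longrightarrow> \<not> is_pole g z"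
    by (rule proximity_nonneg_M1[OF g]) (rule that; assumption)
  define K where "K = log_plus (norm c) + ln 2"
  have K: "K \<ge> 0" by (simp add: K_def add_nonneg_nonneg)
  show ?thesis
  proof (rule that[of "norm ` {z. \<phi> z = 0}" "C1 + K" "max r1 r2"])
    show "countable (norm ` {z. \<phi> z = 0})" by (rule countable_zero_radii[OF hol nz])
    show "C1 + K \<ge> 0" using 1 K by simp
    show "max r1 r2 \<ge> 1" using 1 by simp
    show "continuous_on (sphere 0 r) g" if "r \<ge> max r1 r2" for r using r2 that by simp
    show "\<not> is_pole g z \<and> g z \<noteq> c" if "r \<ge> max r1 r2" "r \<notin> norm ` {z. \<phi> z = 0}" "norm z = r" for r z
    proof -
      have "\<not> is_pole g z" using r2(3)[of r z] that by simp
      moreover have "\<phi> z \<noteq> 0" using that(2,3) by auto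
      ultimately show ?thesis using gc[of z] ud(3)[of z] by auto
    qed
    fix r assume r: "r \<ge> max r1 r2" "r \<notin> norm ` {z. \<phi> z = 0}"
    have rp: "r \<ge> 0" "ln r \<ge> 0" using r 1 by auto
    have gcr: "g z - c = \<phi> z / poly d z" if "norm z = r" for z using gc[of z] r2(3)[of r z] that r by simp
    have cg: "continuous_on (sphere 0 r) g" using r r2 by simp
    have "circle_mean r (\<lambda>z. log_plus (1 / norm (g z - c))) = circle_mean r (\<lambda>z. log_plus (1 / norm (\<phi> z / poly d z)))"
      by (rule circle_mean_cong) (use gcr rp in auto)
    also have "\<dots> \<le> circle_mean r (\<lambda>z. log_plus (norm (\<phi> z / poly d z))) + C1 * (1 + ln r)"
      using 1(3) r by simp
    also have "circle_mean r (\<lambda>z. log_plus (norm (\<phi> z / poly d z))) = circle_mean r (\<lambda>z. log_plus (norm (g z - c)))"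
      by (rule circle_mean_cong) (use gcr rp in auto)
    also have "\<dots> \<le> 1 * circle_mean r (\<lambda>z. log_plus (norm (g z))) + 0 * circle_mean r (\<lambda>z. log_plus (norm (g z))) + K"
      by (rule circle_mean_linear_bound) (use rp log_plus_shift(1)[of "g _" c] in \<open>auto intro!: continuous_intros cg simp: K_def\<close>)
    finally have "circle_mean r (\<lambda>z. log_plus (1 / norm (g z - c))) \<le> proximity r g + K + C1 * (1 + ln r)"
      by (simp add: proximity_eq_circle_mean)
    moreover have "K * 1 \<le> K * (1 + ln r)" using K rp by (intro mult_left_mono) auto
    ultimately show "circle_mean r (\<lambda>z. log_plus (1 / norm (g z - c))) \<le> proximity r g + (C1 + K) * (1 + ln r)"
      by (simp add: distrib_right)
  qed
qed

lemma norm_lower_coeff_sum: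
  fixes c :: "nat \<Rightarrow> complex"
  assumes "norm y \<ge> 1" "n \<ge> 1"
  shows "norm (\<Sum>k<n. c k * y ^ k) \<le> (\<Sum>k<n. norm (c k)) * norm y ^ (n - 1)"
proof -
  have "norm (\<Sum>k<n. c k * y ^ k) \<le> (\<Sum>k<n. norm (c k * y ^ k))" by (rule norm_sum)
  also have "\<dots> \<le> (\<Sum>k<n. norm (c k) * norm y ^ (n - 1))"
    unfolding norm_mult norm_power using assms by (intro sum_mono mult_left_mono power_increasing) auto
  finally show ?thesis by (simp add: sum_distrib_right)
qed

text \<open>
  The bound is only needed where \<open>y\<close> is large, since \<open>log_plus\<close> ignores
  the rest.
\<close>

lemma log_plus_scaled:
  assumes le: "norm (y :: complex) \<ge> 1 \<Longrightarrow> norm y \<le> K * x" and K: "K \<ge> 0" and x: "x \<ge> 0"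
  shows "log_plus (norm y) \<le> log_plus K + log_plus x"
proof (cases "norm y \<ge> 1")
  case True
  have "log_plus (norm y) \<le> log_plus (K * x)" by (rule log_plus_mono) (use le True in auto)
  then show ?thesis using log_plus_mult_le[OF K x] by linarith
next
  case False
  then have "log_plus (norm y) = 0" by (simp add: log_plus_eq_ln_max max_def)
  moreover have "log_plus K \<ge> 0" "log_plus x \<ge> 0" by simp_all
  ultimately show ?thesis by linarith
qed

text \<open>
  The leading monomial dominates: \<open>\<bar>y\<bar>\<close> is at most a constant times
  \<open>max 1 \<bar>x\<bar>\<close>.
\<close>

lemma affine_equal_values_growth:
  fixes P :: "complex poly"
  assumes n: "degree P \<ge> 1"
  obtains C where "C \<ge> 0"
    "\<And>x y. poly P y = \<kappa> * poly P x + \<mu> \<Longrightarrow> log_plus (norm y) \<le> log_plus (norm x) + C"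
proof -
  define n where "n = degree P"
  define l where "l = norm (coeff P n)"
  have l: "l > 0" using n by (auto simp: l_def n_def)
  define S where "S = (\<Sum>k<n. norm (coeff P k))"
  have S0: "S \<ge> 0" unfolding S_def by (rule sum_nonneg) simp
  define T where "T = norm \<kappa> * (S + l) + norm \<mu> + S"
  have T0: "T \<ge> 0" using S0 l by (simp add: T_def)
  have split: "poly P x = (\<Sum>k<n. coeff P k * x ^ k) + coeff P n * x ^ n" for x
    unfolding poly_altdef n_def by (simp add: lessThan_Suc_atMost[symmetric])
  define K where "K = max 1 (T / l)"
  have K: "K \<ge> 1" "K \<ge> T / l" by (auto simp: K_def)
  show ?thesis
  proof (rule that[of "log_plus K"])
    fix x y assume eq: "poly P y = \<kappa> * poly P x + \<mu>"
    define X where "X = max 1 (norm x)"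
    have X: "X \<ge> 1" "norm x \<le> X" by (auto simp: X_def)
    have Px: "norm (poly P x) \<le> (S + l) * X ^ n"
    proof -
      have "norm (poly P x) \<le> (\<Sum>k\<le>n. norm (coeff P k * x ^ k))"
        unfolding poly_altdef n_def by (rule norm_sum)
      also have "\<dots> \<le> (\<Sum>k\<le>n. norm (coeff P k) * X ^ n)"
      proof (rule sum_mono)
        fix k assume k: "k \<in> {..n}"
        have "norm x ^ k \<le> X ^ k" using X by (intro power_mono) auto
        also have "\<dots> \<le> X ^ n" using X k by (intro power_increasing) auto
        finally show "norm (coeff P k * x ^ k) \<le> norm (coeff P k) * X ^ n"
          unfolding norm_mult norm_power by (intro mult_left_mono) auto
      qed
      also have "\<dots> = (\<Sum>k\<le>n. norm (coeff P k)) * X ^ n" by (simp add: sum_distrib_right)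
      also have "(\<Sum>k\<le>n. norm (coeff P k)) = S + l" by (simp add: S_def l_def lessThan_Suc_atMost[symmetric])
      finally show ?thesis .
    qed
    have "norm y \<le> K * X" if y: "norm y \<ge> 1"
    proof (cases "norm y \<le> X")
      case True
      have "1 * X \<le> K * X" using K X by (intro mult_right_mono) auto
      then show ?thesis using True by simp
    next
      case False
      then have Xy: "X \<le> norm y" by simp
      have n1: "n \<ge> 1" using n by (simp add: n_def)
      have yn: "norm y ^ n = norm y ^ (n - 1) * norm y" using n1 by (simp flip: power_Suc2)
      have Xn: "X ^ n \<le> norm y ^ (n - 1) * X"
      proof -
        have "X ^ n = X ^ (n - 1) * X" using n1 by (simp flip: power_Suc2)
        also have "\<dots> \<le> norm y ^ (n - 1) * X" using X Xy by (intro mult_right_mono power_mono) auto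
        finally show ?thesis .
      qed
      have y1: "norm y ^ (n - 1) \<le> norm y ^ (n - 1) * X" using X mult_left_mono[of 1 X "norm y ^ (n - 1)"] by simp
      have y2: "1 \<le> norm y ^ (n - 1) * X" using y X by (meson mult_ge1_I one_le_power)
      have "coeff P n * y ^ n = \<kappa> * poly P x + \<mu> - (\<Sum>k<n. coeff P k * y ^ k)" using split[of y] eq by simp
      then have "norm (coeff P n * y ^ n) \<le> norm (\<kappa> * poly P x + \<mu>) + norm (\<Sum>k<n. coeff P k * y ^ k)"
        by (simp only: norm_triangle_ineq4)
      also have "\<dots> \<le> norm \<kappa> * norm (poly P x) + norm \<mu> + S * norm y ^ (n - 1)"
        using norm_triangle_ineq[of "\<kappa> * poly P x" \<mu>] norm_lower_coeff_sum[OF y n1, of "coeff P"]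
        by (simp add: S_def norm_mult)
      also have "\<dots> \<le> norm \<kappa> * ((S + l) * (norm y ^ (n - 1) * X)) + norm \<mu> * (norm y ^ (n - 1) * X) + S * (norm y ^ (n - 1) * X)"
      proof (intro add_mono mult_left_mono)
        show "norm (poly P x) \<le> (S + l) * (norm y ^ (n - 1) * X)"
          using Px mult_left_mono[OF Xn, of "S + l"] S0 l by linarith
        show "norm \<mu> \<le> norm \<mu> * (norm y ^ (n - 1) * X)" using mult_left_mono[OF y2, of "norm \<mu>"] by simp
      qed (use S0 y1 in auto)
      also have "\<dots> = norm y ^ (n - 1) * (T * X)" by (simp add: T_def algebra_simps)
      finally have "norm y ^ (n - 1) * (l * norm y) \<le> norm y ^ (n - 1) * (T * X)"
        by (simp add: norm_mult norm_power l_def yn mult_ac)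
      moreover have "0 < norm y ^ (n - 1)" by (rule zero_less_power) (use y in linarith)
      ultimately have "l * norm y \<le> T * X" by (rule mult_left_le_imp_le)
      then have "norm y \<le> T / l * X" using l by (simp add: field_simps)
      also have "\<dots> \<le> K * X" using K X by (intro mult_right_mono) auto
      finally show ?thesis .
    qed
    then have "log_plus (norm y) \<le> log_plus K + log_plus X"
      by (rule log_plus_scaled) (use K X in auto)
    also have "log_plus X = log_plus (norm x)" by (simp add: X_def log_plus_eq_ln_max)
    finally show "log_plus (norm y) \<le> log_plus (norm x) + log_plus K" by simp
  qed simp
qed

text \<open>
  Let \<open>n\<close> be the degree.  In the expansion of \<open>P(b + t y) = P(b + y)\<close> in
  powers of \<open>y\<close>, the top terms give \<open>(t\<^sup>n - 1) y\<^sup>n\<close> as a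
  combination of lower powers of \<open>y\<close>.  So \<open>y\<close> is controlled by
  \<open>t\<close> and \<open>1 / (t\<^sup>n - 1)\<close>.  The latter is replaced by \<open>1 /
  (t\<^bsup>a n\<^esup> - 1)\<close>, since it is the power \<open>t\<^bsup>a n\<^esup>\<close> that
  extends to a zero-free function.
\<close>

lemma equal_values_ratio_growth:
  fixes P :: "complex poly"
  assumes n: "degree P \<ge> 1" and a: "a \<ge> 1"
  obtains C where "C \<ge> 0"
    "\<And>t y. poly P (b + t * y) = poly P (b + y) \<Longrightarrow> t ^ (a * degree P) \<noteq> 1 \<Longrightarrow>
       log_plus (norm (b + t * y)) \<le> C * (1 + log_plus (norm (t ^ (a * degree P)))) + log_plus (1 / norm (t ^ (a * degree P) - 1))"
proof -
  define n where "n = degree P"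
  have n1: "n \<ge> 1" using n by (simp add: n_def)
  define R where "R = pcompose P [:b, 1:]"
  have degR: "degree R = n" by (simp add: R_def n_def degree_pcompose)
  have R: "poly R x = poly P (b + x)" for x by (simp add: R_def poly_pcompose)
  define l where "l = norm (coeff R n)"
  have l: "l > 0" using n1 degR by (auto simp: l_def)
  have split: "poly R x = (\<Sum>k<n. coeff R k * x ^ k) + coeff R n * x ^ n" for x
    unfolding poly_altdef degR by (simp add: lessThan_Suc_atMost[symmetric])
  define S where "S = (\<Sum>k<n. 2 * norm (coeff R k))"
  have S0: "S \<ge> 0" unfolding S_def by (rule sum_nonneg) simp
  define N where "N = a * n"
  have N1: "N \<ge> 1" using a n1 by (simp add: N_def)
  define K where "K = real a * S / l"
  have K0: "K \<ge> 0" using S0 l by (simp add: K_def)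
  define D where "D = log_plus K + log_plus (norm b) + ln 2"
  have D0: "D \<ge> 0" by (simp add: D_def add_nonneg_nonneg)
  define C where "C = D + real (n + N) + 1"
  have C0: "C \<ge> 0" using D0 by (simp add: C_def)
  show ?thesis
  proof (rule that[OF C0])
    fix t y assume eq: "poly P (b + t * y) = poly P (b + y)" and t: "t ^ (a * degree P) \<noteq> 1"
    have tN: "t ^ N \<noteq> 1" using t by (simp add: N_def n_def)
    define M where "M = max 1 (norm t)"
    have M: "M \<ge> 1" "norm t \<le> M" by (auto simp: M_def)
    define e where "e = norm (t ^ N - 1)"
    have e: "e > 0" using tN by (simp add: e_def)
    have tkM: "norm (t ^ k - 1) \<le> 2 * M ^ n" if "k \<le> n" for k
    proof -
      have "norm t ^ k \<le> M ^ k" using M by (intro power_mono) auto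
      also have "\<dots> \<le> M ^ n" using M that by (intro power_increasing) auto
      finally have "norm (t ^ k) \<le> M ^ n" by (simp add: norm_power)
      moreover have "1 \<le> M ^ n" using M by simp
      ultimately show ?thesis using norm_triangle_ineq4[of "t ^ k" 1] by simp
    qed
    have eM: "e \<le> norm (t ^ n - 1) * (real a * M ^ N)"
    proof -
      have "t ^ N - 1 = (t ^ n) ^ a - 1" by (simp add: N_def power_mult[symmetric] mult.commute)
      also have "\<dots> = (t ^ n - 1) * (\<Sum>i<a. (t ^ n) ^ i)" by (rule power_diff_1_eq)
      finally have "e = norm (t ^ n - 1) * norm (\<Sum>i<a. (t ^ n) ^ i)" by (simp add: e_def norm_mult)
      also have "norm (\<Sum>i<a. (t ^ n) ^ i) \<le> (\<Sum>i<a. norm ((t ^ n) ^ i))" by (rule norm_sum)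
      also have "\<dots> \<le> (\<Sum>i<a. M ^ N)"
      proof (rule sum_mono)
        fix i assume i: "i \<in> {..<a}"
        have "norm ((t ^ n) ^ i) = norm t ^ (n * i)" by (simp add: norm_power power_mult)
        also have "\<dots> \<le> M ^ (n * i)" using M by (intro power_mono) auto
        also have "\<dots> \<le> M ^ N" using M i by (intro power_increasing) (auto simp: N_def mult.commute)
        finally show "norm ((t ^ n) ^ i) \<le> M ^ N" .
      qed
      finally show ?thesis by (simp add: mult_left_mono)
    qed
    have "norm y \<le> K * (M ^ (n + N) * (1 / e))" if y: "norm y \<ge> 1"
    proof -
      have "(\<Sum>k<n. coeff R k * (t * y) ^ k) + coeff R n * (t * y) ^ n = (\<Sum>k<n. coeff R k * y ^ k) + coeff R n * y ^ n"
        using eq R split by metis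
      then have "coeff R n * (t ^ n - 1) * y ^ n = - ((\<Sum>k<n. coeff R k * (t * y) ^ k) - (\<Sum>k<n. coeff R k * y ^ k))"
        by (simp add: power_mult_distrib algebra_simps)
      also have "(\<Sum>k<n. coeff R k * (t * y) ^ k) - (\<Sum>k<n. coeff R k * y ^ k) = (\<Sum>k<n. (coeff R k * (t ^ k - 1)) * y ^ k)"
        unfolding sum_subtractf[symmetric] by (rule sum.cong) (simp_all add: power_mult_distrib algebra_simps)
      finally have "norm (coeff R n * (t ^ n - 1) * y ^ n) = norm (\<Sum>k<n. (coeff R k * (t ^ k - 1)) * y ^ k)"
        by simp
      also have "\<dots> \<le> (\<Sum>k<n. norm (coeff R k * (t ^ k - 1))) * norm y ^ (n - 1)"
        by (rule norm_lower_coeff_sum[OF y n1])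
      also have "\<dots> \<le> (S * M ^ n) * norm y ^ (n - 1)"
      proof (rule mult_right_mono)
        have "(\<Sum>k<n. norm (coeff R k * (t ^ k - 1))) \<le> (\<Sum>k<n. 2 * norm (coeff R k) * M ^ n)"
        proof (rule sum_mono)
          fix k assume "k \<in> {..<n}"
          then have "norm (coeff R k) * norm (t ^ k - 1) \<le> norm (coeff R k) * (2 * M ^ n)"
            using tkM[of k] by (intro mult_left_mono) auto
          then show "norm (coeff R k * (t ^ k - 1)) \<le> 2 * norm (coeff R k) * M ^ n" by (simp add: norm_mult mult_ac)
        qed
        then show "(\<Sum>k<n. norm (coeff R k * (t ^ k - 1))) \<le> S * M ^ n" by (simp add: S_def sum_distrib_right)
      qed simp
      finally have 1: "norm y ^ (n - 1) * (l * norm (t ^ n - 1) * norm y) \<le> norm y ^ (n - 1) * (S * M ^ n)"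
      proof -
        assume h: "norm (coeff R n * (t ^ n - 1) * y ^ n) \<le> (S * M ^ n) * norm y ^ (n - 1)"
        have yn: "norm y ^ n = norm y ^ (n - 1) * norm y" using n1 by (simp flip: power_Suc2)
        have "norm (coeff R n * (t ^ n - 1) * y ^ n) = l * norm (t ^ n - 1) * norm y ^ n"
          by (simp only: norm_mult norm_power l_def)
        then show ?thesis using h yn by (simp add: mult_ac)
      qed
      have 2: "l * norm (t ^ n - 1) * norm y \<le> S * M ^ n"
        by (rule mult_left_le_imp_le[OF 1], rule zero_less_power) (use y in linarith)
      have "l * (e * norm y) \<le> l * ((norm (t ^ n - 1) * (real a * M ^ N)) * norm y)"
        using eM l by (intro mult_left_mono mult_right_mono) auto
      also have "\<dots> = (l * norm (t ^ n - 1) * norm y) * (real a * M ^ N)" by (simp add: mult_ac)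
      also have "\<dots> \<le> (S * M ^ n) * (real a * M ^ N)" using 2 M by (intro mult_right_mono) auto
      finally have "l * (e * norm y) \<le> real a * S * M ^ (n + N)" by (simp add: power_add mult_ac)
      then show ?thesis using l e by (simp add: K_def field_simps)
    qed
    then have "log_plus (norm y) \<le> log_plus K + log_plus (M ^ (n + N) * (1 / e))"
      by (rule log_plus_scaled) (use K0 M e in auto)
    also have "log_plus (M ^ (n + N) * (1 / e)) \<le> log_plus (M ^ (n + N)) + log_plus (1 / e)"
      by (rule log_plus_mult_le) (use M e in auto)
    also have "log_plus (M ^ (n + N)) = real (n + N) * log_plus M" by (rule log_plus_power) (use M in auto)
    also have "log_plus M = log_plus (norm t)" by (simp add: M_def log_plus_eq_ln_max)
    finally have ly: "log_plus (norm y) \<le> log_plus K + real (n + N) * log_plus (norm t) + log_plus (1 / e)" by simp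
    have lt: "log_plus (norm t) \<le> log_plus (norm (t ^ N))"
    proof -
      have "1 * log_plus (norm t) \<le> real N * log_plus (norm t)" using N1 by (intro mult_right_mono) auto
      then show ?thesis by (simp add: norm_power log_plus_power)
    qed
    have "norm (b + t * y) \<le> norm t * norm y + norm b" using norm_triangle_ineq[of "t * y" b] by (simp add: norm_mult add.commute)
    then have "log_plus (norm (b + t * y)) \<le> log_plus (norm t * norm y + norm b)" by (intro log_plus_mono) auto
    also have "\<dots> \<le> log_plus (norm t * norm y) + log_plus (norm b) + ln 2" by (rule log_plus_add_le) auto
    also have "log_plus (norm t * norm y) \<le> log_plus (norm t) + log_plus (norm y)" by (rule log_plus_mult_le) auto
    finally have "log_plus (norm (b + t * y)) \<le> D + real (n + N) * log_plus (norm t) + log_plus (norm t) + log_plus (1 / e)"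
      using ly by (simp add: D_def)
    also have "\<dots> = D + (real (n + N) + 1) * log_plus (norm t) + log_plus (1 / e)" by (simp add: distrib_right)
    also have "\<dots> \<le> D + (real (n + N) + 1) * log_plus (norm (t ^ N)) + log_plus (1 / e)"
      using lt by (intro add_mono mult_left_mono) auto
    also have "\<dots> \<le> C * (1 + log_plus (norm (t ^ N))) + log_plus (1 / e)"
    proof -
      have "0 \<le> D * log_plus (norm (t ^ N))" using D0 by simp
      then show ?thesis by (simp add: C_def algebra_simps)
    qed
    finally show "log_plus (norm (b + t * y)) \<le> C * (1 + log_plus (norm (t ^ (a * degree P)))) + log_plus (1 / norm (t ^ (a * degree P) - 1))"
      by (simp add: e_def N_def n_def)
  qed
qed

text \<open>
  Where \<open>f - b1\<close> and \<open>g - c\<close> vanish together, the quotient of the powers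
  is \<open>R(g) / Q(f)\<close>, which is regular and non-zero there.  The means of its logarithm
  are bounded by those of \<open>f\<close> and \<open>g\<close>, hence by the proximity function of
  \<open>f\<close>.
\<close>

lemma zero_free_quotient:
  assumes fM: "f \<in> M1" and gM: "g \<in> M1" and A: "finite A" "\<And>z. z \<notin> A \<Longrightarrow> \<not> is_pole f z \<and> \<not> is_pole g z"
    and gnc: "\<And>z c. \<not> (\<exists>\<^sub>F w in at z. g w = c)"
    and ab: "a \<ge> 1" "b \<ge> 1"
    and iff: "\<And>z. z \<notin> A \<Longrightarrow> f z = b1 \<longleftrightarrow> g z = c"
    and eq: "\<And>z. z \<notin> A \<Longrightarrow> (f z - b1) ^ a * poly Q (f z) = (g z - c) ^ b * poly R (g z)"
    and QR: "poly Q b1 \<noteq> 0" "poly R c \<noteq> 0"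
    and C1: "C1 \<ge> 0" "\<And>z. z \<notin> A \<Longrightarrow> log_plus (norm (g z)) \<le> log_plus (norm (f z)) + C1"
  obtains E B C r0 where "E \<in> M1" "\<And>z. z \<notin> A \<Longrightarrow> \<not> is_pole E z \<and> E z \<noteq> 0"
    "\<And>z. z \<notin> A \<Longrightarrow> g z \<noteq> c \<Longrightarrow> E z = (f z - b1) ^ a / (g z - c) ^ b"
    "countable B" "C \<ge> 0" "r0 \<ge> 1" "\<And>r z. r \<ge> r0 \<Longrightarrow> r \<notin> B \<Longrightarrow> norm z = r \<Longrightarrow> z \<notin> A \<and> g z \<noteq> c"
    "\<And>r. r \<ge> r0 \<Longrightarrow> continuous_on (sphere 0 r) f" "\<And>r. r \<ge> r0 \<Longrightarrow> continuous_on (sphere 0 r) E"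
    "\<And>r. r \<ge> r0 \<Longrightarrow> r \<notin> B \<Longrightarrow> circle_mean r (\<lambda>z. log_plus (norm (E z))) \<le> C * (1 + ln r + proximity r f)"
proof -
  define q where "q = (\<lambda>z. (f z - b1) ^ a / (g z - c) ^ b)"
  define E where "E = remove_sings q"
  have mer: "f meromorphic_on UNIV" "g meromorphic_on UNIV"
    using fM gM by (simp_all add: M1_def nicely_meromorphic_on_def)
  have En: "E nicely_meromorphic_on UNIV" unfolding E_def q_def
    by (rule remove_sings_nicely_meromorphic) (intro meromorphic_intros mer)
  have fan: "f analytic_on {z}" and gan: "g analytic_on {z}" if "z \<notin> A" for z
    using A(2)[OF that] M1_analytic_at fM gM by auto
  have Eq: "\<not> is_pole E z \<and> E z = q z" if z: "z \<notin> A" "g z \<noteq> c" for z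
  proof -
    have an: "q analytic_on {z}" unfolding q_def
      by (intro analytic_intros fan gan z(1)) (use z ab in auto)
    show ?thesis unfolding E_def using remove_sings_eventually_analytic[OF _ an, of q] by simp
  qed
  have Enz: "\<not> is_pole E z \<and> E z \<noteq> 0" if z: "z \<notin> A" for z
  proof (cases "g z = c")
    case False
    then show ?thesis using Eq[OF z False] iff[OF z] by (simp add: q_def)
  next
    case True
    then have fz: "f z = b1" using iff[OF z] by simp
    have an: "(\<lambda>w. poly R (g w) / poly Q (f w)) analytic_on {z}"
      by (intro analytic_intros analytic_poly_comp fan gan z) (use QR fz in auto)
    have "(\<lambda>w. poly Q (f w)) analytic_on {z}" by (intro analytic_poly_comp fan z)
    then have "isCont (\<lambda>w. poly Q (f w)) z" by (rule analytic_at_imp_isCont)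
    then have "((\<lambda>w. poly Q (f w)) \<longlongrightarrow> poly Q (f z)) (at z)" by (simp add: isCont_def)
    then have e1: "\<forall>\<^sub>F w in at z. poly Q (f w) \<noteq> 0"
      by (rule tendsto_imp_eventually_ne) (use QR fz in auto)
    have e2: "\<forall>\<^sub>F w in at z. g w \<noteq> c" by (rule M1_not_frequently[OF gM gnc])
    have "\<forall>\<^sub>F w in at z. q w = poly R (g w) / poly Q (f w)"
      using e1 e2 finite_avoided_near[OF A(1) z]
    proof eventually_elim
      case (elim w)
      then show ?case using eq[of w] by (simp add: q_def field_simps)
    qed
    then show ?thesis using remove_sings_eventually_analytic[OF _ an] QR True fz by (simp add: E_def)
  qed
  have EM: "E \<in> M1"
  proof -
    have "{z. is_pole E z} \<subseteq> A" using Enz by auto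
    then show ?thesis using A En by (auto simp: M1_def intro: finite_subset)
  qed
  have "A \<noteq> UNIV" using A(1) infinite_UNIV_char_0[where ?'a = complex] by auto
  then obtain z0 where z0: "z0 \<notin> A" by blast
  have "\<exists>w. \<not> is_pole g w \<and> g w \<noteq> c"
  proof -
    have "\<forall>\<^sub>F w in at z0. w \<notin> A \<and> g w \<noteq> c"
      using finite_avoided_near[OF A(1) z0] M1_not_frequently[OF gM gnc] by eventually_elim simp
    then have "\<exists>w. w \<notin> A \<and> g w \<noteq> c" by (rule eventually_happens'[rotated]) simp
    then show ?thesis using A(2) by blast
  qed
  then obtain w where w: "\<not> is_pole g w" "g w \<noteq> c" by blast
  obtain B C0 r0 where g1: "countable B" "C0 \<ge> 0" "r0 \<ge> 1"
    "\<And>r z. r \<ge> r0 \<Longrightarrow> r \<notin> B \<Longrightarrow> norm z = r \<Longrightarrow> \<not> is_pole g z \<and> g z \<noteq> c"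
    "\<And>r. r \<ge> r0 \<Longrightarrow> continuous_on (sphere 0 r) g"
    "\<And>r. r \<ge> r0 \<Longrightarrow> r \<notin> B \<Longrightarrow>
      circle_mean r (\<lambda>z. log_plus (1 / norm (g z - c))) \<le> proximity r g + C0 * (1 + ln r)"
    by (rule M1_reciprocal_mean[OF gM w]) (rule that; assumption)
  obtain r1 where r1: "r1 \<ge> 1" "\<And>r. r \<ge> r1 \<Longrightarrow> proximity r f \<ge> 0" "\<And>r. r \<ge> r1 \<Longrightarrow> continuous_on (sphere 0 r) f"
    by (rule proximity_nonneg_M1[OF fM]) (rule that; assumption)
  obtain r2 where r2: "r2 \<ge> 1" "\<And>r. r \<ge> r2 \<Longrightarrow> continuous_on (sphere 0 r) E"
    by (rule proximity_nonneg_M1[OF EM]) (rule that; assumption)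
  have "bounded A" using A(1) by (rule finite_imp_bounded)
  then obtain r3 where r3: "\<And>z. z \<in> A \<Longrightarrow> norm z \<le> r3" by (auto simp: bounded_iff)
  define rr where "rr = Max {r0, r1, r2, r3 + 1}"
  have rr: "rr \<ge> r0" "rr \<ge> r1" "rr \<ge> r2" "rr \<ge> r3 + 1" by (auto simp: rr_def)
  have big: "r \<ge> r0" "r \<ge> r1" "r \<ge> r2" "r \<ge> r3 + 1" if "r \<ge> rr" for r using rr that by linarith+
  have out: "z \<notin> A \<and> g z \<noteq> c" if "r \<ge> rr" "r \<notin> B" "norm z = r" for r z
    using g1(4)[OF big(1)[OF that(1)] that(2,3)] r3[of z] big(4)[OF that(1)] that(3) by auto
  define K where "K = log_plus (norm b1) + ln 2"
  have K0: "K \<ge> 0" by (simp add: K_def add_nonneg_nonneg)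
  define C where "C = real a + real a * K + real b * (1 + C1 + C0)"
  have C0: "C \<ge> 0" using K0 C1 g1(2) by (simp add: C_def)
  have mean: "circle_mean r (\<lambda>z. log_plus (norm (E z))) \<le> C * (1 + ln r + proximity r f)" if r: "r \<ge> rr" "r \<notin> B" for r
  proof -
    note bg = big[OF r(1)]
    have rp: "r \<ge> 0" "ln r \<ge> 0" using bg(1) g1(3) by auto
    have pf: "proximity r f \<ge> 0" using r1 bg by simp
    note ou = out[OF r]
    have cf: "continuous_on (sphere 0 r) (\<lambda>z. log_plus (norm (f z)))"
      and cE: "continuous_on (sphere 0 r) (\<lambda>z. log_plus (norm (E z)))"
      and cg: "continuous_on (sphere 0 r) (\<lambda>z. log_plus (norm (g z)))"
      using bg by (intro continuous_intros r1 r2 g1; simp)+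
    have "continuous_on (sphere 0 r) (\<lambda>z. 1 / (g z - c))"
      by (intro continuous_intros g1(5)[OF bg(1)]) (use ou in auto)
    then have "continuous_on (sphere 0 r) (\<lambda>z. log_plus (norm (1 / (g z - c))))" by (rule continuous_on_log_plus_norm)
    then have cr: "continuous_on (sphere 0 r) (\<lambda>z. log_plus (1 / norm (g z - c)))" by (simp only: norm_divide norm_one)
    have "circle_mean r (\<lambda>z. log_plus (norm (E z))) \<le>
        real a * circle_mean r (\<lambda>z. log_plus (norm (f z))) + real b * circle_mean r (\<lambda>z. log_plus (1 / norm (g z - c))) + real a * K"
    proof (rule circle_mean_linear_bound[OF cE cf cr rp(1)])
      fix z :: complex assume z: "norm z = r"
      have nE: "norm (E z) = norm (f z - b1) ^ a * (1 / norm (g z - c)) ^ b"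
        using Eq ou[OF z] by (simp add: q_def norm_divide norm_power power_one_over)
      have "log_plus (norm (E z)) \<le> log_plus (norm (f z - b1) ^ a) + log_plus ((1 / norm (g z - c)) ^ b)"
        unfolding nE by (rule log_plus_mult_le) simp_all
      also have "\<dots> = real a * log_plus (norm (f z - b1)) + real b * log_plus (1 / norm (g z - c))"
        by (simp add: log_plus_power)
      also have "\<dots> \<le> real a * (log_plus (norm (f z)) + K) + real b * log_plus (1 / norm (g z - c))"
        using log_plus_shift(1)[of "f z" b1] by (intro add_mono mult_left_mono) (auto simp: K_def)
      finally show "log_plus (norm (E z)) \<le> real a * log_plus (norm (f z)) + real b * log_plus (1 / norm (g z - c)) + real a * K"
        by (simp add: algebra_simps)
    qed
    also have "circle_mean r (\<lambda>z. log_plus (1 / norm (g z - c))) \<le> proximity r f + C1 + C0 * (1 + ln r)"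
    proof -
      have "circle_mean r (\<lambda>z. log_plus (norm (g z))) \<le> 1 * circle_mean r (\<lambda>z. log_plus (norm (f z))) + 0 * circle_mean r (\<lambda>z. log_plus (norm (f z))) + C1"
        by (rule circle_mean_linear_bound[OF cg cf cf rp(1)]) (use C1(2) ou in auto)
      then have "proximity r g \<le> proximity r f + C1" by (simp add: proximity_eq_circle_mean)
      then show ?thesis using g1(6)[OF bg(1) r(2)] by linarith
    qed
    finally have "circle_mean r (\<lambda>z. log_plus (norm (E z))) \<le> real a * proximity r f + real b * (proximity r f + C1 + C0 * (1 + ln r)) + real a * K"
      by (simp add: proximity_eq_circle_mean mult_left_mono)
    also have "\<dots> \<le> C * (1 + ln r + proximity r f)"
    proof -
      define X where "X = 1 + ln r + proximity r f"
      have X: "X \<ge> 1" "proximity r f \<le> X" "1 + ln r \<le> X" using rp pf by (auto simp: X_def)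
      have "real a * proximity r f \<le> real a * X" using X by (intro mult_left_mono) auto
      moreover have "real a * K * 1 \<le> real a * K * X" using X K0 by (intro mult_left_mono) auto
      moreover have "real b * (proximity r f + C1 + C0 * (1 + ln r)) \<le> real b * (X + C1 * X + C0 * X)"
        using X C1 g1(2) mult_left_mono[of 1 X C1] by (intro mult_left_mono add_mono) auto
      moreover have "C * X = real a * X + real a * K * X + real b * (X + C1 * X + C0 * X)" by (simp add: C_def algebra_simps)
      ultimately show ?thesis unfolding X_def[symmetric] by linarith
    qed
    finally show ?thesis .
  qed
  show ?thesis
  proof (rule that[of E B C rr])
    show "E z = (f z - b1) ^ a / (g z - c) ^ b" if "z \<notin> A" "g z \<noteq> c" for z
      using Eq[OF that] by (simp add: q_def)
    show "rr \<ge> 1" using rr(1) g1(3) by simp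
    show "continuous_on (sphere 0 r) f" if "r \<ge> rr" for r using r1(3) big(2)[OF that] by simp
    show "continuous_on (sphere 0 r) E" if "r \<ge> rr" for r using r2(2) big(3)[OF that] by simp
  qed (use EM Enz out mean C0 g1(1) in auto)
qed

section \<open>Uniqueness\<close>

text \<open>
  The two functions agree near every point apart from the point itself, and the values of normalised
  functions are determined by this.
\<close>

lemma M1_eqI:
  assumes f: "f \<in> M1" and g: "g \<in> M1" and r: "r > 0" and eq: "\<And>z. z \<in> ball z1 r \<Longrightarrow> f z = g z"
  shows "f = g"
proof
  fix z0
  have mer: "f meromorphic_on UNIV" "g meromorphic_on UNIV"
    using f g by (simp_all add: M1_def nicely_meromorphic_on_def)
  define A where "A = {z. is_pole f z} \<union> {z. is_pole g z}"
  have fin: "finite A" using f g by (simp add: A_def M1_def)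
  have eqA: "f w = g w" if "w \<notin> A" for w
  proof -
    have "f w - g w = 0"
    proof (rule meromorphic_identity[of "\<lambda>z. f z - g z", OF _ r])
      show "(\<lambda>z. f z - g z) meromorphic_on UNIV" by (intro meromorphic_intros mer)
      have np: "\<not> is_pole f w" "\<not> is_pole g w" using that by (auto simp: A_def)
      show "(\<lambda>z. f z - g z) analytic_on {w}"
        by (intro analytic_intros M1_analytic_at[OF f np(1)] M1_analytic_at[OF g np(2)])
      show "f z - g z = 0" if "z \<in> ball z1 r" for z using eq[OF that] by simp
    qed
    then show ?thesis by simp
  qed
  have "finite (A - {z0})" "z0 \<notin> A - {z0}" using fin by auto
  then have ev: "\<forall>\<^sub>F w in at z0. w \<notin> A - {z0}" by (rule finite_avoided_near)
  have "\<forall>\<^sub>F w in at z0. w \<noteq> z0" by (simp add: eventually_at_filter)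
  with ev have "\<forall>\<^sub>F w in at z0. f w = g w" by eventually_elim (use eqA in blast)
  then have "remove_sings f z0 = remove_sings g z0" by (rule remove_sings_cong) simp
  moreover have "remove_sings h z0 = h z0" if h: "h \<in> M1" for h
  proof -
    have "(is_pole h z0 \<and> h z0 = 0) \<or> h \<midarrow>z0\<rightarrow> h z0" using h by (auto simp: M1_def nicely_meromorphic_on_def)
    then show ?thesis by auto
  qed
  ultimately show "f z0 = g z0" using f g by simp
qed

text \<open>
  The zero-free function \<open>E\<close> is the power \<open>t\<^bsup>a n\<^esup>\<close> of
  \<open>t = (f - b1) / (g - b1)\<close>, where \<open>n\<close> is the degree of \<open>P\<close>.
  If it is not identically 1, the growth of \<open>f = b1 + t (g - b1)\<close> is controlled by that
  of \<open>E\<close> and of \<open>1 / (E - 1)\<close>, and the latter by that of \<open>E\<close>.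
  If it is identically 1, then \<open>t\<close> is a root of unity, hence locally constant, and
  \<open>t = 1\<close> at a point where both functions take the value \<open>b2\<close>.
\<close>

lemma equal_values_imp_equal:
  assumes fM: "f \<in> M1" and gM: "g \<in> M1" and ord: "nonint_finite_order f"
    and A: "finite A" "\<And>z. z \<notin> A \<Longrightarrow> \<not> is_pole f z \<and> \<not> is_pole g z"
    and gnc: "\<And>z c. \<not> (\<exists>\<^sub>F w in at z. g w = c)"
    and P: "P = [:- b1, 1:] ^ a * Q" "poly Q b1 \<noteq> 0" "a \<ge> 1" "degree P \<ge> 1"
    and eqP: "\<And>z. z \<notin> A \<Longrightarrow> poly P (f z) = poly P (g z)"
    and iff: "\<And>z. z \<notin> A \<Longrightarrow> f z = b1 \<longleftrightarrow> g z = b1"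
    and b2: "b2 \<noteq> b1" "\<And>z. z \<notin> A \<Longrightarrow> f z = b2 \<Longrightarrow> g z = b2"
  shows "f = g"
proof -
  define N where "N = a * degree P"
  have N1: "N \<ge> 1" using P(3,4) by (simp add: N_def)
  obtain C1 where C1: "C1 \<ge> 0" "\<And>x y. poly P y = 1 * poly P x + 0 \<Longrightarrow> log_plus (norm y) \<le> log_plus (norm x) + C1"
    by (rule affine_equal_values_growth[OF P(4), of 1 0]) (rule that; assumption)
  have PQ: "(x - b1) ^ N * poly (Q ^ degree P) x = poly P x ^ degree P" for x
    unfolding P(1) N_def by (simp add: poly_power power_mult power_mult_distrib del: degree_mult_eq)
  \<comment> \<open>The equation \<open>P(f) = P(g)\<close>, raised to the power \<open>degree P\<close>.\<close>
  have eqQ: "(f z - b1) ^ N * poly (Q ^ degree P) (f z) = (g z - b1) ^ N * poly (Q ^ degree P) (g z)" if "z \<notin> A" for z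
    unfolding PQ using eqP[OF that] by simp
  have gf: "log_plus (norm (g z)) \<le> log_plus (norm (f z)) + C1" if "z \<notin> A" for z
    using C1(2)[of "g z" "f z"] eqP[OF that] by simp
  have Qn: "poly (Q ^ degree P) b1 \<noteq> 0" using P(2) by (simp add: poly_power)
  obtain E B C r0 where E: "E \<in> M1" "\<And>z. z \<notin> A \<Longrightarrow> \<not> is_pole E z \<and> E z \<noteq> 0"
    "\<And>z. z \<notin> A \<Longrightarrow> g z \<noteq> b1 \<Longrightarrow> E z = (f z - b1) ^ N / (g z - b1) ^ N"
    "countable B" "C \<ge> 0" "r0 \<ge> 1" "\<And>r z. r \<ge> r0 \<Longrightarrow> r \<notin> B \<Longrightarrow> norm z = r \<Longrightarrow> z \<notin> A \<and> g z \<noteq> b1"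
    "\<And>r. r \<ge> r0 \<Longrightarrow> continuous_on (sphere 0 r) f" "\<And>r. r \<ge> r0 \<Longrightarrow> continuous_on (sphere 0 r) E"
    "\<And>r. r \<ge> r0 \<Longrightarrow> r \<notin> B \<Longrightarrow> circle_mean r (\<lambda>z. log_plus (norm (E z))) \<le> C * (1 + ln r + proximity r f)"
    by (rule zero_free_quotient[OF fM gM A gnc N1 N1 iff eqQ Qn Qn C1(1) gf]) (assumption | rule that; assumption)+
  have Et: "E z = ((f z - b1) / (g z - b1)) ^ N" if "z \<notin> A" "g z \<noteq> b1" for z
    using E(3)[OF that] by (simp add: power_divide)
  show ?thesis
  proof (cases "\<exists>w. w \<notin> A \<and> E w \<noteq> 1")
    case True
    then obtain w where w: "w \<notin> A" "E w \<noteq> 1" by blast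
    have wp: "\<not> is_pole E w" using E(2) w by blast
    obtain B' C' r1 where R: "countable B'" "C' \<ge> 0" "r1 \<ge> 1"
      "\<And>r z. r \<ge> r1 \<Longrightarrow> r \<notin> B' \<Longrightarrow> norm z = r \<Longrightarrow> \<not> is_pole E z \<and> E z \<noteq> 1"
      "\<And>r. r \<ge> r1 \<Longrightarrow> continuous_on (sphere 0 r) E"
      "\<And>r. r \<ge> r1 \<Longrightarrow> r \<notin> B' \<Longrightarrow>
        circle_mean r (\<lambda>z. log_plus (1 / norm (E z - 1))) \<le> proximity r E + C' * (1 + ln r)"
      by (rule M1_reciprocal_mean[OF E(1) wp w(2)]) (rule that; assumption)
    obtain C2 where C2: "C2 \<ge> 0"
      "\<And>t y. poly P (b1 + t * y) = poly P (b1 + y) \<Longrightarrow> t ^ (a * degree P) \<noteq> 1 \<Longrightarrow>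
       log_plus (norm (b1 + t * y)) \<le> C2 * (1 + log_plus (norm (t ^ (a * degree P)))) + log_plus (1 / norm (t ^ (a * degree P) - 1))"
      by (rule equal_values_ratio_growth[OF P(4,3)]) (rule that; assumption)
    have En: "E nicely_meromorphic_on UNIV" using E(1) by (simp add: M1_def)
    obtain r2 where r2: "r2 \<ge> 1" "\<And>r. r \<ge> r2 \<Longrightarrow> proximity r f \<ge> 0"
      by (rule proximity_nonneg_M1[OF fM]) (rule that; assumption)
    define K where "K = C + C2 + C' + 1"
    have K: "K \<ge> 0" "K \<ge> C" using E(5) C2(1) R(2) by (auto simp: K_def)
    have False
    proof (rule zero_free_meromorphic_contradiction[OF fM ord En A(1) E(2), of "B \<union> B'" "max r0 (max r1 r2)" K])
      show "countable (B \<union> B')" using E(4) R(1) by simp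
      show "K \<ge> 0" by (rule K)
      fix r assume r: "r \<ge> max r0 (max r1 r2)" "r \<notin> B \<union> B'"
      then have bg: "r \<ge> r0" "r \<ge> r1" "r \<ge> r2" "r \<notin> B" "r \<notin> B'" by auto
      have rp: "r \<ge> 0" "ln r \<ge> 0" using bg(1) E(6) by auto
      have "C * (1 + ln r + proximity r f) \<le> K * (1 + ln r + proximity r f)"
        using K(2) rp r2(2)[OF bg(3)] by (intro mult_right_mono) auto
      then show "circle_mean r (\<lambda>z. log_plus (norm (E z))) \<le> K * (1 + ln r + proximity r f)"
        using E(10)[OF bg(1,4)] by linarith
      note ou = E(7)[OF bg(1,4)] and E1 = R(4)[OF bg(2,5)]
      have cf: "continuous_on (sphere 0 r) (\<lambda>z. log_plus (norm (f z)))"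
        and cE: "continuous_on (sphere 0 r) (\<lambda>z. log_plus (norm (E z)))"
        using bg by (intro continuous_intros E(8,9); simp)+
      have "continuous_on (sphere 0 r) (\<lambda>z. 1 / (E z - 1))"
        by (intro continuous_intros E(9)[OF bg(1)]) (use E1 in auto)
      then have "continuous_on (sphere 0 r) (\<lambda>z. log_plus (norm (1 / (E z - 1))))" by (rule continuous_on_log_plus_norm)
      then have cr: "continuous_on (sphere 0 r) (\<lambda>z. log_plus (1 / norm (E z - 1)))" by (simp only: norm_divide norm_one)
      define m where "m = circle_mean r (\<lambda>z. log_plus (norm (E z)))"
      have m0: "m \<ge> 0" unfolding m_def by (rule circle_mean_nonneg[OF cE rp(1)]) simp
      have "proximity r f \<le> C2 * m + 1 * circle_mean r (\<lambda>z. log_plus (1 / norm (E z - 1))) + C2"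
        unfolding proximity_eq_circle_mean m_def
      proof (rule circle_mean_linear_bound[OF cf cE cr rp(1)])
        fix z :: complex assume z: "norm z = r"
        define t where "t = (f z - b1) / (g z - b1)"
        have zA: "z \<notin> A" "g z \<noteq> b1" using ou[OF z] by auto
        have ty: "b1 + t * (g z - b1) = f z" using zA(2) by (simp add: t_def)
        have tN: "t ^ (a * degree P) = E z" using Et[OF zA] by (simp add: t_def N_def)
        have "log_plus (norm (f z)) \<le> C2 * (1 + log_plus (norm (E z))) + log_plus (1 / norm (E z - 1))"
          using C2(2)[of t "g z - b1"] eqP[OF zA(1)] E1[OF z] unfolding ty tN by simp
        then show "log_plus (norm (f z)) \<le> C2 * log_plus (norm (E z)) + 1 * log_plus (1 / norm (E z - 1)) + C2"
          by (simp add: algebra_simps)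
      qed
      moreover have "circle_mean r (\<lambda>z. log_plus (1 / norm (E z - 1))) \<le> m + C' * (1 + ln r)"
        using R(6)[OF bg(2,5)] by (simp add: m_def proximity_eq_circle_mean)
      ultimately have "proximity r f \<le> C2 * (1 + m) + m + C' * (1 + ln r)" by (simp add: algebra_simps)
      also have "\<dots> \<le> C * (1 + ln r + m) + C2 * (1 + ln r + m) + (1 + ln r + m) + C' * (1 + ln r + m)"
      proof -
        have "C2 * (1 + m) \<le> C2 * (1 + ln r + m)" "C' * (1 + ln r) \<le> C' * (1 + ln r + m)" "0 \<le> C * (1 + ln r + m)"
          using C2(1) R(2) E(5) rp m0 by (auto intro!: mult_left_mono)
        then show ?thesis using rp by linarith
      qed
      also have "\<dots> = K * (1 + ln r + m)" by (simp add: K_def algebra_simps)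
      finally show "proximity r f \<le> K * (1 + ln r + circle_mean r (\<lambda>z. log_plus (norm (E z))))" by (simp only: m_def)
    qed
    then show ?thesis ..
  next
    case False
    obtain z2 where z2: "z2 \<notin> A" "f z2 = b2" using M1_takes_every_value[OF fM ord A(1), of b2] by blast
    have gz2: "g z2 = b2" by (rule b2(2)[OF z2])
    have gan: "g analytic_on {z}" and fan: "f analytic_on {z}" if "z \<notin> A" for z
      using A(2)[OF that] M1_analytic_at fM gM by auto
    have "continuous (at z2) g" using analytic_at_imp_isCont[OF gan[OF z2(1)]] .
    then obtain e where e: "e > 0" "\<And>y. dist z2 y < e \<Longrightarrow> g y \<noteq> b1"
      using continuous_at_avoid[of z2 g b1] gz2 b2(1) by blast
    have "open (- A)" using A(1) by (simp add: finite_imp_closed open_Compl)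
    then obtain e' where e': "e' > 0" "ball z2 e' \<subseteq> - A" using z2(1) by (meson ComplI openE)
    define r where "r = min e e'"
    have r: "r > 0" using e e' by (simp add: r_def)
    have inb: "z \<notin> A" "g z \<noteq> b1" if "z \<in> ball z2 r" for z using that e(2)[of z] e'(2) by (auto simp: r_def)
    define t where "t = (\<lambda>z. (f z - b1) / (g z - b1))"
    have "continuous_on (ball z2 r) f" "continuous_on (ball z2 r) g"
      using inb by (auto intro!: continuous_at_imp_continuous_on analytic_at_imp_isCont fan gan)
    then have ct: "continuous_on (ball z2 r) t" unfolding t_def by (intro continuous_intros) (use inb in auto)
    have finU: "finite {x :: complex. x ^ N = 1}"
    proof -
      have "poly (monom 1 N - 1) (0::complex) \<noteq> 0"
        using N1 by (cases N) (simp_all add: poly_monom)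
      then have "monom 1 N - 1 \<noteq> (0 :: complex poly)" by (metis poly_0)
      then have "finite {x :: complex. poly (monom 1 N - 1) x = 0}" by (rule poly_roots_finite)
      then show ?thesis by (simp add: poly_monom)
    qed
    have "t ` ball z2 r \<subseteq> {x. x ^ N = 1}"
    proof
      fix x assume "x \<in> t ` ball z2 r"
      then obtain z where z: "z \<in> ball z2 r" "x = t z" by blast
      have "E z = 1" using False inb(1)[OF z(1)] by blast
      then show "x \<in> {x. x ^ N = 1}" using Et[OF inb[OF z(1)]] z(2) by (simp add: t_def)
    qed
    then have fin: "finite (t ` ball z2 r)" by (rule finite_subset) (rule finU)
    have "t constant_on ball z2 r"
      by (rule continuous_finite_range_constant[OF _ ct fin]) simp
    then obtain k where k: "\<And>z. z \<in> ball z2 r \<Longrightarrow> t z = k" by (auto simp: constant_on_def)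
    have "t z2 = 1" using gz2 z2(2) b2(1) by (simp add: t_def)
    then have "k = 1" using k[of z2] r by simp
    then have "f z = g z" if "z \<in> ball z2 r" for z using k[OF that] inb[OF that] by (simp add: t_def)
    then show ?thesis by (rule M1_eqI[OF fM gM r])
  qed
qed

text \<open>
  For \<open>E = (f - b1)\<^sup>a / (g - b2)\<^sup>b\<close> and \<open>\<bar>g\<bar> = O(max 1
  \<bar>f\<bar>)\<close>, one has \<open>a log_plus \<bar>f\<bar> \<le> log_plus \<bar>E\<bar> + b
  log_plus \<bar>f\<bar> + O(1)\<close>; here \<open>a > b\<close> is essential.
\<close>

lemma reflected_values_contradiction:
  assumes fM: "f \<in> M1" and gM: "g \<in> M1" and ord: "nonint_finite_order f"
    and A: "finite A" "\<And>z. z \<notin> A \<Longrightarrow> \<not> is_pole f z \<and> \<not> is_pole g z"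
    and gnc: "\<And>z c. \<not> (\<exists>\<^sub>F w in at z. g w = c)"
    and P: "P = [:- b1, 1:] ^ a * Q" "poly Q b1 \<noteq> 0" "degree P \<ge> 1"
    and P2: "P - [:q:] = [:- b2, 1:] ^ b * Q2" "poly Q2 b2 \<noteq> 0" and ab: "a > b" "b \<ge> 1"
    and eqP: "\<And>z. z \<notin> A \<Longrightarrow> poly P (g z) = q - poly P (f z)"
    and iff: "\<And>z. z \<notin> A \<Longrightarrow> f z = b1 \<longleftrightarrow> g z = b2"
  shows False
proof -
  have a1: "a \<ge> 1" using ab by simp
  obtain C1 where C1: "C1 \<ge> 0" "\<And>x y. poly P y = (-1) * poly P x + q \<Longrightarrow> log_plus (norm y) \<le> log_plus (norm x) + C1"
    by (rule affine_equal_values_growth[OF P(3), of "-1" q]) (rule that; assumption)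
  have Pf: "poly P x = (x - b1) ^ a * poly Q x" for x unfolding P(1) by (simp add: poly_power)
  have Pg: "poly P x - q = (x - b2) ^ b * poly Q2 x" for x
    using arg_cong[OF P2(1), of "\<lambda>p. poly p x"] by (simp add: poly_power)
  have gf: "log_plus (norm (g z)) \<le> log_plus (norm (f z)) + C1" if "z \<notin> A" for z
    using C1(2)[of "g z" "f z"] eqP[OF that] by simp
  have eqQ: "(f z - b1) ^ a * poly Q (f z) = (g z - b2) ^ b * poly (- Q2) (g z)" if "z \<notin> A" for z
  proof -
    have "(f z - b1) ^ a * poly Q (f z) = poly P (f z)" by (simp only: Pf)
    also have "\<dots> = - (poly P (g z) - q)" using eqP[OF that] by simp
    also have "\<dots> = (g z - b2) ^ b * poly (- Q2) (g z)" unfolding Pg by simp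
    finally show ?thesis .
  qed
  have Q2n: "poly (- Q2) b2 \<noteq> 0" using P2(2) by simp
  obtain E B C r0 where E: "E \<in> M1" "\<And>z. z \<notin> A \<Longrightarrow> \<not> is_pole E z \<and> E z \<noteq> 0"
    "\<And>z. z \<notin> A \<Longrightarrow> g z \<noteq> b2 \<Longrightarrow> E z = (f z - b1) ^ a / (g z - b2) ^ b"
    "countable B" "C \<ge> 0" "r0 \<ge> 1" "\<And>r z. r \<ge> r0 \<Longrightarrow> r \<notin> B \<Longrightarrow> norm z = r \<Longrightarrow> z \<notin> A \<and> g z \<noteq> b2"
    "\<And>r. r \<ge> r0 \<Longrightarrow> continuous_on (sphere 0 r) f" "\<And>r. r \<ge> r0 \<Longrightarrow> continuous_on (sphere 0 r) E"
    "\<And>r. r \<ge> r0 \<Longrightarrow> r \<notin> B \<Longrightarrow> circle_mean r (\<lambda>z. log_plus (norm (E z))) \<le> C * (1 + ln r + proximity r f)"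
    by (rule zero_free_quotient[OF fM gM A gnc a1 ab(2) iff eqQ P(2) Q2n C1(1) gf]) (assumption | rule that; assumption)+
  obtain r2 where r2: "r2 \<ge> 1" "\<And>r. r \<ge> r2 \<Longrightarrow> proximity r f \<ge> 0"
    by (rule proximity_nonneg_M1[OF fM]) (rule that; assumption)
  define K1 where "K1 = log_plus (norm b1) + ln 2"
  define K2 where "K2 = log_plus (norm b2) + ln 2"
  define D where "D = real b * (K1 + C1 + K2) + K1"
  have K12: "K1 \<ge> 0" "K2 \<ge> 0" by (simp_all add: K1_def K2_def add_nonneg_nonneg)
  have D0: "D \<ge> 0" using K12 C1(1) by (simp add: D_def)
  have pt: "log_plus (norm (f z)) \<le> log_plus (norm (E z)) + D" if z: "z \<notin> A" "g z \<noteq> b2" for z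
  proof -
    define X where "X = log_plus (norm (f z - b1))"
    have X0: "X \<ge> 0" by (simp add: X_def)
    have "(f z - b1) ^ a = E z * (g z - b2) ^ b" using E(3)[OF z] z(2) by simp
    then have "norm (f z - b1) ^ a = norm (E z) * norm (g z - b2) ^ b" by (metis norm_mult norm_power)
    then have "log_plus (norm (f z - b1) ^ a) \<le> log_plus (norm (E z)) + log_plus (norm (g z - b2) ^ b)"
      by (metis log_plus_mult_le norm_ge_zero zero_le_power)
    then have 1: "real a * X \<le> log_plus (norm (E z)) + real b * log_plus (norm (g z - b2))"
      by (simp add: log_plus_power X_def)
    have fx: "log_plus (norm (f z)) \<le> X + K1" using log_plus_shift(2)[of "f z" b1] by (simp add: X_def K1_def)
    have "log_plus (norm (g z - b2)) \<le> X + (K1 + C1 + K2)"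
      using log_plus_shift(1)[of "g z" b2] gf[OF z(1)] fx by (simp add: K2_def)
    then have "real b * log_plus (norm (g z - b2)) \<le> real b * (X + (K1 + C1 + K2))" by (rule mult_left_mono) simp
    then have "(real a - real b) * X \<le> log_plus (norm (E z)) + real b * (K1 + C1 + K2)"
      using 1 by (simp add: algebra_simps)
    moreover have "1 * X \<le> (real a - real b) * X" using ab X0 by (intro mult_right_mono) auto
    ultimately show ?thesis using fx by (simp add: D_def)
  qed
  have En: "E nicely_meromorphic_on UNIV" using E(1) by (simp add: M1_def)
  define K where "K = C + D + 1"
  have K: "K \<ge> 0" "K \<ge> C" using E(5) D0 by (auto simp: K_def)
  show False
  proof (rule zero_free_meromorphic_contradiction[OF fM ord En A(1) E(2) E(4), of "max r0 r2" K])
    show "K \<ge> 0" by (rule K)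
    fix r assume r: "r \<ge> max r0 r2" and rB: "r \<notin> B"
    then have bg: "r \<ge> r0" "r \<ge> r2" by auto
    have rp: "r \<ge> 0" "ln r \<ge> 0" using bg(1) E(6) by auto
    have "C * (1 + ln r + proximity r f) \<le> K * (1 + ln r + proximity r f)"
      using K(2) rp r2(2)[OF bg(2)] by (intro mult_right_mono) auto
    then show "circle_mean r (\<lambda>z. log_plus (norm (E z))) \<le> K * (1 + ln r + proximity r f)"
      using E(10)[OF bg(1) rB] by linarith
    have cf: "continuous_on (sphere 0 r) (\<lambda>z. log_plus (norm (f z)))"
      and cE: "continuous_on (sphere 0 r) (\<lambda>z. log_plus (norm (E z)))"
      using bg by (intro continuous_intros E(8,9); simp)+
    define m where "m = circle_mean r (\<lambda>z. log_plus (norm (E z)))"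
    have m0: "m \<ge> 0" unfolding m_def by (rule circle_mean_nonneg[OF cE rp(1)]) simp
    have "proximity r f \<le> 1 * m + 0 * m + D"
      unfolding proximity_eq_circle_mean m_def
      by (rule circle_mean_linear_bound[OF cf cE cE rp(1)]) (use pt E(7)[OF bg(1) rB] in simp)
    also have "\<dots> \<le> C * (1 + ln r + m) + D * (1 + ln r + m) + (1 + ln r + m)"
    proof -
      have "D * 1 \<le> D * (1 + ln r + m)" by (rule mult_left_mono) (use D0 rp m0 in auto)
      moreover have "0 \<le> C * (1 + ln r + m)" by (rule mult_nonneg_nonneg) (use E(5) rp m0 in auto)
      ultimately show ?thesis using rp by linarith
    qed
    also have "\<dots> = K * (1 + ln r + m)" by (simp add: K_def algebra_simps)
    finally show "proximity r f \<le> K * (1 + ln r + circle_mean r (\<lambda>z. log_plus (norm (E z))))" by (simp only: m_def)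
  qed
qed

text \<open>
  The two points \<open>x1\<close>, \<open>x2\<close> (and \<open>y1\<close>, \<open>y2\<close>)
  only express that the function is not constant.  If the auxiliary function did not vanish,
  \<open>f\<close> would grow too slowly for its order; so the second order terms agree, first on
  some ball on which nothing degenerates, and the Moebius relation that results there extends by the
  identity theorem.
\<close>

lemma shared_values_moebius:
  fixes P :: "complex poly" and S :: "complex set"
  assumes fM: "f \<in> M1" and gM: "g \<in> M1" and ord: "nonint_finite_order f"
    and S: "finite S" "card S \<ge> 5" and cc: "cc \<noteq> 0" and PS: "\<And>x. poly P x - 1 = cc * (\<Prod>a\<in>S. x - a)"
    and deg: "degree P \<le> card S" and crit: "\<And>x. poly (pderiv P) x = 0 \<longleftrightarrow> x = b1 \<or> x = b2"
    and bS: "b1 \<notin> S" "b2 \<notin> S"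
    and sS: "\<And>z. \<not> is_pole f z \<and> f z \<in> S \<longleftrightarrow> \<not> is_pole g z \<and> g z \<in> S"
    and sm: "\<And>z. \<not> is_pole f z \<Longrightarrow> f z \<in> S \<Longrightarrow>
       min (nat (zorder (\<lambda>w. f w - f z) z)) 3 = min (nat (zorder (\<lambda>w. g w - g z) z)) 3"
    and sB: "\<And>z. \<not> is_pole f z \<and> f z \<in> {b1, b2} \<longleftrightarrow> \<not> is_pole g z \<and> g z \<in> {b1, b2}"
    and ncf: "\<not> is_pole f x1" "\<not> is_pole f x2" "f x1 \<noteq> f x2"
    and ncg: "\<not> is_pole g y1" "\<not> is_pole g y2" "g y1 \<noteq> g y2"
  obtains \<kappa> c where "\<kappa> \<noteq> 0" "\<And>z. \<not> is_pole f z \<Longrightarrow> \<not> is_pole g z \<Longrightarrow>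
    poly P (g z) - 1 = \<kappa> * (poly P (f z) - 1) + c * (poly P (f z) - 1) * (poly P (g z) - 1)"
proof -
  define A where "A = {z. is_pole f z} \<union> {z. is_pole g z}"
  have finA: "finite A" using fM gM by (simp add: A_def M1_def)
  have openA: "open (- A)" using finA by (simp add: finite_imp_closed open_Compl)
  have mer: "f meromorphic_on UNIV" "g meromorphic_on UNIV"
    using fM gM by (simp_all add: M1_def nicely_meromorphic_on_def)
  have P1: "poly P x = 1 \<longleftrightarrow> x \<in> S" for x
  proof -
    have "poly P x - 1 = 0 \<longleftrightarrow> x \<in> S" unfolding PS using cc S(1) by auto
    then show ?thesis by simp
  qed
  have Pb: "poly P b1 \<noteq> 1" "poly P b2 \<noteq> 1" using P1 bS by auto
  have hol: "h holomorphic_on U" if "h \<in> M1" "\<And>z. z \<in> U \<Longrightarrow> \<not> is_pole h z" for h U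
    by (rule holomorphic_on_subset[OF M1_holomorphic[OF that(1)]]) (use that(2) in auto)
  define \<Psi> where "\<Psi> = sharing_function P b1 b2 f g"
  have loc: "\<exists>\<rho> \<Theta>. \<rho> > 0 \<and> \<Theta> holomorphic_on ball z0 \<rho> \<and> (\<forall>z\<in>ball z0 \<rho> - {z0}. \<Psi> z = \<Theta> z)" if z0: "z0 \<notin> A" for z0
  proof -
    obtain r where r: "r > 0" "ball z0 r \<subseteq> - A" using openA z0 by (meson ComplI openE)
    have np: "\<not> is_pole f z" "\<not> is_pole g z" if "z \<in> ball z0 r" for z using that r(2) by (auto simp: A_def)
    have zb: "z0 \<in> ball z0 r" using r by simp
    have fh: "f holomorphic_on ball z0 r" by (rule hol[OF fM]) (rule np(1))
    have gh: "g holomorphic_on ball z0 r" by (rule hol[OF gM]) (rule np(2))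
    obtain w1 where w1: "w1 \<in> ball z0 r" "f w1 \<noteq> f z0" using M1_nonconstant_on_ball[OF fM ncf r(1)] by blast
    obtain w2 where w2: "w2 \<in> ball z0 r" "g w2 \<noteq> g z0" using M1_nonconstant_on_ball[OF gM ncg r(1)] by blast
    have s1: "poly P (f z0) = 1 \<longleftrightarrow> poly P (g z0) = 1" unfolding P1 using sS[of z0] np[OF zb] by simp
    have s2: "min (nat (zorder (\<lambda>z. f z - f z0) z0)) 3 = min (nat (zorder (\<lambda>z. g z - g z0) z0)) 3" if "poly P (f z0) = 1"
      using that sm[of z0] np[OF zb] unfolding P1 by simp
    have s3: "f z0 \<in> {b1, b2} \<longleftrightarrow> g z0 \<in> {b1, b2}" using sB[of z0] np[OF zb] by simp
    obtain \<rho> \<Theta> where "\<rho> > 0" "\<Theta> holomorphic_on ball z0 \<rho>"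
      "\<And>z. z \<in> ball z0 \<rho> \<Longrightarrow> z \<noteq> z0 \<Longrightarrow> sharing_function P b1 b2 f g z = \<Theta> z"
      by (rule sharing_function_local[OF fh gh r(1) w1 w2 crit Pb s1 s2 s3]) (assumption | rule that; assumption)+
    then show ?thesis unfolding \<Psi>_def by blast
  qed
  have \<Psi>mer: "\<Psi> meromorphic_on UNIV" unfolding \<Psi>_def by (rule sharing_function_meromorphic[OF mer])
  have KM: "remove_sings \<Psi> \<in> M1" by (rule M1_remove_sings(1)[OF \<Psi>mer finA loc])
  have dnz: "\<exists>z. \<not> is_pole h z \<and> deriv h z \<noteq> 0"
    if h: "h \<in> M1" "\<not> is_pole h v1" "\<not> is_pole h v2" "h v1 \<noteq> h v2" for h v1 v2
  proof (rule ccontr)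
    assume no: "\<not> ?thesis"
    obtain r where r: "r > 0" "ball v1 r \<subseteq> {z. \<not> is_pole h z}"
      using open_nonpoles[OF h(1)] h(2) by (metis mem_Collect_eq openE)
    have hh: "h holomorphic_on ball v1 r" by (intro hol h(1)) (use r in auto)
    have "\<exists>k. \<forall>z\<in>ball v1 r. h z = k"
    proof (rule has_field_derivative_zero_constant[OF convex_ball])
      fix z assume z: "z \<in> ball v1 r"
      have "(h has_field_derivative deriv h z) (at z)" by (rule holomorphic_derivI[OF hh open_ball z])
      moreover have "deriv h z = 0" using no z r(2) by blast
      ultimately show "(h has_field_derivative 0) (at z within ball v1 r)" by (simp add: has_field_derivative_at_within)
    qed
    then obtain k where "\<forall>z\<in>ball v1 r. h z = k" by blast
    then show False using M1_nonconstant_on_ball[OF h(1,2,3,4) r(1), of v1 k] by blast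
  qed
  have good: "\<forall>\<^sub>F z in at 0. h z \<notin> insert b1 (insert b2 S) \<and> deriv h z \<noteq> 0"
    if h: "h \<in> M1" "\<not> is_pole h v1" "\<not> is_pole h v2" "h v1 \<noteq> h v2" and hm: "h meromorphic_on UNIV" for h v1 v2
  proof -
    have "\<forall>\<^sub>F z in at 0. \<forall>s\<in>insert b1 (insert b2 S). h z \<noteq> s"
      by (rule eventually_ball_finite)
         (use S(1) M1_not_frequently[OF h(1) M1_not_locally_constant[OF h(1,2,3,4)]] in auto)
    moreover obtain z where z: "\<not> is_pole h z" "deriv h z \<noteq> 0" using dnz[OF h] by blast
    have "\<forall>\<^sub>F z in at 0. deriv h z \<noteq> 0"
      by (rule meromorphic_eventually_nonzero[where \<phi> = "deriv h", OF _ _ z(2)])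
         (intro meromorphic_intros hm, intro analytic_intros analytic_deriv M1_analytic_at[OF h(1) z(1)])
    ultimately show ?thesis by eventually_elim blast
  qed
  have "finite (A - {0})" "0 \<notin> A - {0}" using finA by auto
  then have evA: "\<forall>\<^sub>F w in at 0. w \<notin> A - {0}" by (rule finite_avoided_near)
  have "\<forall>\<^sub>F z in at (0::complex). z \<noteq> 0" by (simp add: eventually_at_filter)
  with evA good[OF fM ncf mer(1)] good[OF gM ncg mer(2)]
  have "\<forall>\<^sub>F z in at 0. z \<notin> A \<and> (f z \<notin> insert b1 (insert b2 S) \<and> deriv f z \<noteq> 0) \<and> (g z \<notin> insert b1 (insert b2 S) \<and> deriv g z \<noteq> 0)"
    by eventually_elim blast
  then obtain d where d: "d > 0" "\<And>z. z \<noteq> 0 \<Longrightarrow> dist z 0 < d \<Longrightarrow>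
     z \<notin> A \<and> (f z \<notin> insert b1 (insert b2 S) \<and> deriv f z \<noteq> 0) \<and> (g z \<notin> insert b1 (insert b2 S) \<and> deriv g z \<noteq> 0)"
    unfolding eventually_at by blast
  \<comment> \<open>Nothing degenerates on a punctured disc of radius \<open>d\<close> about 0, and this ball lies in it.\<close>
  define z1 :: complex where "z1 = of_real (d / 2)"
  define r where "r = d / 2"
  have r: "r > 0" using d by (simp add: r_def)
  have nb: "z \<notin> A" "f z \<notin> insert b1 (insert b2 S)" "deriv f z \<noteq> 0" "g z \<notin> insert b1 (insert b2 S)" "deriv g z \<noteq> 0"
    if z: "z \<in> ball z1 r" for z
  proof -
    have "norm (z1 - z) < d / 2" using z by (simp add: dist_norm r_def)
    moreover have n1: "norm z1 = d / 2" using d(1) by (simp add: z1_def)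
    ultimately have "z \<noteq> 0" "dist z 0 < d" using norm_triangle_ineq2[of z z1] by (auto simp: norm_minus_commute)
    then show "z \<notin> A" "f z \<notin> insert b1 (insert b2 S)" "deriv f z \<noteq> 0" "g z \<notin> insert b1 (insert b2 S)" "deriv g z \<noteq> 0"
      using d(2) by blast+
  qed
  have np: "\<not> is_pole f z" "\<not> is_pole g z" if "z \<in> ball z1 r" for z using nb(1)[OF that] by (auto simp: A_def)
  have pnz: "pderiv_comp P f z \<noteq> 0 \<and> pderiv_comp P g z \<noteq> 0 \<and> poly P (f z) \<noteq> 1 \<and> poly P (g z) \<noteq> 1" if "z \<in> ball z1 r" for z
    using nb[OF that] by (simp add: pderiv_comp_def crit P1)
  have \<Psi>0: "\<Psi> z = 0" if z: "z \<in> ball z1 r" for z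
  proof (rule ccontr)
    assume nz: "\<Psi> z \<noteq> 0"
    have an: "\<Psi> analytic_on {z}" unfolding \<Psi>_def
      by (rule sharing_function_analytic) (use pnz[OF z] np[OF z] M1_analytic_at fM gM in auto)
    have Kz: "\<not> is_pole (remove_sings \<Psi>) z" "remove_sings \<Psi> z \<noteq> 0"
      using remove_sings_eventually_analytic[OF _ an, of \<Psi>] nz by auto
    have nf: "\<exists>z. \<not> is_pole f z \<and> f z \<noteq> c" and ng: "\<exists>z. \<not> is_pole g z \<and> g z \<noteq> c" for c
      using ncf ncg by metis+
    obtain C r0 where "r0 \<ge> 1" "C \<ge> 0" "\<And>r. r \<ge> r0 \<Longrightarrow> proximity r f \<le> C * (1 + ln r)\<^sup>2"
      by (rule slow_growth_of_sharing_function[OF fM gM S cc PS deg crit nf dnz[OF fM ncf] ng dnz[OF gM ncg] KM[unfolded \<Psi>_def] Kz[unfolded \<Psi>_def]])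
         (rule that; assumption)
    then show False using slow_growth_contradiction[OF fM ord] by blast
  qed
  have eq: "second_order_term P f z = second_order_term P g z" if z: "z \<in> ball z1 r" for z
  proof -
    have "ramification_factor P b1 b2 f z \<noteq> 0" "ramification_factor P b1 b2 g z \<noteq> 0"
      using nb[OF z] pnz[OF z] by (simp_all add: ramification_factor_def)
    then show ?thesis using \<Psi>0[OF z] by (simp add: \<Psi>_def sharing_function_def)
  qed
  have fh: "f holomorphic_on ball z1 r" by (rule hol[OF fM]) (rule np(1))
  have gh: "g holomorphic_on ball z1 r" by (rule hol[OF gM]) (rule np(2))
  obtain \<kappa> c where mb: "\<kappa> \<noteq> 0" "\<And>z. z \<in> ball z1 r \<Longrightarrow>
      poly P (g z) - 1 = \<kappa> * (poly P (f z) - 1) + c * (poly P (f z) - 1) * (poly P (g z) - 1)"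
    by (rule moebius_of_equal_second_order_terms[OF fh gh r pnz eq]) (assumption | rule that; assumption)+
  show ?thesis
  proof (rule that[OF mb(1)])
    fix w assume w: "\<not> is_pole f w" "\<not> is_pole g w"
    define \<phi> where "\<phi> = (\<lambda>z. poly P (g z) - 1 - (\<kappa> * (poly P (f z) - 1) + c * (poly P (f z) - 1) * (poly P (g z) - 1)))"
    have "\<phi> w = 0"
    proof (rule meromorphic_identity[of \<phi>, OF _ r])
      show "\<phi> meromorphic_on UNIV" unfolding \<phi>_def by (intro meromorphic_intros mer)
      show "\<phi> analytic_on {w}" unfolding \<phi>_def
        by (intro analytic_intros analytic_poly_comp M1_analytic_at[OF fM w(1)] M1_analytic_at[OF gM w(2)])
      show "\<phi> z = 0" if "z \<in> ball z1 r" for z using mb(2)[OF that] by (simp only: \<phi>_def diff_self)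
    qed
    then show "poly P (g w) - 1 = \<kappa> * (poly P (f w) - 1) + c * (poly P (f w) - 1) * (poly P (g w) - 1)"
      by (simp only: \<phi>_def right_minus_eq)
  qed
qed

text \<open>
  All three steps rest on the fact that \<open>f\<close> takes every value at a common regular
  point: the value with \<open>P(f) = 1 + 1 / c\<close> rules out \<open>c \<noteq> 0\<close>, and
  the values \<open>b1\<close> and \<open>b2\<close> leave \<open>\<kappa> = 1\<close> and
  \<open>\<kappa> = -1\<close>.
\<close>

lemma moebius_sharing_critical_values_imp_equal:
  assumes fM: "f \<in> M1" and gM: "g \<in> M1" and ord: "nonint_finite_order f"
    and gnc: "\<And>z c. \<not> (\<exists>\<^sub>F w in at z. g w = c)"
    and b: "b1 \<noteq> b2" "poly P b1 = 0" "poly P b2 \<noteq> 0" "degree P \<ge> 1"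
    and P: "P = [:- b1, 1:] ^ a * Q" "poly Q b1 \<noteq> 0"
    and P2: "P - [:poly P b2:] = [:- b2, 1:] ^ b * Q2" "poly Q2 b2 \<noteq> 0" and ab: "a > b" "b \<ge> 1"
    and sB: "\<And>z. \<not> is_pole f z \<and> f z \<in> {b1, b2} \<longleftrightarrow> \<not> is_pole g z \<and> g z \<in> {b1, b2}"
    and mb: "\<kappa> \<noteq> 0" "\<And>z. \<not> is_pole f z \<Longrightarrow> \<not> is_pole g z \<Longrightarrow>
      poly P (g z) - 1 = \<kappa> * (poly P (f z) - 1) + c * (poly P (f z) - 1) * (poly P (g z) - 1)"
  shows "f = g"
proof -
  define A where "A = {z. is_pole f z} \<union> {z. is_pole g z}"
  have finA: "finite A" using fM gM by (simp add: A_def M1_def)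
  have A: "\<not> is_pole f z \<and> \<not> is_pole g z" if "z \<notin> A" for z using that by (simp add: A_def)
  have val: "\<exists>z. z \<notin> A \<and> f z = v" for v using M1_takes_every_value[OF fM ord finA, of v] by blast
  have mb': "poly P (g z) - 1 = \<kappa> * (poly P (f z) - 1) + c * (poly P (f z) - 1) * (poly P (g z) - 1)" if "z \<notin> A" for z
    using mb(2) A[OF that] by blast
  have sB': "f z = b1 \<or> f z = b2 \<longleftrightarrow> g z = b1 \<or> g z = b2" if "z \<notin> A" for z using sB[of z] A[OF that] by auto
  have c0: "c = 0"
  proof (rule ccontr)
    assume c: "c \<noteq> 0"
    have "degree (- [:1 + 1 / c:]) < degree P" using b(4) by simp
    then have "degree (P - [:1 + 1 / c:]) = degree P"
      unfolding diff_conv_add_uminus[of P] by (rule degree_add_eq_left)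
    then have "\<exists>v. poly (P - [:1 + 1 / c:]) v = 0" using b(4) by (intro alg_closed_imp_poly_has_root) simp
    then obtain v where v: "poly P v = 1 + 1 / c" by auto
    obtain z where z: "z \<notin> A" "f z = v" using val by blast
    have "poly P (g z) - 1 = \<kappa> * (1 / c) + c * (1 / c) * (poly P (g z) - 1)" using mb'[OF z(1)] z(2) v by simp
    then have "\<kappa> / c = 0" using c by simp
    then show False using mb(1) c by simp
  qed
  have aff: "poly P (g z) = \<kappa> * poly P (f z) + (1 - \<kappa>)" if "z \<notin> A" for z
    using mb'[OF that] by (simp add: c0 algebra_simps)
  show ?thesis
  proof (cases "\<kappa> = 1")
    case True
    have eq: "poly P (f z) = poly P (g z)" if "z \<notin> A" for z using aff[OF that] True by simp
    have iff1: "f z = b1 \<longleftrightarrow> g z = b1" if "z \<notin> A" for z using eq[OF that] sB'[OF that] b by auto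
    have iff2: "g z = b2" if "z \<notin> A" "f z = b2" for z using eq[OF that(1)] sB'[OF that(1)] that(2) b by auto
    have a1: "a \<ge> 1" using ab by simp
    show ?thesis
      by (rule equal_values_imp_equal[OF fM gM ord finA A gnc P a1 b(4) eq iff1 b(1)[symmetric] iff2])
  next
    case False
    obtain z where z: "z \<notin> A" "f z = b1" using val by blast
    have g1: "poly P (g z) = 1 - \<kappa>" using aff[OF z(1)] z(2) b by simp
    then have "g z \<noteq> b1" using False b by auto
    then have q: "poly P b2 = 1 - \<kappa>" using sB'[OF z(1)] z(2) g1 by auto
    obtain z' where z': "z' \<notin> A" "f z' = b2" using val by blast
    have g2: "poly P (g z') = (1 + \<kappa>) * poly P b2" using aff[OF z'(1)] z'(2) by (simp add: q algebra_simps)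
    have "g z' \<noteq> b2"
    proof
      assume "g z' = b2"
      then have "\<kappa> * poly P b2 = 0" using g2 by (simp add: algebra_simps)
      then show False using mb(1) b by simp
    qed
    then have "g z' = b1" using sB'[OF z'(1)] z'(2) by auto
    then have "1 + \<kappa> = 0" using g2 b by simp
    then have \<kappa>: "\<kappa> = -1" by (simp add: add_eq_0_iff)
    have refl: "poly P (g z) = poly P b2 - poly P (f z)" if "z \<notin> A" for z using aff[OF that] q \<kappa> by simp
    have iff: "f z = b1 \<longleftrightarrow> g z = b2" if "z \<notin> A" for z using refl[OF that] sB'[OF that] b by auto
    have False by (rule reflected_values_contradiction[OF fM gM ord finA A gnc P b(4) P2 ab refl iff])
    then show ?thesis ..
  qed
qed

theorem theorem2p3:
  fixes n :: nat
    and f g :: "complex \<Rightarrow> complex"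
    and \<alpha> :: "nat \<Rightarrow> complex"
    and \<beta>1 \<beta>2 :: complex
    and S1 S2 :: "complex set"
  assumes n_pos: "n \<ge> 1"
    and fM: "f \<in> M1" and gM: "g \<in> M1"
    and S1: "S1 = \<alpha> ` {1..n}" and S2: "S2 = {\<beta>1, \<beta>2}"
    and alpha_distinct: "inj_on \<alpha> {1..n}"
    and beta_distinct: "\<beta>1 \<noteq> \<beta>2"
    and disjoint: "S1 \<inter> S2 = {}"
    and nonzero: "0 \<notin> S1 \<union> S2"
    and n_large: "n > max 4 (2 * Gamma1 n \<alpha>)"
    and deriv_zeros: "{z. poly (pderiv (assoc_poly n \<alpha>)) z = 0} = {\<beta>1, \<beta>2}"
    and Gamma1_ge: "Gamma1 n \<alpha> \<ge> 3"
    and prods_neq: "(\<Prod>i=1..n. \<beta>1 - \<alpha> i) \<noteq> (\<Prod>i=1..n. \<beta>2 - \<alpha> i)"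
    and f_order: "nonint_finite_order f"
    and share_S1: "share f g S1 2"
    and share_S2: "share_IM f g S2"
  shows "f = g"
proof -
  define P where "P = assoc_poly n \<alpha>"
  have n5: "n \<ge> 5" using n_large by simp
  have finS: "finite S1" and cardS: "card S1 = n" using alpha_distinct by (simp_all add: S1 card_image)
  obtain k where k: "k \<noteq> 0" "\<And>x. poly P x - 1 = k * (\<Prod>a\<in>S1. x - a)"
    using assoc_poly_eq_prod[OF alpha_distinct] nonzero unfolding S1 P_def by blast
  have degP: "degree P = n" using degree_of_prod_form[OF finS _ k] cardS n_pos by simp
  have P0: "P \<noteq> 0" using degP n_pos by auto
  have crit: "poly (pderiv P) x = 0 \<longleftrightarrow> x = \<beta>1 \<or> x = \<beta>2" for x
    using deriv_zeros unfolding P_def by (metis (mono_tags, lifting) insert_iff mem_Collect_eq singletonD)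
  have Gam: "Gamma1 n \<alpha> = card {z. poly P z = 0}"
  proof -
    have fin: "finite {z. poly P z = 0}" by (rule poly_roots_finite[OF P0])
    have "card {z. poly P z = 0} = card ({z. poly P z = 0 \<and> order z P = 1} \<union> {z. poly P z = 0 \<and> order z P > 1})"
    proof (rule arg_cong[where f = card])
      have "order z P = 1 \<or> order z P > 1" if "poly P z = 0" for z
      proof -
        have "order z P \<noteq> 0" using that P0 order_root[of P z] by simp
        then show ?thesis by linarith
      qed
      then show "{z. poly P z = 0} = {z. poly P z = 0 \<and> order z P = 1} \<union> {z. poly P z = 0 \<and> order z P > 1}"
        by blast
    qed
    also have "\<dots> = card {z. poly P z = 0 \<and> order z P = 1} + card {z. poly P z = 0 \<and> order z P > 1}"
      by (rule card_Un_disjoint) (use fin in auto)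
    finally show ?thesis by (simp add: Gamma1_def num_simple_zeros_def num_multiple_zeros_def P_def)
  qed
  have few: "n > 2 * card {z. poly P z = 0}" using n_large Gam by simp
  have prodS: "(\<Prod>a\<in>S1. x - a) = (\<Prod>i=1..n. x - \<alpha> i)" for x
    unfolding S1 by (subst prod.reindex[OF alpha_distinct]) simp
  have vals: "poly P \<beta>1 \<noteq> poly P \<beta>2"
  proof
    assume h: "poly P \<beta>1 = poly P \<beta>2"
    then have "k * (\<Prod>a\<in>S1. \<beta>1 - a) = k * (\<Prod>a\<in>S1. \<beta>2 - a)" by (simp only: k(2)[symmetric] h)
    then show False using k(1) prods_neq by (simp add: prodS)
  qed
  have n2: "n \<ge> 2" using n5 by simp
  obtain b1 b2 a b Q Q2 where str: "{b1, b2} = {\<beta>1, \<beta>2}" "b1 \<noteq> b2" "poly P b1 = 0" "poly P b2 \<noteq> 0"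
    "a > b" "b \<ge> 1" "P = [:- b1, 1:] ^ a * Q" "poly Q b1 \<noteq> 0"
    "P - [:poly P b2:] = [:- b2, 1:] ^ b * Q2" "poly Q2 b2 \<noteq> 0"
    by (rule critical_structure[OF degP n2 crit beta_distinct vals few]) (rule that; assumption)
  have crit': "poly (pderiv P) x = 0 \<longleftrightarrow> x = b1 \<or> x = b2" for x
  proof -
    have "x \<in> {b1, b2} \<longleftrightarrow> x \<in> {\<beta>1, \<beta>2}" using str(1) by simp
    then show ?thesis using crit[of x] by simp
  qed
  have bS: "b1 \<notin> S1" "b2 \<notin> S1" using disjoint str(1) unfolding S2 by blast+
  have sS: "\<not> is_pole f z \<and> f z \<in> S1 \<longleftrightarrow> \<not> is_pole g z \<and> g z \<in> S1" for z
    using E_set_eq_0_iff[OF fM, of S1 z] E_set_eq_0_iff[OF gM, of S1 z] share_S1 by (simp add: share_def)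
  have sB2: "\<not> is_pole f z \<and> f z \<in> S2 \<longleftrightarrow> \<not> is_pole g z \<and> g z \<in> S2" for z
  proof -
    have "z \<in> E_bar f S2 \<longleftrightarrow> z \<in> E_bar g S2" using share_S2 by (simp add: share_IM_def)
    then show ?thesis by (auto simp: E_bar_def is_a_point_def)
  qed
  then have sB: "\<not> is_pole f z \<and> f z \<in> {b1, b2} \<longleftrightarrow> \<not> is_pole g z \<and> g z \<in> {b1, b2}" for z
    unfolding str(1) S2 .
  have "\<alpha> 1 \<in> S1" using n_pos by (simp add: S1)
  obtain x1 where x1: "\<not> is_pole f x1" "f x1 = \<alpha> 1" using M1_takes_every_value[OF fM f_order finite.emptyI] by blast
  obtain x2 where x2: "\<not> is_pole f x2" "f x2 = \<beta>1" using M1_takes_every_value[OF fM f_order finite.emptyI] by blast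
  have g1: "\<not> is_pole g x1" "g x1 \<in> S1" using sS[of x1] x1 \<open>\<alpha> 1 \<in> S1\<close> by auto
  have g2: "\<not> is_pole g x2" "g x2 \<in> S2" using sB2[of x2] x2 by (auto simp: S2)
  have gne: "g x1 \<noteq> g x2" using g1 g2 disjoint by auto
  have fne: "f x1 \<noteq> f x2" using x1 x2 disjoint \<open>\<alpha> 1 \<in> S1\<close> by (auto simp: S2)
  have gnc: "\<not> (\<exists>\<^sub>F w in at z. g w = c)" for z c by (rule M1_not_locally_constant[OF gM g1(1) g2(1) gne])
  have fnc: "\<not> (\<exists>\<^sub>F w in at z. f w = c)" for z c by (rule M1_not_locally_constant[OF fM x1(1) x2(1) fne])
  have sm: "min (nat (zorder (\<lambda>w. f w - f z) z)) 3 = min (nat (zorder (\<lambda>w. g w - g z) z)) 3"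
    if z: "\<not> is_pole f z" "f z \<in> S1" for z
  proof -
    have gz: "\<not> is_pole g z" "g z \<in> S1" using sS[of z] z by auto
    have nc: "\<not> (\<forall>\<^sub>F w in at z. h w = c)" if "\<not> (\<exists>\<^sub>F w in at z. h w = c)" for h :: "complex \<Rightarrow> complex" and c
      using that eventually_frequently[of "at z" "\<lambda>w. h w = c"] by auto
    have "E_set f S1 2 z = E_set g S1 2 z" using share_S1 by (simp add: share_def)
    then show ?thesis
      unfolding E_set_eq_min[OF z nc[OF fnc]] E_set_eq_min[OF gz nc[OF gnc]] by simp
  qed
  have card5: "card S1 \<ge> 5" and degle: "degree P \<le> card S1" and deg1: "degree P \<ge> 1"
    using cardS n5 degP by simp_all
  obtain \<kappa> c where mb: "\<kappa> \<noteq> 0" "\<And>z. \<not> is_pole f z \<Longrightarrow> \<not> is_pole g z \<Longrightarrow>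
      poly P (g z) - 1 = \<kappa> * (poly P (f z) - 1) + c * (poly P (f z) - 1) * (poly P (g z) - 1)"
    by (rule shared_values_moebius[OF fM gM f_order finS card5 k degle crit' bS sS sm sB x1(1) x2(1) fne g1(1) g2(1) gne])
       (assumption | rule that; assumption)+
  show ?thesis
    by (rule moebius_sharing_critical_values_imp_equal[OF fM gM f_order gnc str(2,3,4) deg1 str(7,8,9,10,5,6) sB mb])
qed

end
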